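(* Let $p$ be a prime and $s>-1$. Let $\nu^{(s)}$ be the unique probability measure on $\Delta$ such that $\mathsf{M}^{(s)}=\int_{\Delta}\mu_{\mathbf{k}}\,\nu^{(s)}(d\mathbf{k})$ (i.e. $\mathsf{M}^{(s)}(\mathfrak{F})=\int_\Delta \mu_{\mathbf{k}}(\mathfrak{F})\,\nu^{(s)}(d\mathbf{k})$ for every bounded Borel function $\mathfrak{F}$ on $\mathrm{Mat}(\mathbb{N},\mathbb{Q}_p)$). Then $\nu^{(s)}$ is supported on $\Delta_0$. Moreover, if $\mathbf{k}$ is random with law $\nu^{(s)}$, then the sequence $\{\mathsf{X}_i(\mathbf{k})\}_{i=1}^\infty$, where $\mathsf{X}_i(\mathbf{k})=\sum_{j=i}^{\infty}l_j(\mathbf{k})$, is a time-homogeneous Markov chain on $\mathbb{Z}_+$ with initial distribution $\pi^{(s)}$ and transition kernel $\mathsf{P}^{(s)}$; that is, $\sum_{i\ge1}l_i(\mathbf{k})$ has law $\pi^{(s)}$ and the conditional law of $\sum_{j\ge i+1}l_j(\mathbf{k})$ given the previous values is $\mathsf{P}^{(s)}\big(\sum_{j\ge i}l_j(\mathbf{k}),\cdot\big)$. Equivalently, for every $\mathbf{k}\in\Delta_0$, \[ \nu^{(s)}(\mathbf{k})=\left(p^{-1-s};p^{-1}\right)_\infty\, p^{-\sum_{i=1}^{\infty}\left(\sum_{j=i}^{\infty}l_j(\mathbf{k})\right)^2-s\sum_{i=1}^{\infty}i\,l_i(\mathbf{k})}\prod_{i=1}^{\infty}\frac{1}{\left(p^{-1};p^{-1}\right)_{l_i(\mathbf{k})}}.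 \]
   Context: $\mathbb{Q}_p$ is the field of $p$-adic numbers with absolute value $|\cdot|$, $\mathbb{Z}_p=\{x:|x|\le1\}$. $(\alpha;q)_N=\prod_{j=0}^{N-1}(1-\alpha q^j)$, $(\alpha;q)_0=1$, $(\alpha;q)_\infty=\prod_{j\ge0}(1-\alpha q^j)$. $\mathsf{vol}$ denotes the Haar measure on $\mathrm{Mat}(N,\mathbb{Q}_p)\simeq\mathbb{Q}_p^{N^2}$ normalized so that $\mathsf{vol}(\mathrm{Mat}(N,\mathbb{Z}_p))=1$. Every $\mathbf{Z}\in\mathrm{Mat}(N,\mathbb{Q}_p)$ can be written $\mathbf{Z}=\mathbf{B}\,\mathrm{diag}(p^{-k_1},\dots,p^{-k_N})\,\mathbf{C}$ with $\mathbf{B},\mathbf{C}\in\mathrm{GL}(N,\mathbb{Z}_p)$ and uniquely determined $k_1\ge\dots\ge k_N\ge-\infty$ (with $p^{-(-\infty)}=0$), the singular numbers of $\mathbf{Z}$. Define $\gamma(\mathbf{Z})=\prod_{j:k_j>0}p^{k_j}$ ($=1$ if all $k_j\le0$), and for $s>-1$ the probability measure $d\mathsf{M}_N^{(s)}(\mathbf{Z})=\frac{(p^{-1-s};p^{-1})_N^2}{(p^{-1-s};p^{-1})_{2N}}\gamma(\mathbf{Z})^{-s-2N}d\mathsf{vol}(\mathbf{Z})$ on $\mathrm{Mat}(N,\mathbb{Q}_p)$. $\mathrm{Mat}(\mathbb{N},\mathbb{Q}_p)$ is the space of infinite matrices $\{\mathbf{Z}_{ij}\}_{i,j\ge1}$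 over $\mathbb{Q}_p$ with the product topology; $\mathsf{M}^{(s)}$ is the unique probability measure on it whose image under the map to the top-left $N\times N$ corner is $\mathsf{M}_N^{(s)}$ for every $N$. $\Delta=\{\mathbf{k}=(k_j)_{j\ge1}\in(\mathbb{Z}\cup\{-\infty\})^{\mathbb{N}}:k_1\ge k_2\ge\cdots\}$ with the product topology; $\Delta_0=\{\mathbf{k}\in\mathbb{Z}_+^{\mathbb{N}}:k_1\ge k_2\ge\cdots,\ k_i=0\text{ for $i$ large}\}$, $\mathbb{Z}_+=\{0,1,2,\dots\}$; $l_i(\mathbf{k})=\#\{j:k_j=i\}$. For $\mathbf{k}\in\Delta$ with $k=\lim_j k_j\in\mathbb{Z}\cup\{-\infty\}$, $\mu_{\mathbf{k}}$ is the law of the random infinite matrix $\mathbf{A}_{\mathbf{k}}=\big[\sum_{N:k_N>k}p^{-k_N}X_i^{(N)}Y_j^{(N)}+p^{-k}Z_{ij}\big]_{i,j\in\mathbb{N}}$, where $X_i^{(N)},Y_j^{(N)},Z_{ij}$ are i.i.d. with the Haar probability measure on $\mathbb{Z}_p$ (the series converges a.s.; the last term is $0$ if $k=-\infty$). The Markov kernel $\mathsf{P}^{(s)}$ on $\mathbb{Z}_+$ is $\mathsf{P}^{(s)}(x_1,x_2)=\frac{p^{-x_2^2-sx_2}(p^{-1};p^{-1})_{x_1}(p^{-1-s};p^{-1})_{x_1}}{(p^{-1};p^{-1})_{x_2}(p^{-1};p^{-1})_{x_1-x_2}(p^{-1-s};p^{-1})_{x_2}}\mathbf{1}(0\le x_2\le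 x_1)$, and $\pi^{(s)}(x)=\frac{p^{-x^2-sx}(p^{-1-s};p^{-1})_\infty}{(p^{-1};p^{-1})_x(p^{-1-s};p^{-1})_x}$, $x\in\mathbb{Z}_+$ (both are probability distributions). *)

theory Defs
  imports "HOL-Probability.Probability"
begin

text \<open>An element x of Q_p is represented by its (unique) p-adic digit expansion
  x = sum_i d i * p^i, with 0 <= d i < p and d i = 0 for i sufficiently negative.\<close>

type_synonym qp = "int \<Rightarrow> nat"

definition Qp :: "nat \<Rightarrow> qp set" where
  "Qp p = {d. (\<forall>i. d i < p) \<and> (\<exists>N. \<forall>i<N. d i = 0)}"

definition Zp :: "nat \<Rightarrow> qp set" where
  "Zp p = {d \<in> Qp p. \<forall>i<0. d i = 0}"

definition qp_zero :: qp where "qp_zero = (\<lambda>_. 0)"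
definition qp_one :: qp where "qp_one = (\<lambda>i. if i = 0 then 1 else 0)"

definition tr :: "nat \<Rightarrow> qp \<Rightarrow> nat \<Rightarrow> real" where
  "tr p d K = (\<Sum>i\<in>{i. i < int K \<and> d i \<noteq> 0}. real (d i) * real p powi i)"

definition dig :: "nat \<Rightarrow> real \<Rightarrow> int \<Rightarrow> nat" where
  "dig p r i = nat (\<lfloor>r / real p powi i\<rfloor> mod int p)"

text \<open>p-adic limit of a sequence of nonnegative numbers in Z[1/p]: digitwise eventual value.\<close>
definition qp_lim :: "nat \<Rightarrow> (nat \<Rightarrow> real) \<Rightarrow> qp" where
  "qp_lim p r = (\<lambda>i. THE c. eventually (\<lambda>K. dig p (r K) i = c) sequentially)"

definition qp_add :: "nat \<Rightarrow> qp \<Rightarrow> qp \<Rightarrow> qp" where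
  "qp_add p x y = qp_lim p (\<lambda>K. tr p x K + tr p y K)"

definition qp_mult :: "nat \<Rightarrow> qp \<Rightarrow> qp \<Rightarrow> qp" where
  "qp_mult p x y = qp_lim p (\<lambda>K. tr p x K * tr p y K)"

definition qp_suminf :: "nat \<Rightarrow> (nat \<Rightarrow> qp) \<Rightarrow> qp" where
  "qp_suminf p f = qp_lim p (\<lambda>K. \<Sum>n<K. tr p (f n) K)"

text \<open>p^(-e) for e in Z \<union> {-\<infinity>}, with p^(-(-\<infinity>)) = 0.\<close>
definition qp_ppow :: "nat \<Rightarrow> ereal \<Rightarrow> qp" where
  "qp_ppow p e = (if e = -\<infinity> then qp_zero
                  else (\<lambda>i. if i = - \<lfloor>real_of_ereal e\<rfloor> then 1 else 0))"

text \<open>Borel sigma-algebra of Q_p (generated by the digit cylinders, equivalently by the balls).\<close>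
definition qp_space :: "nat \<Rightarrow> qp measure" where
  "qp_space p = sigma (Qp p) {{d \<in> Qp p. d i = c} | i c. True}"

text \<open>Haar probability measure on p^(-m) Z_p: i.i.d. uniform digits at positions >= -m.\<close>
definition haar_shift :: "nat \<Rightarrow> int \<Rightarrow> qp measure" where
  "haar_shift p m = distr (PiM (UNIV :: nat set) (\<lambda>_. uniform_count_measure {..<p}))
      (qp_space p) (\<lambda>f i. if i < - m then 0 else f (nat (i + m)))"

definition haarZp :: "nat \<Rightarrow> qp measure" where
  "haarZp p = haar_shift p 0"

text \<open>Haar measure on Q_p normalised by vol(Z_p) = 1.\<close>
definition vol_Qp :: "nat \<Rightarrow> qp measure" where
  "vol_Qp p = measure_of (Qp p) (sets (qp_space p))
     (\<lambda>A. SUP m::nat. of_nat (p ^ m) * emeasure (haar_shift p (int m)) A)"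

text \<open>Matrices are functions nat \<times> nat \<Rightarrow> qp; an N x N matrix uses the indices {..<N} x {..<N}
  (0-based indices).\<close>

definition qp_sum :: "nat \<Rightarrow> (nat \<Rightarrow> qp) \<Rightarrow> nat \<Rightarrow> qp" where
  "qp_sum p f n = foldr (\<lambda>l acc. qp_add p (f l) acc) [0..<n] qp_zero"

definition matmul :: "nat \<Rightarrow> nat \<Rightarrow> (nat \<times> nat \<Rightarrow> qp) \<Rightarrow> (nat \<times> nat \<Rightarrow> qp) \<Rightarrow> (nat \<times> nat \<Rightarrow> qp)" where
  "matmul p N A B = (\<lambda>(i, j). qp_sum p (\<lambda>l. qp_mult p (A (i, l)) (B (l, j))) N)"

definition idm :: "nat \<times> nat \<Rightarrow> qp" where
  "idm = (\<lambda>(i, j). if i = j then qp_one else qp_zero)"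

definition inGL :: "nat \<Rightarrow> nat \<Rightarrow> (nat \<times> nat \<Rightarrow> qp) \<Rightarrow> bool" where
  "inGL p N B \<longleftrightarrow> (\<forall>i<N. \<forall>j<N. B (i, j) \<in> Zp p) \<and>
     (\<exists>B'. (\<forall>i<N. \<forall>j<N. B' (i, j) \<in> Zp p) \<and>
        (\<forall>i<N. \<forall>j<N. matmul p N B B' (i, j) = idm (i, j) \<and> matmul p N B' B (i, j) = idm (i, j)))"

definition Zbar :: "ereal set" where
  "Zbar = insert (-\<infinity>) (range (\<lambda>n::int. ereal (real_of_int n)))"

definition diagm :: "nat \<Rightarrow> nat \<Rightarrow> (nat \<Rightarrow> ereal) \<Rightarrow> (nat \<times> nat \<Rightarrow> qp)" where
  "diagm p N k = (\<lambda>(i, j). if i = j then qp_ppow p (k i) else qp_zero)"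

definition is_sing :: "nat \<Rightarrow> nat \<Rightarrow> (nat \<times> nat \<Rightarrow> qp) \<Rightarrow> (nat \<Rightarrow> ereal) \<Rightarrow> bool" where
  "is_sing p N Z k \<longleftrightarrow> (\<forall>j<N. k j \<in> Zbar) \<and> (\<forall>j\<ge>N. k j = 0) \<and>
     (\<forall>i j. i \<le> j \<longrightarrow> j < N \<longrightarrow> k j \<le> k i) \<and>
     (\<exists>B C. inGL p N B \<and> inGL p N C \<and>
        (\<forall>i<N. \<forall>j<N. Z (i, j) = matmul p N (matmul p N B (diagm p N k)) C (i, j)))"

definition singnum :: "nat \<Rightarrow> nat \<Rightarrow> (nat \<times> nat \<Rightarrow> qp) \<Rightarrow> nat \<Rightarrow> ereal" where
  "singnum p N Z = (THE k. is_sing p N Z k)"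

definition gamma_mat :: "nat \<Rightarrow> nat \<Rightarrow> (nat \<times> nat \<Rightarrow> qp) \<Rightarrow> real" where
  "gamma_mat p N Z = (\<Prod>j\<in>{j. j < N \<and> singnum p N Z j > 0}.
      real p powr real_of_ereal (singnum p N Z j))"

definition qpoch :: "real \<Rightarrow> real \<Rightarrow> nat \<Rightarrow> real" where
  "qpoch a q n = (\<Prod>j<n. (1 - a * q ^ j))"

definition qpoch_inf :: "real \<Rightarrow> real \<Rightarrow> real" where
  "qpoch_inf a q = prodinf (\<lambda>j. 1 - a * q ^ j)"

definition matvol :: "nat \<Rightarrow> nat \<Rightarrow> (nat \<times> nat \<Rightarrow> qp) measure" where
  "matvol p N = PiM ({..<N} \<times> {..<N}) (\<lambda>_. vol_Qp p)"

definition MN :: "nat \<Rightarrow> real \<Rightarrow> nat \<Rightarrow> (nat \<times> nat \<Rightarrow> qp) measure" where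
  "MN p s N = density (matvol p N)
     (\<lambda>Z. ennreal (qpoch (real p powr (-1 - s)) (1 / real p) N ^ 2
                   / qpoch (real p powr (-1 - s)) (1 / real p) (2 * N)
                   * gamma_mat p N Z powr (- s - 2 * real N)))"

definition matinf :: "nat \<Rightarrow> (nat \<times> nat \<Rightarrow> qp) measure" where
  "matinf p = PiM (UNIV :: (nat \<times> nat) set) (\<lambda>_. qp_space p)"

definition corner :: "nat \<Rightarrow> (nat \<times> nat \<Rightarrow> qp) \<Rightarrow> (nat \<times> nat \<Rightarrow> qp)" where
  "corner N Z = restrict Z ({..<N} \<times> {..<N})"

definition Ms :: "nat \<Rightarrow> real \<Rightarrow> (nat \<times> nat \<Rightarrow> qp) measure" where
  "Ms p s = (THE M. sets M = sets (matinf p) \<and> prob_space M \<and>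
      (\<forall>N\<ge>1. distr M (PiM ({..<N} \<times> {..<N}) (\<lambda>_. qp_space p)) (corner N) = MN p s N))"

definition Delta :: "(nat \<Rightarrow> ereal) set" where
  "Delta = {k. (\<forall>j. k j \<in> Zbar) \<and> decseq k}"

definition delta_space :: "(nat \<Rightarrow> ereal) measure" where
  "delta_space = restrict_space (PiM (UNIV :: nat set) (\<lambda>_. count_space Zbar)) Delta"

definition Delta0 :: "(nat \<Rightarrow> ereal) set" where
  "Delta0 = {k \<in> Delta. (\<forall>j. k j \<ge> 0) \<and> (\<exists>n. \<forall>j\<ge>n. k j = 0)}"

definition lfun :: "(nat \<Rightarrow> ereal) \<Rightarrow> nat \<Rightarrow> nat" where
  "lfun k i = card {j. k j = ereal (real i)}"

definition Xs :: "(nat \<Rightarrow> ereal) \<Rightarrow> nat \<Rightarrow> real" where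
  "Xs k i = (\<Sum>j. real (lfun k (i + j)))"

definition klim :: "(nat \<Rightarrow> ereal) \<Rightarrow> ereal" where
  "klim k = (INF j. k j)"

text \<open>Underlying probability space: i.i.d. Haar(Z_p) variables
  X_i^(N) = w (0, N, i), Y_j^(N) = w (1, N, j), Z_ij = w (2, i, j).\<close>
definition Omega :: "nat \<Rightarrow> (nat \<times> nat \<times> nat \<Rightarrow> qp) measure" where
  "Omega p = PiM (UNIV :: (nat \<times> nat \<times> nat) set) (\<lambda>_. haarZp p)"

definition Amat :: "nat \<Rightarrow> (nat \<Rightarrow> ereal) \<Rightarrow> (nat \<times> nat \<times> nat \<Rightarrow> qp) \<Rightarrow> (nat \<times> nat \<Rightarrow> qp)" where
  "Amat p k w = (\<lambda>(i, j). qp_add p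
      (qp_suminf p (\<lambda>N. if k N > klim k
          then qp_mult p (qp_ppow p (k N)) (qp_mult p (w (0, N, i)) (w (1, N, j)))
          else qp_zero))
      (qp_mult p (qp_ppow p (klim k)) (w (2, i, j))))"

definition mu :: "nat \<Rightarrow> (nat \<Rightarrow> ereal) \<Rightarrow> (nat \<times> nat \<Rightarrow> qp) measure" where
  "mu p k = distr (Omega p) (matinf p) (Amat p k)"

definition Pker :: "nat \<Rightarrow> real \<Rightarrow> nat \<Rightarrow> nat \<Rightarrow> real" where
  "Pker p s x1 x2 = (if x2 \<le> x1 then
     real p powr (- ((real x2)^2) - s * real x2)
       * qpoch (1 / real p) (1 / real p) x1 * qpoch (real p powr (-1 - s)) (1 / real p) x1
     / (qpoch (1 / real p) (1 / real p) x2 * qpoch (1 / real p) (1 / real p) (x1 - x2)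
        * qpoch (real p powr (-1 - s)) (1 / real p) x2)
   else 0)"

definition pidist :: "nat \<Rightarrow> real \<Rightarrow> nat \<Rightarrow> real" where
  "pidist p s x = real p powr (- ((real x)^2) - s * real x)
     * qpoch_inf (real p powr (-1 - s)) (1 / real p)
     / (qpoch (1 / real p) (1 / real p) x * qpoch (real p powr (-1 - s)) (1 / real p) x)"

end

theory Submission
  imports Defs "HOL-Number_Theory.Cong" "HOL-Combinatorics.Transposition"
begin

text \<open>
  Everything is read off from matrices modulo \<open>\<int>\<^sub>p\<close>. By the Smith normal form, \<open>\<gamma>(Z)\<close> is the order of the subgroup
  of \<open>(\<rat>\<^sub>p/\<int>\<^sub>p)\<^sup>N\<close> generated by the rows of \<open>Z\<close>; adding rows one at a time, with independent geometric
  denominators, gives a random matrix with the law \<open>M\<^sup>(\<^sup>s\<^sup>)\<close>, so that the definite description of \<open>M\<^sup>(\<^sup>s\<^sup>)\<close> is meaningful.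

  The disintegration is tested on events about the \<open>N \<times> N\<close> corner, with \<open>N \<rightarrow> \<infinity>\<close>. The corner lying in \<open>p\<int>\<^sub>p\<close> is
  much too likely under \<open>\<mu>\<^sub>k\<close> if some \<open>k\<^sub>j < 0\<close>; two rows agreeing modulo \<open>\<int>\<^sub>p\<close> is much too unlikely if all
  \<open>k\<^sub>j \<ge> 1\<close>, whereas under \<open>M\<^sup>(\<^sup>s\<^sup>)\<close> it happens with probability tending to \<open>1\<close>. Hence \<open>\<nu>\<close> lives on \<open>\<Delta>\<^sub>0\<close>. For \<open>k\<close>
  in \<open>\<Delta>\<^sub>0\<close> with group \<open>G = \<Oplus>\<^sub>j \<int>/p\<^sup>k\<^sup>j\<close>, the corner is congruent to \<open>diag(p\<^sup>-\<^sup>k\<^sup>j)\<close> with \<open>\<mu>\<^sub>k\<close>-probability at least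
  \<open>|Aut G| |G|\<^sup>-\<^sup>2\<^sup>N\<close>, which bounds \<open>\<nu>{k}\<close> from above by the claimed weight. These weights are the path probabilities of
  the Markov chain, whose initial law and kernel have total mass at most \<open>1\<close>; since \<open>\<nu>\<close> has mass \<open>1\<close> on \<open>\<Delta>\<^sub>0\<close>, all
  the upper bounds are equalities.
\<close>

section \<open>Digit expansions and p-adic arithmetic\<close>

text \<open>The test event for a point \<open>k\<close> of \<open>\<Delta>\<^sub>0\<close> is chosen
  so that \<open>N\<close> cancels. If \<open>G\<close> is the group of \<open>k\<close>, then under
  \<open>M\<^sup>(\<^sup>s\<^sup>)\<close> the \<open>N \<times> N\<close> corner is congruent to
  the diagonal matrix with probability \<open>c_N |G|^(-s-2N)\<close>, where \<open>c_N\<close> is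
  the normalizing constant of the density. Divided by the lower bound for
  \<open>\<mu>\<^sub>k\<close> this is \<open>c_N |G|^(-s) / |Aut G|\<close>, and \<open>c_N\<close>
  tends to the infinite product. The limit is a Cohen-Lenstra weight; written in the conjugate
  partition of \<open>k\<close> it factors along the chain. Two obstacles shape the measure theory:
  \<open>\<mu>\<^sub>k\<close> is not known to be measurable in \<open>k\<close>, and the image
  measure along a map not known to be measurable may be 0. The decomposition hypothesis itself
  settles both. Events of positive mass have integrable probabilities, and the constant function 1
  shows that almost every \<open>\<mu>\<^sub>k\<close> has mass 1. After that only one-sided
  comparisons with measurable events of the underlying space are made. Arithmetic in Q_p is done
  with real numbers in Z[1/p] modulo powers of \<open>p\<close>, so that every probability becomes a
  count of residues.\<close>

locale padic =
  fixes p :: nat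
  assumes prime_p: "prime p"
begin

lemma p_gt1: "1 < p" "0 < p" "p \<noteq> 0" "real p > 0" "real p > 1" "real p \<ge> 1" "real p \<noteq> 0"
  using prime_gt_1_nat[OF prime_p] by auto

text \<open>Since Z[1/p] meets Z_p in Z, a number in Z[1/p] lies in \<open>PZ e\<close> exactly if
  its p-adic valuation is at least \<open>e\<close>. Congruence modulo \<open>PZ e\<close> between
  reals is the working form of p-adic closeness.\<close>

definition PZ :: "int \<Rightarrow> real set" where
  "PZ e = {of_int n * real p powi e | n. True}"

lemma PZ_I: "of_int n * real p powi e \<in> PZ e"
  by (auto simp: PZ_def)

lemma PZ_0 [simp]: "0 \<in> PZ e"
  using PZ_I[of 0 e] by simp

lemma PZ_add: "x \<in> PZ e ==> y \<in> PZ e ==> x + y \<in> PZ e"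
  unfolding PZ_def by (auto simp flip: distrib_right of_int_add)

lemma PZ_uminus: "x \<in> PZ e ==> - x \<in> PZ e"
proof -
  assume "x \<in> PZ e"
  then obtain n where "x = of_int n * real p powi e" by (auto simp: PZ_def)
  hence "- x = of_int (- n) * real p powi e" by simp
  thus ?thesis using PZ_I by metis
qed

lemma PZ_diff: "x \<in> PZ e ==> y \<in> PZ e ==> x - y \<in> PZ e"
  using PZ_add[of x e "- y"] PZ_uminus[of y e] by simp

lemma PZ_diff_commute: "x - y \<in> PZ e ==> y - x \<in> PZ e"
  using PZ_uminus[of "x - y" e] by simp

lemma PZ_trans: "x - y \<in> PZ e ==> y - z \<in> PZ e ==> x - z \<in> PZ e"
  using PZ_add[of "x - y" e "y - z"] by simp

lemma PZ_mult: "x \<in> PZ e ==> y \<in> PZ f ==> x * y \<in> PZ (e + f)"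
proof -
  assume "x \<in> PZ e" "y \<in> PZ f"
  then obtain m n where "x = of_int m * real p powi e" "y = of_int n * real p powi f"
    by (auto simp: PZ_def)
  hence "x * y = of_int (m * n) * real p powi (e + f)"
    using p_gt1 by (simp add: power_int_add)
  thus ?thesis using PZ_I by metis
qed

lemma PZ_zero_eq: "PZ 0 = \<int>"
  by (auto simp: PZ_def Ints_def)

lemma powi_PZ: "real p powi e \<in> PZ e"
  using PZ_I[of 1 e] by simp

lemma powi_Ints: "e \<ge> 0 ==> real p powi e \<in> \<int>"
  by (auto simp: power_int_def)

lemma PZ_mono: assumes "e \<le> f" shows "PZ f \<subseteq> PZ e"
proof
  fix x assume "x \<in> PZ f"
  moreover have "real p powi (e - f) * (real p powi (f - e)) = 1"
    using p_gt1 by (simp flip: power_int_add)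
  ultimately obtain n where n: "x = of_int n * real p powi f" by (auto simp: PZ_def)
  have "real p powi (f - e) \<in> PZ 0" using powi_Ints assms by (simp add: PZ_zero_eq)
  moreover have "of_int n * real p powi e \<in> PZ e" by (rule PZ_I)
  ultimately have "of_int n * real p powi e * real p powi (f - e) \<in> PZ (e + 0)" by (rule PZ_mult[rotated])
  moreover have "real p powi e * real p powi (f - e) = real p powi f"
    using p_gt1 by (simp flip: power_int_add)
  ultimately show "x \<in> PZ e" using n by (simp add: mult.assoc)
qed

lemma PZ_monoD: "x \<in> PZ f ==> e \<le> f ==> x \<in> PZ e"
  using PZ_mono by blast

lemma PZ_int_mult: "n \<in> \<int> ==> x \<in> PZ e ==> n * x \<in> PZ e"
  using PZ_mult[of n 0 x e] by (simp add: PZ_zero_eq)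

lemma PZ_sum: "(\<And>i. i \<in> A ==> f i \<in> PZ e) ==> sum f A \<in> PZ e"
  by (induction A rule: infinite_finite_induct) (auto intro: PZ_add)

lemma PZ_small: assumes "x \<in> PZ e" "\<bar>x\<bar> < real p powi e" shows "x = 0"
proof -
  obtain n where n: "x = of_int n * real p powi e" using assms by (auto simp: PZ_def)
  have pos: "real p powi e > 0" using p_gt1 by simp
  have "\<bar>of_int n\<bar> * real p powi e < 1 * real p powi e" using assms(2) n pos by (simp add: abs_mult)
  hence "\<bar>real_of_int n\<bar> < 1" using pos by (simp only: mult_less_cancel_right_pos)
  hence "n = 0" by linarith
  thus ?thesis using n by simp
qed

text \<open>\<open>tr\<close> with an integer cutoff. A cutoff \<open>e\<close> represents
  \<open>x\<close> modulo \<open>p^e Z_p\<close>, for negative \<open>e\<close> as well;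
  \<open>T x 0\<close> is the p-adic fractional part.\<close>

definition T :: "qp \<Rightarrow> int \<Rightarrow> real" where
  "T x e = (\<Sum>i\<in>{i. i < e \<and> x i \<noteq> 0}. real (x i) * real p powi i)"

lemma tr_eq_T: "tr p x K = T x (int K)"
  by (simp add: tr_def T_def)

lemma QpD: "x \<in> Qp p ==> x i < p" by (simp add: Qp_def)

lemma Qp_low: "x \<in> Qp p ==> \<exists>N. \<forall>i<N. x i = 0" by (auto simp: Qp_def)

lemma T_interval: assumes "\<forall>i<N. x i = 0" shows "T x e = (\<Sum>i\<in>{N..<e}. real (x i) * real p powi i)"
  unfolding T_def
  by (rule sum.mono_neutral_left) (use assms in \<open>auto simp: not_less[symmetric]\<close>)

lemma T_low: "\<forall>i<e. x i = 0 ==> T x e = 0"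
  unfolding T_def by (rule sum.neutral) auto

lemma T_Suc: assumes "x \<in> Qp p" shows "T x (e + 1) = T x e + real (x e) * real p powi e"
proof -
  obtain N0 where N0: "\<forall>i<N0. x i = 0" using Qp_low assms by blast
  define N where "N = min N0 e"
  have N: "\<forall>i<N. x i = 0" "N \<le> e" using N0 by (auto simp: N_def)
  have "{N..<e + 1} = insert e {N..<e}" using N by auto
  thus ?thesis by (simp add: T_interval[OF N(1)])
qed

lemma T_nonneg: "T x e \<ge> 0"
  unfolding T_def using p_gt1 by (intro sum_nonneg) auto

lemma powi_add1: "real p powi (e + 1) = real p * real p powi e"
  using p_gt1 by (simp add: power_int_add)

lemma T_less: assumes "x \<in> Qp p" shows "T x e < real p powi e"
proof -
  obtain N0 where N0: "\<forall>i<N0. x i = 0" using Qp_low assms by blast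
  define N where "N = min N0 e"
  have N: "\<forall>i<N. x i = 0" "N \<le> e" using N0 by (auto simp: N_def)
  from N(2) show ?thesis
  proof (induction e rule: int_ge_induct)
    case base thus ?case using T_low[OF N(1)] p_gt1 by simp
  next
    case (step i)
    have "real (x i) \<le> real p - 1" using QpD[OF assms, of i] by linarith
    hence "real (x i) * real p powi i \<le> (real p - 1) * real p powi i"
      using p_gt1 by (intro mult_right_mono) auto
    thus ?case using step(2) T_Suc[OF assms, of i] powi_add1[of i] by (simp add: algebra_simps)
  qed
qed

lemma T_PZ: assumes "\<forall>i<N. x i = 0" shows "T x e \<in> PZ N"
  unfolding T_interval[OF assms]
proof (rule PZ_sum)
  fix i assume "i \<in> {N..<e}"
  thus "real (x i) * real p powi i \<in> PZ N"
    using PZ_int_mult[OF _ PZ_monoD[OF powi_PZ, of N i], of "real (x i)"] by auto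
qed

lemma T_bounded: assumes "x \<in> Qp p" shows "\<exists>m. \<forall>e. T x e \<in> PZ m"
  using T_PZ Qp_low[OF assms] by blast

lemma T_diff: assumes "x \<in> Qp p" "e \<le> f" shows "T x f - T x e \<in> PZ e"
  using assms(2)
proof (induction f rule: int_ge_induct)
  case base thus ?case by simp
next
  case (step i)
  have "real (x i) * real p powi i \<in> PZ e"
    using PZ_int_mult[OF _ PZ_monoD[OF powi_PZ step(1)], of "real (x i)"] by auto
  from PZ_add[OF step(2) this] show ?case using T_Suc[OF assms(1), of i] by (simp add: algebra_simps)
qed

lemma T_eq_iff: assumes "x \<in> Qp p" "y \<in> Qp p"
  shows "T x e - T y e \<in> PZ e \<longleftrightarrow> T x e = T y e"
proof
  assume "T x e - T y e \<in> PZ e"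
  moreover have "\<bar>T x e - T y e\<bar> < real p powi e"
    using T_less[OF assms(1), of e] T_less[OF assms(2), of e] T_nonneg[of x e] T_nonneg[of y e]
    by linarith
  ultimately show "T x e = T y e" using PZ_small by fastforce
qed auto

text \<open>Truncations at \<open>e\<close> lie in \<open>[0, p^e)\<close>, so a congruence modulo
  \<open>p^e\<close> between them is an equality. It descends to all smaller cutoffs, and digit
  \<open>i\<close> is the increment from cutoff \<open>i\<close> to \<open>i + 1\<close>.\<close>

lemma T_cong_iff: assumes "x \<in> Qp p" "y \<in> Qp p"
  shows "T x e - T y e \<in> PZ e \<longleftrightarrow> (\<forall>i<e. x i = y i)"
proof
  assume *: "T x e - T y e \<in> PZ e"
  have eq: "T x f = T y f" if "f \<le> e" for f
  proof -
    have "T x f - T x e \<in> PZ f" "T y e - T y f \<in> PZ f"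
      using T_diff[OF assms(1) that] T_diff[OF assms(2) that] PZ_diff_commute by auto
    hence "T x f - T y f \<in> PZ f"
      using PZ_monoD[OF * that] PZ_trans by blast
    thus ?thesis using T_eq_iff assms by blast
  qed
  show "\<forall>i<e. x i = y i"
  proof (intro allI impI)
    fix i assume "i < e"
    hence "real (x i) * real p powi i = real (y i) * real p powi i"
      using eq[of "i+1"] eq[of i] T_Suc[OF assms(1), of i] T_Suc[OF assms(2), of i] by simp
    thus "x i = y i" using p_gt1 by simp
  qed
next
  assume "\<forall>i<e. x i = y i"
  hence "T x e = T y e" unfolding T_def by (intro sum.cong) auto
  thus "T x e - T y e \<in> PZ e" by simp
qed

text \<open>Division by \<open>p^i\<close> leaves a fraction in \<open>[0, 1)\<close> from the lower
  digits, the digit itself, and a multiple of \<open>p\<close> that \<open>mod\<close> removes. The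
  digit thus ignores an error in \<open>PZ (i + 1)\<close>.\<close>

lemma dig_eq: assumes "x \<in> Qp p" "r - T x (i + 1) \<in> PZ (i + 1)"
  shows "dig p r i = x i"
proof -
  obtain n where n: "r - T x (i + 1) = of_int n * real p powi (i + 1)" using assms(2) by (auto simp: PZ_def)
  have pos: "real p powi i > 0" using p_gt1 by simp
  have "r = T x i + (real (x i) + real_of_int n * real p) * real p powi i"
    using n T_Suc[OF assms(1), of i] powi_add1[of i] by (simp add: algebra_simps)
  hence "r / real p powi i = T x i / real p powi i + of_int (int (x i) + n * int p)"
    using pos by (metis add_divide_distrib nonzero_mult_div_cancel_right less_irrefl of_int_add of_int_mult of_int_of_nat_eq)
  moreover have "0 \<le> T x i / real p powi i" "T x i / real p powi i < 1"
    using T_nonneg[of x i] T_less[OF assms(1), of i] pos by auto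
  ultimately have "\<lfloor>r / real p powi i\<rfloor> = int (x i) + n * int p"
    by linarith
  hence "\<lfloor>r / real p powi i\<rfloor> mod int p = int (x i)"
    using QpD[OF assms(1), of i] by simp
  thus ?thesis by (simp add: dig_def)
qed

text \<open>Rounding down and \<open>mod\<close> also give the right expansion of a negative number:
  the digits of -1 at positions \<open>i \<ge> 0\<close> are all \<open>p - 1\<close>. Negation in
  Q_p relies on this.\<close>

definition of_pfrac :: "real \<Rightarrow> qp" where "of_pfrac r = (\<lambda>i. dig p r i)"

lemma of_pfrac: assumes "r \<in> PZ m"
  shows "of_pfrac r \<in> Qp p" "\<forall>i<m. of_pfrac r i = 0" "r - T (of_pfrac r) e \<in> PZ e"
proof -
  have low: "dig p r i = 0" if i: "i < m" for i
  proof -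
    obtain n where n: "r = of_int n * real p powi (i + 1)"
      using PZ_monoD[OF assms, of "i + 1"] i by (auto simp: PZ_def)
    hence "r / real p powi i = of_int (n * int p)" using p_gt1 by (simp add: powi_add1)
    hence "\<lfloor>r / real p powi i\<rfloor> mod int p = 0" by (metis floor_of_int mod_mult_self2_is_0)
    thus ?thesis by (simp add: dig_def)
  qed
  thus l: "\<forall>i<m. of_pfrac r i = 0" by (simp add: of_pfrac_def)
  have lt: "dig p r i < p" for i using p_gt1 by (simp add: dig_def nat_less_iff)
  thus Q: "of_pfrac r \<in> Qp p" using l unfolding Qp_def by (auto simp: of_pfrac_def)
  show "r - T (of_pfrac r) e \<in> PZ e"
  proof (cases "e \<le> m")
    case True
    hence "T (of_pfrac r) e = 0" using l T_low by auto
    thus ?thesis using PZ_monoD[OF assms True] by simp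
  next
    case False
    hence "m \<le> e" by simp
    thus ?thesis
    proof (induction e rule: int_ge_induct)
      case base thus ?case using T_low[OF l] assms by simp
    next
      case (step i)
      let ?x = "of_pfrac r"
      obtain n where n: "r - T ?x i = of_int n * real p powi i" using step by (auto simp: PZ_def)
      have pos: "real p powi i > 0" using p_gt1 by simp
      have "r = T ?x i + of_int n * real p powi i" using n by simp
      hence "r / real p powi i = T ?x i / real p powi i + of_int n"
        using pos by (metis add_divide_distrib nonzero_mult_div_cancel_right less_irrefl)
      moreover have "0 \<le> T ?x i / real p powi i" "T ?x i / real p powi i < 1"
        using T_nonneg[of ?x i] T_less[OF Q, of i] pos by auto
      ultimately have "\<lfloor>r / real p powi i\<rfloor> = n" by linarith
      hence d: "int (?x i) = n mod int p" using p_gt1 by (simp add: of_pfrac_def dig_def)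
      have "n = (n div int p) * int p + n mod int p" by simp
      hence "real_of_int n = real_of_int (n div int p) * real p + real (?x i)"
        using d by (metis of_int_add of_int_mult of_int_of_nat_eq)
      hence "r - T ?x (i + 1) = of_int (n div int p) * real p powi (i + 1)"
        using n T_Suc[OF Q, of i] powi_add1[of i] by (simp add: algebra_simps)
      thus ?case using PZ_I by simp
    qed
  qed
qed

text \<open>The relational form of \<open>qp_lim\<close>. The approximations may be any numbers in
  Z[1/p], negative ones included, and the common bound \<open>m\<close> on the denominators is what
  makes products converge.\<close>

definition plim :: "(nat \<Rightarrow> real) \<Rightarrow> qp \<Rightarrow> bool" where
  "plim r x \<longleftrightarrow> x \<in> Qp p \<and> (\<exists>m. \<forall>K. r K \<in> PZ m) \<and> (\<forall>e. \<forall>\<^sub>F K in sequentially. r K - T x e \<in> PZ e)"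

definition pcauchy :: "(nat \<Rightarrow> real) \<Rightarrow> bool" where
  "pcauchy r \<longleftrightarrow> (\<exists>m. \<forall>K. r K \<in> PZ m) \<and> (\<forall>e. \<exists>K0. \<forall>K\<ge>K0. r K - r K0 \<in> PZ e)"

lemma plim_Qp: "plim r x ==> x \<in> Qp p" by (simp add: plim_def)

lemma plim_qp_lim: assumes "plim r x" shows "qp_lim p r = x"
proof
  fix i
  have x: "x \<in> Qp p" using assms by (simp add: plim_def)
  have "\<forall>\<^sub>F K in sequentially. r K - T x (i + 1) \<in> PZ (i + 1)" using assms by (simp add: plim_def)
  hence ev: "\<forall>\<^sub>F K in sequentially. dig p (r K) i = x i"
    by eventually_elim (rule dig_eq[OF x])
  show "qp_lim p r i = x i" unfolding qp_lim_def
  proof (rule the_equality)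
    show "\<forall>\<^sub>F K in sequentially. dig p (r K) i = x i" by (rule ev)
    fix c assume "\<forall>\<^sub>F K in sequentially. dig p (r K) i = c"
    with ev have "\<forall>\<^sub>F K in sequentially. c = x i" by eventually_elim simp
    thus "c = x i" by simp
  qed
qed

lemma plim_unique: "plim r x ==> plim r y ==> x = y"
  using plim_qp_lim by metis

lemma plim_pcauchy: assumes "plim r x" shows "pcauchy r"
  unfolding pcauchy_def
proof (intro conjI allI)
  show "\<exists>m. \<forall>K. r K \<in> PZ m" using assms by (simp add: plim_def)
  fix e
  obtain K0 where K0: "\<And>K. K \<ge> K0 ==> r K - T x e \<in> PZ e"
    using assms unfolding plim_def eventually_sequentially by metis
  have "r K - r K0 \<in> PZ e" if "K \<ge> K0" for K
    using PZ_trans[OF K0[OF that] PZ_diff_commute[OF K0]] by simp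
  thus "\<exists>K0. \<forall>K\<ge>K0. r K - r K0 \<in> PZ e" by blast
qed

text \<open>Completeness: once \<open>r\<close> varies only within \<open>PZ e\<close>, the
  expansions of \<open>r K\<close> agree below position \<open>e\<close>, so every digit has an
  eventual value.\<close>

lemma pcauchy_plim: assumes "pcauchy r" shows "\<exists>x. plim r x"
proof -
  obtain m where m: "\<And>K. r K \<in> PZ m" using assms by (auto simp: pcauchy_def)
  define y where "y = (\<lambda>K. of_pfrac (r K))"
  have y: "y K \<in> Qp p" "\<forall>i<m. y K i = 0" "r K - T (y K) e \<in> PZ e" for K e
    using of_pfrac[OF m] by (auto simp: y_def)
  have "\<exists>K0. \<forall>K\<ge>K0. r K - r K0 \<in> PZ e" for e using assms by (simp add: pcauchy_def)
  then obtain K0 where K0: "\<And>e K. K \<ge> K0 e ==> r K - r (K0 e) \<in> PZ e" by metis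
  have stab: "\<forall>i<e. y K i = y (K0 e) i" if "K \<ge> K0 e" for e K
  proof -
    have "T (y K) e - T (y (K0 e)) e \<in> PZ e"
      using PZ_trans[OF PZ_trans[OF PZ_diff_commute[OF y(3)[of K e]] K0[OF that]] y(3)] .
    thus ?thesis using T_cong_iff y by blast
  qed
  \<comment> \<open>Digit \<open>i\<close> is read at an index from which all positions below
    \<open>i + 1\<close> are stable.\<close>
  define x where "x = (\<lambda>i. y (K0 (i + 1)) i)"
  have xy: "x i = y K i" if "K \<ge> K0 (i + 1)" for i K
    using stab[OF that] by (simp add: x_def)
  have x: "x \<in> Qp p" unfolding Qp_def x_def using y(1,2) QpD by auto
  have xlow: "\<forall>i<m. x i = 0" using y(2) by (simp add: x_def)
  have "\<forall>\<^sub>F K in sequentially. r K - T x e \<in> PZ e" for e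
  proof -
    have agree: "x i = y (K0 e) i" if "i < e" for i
    proof -
      let ?K = "max (K0 e) (K0 (i + 1))"
      have "x i = y ?K i" by (rule xy) simp
      also have "\<dots> = y (K0 e) i" using stab[of e ?K] that by simp
      finally show ?thesis .
    qed
    have "r K - T x e \<in> PZ e" if "K \<ge> K0 e" for K
    proof -
      have "T (y K) e - T x e \<in> PZ e"
        using agree stab[OF that] by (subst T_cong_iff[OF y(1) x]) auto
      thus ?thesis using PZ_trans[OF y(3)] by blast
    qed
    thus ?thesis unfolding eventually_sequentially by blast
  qed
  hence "plim r x" using x m by (auto simp: plim_def)
  thus ?thesis by blast
qed

lemma plim_null: assumes "plim r x" "\<exists>m. \<forall>K. s K \<in> PZ m"
    "\<And>e. \<forall>\<^sub>F K in sequentially. s K - r K \<in> PZ e"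
  shows "plim s x"
proof -
  have "\<forall>\<^sub>F K in sequentially. s K - T x e \<in> PZ e" for e
  proof -
    have "\<forall>\<^sub>F K in sequentially. r K - T x e \<in> PZ e" using assms(1) by (simp add: plim_def)
    with assms(3)[of e] show ?thesis by eventually_elim (rule PZ_trans)
  qed
  thus ?thesis using assms by (auto simp: plim_def)
qed

lemma plim_diff_null: assumes "plim r x" "plim s x"
  shows "\<forall>\<^sub>F K in sequentially. s K - r K \<in> PZ e"
proof -
  have "\<forall>\<^sub>F K in sequentially. r K - T x e \<in> PZ e" "\<forall>\<^sub>F K in sequentially. s K - T x e \<in> PZ e"
    using assms by (auto simp: plim_def)
  thus ?thesis by eventually_elim (metis PZ_trans PZ_diff_commute)
qed

lemma plim_tr: assumes "x \<in> Qp p" shows "plim (tr p x) x"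
proof -
  have "\<forall>\<^sub>F K in sequentially. tr p x K - T x e \<in> PZ e" for e
    unfolding eventually_sequentially
    by (intro exI[of _ "nat e"]) (auto simp: tr_eq_T intro!: T_diff[OF assms])
  moreover have "\<exists>m. \<forall>K. tr p x K \<in> PZ m" using T_bounded[OF assms] by (auto simp: tr_eq_T)
  ultimately show ?thesis using assms by (auto simp: plim_def)
qed

lemma bdd_add: "\<exists>m. \<forall>K. r K \<in> PZ m ==> \<exists>m. \<forall>K. s K \<in> PZ m ==> \<exists>m. \<forall>K. (r K + s K) \<in> PZ m"
proof -
  assume "\<exists>m. \<forall>K. r K \<in> PZ m" "\<exists>m. \<forall>K. s K \<in> PZ m"
  then obtain m n where "\<And>K. r K \<in> PZ m" "\<And>K. s K \<in> PZ n" by blast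
  hence "r K \<in> PZ (min m n)" "s K \<in> PZ (min m n)" for K
    using PZ_monoD[of _ m "min m n"] PZ_monoD[of _ n "min m n"] by auto
  thus ?thesis using PZ_add by blast
qed

lemma bdd_mult: "\<exists>m. \<forall>K. r K \<in> PZ m ==> \<exists>m. \<forall>K. s K \<in> PZ m ==> \<exists>m. \<forall>K. (r K * s K) \<in> PZ m"
  using PZ_mult by blast

text \<open>\<open>qp_add\<close> is defined through the truncations \<open>tr\<close>. Other
  approximating sequences differ from them by null sequences and have the same limit; this frees all
  later arithmetic from \<open>tr\<close>.\<close>

lemma plim_add: assumes "plim r x" "plim s y" shows "plim (\<lambda>K. r K + s K) (qp_add p x y)"
proof -
  have x: "x \<in> Qp p" "y \<in> Qp p" using assms plim_Qp by auto
  have b: "\<exists>m. \<forall>K. (r K + s K) \<in> PZ m" using bdd_add assms by (auto simp: plim_def)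
  have "pcauchy (\<lambda>K. r K + s K)" unfolding pcauchy_def
  proof (intro conjI allI b)
    fix e
    obtain K1 K2 where "\<And>K. K \<ge> K1 ==> r K - T x e \<in> PZ e" "\<And>K. K \<ge> K2 ==> s K - T y e \<in> PZ e"
      using assms by (auto simp: plim_def eventually_sequentially) metis
    hence "(r K + s K) - (T x e + T y e) \<in> PZ e" if "K \<ge> max K1 K2" for K
      using that PZ_add[of "r K - T x e" e "s K - T y e"] by (simp add: algebra_simps)
    hence "(r K + s K) - (r (max K1 K2) + s (max K1 K2)) \<in> PZ e" if "K \<ge> max K1 K2" for K
      using that by (meson PZ_trans PZ_diff_commute order_refl)
    thus "\<exists>K0. \<forall>K\<ge>K0. r K + s K - (r K0 + s K0) \<in> PZ e" by blast
  qed
  then obtain z where z: "plim (\<lambda>K. r K + s K) z" using pcauchy_plim by blast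
  have "plim (\<lambda>K. tr p x K + tr p y K) z"
  proof (rule plim_null[OF z])
    show "\<exists>m. \<forall>K. tr p x K + tr p y K \<in> PZ m"
      using bdd_add plim_tr[OF x(1)] plim_tr[OF x(2)] by (auto simp: plim_def)
    fix e
    from plim_diff_null[OF assms(1) plim_tr[OF x(1)], of e] plim_diff_null[OF assms(2) plim_tr[OF x(2)], of e]
    show "\<forall>\<^sub>F K in sequentially. tr p x K + tr p y K - (r K + s K) \<in> PZ e"
      by eventually_elim (use PZ_add in \<open>fastforce simp: algebra_simps\<close>)
  qed
  hence "qp_add p x y = z" unfolding qp_add_def by (rule plim_qp_lim)
  thus ?thesis using z by simp
qed

lemma mult_null: assumes "\<exists>m. \<forall>K. (b::nat \<Rightarrow> real) K \<in> PZ m" "\<And>e. \<forall>\<^sub>F K in sequentially. a K \<in> PZ e"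
  shows "\<forall>\<^sub>F K in sequentially. a K * b K \<in> PZ e"
proof -
  obtain m where m: "\<And>K. b K \<in> PZ m" using assms(1) by blast
  from assms(2)[of "e - m"] show ?thesis
    by eventually_elim (use PZ_mult[OF _ m] in fastforce)
qed

lemma plim_mult: assumes "plim r x" "plim s y" shows "plim (\<lambda>K. r K * s K) (qp_mult p x y)"
proof -
  have x: "x \<in> Qp p" "y \<in> Qp p" using assms plim_Qp by auto
  have br: "\<exists>m. \<forall>K. r K \<in> PZ m" and bs: "\<exists>m. \<forall>K. s K \<in> PZ m" using assms by (auto simp: plim_def)
  have b: "\<exists>m. \<forall>K. (r K * s K) \<in> PZ m" using bdd_mult br bs by auto
  have "pcauchy (\<lambda>K. r K * s K)" unfolding pcauchy_def
  proof (intro conjI allI b)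
    fix e
    obtain m n where mn: "\<And>K. r K \<in> PZ m" "\<And>K. s K \<in> PZ n" using br bs by blast
    \<comment> \<open>Each precision is raised by the denominator bound of the other factor.\<close>
    obtain K1 K2 where K: "\<And>K. K \<ge> K1 ==> r K - r K1 \<in> PZ (e - n)" "\<And>K. K \<ge> K2 ==> s K - s K2 \<in> PZ (e - m)"
      using plim_pcauchy[OF assms(1)] plim_pcauchy[OF assms(2)] unfolding pcauchy_def by metis
    define L where "L = max K1 K2"
    have "r K * s K - r L * s L \<in> PZ e" if "K \<ge> L" for K
    proof -
      have L: "K1 \<le> L" "K2 \<le> L" "K1 \<le> K" "K2 \<le> K" using that by (auto simp: L_def)
      have "r K - r L \<in> PZ (e - n)" using PZ_trans[OF K(1)[OF L(3)] PZ_diff_commute[OF K(1)[OF L(1)]]] .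
      hence 1: "(r K - r L) * s K \<in> PZ e" using PZ_mult[OF _ mn(2)] by fastforce
      have "s K - s L \<in> PZ (e - m)" using PZ_trans[OF K(2)[OF L(4)] PZ_diff_commute[OF K(2)[OF L(2)]]] .
      hence 2: "r L * (s K - s L) \<in> PZ e" using PZ_mult[OF mn(1)[of L]] by fastforce
      show ?thesis using PZ_add[OF 1 2] by (simp add: algebra_simps)
    qed
    thus "\<exists>K0. \<forall>K\<ge>K0. r K * s K - (r K0 * s K0) \<in> PZ e" by blast
  qed
  then obtain z where z: "plim (\<lambda>K. r K * s K) z" using pcauchy_plim by blast
  have "plim (\<lambda>K. tr p x K * tr p y K) z"
  proof (rule plim_null[OF z])
    have bx: "\<exists>m. \<forall>K. tr p x K \<in> PZ m" and bY: "\<exists>m. \<forall>K. tr p y K \<in> PZ m"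
      using plim_tr[OF x(1)] plim_tr[OF x(2)] by (auto simp: plim_def)
    thus "\<exists>m. \<forall>K. tr p x K * tr p y K \<in> PZ m" using bdd_mult by blast
    fix e
    have "\<forall>\<^sub>F K in sequentially. (tr p x K - r K) * tr p y K \<in> PZ e"
      by (rule mult_null[OF bY]) (rule plim_diff_null[OF assms(1) plim_tr[OF x(1)]])
    moreover have "\<forall>\<^sub>F K in sequentially. (tr p y K - s K) * r K \<in> PZ e"
      by (rule mult_null[OF br]) (rule plim_diff_null[OF assms(2) plim_tr[OF x(2)]])
    ultimately show "\<forall>\<^sub>F K in sequentially. tr p x K * tr p y K - r K * s K \<in> PZ e"
      by eventually_elim (use PZ_add in \<open>fastforce simp: algebra_simps\<close>)
  qed
  hence "qp_mult p x y = z" unfolding qp_mult_def by (rule plim_qp_lim)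
  thus ?thesis using z by simp
qed

section \<open>Constants, powers of p, finite sums and matrix products as limits\<close>

lemma qp_zero_Qp: "qp_zero \<in> Qp p" using p_gt1 by (auto simp: qp_zero_def Qp_def)

lemma T_zero [simp]: "T qp_zero e = 0" by (simp add: T_def qp_zero_def)

lemma plim_zero: "plim (\<lambda>_. 0) qp_zero"
  unfolding plim_def using qp_zero_Qp by auto

lemma T_monom: assumes "x = (\<lambda>i. if i = v then 1 else 0)" shows "T x e = (if v < e then real p powi v else 0)"
proof -
  have "{i. i < e \<and> x i \<noteq> 0} = (if v < e then {v} else {})" using assms by auto
  thus ?thesis using assms by (simp add: T_def)
qed

lemma plim_monom: assumes "x = (\<lambda>i. if i = v then 1 else 0)" shows "plim (\<lambda>_. real p powi v) x"
  unfolding plim_def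
proof (intro conjI allI)
  show "x \<in> Qp p" unfolding Qp_def using p_gt1 assms by auto
  show "\<exists>m. \<forall>K::nat. real p powi v \<in> PZ m" using powi_PZ by blast
  fix e
  have "real p powi v - T x e \<in> PZ e"
    using T_monom[OF assms, of e] PZ_monoD[OF powi_PZ, of e v] by (auto split: if_splits)
  thus "\<forall>\<^sub>F K::nat in sequentially. real p powi v - T x e \<in> PZ e" by simp
qed

lemma plim_one: "plim (\<lambda>_. 1) qp_one"
  using plim_monom[of qp_one 0] by (simp add: qp_one_def)

definition ppow_real :: "ereal \<Rightarrow> real" where
  "ppow_real k = (if k = -\<infinity> then 0 else real p powi (- \<lfloor>real_of_ereal k\<rfloor>))"

lemma plim_ppow: "plim (\<lambda>_. ppow_real k) (qp_ppow p k)"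
  unfolding qp_ppow_def ppow_real_def using plim_zero plim_monom by auto

lemma plim_foldr: "(\<And>l. l \<in> set xs ==> plim (r l) (f l)) ==>
   plim (\<lambda>K. \<Sum>l\<leftarrow>xs. r l K) (foldr (\<lambda>l acc. qp_add p (f l) acc) xs qp_zero)"
  by (induction xs) (auto intro: plim_add plim_zero)

lemma plim_sum: assumes "\<And>l. l < n ==> plim (r l) (f l)"
  shows "plim (\<lambda>K. \<Sum>l<n. r l K) (qp_sum p f n)"
proof -
  have "(\<Sum>l\<leftarrow>[0..<n]. r l K) = (\<Sum>l<n. r l K)" for K
    by (simp add: interv_sum_list_conv_sum_set_nat atLeast0LessThan)
  thus ?thesis unfolding qp_sum_def using plim_foldr[of "[0..<n]" r f] assms by simp
qed

lemma plim_matmul: assumes "\<And>l. l < N ==> plim (a i l) (A (i, l))" "\<And>l. l < N ==> plim (b l j) (B (l, j))"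
  shows "plim (\<lambda>K. \<Sum>l<N. a i l K * b l j K) (matmul p N A B (i, j))"
  unfolding matmul_def by (simp, rule plim_sum, rule plim_mult) (use assms in auto)

lemma qp_add_Qp: "x \<in> Qp p ==> y \<in> Qp p ==> qp_add p x y \<in> Qp p"
  using plim_Qp[OF plim_add[OF plim_tr plim_tr]] .
lemma qp_mult_Qp: "x \<in> Qp p ==> y \<in> Qp p ==> qp_mult p x y \<in> Qp p"
  using plim_Qp[OF plim_mult[OF plim_tr plim_tr]] .
lemma qp_sum_Qp: "(\<And>l. l < n ==> f l \<in> Qp p) ==> qp_sum p f n \<in> Qp p"
  using plim_Qp[OF plim_sum[of n "\<lambda>l. tr p (f l)" f]] plim_tr by auto

text \<open>Carries may leave the range \<open>[0, p^e)\<close>, so truncation is additive only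
  modulo \<open>p^e\<close>.\<close>

lemma T_add: assumes "x \<in> Qp p" "y \<in> Qp p" shows "T (qp_add p x y) e - (T x e + T y e) \<in> PZ e"
proof -
  have "plim (\<lambda>K. tr p x K + tr p y K) (qp_add p x y)" using plim_add plim_tr assms by blast
  hence "\<forall>\<^sub>F K in sequentially. (tr p x K + tr p y K) - T (qp_add p x y) e \<in> PZ e" by (simp add: plim_def)
  moreover have "\<forall>\<^sub>F K in sequentially. tr p x K - T x e \<in> PZ e" "\<forall>\<^sub>F K in sequentially. tr p y K - T y e \<in> PZ e"
    using plim_tr assms by (auto simp: plim_def)
  ultimately have "\<forall>\<^sub>F K::nat in sequentially. T (qp_add p x y) e - (T x e + T y e) \<in> PZ e"
  proof eventually_elim
    case (elim K)
    have "T (qp_add p x y) e - (tr p x K + tr p y K) \<in> PZ e" using elim(1) PZ_diff_commute by blast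
    from PZ_add[OF PZ_add[OF this elim(2)] elim(3)] show ?case by (simp add: algebra_simps)
  qed
  thus ?thesis by simp
qed

lemma Zp_Qp: "x \<in> Zp p ==> x \<in> Qp p" by (simp add: Zp_def)

lemma T_Zp: "x \<in> Zp p ==> T x e \<in> \<int>"
  using T_PZ[of 0 x e] by (auto simp: Zp_def PZ_zero_eq)

lemma Zp_iff: "x \<in> Qp p ==> x \<in> Zp p \<longleftrightarrow> T x 0 \<in> \<int>"
proof
  assume x: "x \<in> Qp p" "T x 0 \<in> \<int>"
  hence "T x 0 - T qp_zero 0 \<in> PZ 0" by (simp add: PZ_zero_eq)
  hence "\<forall>i<0. x i = qp_zero i" using T_cong_iff[OF x(1) qp_zero_Qp] by blast
  thus "x \<in> Zp p" using x by (simp add: Zp_def qp_zero_def)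
qed (use T_Zp in auto)

lemma plim_Zp: assumes "plim r x" "\<And>K. r K \<in> \<int>" shows "x \<in> Zp p"
proof -
  have "\<forall>\<^sub>F K in sequentially. r K - T x 0 \<in> PZ 0" using assms(1) by (simp add: plim_def)
  then obtain K where "r K - T x 0 \<in> \<int>" by (auto simp: PZ_zero_eq eventually_sequentially)
  hence "T x 0 \<in> \<int>" using assms(2)[of K] by (metis Ints_diff diff_diff_eq2 add_diff_cancel_left')
  thus ?thesis using Zp_iff plim_Qp[OF assms(1)] by blast
qed

lemma qp_add_Zp: "x \<in> Zp p ==> y \<in> Zp p ==> qp_add p x y \<in> Zp p"
  by (rule plim_Zp[OF plim_add[OF plim_tr plim_tr]]) (auto simp: Zp_Qp tr_eq_T T_Zp)
lemma qp_mult_Zp: "x \<in> Zp p ==> y \<in> Zp p ==> qp_mult p x y \<in> Zp p"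
  by (rule plim_Zp[OF plim_mult[OF plim_tr plim_tr]]) (auto simp: Zp_Qp tr_eq_T T_Zp)

end

section \<open>Smith normal form\<close>

definition dl :: "nat \<Rightarrow> nat \<Rightarrow> 'a::comm_ring_1" where "dl i j = (if i = j then 1 else 0)"

definition mm :: "nat \<Rightarrow> (nat \<Rightarrow> nat \<Rightarrow> 'a::comm_ring_1) \<Rightarrow> (nat \<Rightarrow> nat \<Rightarrow> 'a) \<Rightarrow> nat \<Rightarrow> nat \<Rightarrow> 'a" where
  "mm N A B = (\<lambda>i j. \<Sum>l<N. A i l * B l j)"

lemma mm_assoc: "mm N (mm N A B) C = mm N A (mm N B C)"
proof (intro ext)
  fix i j
  have "mm N (mm N A B) C i j = (\<Sum>l<N. \<Sum>k<N. A i k * B k l * C l j)"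
    by (simp add: mm_def sum_distrib_right)
  also have "\<dots> = (\<Sum>k<N. \<Sum>l<N. A i k * B k l * C l j)" by (rule sum.swap)
  also have "\<dots> = mm N A (mm N B C) i j" by (simp add: mm_def sum_distrib_left mult.assoc)
  finally show "mm N (mm N A B) C i j = mm N A (mm N B C) i j" .
qed

lemma mm_cong: "(\<And>l. l < N ==> A i l = A' i l) ==> (\<And>l. l < N ==> B l j = B' l j) ==> mm N A B i j = mm N A' B' i j"
  by (simp add: mm_def)

lemma dl_sum1 [simp]: "i < N ==> (\<Sum>l<N. dl i l * f l) = f i"
  by (simp add: dl_def if_distrib[of "\<lambda>x. x * _"] cong: if_cong)

lemma dl_sum2 [simp]: "j < N ==> (\<Sum>l<N. f l * dl l j) = f j"
  by (simp add: dl_def if_distrib[of "\<lambda>x. _ * x"] cong: if_cong)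

lemma mm_dl1: "i < N ==> mm N dl A i j = A i j" by (simp add: mm_def)
lemma mm_dl2: "j < N ==> mm N A dl i j = A i j" by (simp add: mm_def)

lemma dl_commute: "dl i j = dl j i" by (simp add: dl_def)
lemma dl_Suc [simp]: "dl (Suc i) (Suc j) = dl i j" "dl 0 (Suc j) = 0" "dl (Suc i) 0 = 0" "dl i i = 1"
  by (auto simp: dl_def)

text \<open>Smith normal form over a ring in which, on the entries that occur (the set \<open>F\<close>),
  any two elements are comparable for divisibility by the subring \<open>R\<close>; \<open>D\<close> holds representatives up to
  units of \<open>R\<close>.\<close>

locale smith =
  fixes R F D :: "'a::comm_ring_1 set"
  assumes R1: "1 \<in> R" and R_add: "a \<in> R ==> b \<in> R ==> a + b \<in> R"
    and R_mult: "a \<in> R ==> b \<in> R ==> a * b \<in> R" and R_uminus: "a \<in> R ==> - a \<in> R"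
    and F_add: "x \<in> F ==> y \<in> F ==> x + y \<in> F" and F_mult: "a \<in> R ==> x \<in> F ==> a * x \<in> F"
    and comparable: "x \<in> F ==> y \<in> F ==> \<exists>m\<in>R. x = m * y \<or> y = m * x"
    and normal: "x \<in> F ==> \<exists>u\<in>R. \<exists>u'\<in>R. u * u' = 1 \<and> u * x \<in> D"
begin

lemma R0: "0 \<in> R" using R_add[OF R1 R_uminus[OF R1]] by simp

lemma R_sum: "(\<And>i. i \<in> A ==> f i \<in> R) ==> sum f A \<in> R"
  by (induction A rule: infinite_finite_induct) (auto intro: R_add R0)

lemma R_dl: "dl i j \<in> R" by (simp add: dl_def R0 R1)

text \<open>Invertibility over \<open>R\<close> is witnessed by an explicit inverse. Products,
  transposes and block extensions are then direct, and no determinants occur.\<close>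

definition gl :: "nat \<Rightarrow> (nat \<Rightarrow> nat \<Rightarrow> 'a) \<Rightarrow> (nat \<Rightarrow> nat \<Rightarrow> 'a) \<Rightarrow> bool" where
  "gl N U U' \<longleftrightarrow> (\<forall>i<N. \<forall>j<N. U i j \<in> R \<and> U' i j \<in> R \<and> mm N U U' i j = dl i j \<and> mm N U' U i j = dl i j)"

definition eqv :: "nat \<Rightarrow> (nat \<Rightarrow> nat \<Rightarrow> 'a) \<Rightarrow> (nat \<Rightarrow> nat \<Rightarrow> 'a) \<Rightarrow> bool" where
  "eqv N Z Z' \<longleftrightarrow> (\<exists>U U' V V'. gl N U U' \<and> gl N V V' \<and> (\<forall>i<N. \<forall>j<N. Z' i j = mm N (mm N U Z) V i j))"

lemma gl_dl: "gl N dl dl" by (simp add: gl_def R_dl mm_def)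

lemma gl_mult: assumes "gl N U U'" "gl N V V'" shows "gl N (mm N U V) (mm N V' U')"
  unfolding gl_def
proof (intro allI impI conjI)
  fix i j assume ij: "i < N" "j < N"
  show "mm N U V i j \<in> R" "mm N V' U' i j \<in> R"
    using assms ij unfolding gl_def mm_def by (auto intro!: R_sum R_mult)
  have "mm N (mm N U V) (mm N V' U') i j = mm N U (mm N (mm N V V') U') i j" by (simp add: mm_assoc)
  also have "\<dots> = mm N U U' i j"
    by (intro mm_cong refl, subst mm_cong[of N _ _ dl _ _ U']) (use assms in \<open>auto simp: gl_def mm_dl1\<close>)
  finally show "mm N (mm N U V) (mm N V' U') i j = dl i j" using assms ij by (simp add: gl_def)
  have "mm N (mm N V' U') (mm N U V) i j = mm N V' (mm N (mm N U' U) V) i j" by (simp add: mm_assoc)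
  also have "\<dots> = mm N V' V i j"
    by (intro mm_cong refl, subst mm_cong[of N _ _ dl _ _ V]) (use assms in \<open>auto simp: gl_def mm_dl1\<close>)
  finally show "mm N (mm N V' U') (mm N U V) i j = dl i j" using assms ij by (simp add: gl_def)
qed

lemma eqv_trans: assumes "eqv N X Y" "eqv N Y Z" shows "eqv N X Z"
proof -
  obtain U U' V V' where 1: "gl N U U'" "gl N V V'" "\<forall>i<N. \<forall>j<N. Y i j = mm N (mm N U X) V i j"
    using assms(1) by (auto simp: eqv_def)
  obtain A A' B B' where 2: "gl N A A'" "gl N B B'" "\<forall>i<N. \<forall>j<N. Z i j = mm N (mm N A Y) B i j"
    using assms(2) by (auto simp: eqv_def)
  have "Z i j = mm N (mm N (mm N A U) X) (mm N V B) i j" if ij: "i < N" "j < N" for i j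
  proof -
    have "Z i j = mm N (mm N A Y) B i j" using 2 ij by simp
    also have "\<dots> = mm N (mm N A (mm N (mm N U X) V)) B i j"
      by (rule mm_cong, rule mm_cong) (use 1 in auto)
    finally show ?thesis by (simp add: mm_assoc)
  qed
  thus ?thesis unfolding eqv_def using gl_mult[OF 2(1) 1(1)] gl_mult[OF 1(2) 2(2)] by blast
qed

lemma eqv_rows: assumes "gl N U U'" "\<And>i j. i < N ==> j < N ==> Z' i j = mm N U Z i j" shows "eqv N Z Z'"
  unfolding eqv_def
  by (rule exI[of _ U], rule exI[of _ U'], rule exI[of _ dl], rule exI[of _ dl])
     (use assms gl_dl in \<open>auto simp: mm_dl2\<close>)

lemma eqv_cong: "(\<And>i j. i < N ==> j < N ==> Z' i j = Z i j) ==> eqv N Z Z'"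
  by (rule eqv_rows[OF gl_dl]) (auto simp: mm_dl1)

lemma mm_transpose: "mm N A B i j = mm N (\<lambda>a b. B b a) (\<lambda>a b. A b a) j i"
  by (simp add: mm_def mult.commute)

lemma gl_transpose: "gl N U U' ==> gl N (\<lambda>i j. U j i) (\<lambda>i j. U' j i)"
  unfolding gl_def using mm_transpose[of N U U'] mm_transpose[of N U' U]
  by (auto simp: dl_commute)

lemma eqv_transpose: assumes "eqv N Z Z'" shows "eqv N (\<lambda>i j. Z j i) (\<lambda>i j. Z' j i)"
proof -
  obtain U U' V V' where 1: "gl N U U'" "gl N V V'" "\<forall>i<N. \<forall>j<N. Z' i j = mm N (mm N U Z) V i j"
    using assms by (auto simp: eqv_def)
  have "Z' j i = mm N (mm N (\<lambda>i j. V j i) (\<lambda>i j. Z j i)) (\<lambda>i j. U j i) i j" if "i < N" "j < N" for i j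
  proof -
    have "Z' j i = mm N (mm N U Z) V j i" using 1 that by simp
    also have "\<dots> = mm N (\<lambda>a b. V b a) (mm N (\<lambda>a b. Z b a) (\<lambda>a b. U b a)) i j"
      by (subst mm_transpose) (rule mm_cong, auto simp: mm_transpose[of N U Z])
    finally show ?thesis by (simp add: mm_assoc)
  qed
  thus ?thesis unfolding eqv_def using gl_transpose 1 by blast
qed

lemma eqv_swap: assumes "a < N" shows "eqv N Z (\<lambda>i j. Z (Transposition.transpose 0 a i) j)"
proof (rule eqv_rows)
  let ?s = "Transposition.transpose 0 a" let ?U = "\<lambda>i. dl (?s i) :: nat \<Rightarrow> 'a"
  have s: "?s i < N" if "i < N" for i using that assms by (auto simp: Transposition.transpose_def)
  show "gl N ?U ?U" unfolding gl_def mm_def using s by (auto simp: R_dl)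
  show "Z (?s i) j = mm N ?U Z i j" if "i < N" for i j unfolding mm_def using s[OF that] by simp
qed

text \<open>Because \<open>m 0 = 0\<close>, row 0 stays fixed, and the inverse operation adds the
  same multiples back.\<close>

lemma eqv_elim: assumes "\<And>i. i < N ==> m i \<in> R" "m 0 = 0" "0 < N"
  shows "eqv N Z (\<lambda>i j. Z i j - m i * Z 0 j)"
proof (rule eqv_rows)
  let ?U = "\<lambda>i k. dl i k - m i * dl 0 k" let ?U' = "\<lambda>i k. dl i k + m i * dl 0 k"
  have e: "(\<Sum>l<N. m i * dl 0 l * g l) = m i * g 0" for i and g :: "nat \<Rightarrow> 'a"
    using dl_sum1[OF assms(3), of g] by (simp add: mult.assoc flip: sum_distrib_left)
  have mu: "mm N ?U A i j = A i j - m i * A 0 j" and mu': "mm N ?U' A i j = A i j + m i * A 0 j"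
    if "i < N" for i j A
    using that e[of i "\<lambda>l. A l j"] by (auto simp: mm_def ring_distribs sum.distrib sum_subtractf)
  show "gl N ?U ?U'" unfolding gl_def
  proof (intro allI impI conjI)
    fix i j assume "i < N" "j < N"
    thus "?U i j \<in> R" "?U' i j \<in> R"
      using assms R_dl R_mult R_add R_uminus by (auto simp: diff_conv_add_uminus simp del: add_uminus_conv_diff)
    show "mm N ?U ?U' i j = dl i j" "mm N ?U' ?U i j = dl i j"
      using \<open>i < N\<close> assms(2) by (auto simp: mu mu' algebra_simps)
  qed
  show "Z i j - m i * Z 0 j = mm N ?U Z i j" if "i < N" for i j using mu that by simp
qed

lemma eqv_scale: assumes "u \<in> R" "u' \<in> R" "u * u' = 1"
  shows "eqv N Z (\<lambda>i j. (if i = 0 then u else 1) * Z i j)"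
proof (rule eqv_rows)
  let ?U = "\<lambda>i k. (if i = 0 then u else 1) * dl i k" let ?U' = "\<lambda>i k. (if i = 0 then u' else 1) * dl i k"
  have mu: "mm N (\<lambda>i k. c i * dl i k) A i j = c i * A i j" if "i < N" for i j c A
    using that by (simp add: mm_def mult.assoc flip: sum_distrib_left)
  note mu' = mu[of _ "\<lambda>i. if i = 0 then _ else 1"]
  have u: "u' * u = 1" using assms by (simp add: mult.commute)
  show "gl N ?U ?U'" unfolding gl_def
    using assms u R_dl R_mult R0 R1 by (auto simp: mu' mult.assoc[symmetric])
  show "(if i = 0 then u else 1) * Z i j = mm N ?U Z i j" if "i < N" for i j
    by (rule mu'[OF that, symmetric])
qed

definition blk :: "'a \<Rightarrow> (nat \<Rightarrow> nat \<Rightarrow> 'a) \<Rightarrow> nat \<Rightarrow> nat \<Rightarrow> 'a" where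
  "blk d W i j = (case i of 0 \<Rightarrow> (case j of 0 \<Rightarrow> d | Suc _ \<Rightarrow> 0) | Suc i' \<Rightarrow> (case j of 0 \<Rightarrow> 0 | Suc j' \<Rightarrow> W i' j'))"

lemma blk_simps [simp]: "blk d W 0 0 = d" "blk d W 0 (Suc j) = 0" "blk d W (Suc i) 0 = 0"
    "blk d W (Suc i) (Suc j) = W i j"
  by (auto simp: blk_def)

lemma mm_blk: "mm (Suc n) (blk a A) (blk b B) = blk (a * b) (mm n A B)"
proof (intro ext)
  fix i j show "mm (Suc n) (blk a A) (blk b B) i j = blk (a * b) (mm n A B) i j"
    by (cases i; cases j) (simp_all add: mm_def sum.lessThan_Suc_shift del: sum.lessThan_Suc)
qed

lemma gl_blk: assumes "gl n U U'" shows "gl (Suc n) (blk 1 U) (blk 1 U')"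
  unfolding gl_def mm_blk
proof (intro allI impI)
  fix i j assume "i < Suc n" "j < Suc n"
  thus "blk 1 U i j \<in> R \<and> blk 1 U' i j \<in> R \<and> blk (1 * 1) (mm n U U') i j = dl i j
      \<and> blk (1 * 1) (mm n U' U) i j = dl i j"
    using assms R0 R1 by (cases i; cases j) (auto simp: gl_def)
qed

lemma eqv_blk: assumes "eqv n W W'" shows "eqv (Suc n) (blk d W) (blk d W')"
proof -
  obtain U U' V V' where 1: "gl n U U'" "gl n V V'" "\<forall>i<n. \<forall>j<n. W' i j = mm n (mm n U W) V i j"
    using assms by (auto simp: eqv_def)
  have "blk d W' i j = mm (Suc n) (mm (Suc n) (blk 1 U) (blk d W)) (blk 1 V) i j" if "i < Suc n" "j < Suc n" for i j
    using that 1(3) unfolding mm_blk by (cases i; cases j) auto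
  thus ?thesis unfolding eqv_def using gl_blk 1 by blast
qed

text \<open>Entries of an equivalent matrix are \<open>R\<close>-combinations of the original ones.
  Hence a pivot that divides all entries keeps dividing them throughout the reduction.\<close>

lemma F_R_multiple: assumes "eqv N Z Z'" "\<And>i j. i < N ==> j < N ==> \<exists>m\<in>R. Z i j = m * d" "i < N" "j < N"
  shows "\<exists>m\<in>R. Z' i j = m * d"
proof -
  obtain U U' V V' where 1: "gl N U U'" "gl N V V'" "\<forall>i<N. \<forall>j<N. Z' i j = mm N (mm N U Z) V i j"
    using assms by (auto simp: eqv_def)
  obtain m where m: "\<And>i j. i < N ==> j < N ==> m i j \<in> R \<and> Z i j = m i j * d" using assms(2) by metis
  have "Z' i j = mm N (mm N U (\<lambda>i j. m i j * d)) V i j"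
  proof -
    have "mm N (mm N U Z) V i j = mm N (mm N U (\<lambda>i j. m i j * d)) V i j"
    proof (rule mm_cong)
      fix l assume "l < N"
      thus "mm N U Z i l = mm N U (\<lambda>i j. m i j * d) i l" by (intro mm_cong) (use m in auto)
    qed simp
    thus ?thesis using 1(3) assms(3,4) by simp
  qed
  also have "\<dots> = mm N (mm N U m) V i j * d"
    by (simp add: mm_def sum_distrib_right sum_distrib_left algebra_simps)
  finally have "Z' i j = mm N (mm N U m) V i j * d" .
  moreover have "mm N (mm N U m) V i j \<in> R"
    using 1 assms(3,4) m unfolding gl_def mm_def by (auto intro!: R_sum R_mult)
  ultimately show ?thesis by blast
qed

lemma F_multiple: "d \<in> F ==> \<exists>m\<in>R. x = m * d ==> x \<in> F" using F_mult by blast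

text \<open>Divisibility by \<open>R\<close> is a total preorder on \<open>F\<close>, so a finite
  nonempty set has an element that divides all others.\<close>

lemma exists_pivot: assumes "finite S" "S \<noteq> {}" "S \<subseteq> F" shows "\<exists>y\<in>S. \<forall>x\<in>S. \<exists>m\<in>R. x = m * y"
  using assms
proof (induction S rule: finite_ne_induct)
  case (singleton x)
  have "x = 1 * x" by simp
  thus ?case using R1 by blast
next
  case (insert x S)
  then obtain y where y: "y \<in> S" "\<forall>z\<in>S. \<exists>m\<in>R. z = m * y" by auto
  then obtain m where m: "m \<in> R" "x = m * y \<or> y = m * x" using comparable[of x y] insert by auto
  show ?case
  proof (cases "x = m * y")
    case True thus ?thesis using y m by blast
  next
    case False
    hence yx: "y = m * x" using m by blast
    have "\<exists>k\<in>R. z = k * x" if z: "z \<in> S" for z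
    proof -
      obtain k where k: "k \<in> R" "z = k * y" using y z by blast
      hence "z = (k * m) * x" by (subst k(2), subst yx) (simp add: mult.assoc)
      thus ?thesis using R_mult[OF k(1) m(1)] by blast
    qed
    moreover have "x = 1 * x" by simp
    ultimately show ?thesis using R1 by blast
  qed
qed

lemma clear_column:
  assumes "\<And>i j. i < N ==> j < N ==> \<exists>m\<in>R. Z i j = m * Z 0 0" "0 < N"
  obtains m where "eqv N Z (\<lambda>i j. Z i j - m i * Z 0 j)" "m 0 = 0" "\<And>i. i < N ==> i \<noteq> 0 ==> Z i 0 = m i * Z 0 0"
proof -
  have "\<forall>i. \<exists>m. i < N \<longrightarrow> m \<in> R \<and> Z i 0 = m * Z 0 0" using assms by blast
  then obtain m0 where m0: "\<And>i. i < N ==> m0 i \<in> R \<and> Z i 0 = m0 i * Z 0 0" by metis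
  define m where "m = (\<lambda>i. if i = 0 then 0 else m0 i)"
  have "eqv N Z (\<lambda>i j. Z i j - m i * Z 0 j)"
    by (rule eqv_elim) (use m0 R0 assms(2) in \<open>simp_all add: m_def\<close>)
  thus ?thesis by (intro that[of m]) (simp_all add: m_def m0[THEN conjunct2, symmetric])
qed

text \<open>A pivot dividing all entries is moved to the corner, its column and, by transposition,
  its row are cleared, and it is normalized by a unit. The remaining block still consists of
  multiples of the pivot, so the induction also yields the divisibility chain.\<close>

theorem smith_normal_form:
  assumes "\<And>i j. i < N ==> j < N ==> Z i j \<in> F"
  shows "\<exists>Z'. eqv N Z Z' \<and> (\<forall>i<N. \<forall>j<N. Z' i j = (if i = j then Z' i i else 0)) \<and> (\<forall>i<N. Z' i i \<in> D)
     \<and> (\<forall>i j. i \<le> j \<longrightarrow> j < N \<longrightarrow> (\<exists>m\<in>R. Z' j j = m * Z' i i))"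
  using assms
proof (induction N arbitrary: Z)
  case 0
  show ?case by (rule exI[of _ Z]) (auto intro: eqv_cong)
next
  case (Suc n)
  let ?N = "Suc n"
  let ?S = "(\<lambda>q. Z (fst q) (snd q)) ` ({..<?N} \<times> {..<?N})"
  have mem: "Z i j \<in> ?S" if "i < ?N" "j < ?N" for i j
    using that by (intro image_eqI[of _ _ "(i, j)"]) simp_all
  have SF: "?S \<subseteq> F" using Suc.prems by (auto simp: mem_Times_iff)
  have Sne: "?S \<noteq> {}" using mem[of 0 0] by blast
  have "finite ?S" by simp
  from exists_pivot[OF this Sne SF] obtain y where y: "y \<in> ?S" "\<forall>x\<in>?S. \<exists>m\<in>R. x = m * y"
    by (rule bexE)
  obtain q where q: "q \<in> {..<?N} \<times> {..<?N}" "y = Z (fst q) (snd q)" using y(1) by (rule imageE) simp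
  define a where "a = fst q"
  define b where "b = snd q"
  have ab: "a < ?N" "b < ?N" "y = Z a b" using q by (simp_all add: a_def b_def mem_Times_iff)
  have piv: "\<exists>m\<in>R. Z i j = m * Z a b" if "i < ?N" "j < ?N" for i j
    using bspec[OF y(2) mem[OF that]] ab(3) by simp
  have "\<exists>Z1. eqv ?N Z Z1 \<and> Z1 0 0 = Z a b"
  proof -
    have "eqv ?N Z (\<lambda>i j. Z (Transposition.transpose 0 a i) j)" by (rule eqv_swap[OF ab(1)])
    moreover have "eqv ?N (\<lambda>i j. Z (Transposition.transpose 0 a i) j) (\<lambda>i j. Z (Transposition.transpose 0 a i) (Transposition.transpose 0 b j))"
      using eqv_transpose[OF eqv_swap[OF ab(2), of "\<lambda>j i. Z (Transposition.transpose 0 a i) j"]] by simp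
    ultimately show ?thesis
      by (intro exI[of _ "\<lambda>i j. Z (Transposition.transpose 0 a i) (Transposition.transpose 0 b j)"]) (auto intro: eqv_trans)
  qed
  then obtain Z1 where Z1: "eqv ?N Z Z1" "Z1 0 0 = Z a b" by blast
  define d where "d = Z a b"
  have mult: "\<exists>m\<in>R. X i j = m * d" if "eqv ?N Z X" "i < ?N" "j < ?N" for X i j
    using F_R_multiple[OF that(1) piv that(2,3)] by (simp add: d_def)
  have Z1m: "\<exists>m\<in>R. Z1 i j = m * Z1 0 0" if "i < ?N" "j < ?N" for i j
    using mult[OF Z1(1) that] Z1(2) by (simp add: d_def)
  obtain m where m: "eqv ?N Z1 (\<lambda>i j. Z1 i j - m i * Z1 0 j)" "m 0 = 0"
      "\<And>i. i < ?N ==> i \<noteq> 0 ==> Z1 i 0 = m i * Z1 0 0"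
    by (rule clear_column[of ?N Z1, OF Z1m]) simp_all
  define Z2 where "Z2 = (\<lambda>i j. Z1 i j - m i * Z1 0 j)"
  have Z2: "eqv ?N Z1 Z2" "Z2 0 0 = d" "\<And>i. i < ?N ==> i \<noteq> 0 ==> Z2 i 0 = 0"
    using m Z1(2) by (simp_all add: Z2_def d_def)
  have E2: "eqv ?N Z Z2" by (rule eqv_trans[OF Z1(1) Z2(1)])
  have Z2m: "\<exists>m\<in>R. Z2 j i = m * Z2 0 0" if "i < ?N" "j < ?N" for i j
    using mult[OF E2 that(2,1)] Z2(2) by simp
  obtain k where k: "eqv ?N (\<lambda>i j. Z2 j i) (\<lambda>i j. Z2 j i - k i * Z2 j 0)" "k 0 = 0"
      "\<And>i. i < ?N ==> i \<noteq> 0 ==> Z2 0 i = k i * Z2 0 0"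
    by (rule clear_column[of ?N "\<lambda>i j. Z2 j i", OF Z2m]) simp_all
  define Y where "Y = (\<lambda>i j. Z2 j i - k i * Z2 j 0)"
  have Y: "eqv ?N (\<lambda>i j. Z2 j i) Y" using k(1) by (simp add: Y_def)
  have Y0: "Y 0 0 = d" "\<And>j. j < ?N ==> j \<noteq> 0 ==> Y 0 j = 0" "\<And>i. i < ?N ==> i \<noteq> 0 ==> Y i 0 = 0"
    using Z2 k by (simp_all add: Y_def)
  have E3: "eqv ?N Z (\<lambda>i j. Y j i)" using eqv_trans[OF E2] eqv_transpose[OF Y] by simp
  have "d \<in> F" using Suc.prems ab by (simp add: d_def)
  then obtain u u' where u: "u \<in> R" "u' \<in> R" "u * u' = 1" "u * d \<in> D" using normal by blast
  define Z4 where "Z4 = (\<lambda>i j. (if i = 0 then u else 1) * Y j i)"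
  have E4: "eqv ?N Z Z4" unfolding Z4_def
    using eqv_trans[OF E3] eqv_scale[OF u(1-3), of ?N "\<lambda>i j. Y j i"] by simp
  define W where "W = (\<lambda>i j. Z4 (Suc i) (Suc j))"
  have blk: "blk (u * d) W i j = Z4 i j" if "i < ?N" "j < ?N" for i j
    using that Y0 by (cases i; cases j) (simp_all add: Z4_def W_def)
  have E5: "eqv ?N Z (blk (u * d) W)" using eqv_trans[OF E4 eqv_cong] blk by blast
  have Wd: "\<exists>m\<in>R. W i j = m * d" if "i < n" "j < n" for i j using mult[OF E4, of "Suc i" "Suc j"] that by (simp add: W_def)
  hence WF: "W i j \<in> F" if "i < n" "j < n" for i j using F_multiple \<open>d \<in> F\<close> that by blast
  have IH: "\<exists>Z'. eqv n W Z' \<and> (\<forall>i<n. \<forall>j<n. Z' i j = (if i = j then Z' i i else 0)) \<and> (\<forall>i<n. Z' i i \<in> D)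
     \<and> (\<forall>i j. i \<le> j \<longrightarrow> j < n \<longrightarrow> (\<exists>m\<in>R. Z' j j = m * Z' i i))"
    by (rule Suc.IH) (rule WF)
  obtain W' where W': "eqv n W W'" "\<forall>i<n. \<forall>j<n. W' i j = (if i = j then W' i i else 0)"
     "\<forall>i<n. W' i i \<in> D" "\<forall>i j. i \<le> j \<longrightarrow> j < n \<longrightarrow> (\<exists>m\<in>R. W' j j = m * W' i i)"
    using IH by (elim exE conjE) (rule that)
  \<comment> \<open>The corner entry has been rescaled to \<open>u * d\<close>; multiplying the
    quotient by \<open>u'\<close> restores divisibility of the later diagonal entries by it.\<close>
  have ud: "\<exists>m\<in>R. W' j j = m * (u * d)" if j: "j < n" for j
  proof -
    obtain m where "m \<in> R" "W' j j = m * d" using F_R_multiple[of n W W' d j j, OF W'(1) Wd j j] by blast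
    moreover have "m * d = (m * u') * (u * d)"
    proof -
      have "(m * u') * (u * d) = (u * u') * (m * d)" by (simp only: mult.assoc mult.commute mult.left_commute)
      thus ?thesis using u(3) by simp
    qed
    moreover have "m * u' \<in> R" using \<open>m \<in> R\<close> u(2) by (rule R_mult)
    ultimately show ?thesis by metis
  qed
  show ?case
  proof (intro exI[of _ "blk (u * d) W'"] conjI allI impI)
    show "eqv ?N Z (blk (u * d) W')" using eqv_trans[OF E5 eqv_blk[OF W'(1)]] .
    show "blk (u * d) W' i j = (if i = j then blk (u * d) W' i i else 0)" if "i < ?N" "j < ?N" for i j
      using that W'(2)[rule_format, of "i - 1" "j - 1"] by (cases i; cases j) (simp_all split: if_splits)
    show "blk (u * d) W' i i \<in> D" if "i < ?N" for i using that W'(3)[rule_format, of "i - 1"] u by (cases i) simp_all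
    show "\<exists>m\<in>R. blk (u * d) W' j j = m * blk (u * d) W' i i" if ij: "i \<le> j" "j < ?N" for i j
    proof (cases i)
      case 0
      show ?thesis
      proof (cases j)
        case 0
        have "u * d = 1 * (u * d)" by simp
        thus ?thesis using 0 \<open>i = 0\<close> R1 by (metis blk_simps(1))
      next
        case (Suc j')
        thus ?thesis using ud[of j'] that \<open>i = 0\<close> by simp
      qed
    next
      case (Suc i')
      then obtain j' where "j = Suc j'" using ij by (cases j) auto
      thus ?thesis using W'(4)[rule_format, of i' j'] ij Suc by simp
    qed
  qed
qed

end

section \<open>Ring laws, units and valuations in Q_p\<close>

context padic
begin

lemma qp_add_commute: "qp_add p x y = qp_add p y x"
  by (simp add: qp_add_def add.commute)

lemma qp_mult_commute: "qp_mult p x y = qp_mult p y x"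
  by (simp add: qp_mult_def mult.commute)

lemma qp_add_assoc:
  assumes "x \<in> Qp p" "y \<in> Qp p" "z \<in> Qp p"
  shows "qp_add p (qp_add p x y) z = qp_add p x (qp_add p y z)"
proof -
  have "plim (\<lambda>K. (tr p x K + tr p y K) + tr p z K) (qp_add p (qp_add p x y) z)"
    "plim (\<lambda>K. tr p x K + (tr p y K + tr p z K)) (qp_add p x (qp_add p y z))"
    using assms by (intro plim_add plim_tr; simp)+
  thus ?thesis using plim_unique by (simp add: add.assoc)
qed

lemma qp_mult_assoc:
  assumes "x \<in> Qp p" "y \<in> Qp p" "z \<in> Qp p"
  shows "qp_mult p (qp_mult p x y) z = qp_mult p x (qp_mult p y z)"
proof -
  have "plim (\<lambda>K. (tr p x K * tr p y K) * tr p z K) (qp_mult p (qp_mult p x y) z)"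
    "plim (\<lambda>K. tr p x K * (tr p y K * tr p z K)) (qp_mult p x (qp_mult p y z))"
    using assms by (intro plim_mult plim_tr; simp)+
  thus ?thesis using plim_unique by (simp add: mult.assoc)
qed

lemma qp_distrib:
  assumes "x \<in> Qp p" "y \<in> Qp p" "z \<in> Qp p"
  shows "qp_mult p (qp_add p x y) z = qp_add p (qp_mult p x z) (qp_mult p y z)"
proof -
  have "plim (\<lambda>K. (tr p x K + tr p y K) * tr p z K) (qp_mult p (qp_add p x y) z)"
    "plim (\<lambda>K. tr p x K * tr p z K + tr p y K * tr p z K) (qp_add p (qp_mult p x z) (qp_mult p y z))"
    using assms by (intro plim_mult plim_add plim_tr; simp)+
  thus ?thesis using plim_unique by (simp add: distrib_right)
qed

lemma qp_add_zero: assumes "x \<in> Qp p" shows "qp_add p qp_zero x = x"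
  using plim_unique[OF _ plim_tr[OF assms]] plim_add[OF plim_zero plim_tr[OF assms]] by simp

lemma qp_mult_zero: assumes "x \<in> Qp p" shows "qp_mult p qp_zero x = qp_zero"
  using plim_unique[OF _ plim_zero] plim_mult[OF plim_zero plim_tr[OF assms]] by simp

lemma qp_mult_one: assumes "x \<in> Qp p" shows "qp_mult p qp_one x = x"
  using plim_unique[OF _ plim_tr[OF assms]] plim_mult[OF plim_one plim_tr[OF assms]] by simp

definition qp_neg :: "qp \<Rightarrow> qp" where "qp_neg x = qp_lim p (\<lambda>K. - tr p x K)"

lemma plim_neg: assumes "plim r x" shows "plim (\<lambda>K. - r K) (qp_neg x)"
proof -
  have "pcauchy r" using plim_pcauchy assms .
  have neg: "- a - - b \<in> PZ e" if "a - b \<in> PZ e" for a b e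
    using PZ_diff_commute[OF that] by simp
  have "pcauchy (\<lambda>K. - r K)" unfolding pcauchy_def
  proof (intro conjI allI)
    show "\<exists>m. \<forall>K. - r K \<in> PZ m" using \<open>pcauchy r\<close> PZ_uminus unfolding pcauchy_def by blast
    fix e obtain K0 where "\<And>K. K \<ge> K0 ==> r K - r K0 \<in> PZ e" using \<open>pcauchy r\<close> unfolding pcauchy_def by metis
    thus "\<exists>K0. \<forall>K\<ge>K0. - r K - - r K0 \<in> PZ e" using neg by blast
  qed
  then obtain z where z: "plim (\<lambda>K. - r K) z" using pcauchy_plim by blast
  have x: "x \<in> Qp p" using plim_Qp assms .
  have "plim (\<lambda>K. - tr p x K) z"
  proof (rule plim_null[OF z])
    show "\<exists>m. \<forall>K. - tr p x K \<in> PZ m" using plim_tr[OF x] PZ_uminus unfolding plim_def by blast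
    fix e
    show "\<forall>\<^sub>F K in sequentially. - tr p x K - - r K \<in> PZ e"
      using plim_diff_null[OF assms plim_tr[OF x], of e] by eventually_elim (rule neg)
  qed
  thus ?thesis using z plim_qp_lim unfolding qp_neg_def by metis
qed

lemma qp_neg_Qp: "x \<in> Qp p ==> qp_neg x \<in> Qp p"
  using plim_Qp[OF plim_neg[OF plim_tr]] .

lemma qp_neg_Zp: "x \<in> Zp p ==> qp_neg x \<in> Zp p"
  by (rule plim_Zp[OF plim_neg[OF plim_tr]]) (auto simp: Zp_Qp tr_eq_T T_Zp)

lemma qp_add_neg: assumes "x \<in> Qp p" shows "qp_add p (qp_neg x) x = qp_zero"
  using plim_unique[OF _ plim_zero] plim_add[OF plim_neg[OF plim_tr[OF assms]] plim_tr[OF assms]] by simp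

definition mon :: "int \<Rightarrow> qp" where "mon v = (\<lambda>i. if i = v then 1 else 0)"

lemma plim_mon: "plim (\<lambda>_. real p powi v) (mon v)"
  by (rule plim_monom) (simp add: mon_def)

lemma mon_Qp: "mon v \<in> Qp p" using plim_Qp[OF plim_mon] .

lemma mon_mult: "qp_mult p (mon v) (mon w) = mon (v + w)"
proof -
  have "(\<lambda>_::nat. real p powi (v + w)) = (\<lambda>K. real p powi v * real p powi w)"
    using p_gt1 by (simp add: power_int_add)
  thus ?thesis using plim_unique[OF plim_mult[OF plim_mon[of v] plim_mon[of w]]] plim_mon[of "v + w"] by metis
qed

lemma mon_Zp: "v \<ge> 0 ==> mon v \<in> Zp p"
  using mon_Qp[of v] by (auto simp: Zp_def mon_def)

lemma ppow_mon: "qp_ppow p (ereal (real_of_int n)) = mon (- n)"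
  by (simp add: qp_ppow_def mon_def)

lemma T_shift: "T (\<lambda>i. x (i + v)) e * real p powi v = T x (e + v)"
proof -
  have "(\<Sum>i\<in>{i. i < e \<and> x (i + v) \<noteq> 0}. real (x (i + v)) * real p powi i) * real p powi v
     = (\<Sum>i\<in>{i. i < e \<and> x (i + v) \<noteq> 0}. real (x (i + v)) * real p powi (i + v))"
    using p_gt1 by (simp add: sum_distrib_right power_int_add mult.assoc)
  also have "\<dots> = (\<Sum>i\<in>{i. i < e + v \<and> x i \<noteq> 0}. real (x i) * real p powi i)"
    by (rule sum.reindex_bij_witness[of _ "\<lambda>i. i - v" "\<lambda>i. i + v"]) auto
  finally show ?thesis by (simp add: T_def)
qed

lemma shift_Qp: assumes "x \<in> Qp p" shows "(\<lambda>i. x (i + v)) \<in> Qp p"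
proof -
  obtain N where "\<forall>i<N. x i = 0" using Qp_low[OF assms] by blast
  hence "\<forall>i<N - v. x (i + v) = 0" by auto
  thus ?thesis using assms unfolding Qp_def by auto
qed

lemma mult_mon_shift: assumes "x \<in> Qp p" shows "qp_mult p (mon v) (\<lambda>i. x (i + v)) = x"
proof (rule plim_unique)
  let ?u = "\<lambda>i. x (i + v)"
  show "plim (\<lambda>K. real p powi v * tr p ?u K) (qp_mult p (mon v) ?u)"
    by (intro plim_mult plim_mon plim_tr shift_Qp assms)
  have eq: "real p powi v * tr p ?u K = T x (int K + v)" for K
    using T_shift[of x v "int K"] by (simp add: tr_eq_T mult.commute)
  show "plim (\<lambda>K. real p powi v * tr p ?u K) x"
    unfolding plim_def eq
  proof (intro conjI allI assms)
    show "\<exists>m. \<forall>K. T x (int K + v) \<in> PZ m" using T_bounded[OF assms] by blast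
    fix e show "\<forall>\<^sub>F K in sequentially. T x (int K + v) - T x e \<in> PZ e"
      unfolding eventually_sequentially
      by (intro exI[of _ "nat (e - v)"] allI impI T_diff[OF assms]) auto
  qed
qed

definition rs :: "nat \<Rightarrow> qp \<Rightarrow> nat" where "rs K x = (\<Sum>i<K. x (int i) * p ^ i)"

lemma T_rs: assumes "x \<in> Zp p" shows "T x (int K) = real (rs K x)"
proof -
  have "T x (int K) = (\<Sum>i\<in>{0..<int K}. real (x i) * real p powi i)"
    using assms T_interval[of 0 x "int K"] by (simp add: Zp_def)
  also have "\<dots> = (\<Sum>i<K. real (x (int i)) * real p ^ i)"
    by (rule sum.reindex_bij_witness[of _ int nat]) (auto simp: power_int_def)
  finally show ?thesis by (simp add: rs_def)
qed

lemma PZ_of_int: "real_of_int a \<in> PZ (int K) \<longleftrightarrow> int (p ^ K) dvd a"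
proof
  assume "real_of_int a \<in> PZ (int K)"
  then obtain n where "real_of_int a = of_int (n * int (p ^ K))" by (auto simp: PZ_def)
  hence "a = n * int (p ^ K)" by (simp only: of_int_eq_iff)
  thus "int (p ^ K) dvd a" by simp
next
  assume "int (p ^ K) dvd a"
  then obtain n where "a = n * int (p ^ K)" by (metis dvd_def mult.commute)
  thus "real_of_int a \<in> PZ (int K)" using PZ_I[of n "int K"] by simp
qed

lemma PZ_nat_cong: "real a - real b \<in> PZ (int K) \<longleftrightarrow> [a = b] (mod p ^ K)"
proof -
  have "real a - real b = real_of_int (int a - int b)" by simp
  thus ?thesis by (simp only: PZ_of_int cong_iff_dvd_diff flip: cong_int_iff)
qed

text \<open>Every truncation of \<open>x\<close> is invertible modulo \<open>p^K\<close>. Inverses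
  are unique modulo \<open>p^K\<close>, so those for larger moduli reduce to those for smaller ones,
  and the sequence converges to an inverse of \<open>x\<close>.\<close>

lemma unit_inverse: assumes x: "x \<in> Zp p" "x 0 \<noteq> 0"
  shows "\<exists>y\<in>Zp p. qp_mult p x y = qp_one"
proof -
  have "coprime (rs (Suc K) x) p" for K
  proof -
    have "rs (Suc K) x = x 0 + p * (\<Sum>i<K. x (int (Suc i)) * p ^ i)"
      unfolding rs_def sum.lessThan_Suc_shift by (simp add: sum_distrib_left algebra_simps)
    moreover have "\<not> p dvd x 0" using x QpD[OF Zp_Qp[OF x(1)], of 0] by (auto dest: dvd_imp_le)
    ultimately have "\<not> p dvd rs (Suc K) x" by (metis dvd_add_left_iff dvd_triv_left)
    thus ?thesis using prime_imp_coprime[OF prime_p] coprime_commute by blast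
  qed
  hence "coprime (rs K x) (p ^ K)" for K by (cases K) auto
  hence "\<exists>v. [rs K x * v = Suc 0] (mod p ^ K)" for K by (rule cong_solve_coprime_nat)
  then obtain v where v: "\<And>K. [rs K x * v K = Suc 0] (mod p ^ K)" by metis
  have rs_cong: "[rs L x = rs K x] (mod p ^ K)" if "K \<le> L" for K L
    using T_diff[OF Zp_Qp[OF x(1)], of "int K" "int L"] that by (simp add: T_rs[OF x(1)] PZ_nat_cong)
  have vc: "[v L = v K] (mod p ^ K)" if "K \<le> L" for K L
  proof -
    have 1: "[rs L x * v L = Suc 0] (mod p ^ K)"
      using cong_dvd_modulus_nat[OF v[of L] le_imp_power_dvd[OF that]] .
    have 2: "[rs K x * v L = Suc 0] (mod p ^ K)"
      using cong_trans[OF cong_scalar_right[OF cong_sym[OF rs_cong[OF that]]] 1] .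
    have "[v K * (rs K x * v L) = v K * Suc 0] (mod p ^ K)" using cong_scalar_left[OF 2] .
    moreover have "[(rs K x * v K) * v L = Suc 0 * v L] (mod p ^ K)" using cong_scalar_right[OF v] .
    ultimately show ?thesis by (metis cong_sym cong_trans mult.assoc mult.commute mult.right_neutral One_nat_def)
  qed
  have "pcauchy (\<lambda>K. real (v K))" unfolding pcauchy_def
  proof (intro conjI allI)
    show "\<exists>m. \<forall>K. real (v K) \<in> PZ m" by (intro exI[of _ 0]) (auto simp: PZ_zero_eq)
    fix e
    have "real (v K) - real (v (nat e)) \<in> PZ e" if "K \<ge> nat e" for K
      using vc[OF that] PZ_monoD[of _ "int (nat e)" e] by (simp flip: PZ_nat_cong)
    thus "\<exists>K0. \<forall>K\<ge>K0. real (v K) - real (v K0) \<in> PZ e" by blast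
  qed
  then obtain y where y: "plim (\<lambda>K. real (v K)) y" using pcauchy_plim by blast
  have yZ: "y \<in> Zp p" by (rule plim_Zp[OF y]) auto
  have xy: "plim (\<lambda>K. tr p x K * real (v K)) (qp_mult p x y)"
    by (rule plim_mult[OF plim_tr[OF Zp_Qp[OF x(1)]] y])
  have "plim (\<lambda>K. tr p x K * real (v K)) qp_one"
  proof (rule plim_null[OF plim_one])
    show "\<exists>m. \<forall>K. tr p x K * real (v K) \<in> PZ m" using plim_pcauchy[OF xy] by (simp add: pcauchy_def)
    fix e
    have "tr p x K * real (v K) - 1 \<in> PZ e" if "K \<ge> nat e" for K
    proof -
      have "real (rs K x * v K) - real (Suc 0) \<in> PZ (int K)" using v[of K] PZ_nat_cong by blast
      thus ?thesis using PZ_monoD[of _ "int K" e] that by (simp add: tr_eq_T T_rs[OF x(1)])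
    qed
    thus "\<forall>\<^sub>F K in sequentially. tr p x K * real (v K) - 1 \<in> PZ e"
      unfolding eventually_sequentially by blast
  qed
  thus ?thesis using plim_unique xy yZ by blast
qed

lemma val_unit: assumes x: "x \<in> Qp p" "x \<noteq> qp_zero"
  shows "\<exists>v. \<exists>u\<in>Zp p. \<exists>u'\<in>Zp p. qp_mult p u u' = qp_one \<and> x = qp_mult p (mon v) u"
proof -
  obtain N where N: "\<forall>i<N. x i = 0" using Qp_low x by blast
  obtain j where j: "x j \<noteq> 0" using x(2) by (auto simp: qp_zero_def)
  have jN: "j \<ge> N" using N j by (meson not_less)
  define n where "n = (LEAST n. x (N + int n) \<noteq> 0)"
  have ex: "x (N + int (nat (j - N))) \<noteq> 0" using j jN by simp
  have n: "x (N + int n) \<noteq> 0" unfolding n_def by (rule LeastI[of "\<lambda>n. x (N + int n) \<noteq> 0", OF ex])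
  have low: "x i = 0" if "i < N + int n" for i
  proof (cases "i < N")
    case False
    hence "nat (i - N) < n" using that by simp
    hence "\<not> (x (N + int (nat (i - N))) \<noteq> 0)" unfolding n_def by (rule not_less_Least)
    thus ?thesis using False by simp
  qed (use N in auto)
  define v where "v = N + int n"
  let ?u = "\<lambda>i. x (i + v)"
  have "?u \<in> Zp p" using shift_Qp[OF x(1)] low by (auto simp: Zp_def v_def)
  moreover have "?u 0 \<noteq> 0" using n by (simp add: v_def)
  ultimately show ?thesis using unit_inverse[of ?u] mult_mon_shift[OF x(1), of v] by metis
qed

text \<open>Turns divisibility in Z_p into an inequality of exponents; the divisibility chain of the
  normal form becomes the decreasing order of the singular numbers.\<close>

lemma mon_dvd: assumes "m \<in> Zp p" "mon w = qp_mult p m (mon v)" shows "v \<le> w"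
proof (rule ccontr)
  assume "\<not> v \<le> w"
  have "plim (\<lambda>K. tr p m K * real p powi v) (mon w)"
    unfolding assms(2) by (intro plim_mult plim_mon plim_tr Zp_Qp assms(1))
  hence "\<forall>\<^sub>F K in sequentially. tr p m K * real p powi v - T (mon w) v \<in> PZ v" by (simp add: plim_def)
  then obtain K where "tr p m K * real p powi v - T (mon w) v \<in> PZ v" by (auto simp: eventually_sequentially)
  moreover have "tr p m K * real p powi v \<in> PZ v"
    using PZ_int_mult[OF _ powi_PZ] T_Zp[OF assms(1)] by (simp add: tr_eq_T)
  ultimately have "T (mon w) v \<in> PZ v" using PZ_diff by fastforce
  hence "real p powi w \<in> PZ v" using T_monom[of "mon w" w v] \<open>\<not> v \<le> w\<close> by (simp add: mon_def)
  moreover have "\<bar>real p powi w\<bar> < real p powi v" using p_gt1 \<open>\<not> v \<le> w\<close> by (simp add: power_int_strict_increasing)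
  ultimately have "real p powi w = 0" by (rule PZ_small)
  thus False using p_gt1 by simp
qed

lemma qp_one_Qp: "qp_one \<in> Qp p" using plim_Qp[OF plim_one] .
lemma qp_one_Zp: "qp_one \<in> Zp p" using qp_one_Qp by (simp add: Zp_def qp_one_def)
lemma qp_zero_Zp: "qp_zero \<in> Zp p" using qp_zero_Qp by (simp add: Zp_def qp_zero_def)

end

lemma padicI: "prime p ==> padic p" by unfold_locales

text \<open>A single commutative ring containing every \<open>\<rat>\<^sub>p\<close>: the product over all primes. It makes
  type-class algebra available for a prime that is a variable.\<close>

definition padic_family :: "(nat \<Rightarrow> qp) \<Rightarrow> bool" where
  "padic_family f \<longleftrightarrow> (\<forall>q. if prime q then f q \<in> Qp q else f q = qp_zero)"

lemma padic_familyI: "(\<And>q. prime q ==> f q \<in> Qp q) ==> (\<And>q. \<not> prime q ==> f q = qp_zero) ==> padic_family f"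
  by (simp add: padic_family_def)

lemma padic_familyD: "padic_family f ==> prime q ==> f q \<in> Qp q" "padic_family f ==> \<not> prime q ==> f q = qp_zero"
  by (metis padic_family_def)+

lemma padic_family_ext:
  "(\<And>q. prime q ==> padic q ==> f q = g q) ==> (\<And>q. \<not> prime q ==> f q = g q) ==> f = g"
  using padicI by blast

typedef padics = "Collect padic_family"
  by (rule exI[of _ "\<lambda>_. qp_zero"]) (auto intro!: padic_familyI padic.qp_zero_Qp padicI)

setup_lifting type_definition_padics

instantiation padics :: comm_ring_1
begin

lift_definition zero_padics :: padics is "\<lambda>_. qp_zero"
  by (simp only: mem_Collect_eq, rule padic_familyI) (simp_all add: padic.qp_zero_Qp padicI)

lift_definition one_padics :: padics is "\<lambda>q. if prime q then qp_one else qp_zero"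
  by (simp only: mem_Collect_eq, rule padic_familyI) (simp_all add: padic.qp_one_Qp padicI)

lift_definition plus_padics :: "padics \<Rightarrow> padics \<Rightarrow> padics" is
  "\<lambda>f g q. if prime q then qp_add q (f q) (g q) else qp_zero"
  by (simp only: mem_Collect_eq, rule padic_familyI) (simp_all add: padic.qp_add_Qp padicI padic_familyD)

lift_definition times_padics :: "padics \<Rightarrow> padics \<Rightarrow> padics" is
  "\<lambda>f g q. if prime q then qp_mult q (f q) (g q) else qp_zero"
  by (simp only: mem_Collect_eq, rule padic_familyI) (simp_all add: padic.qp_mult_Qp padicI padic_familyD)

lift_definition uminus_padics :: "padics \<Rightarrow> padics" is
  "\<lambda>f q. if prime q then padic.qp_neg q (f q) else qp_zero"
  by (simp only: mem_Collect_eq, rule padic_familyI) (simp_all add: padic.qp_neg_Qp padicI padic_familyD)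

definition minus_padics :: "padics \<Rightarrow> padics \<Rightarrow> padics" where "minus_padics x y = x + - y"

instance
proof
  fix a b c :: padics
  show "a + b + c = a + (b + c)"
    by transfer (rule padic_family_ext; simp add: padic.qp_add_assoc padic_familyD)
  show "a + b = b + a"
    by transfer (rule padic_family_ext; simp add: padic.qp_add_commute)
  show "0 + a = a"
    by transfer (rule padic_family_ext; simp add: padic.qp_add_zero padic_familyD)
  show "- a + a = 0"
    by transfer (rule padic_family_ext; simp add: padic.qp_add_neg padic_familyD)
  show "a - b = a + - b" by (rule minus_padics_def)
  show "a * b * c = a * (b * c)"
    by transfer (rule padic_family_ext; simp add: padic.qp_mult_assoc padic_familyD)
  show "a * b = b * a"
    by transfer (rule padic_family_ext; simp add: padic.qp_mult_commute)
  show "1 * a = a"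
    by transfer (rule padic_family_ext; simp add: padic.qp_mult_one padic_familyD)
  show "(a + b) * c = a * c + b * c"
    by transfer (rule padic_family_ext; simp add: padic.qp_distrib padic_familyD)
  have "qp_zero 0 \<noteq> (if prime (2::nat) then qp_one else qp_zero) 0" by (simp add: qp_zero_def qp_one_def)
  thus "(0::padics) \<noteq> 1" by transfer metis
qed

end

section \<open>Row groups modulo one\<close>

lemma frac_eq_iff_diff: "frac x = frac y \<longleftrightarrow> x - y \<in> \<int>" for x y :: real
proof
  assume "frac x = frac y"
  hence "x - y = of_int (\<lfloor>x\<rfloor> - \<lfloor>y\<rfloor>)" by (simp add: frac_def)
  thus "x - y \<in> \<int>" by (metis Ints_of_int)
next
  assume "x - y \<in> \<int>"
  then obtain n where "x = y + of_int n" by (auto simp: Ints_def algebra_simps)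
  thus "frac x = frac y" by (simp add: frac_def)
qed

text \<open>The subgroup of \<open>(\<real>/\<int>)\<^sup>M\<close> generated by the rows of \<open>t\<close>, with \<open>frac\<close> choosing representatives.\<close>

definition rg :: "nat \<Rightarrow> nat \<Rightarrow> (nat \<Rightarrow> nat \<Rightarrow> real) \<Rightarrow> (nat \<Rightarrow> real) set" where
  "rg N M t = range (\<lambda>v j. if j < M then frac (\<Sum>i<N. real_of_int (v i) * t i j) else 0)"

lemma rg_mem: "w \<in> rg N M t \<longleftrightarrow>
  (\<exists>v. \<forall>j. w j = (if j < M then frac (\<Sum>i<N. real_of_int (v i) * t i j) else 0))"
  by (auto simp: rg_def fun_eq_iff)

lemma rgI: "(\<And>j. w j = (if j < M then frac (\<Sum>i<N. real_of_int (v i) * t i j) else 0)) ==> w \<in> rg N M t"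
  unfolding rg_mem by blast

lemma rg_subset_I:
  assumes "\<And>v. \<exists>v'. \<forall>j<M. (\<Sum>i<N. real_of_int (v i) * t i j) - (\<Sum>i<N'. real_of_int (v' i) * t' i j) \<in> \<int>"
  shows "rg N M t \<subseteq> rg N' M t'"
proof
  fix w assume "w \<in> rg N M t"
  then obtain v where v: "\<And>j. w j = (if j < M then frac (\<Sum>i<N. real_of_int (v i) * t i j) else 0)" by (auto simp: rg_mem)
  obtain v' where v': "\<And>j. j < M ==> (\<Sum>i<N. real_of_int (v i) * t i j) - (\<Sum>i<N'. real_of_int (v' i) * t' i j) \<in> \<int>"
    using assms by metis
  show "w \<in> rg N' M t'" by (rule rgI[where v = v']) (use v v' frac_eq_iff_diff in auto)
qed

lemma Ints_sum_mult: "(\<And>i. i \<in> A ==> f i \<in> \<int>) ==> (\<Sum>i\<in>A. real_of_int (v i) * f i) \<in> \<int>"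
  by (intro Ints_sum Ints_mult) auto

lemma rg_cong:
  assumes "\<And>i j. i < N ==> j < M ==> t i j - t' i j \<in> \<int>"
  shows "rg N M t = rg N M t'"
proof -
  have 1: "rg N M a \<subseteq> rg N M b" if "\<And>i j. i < N ==> j < M ==> a i j - b i j \<in> \<int>" for a b :: "nat \<Rightarrow> nat \<Rightarrow> real"
  proof (rule rg_subset_I)
    fix v :: "nat \<Rightarrow> int"
    have "(\<Sum>i<N. real_of_int (v i) * a i j) - (\<Sum>i<N. real_of_int (v i) * b i j) \<in> \<int>" if j: "j < M" for j
    proof -
      have "(\<Sum>i<N. real_of_int (v i) * (a i j - b i j)) \<in> \<int>"
        by (rule Ints_sum_mult) (use that \<open>\<And>i j. i < N ==> j < M ==> a i j - b i j \<in> \<int>\<close> in auto)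
      thus ?thesis by (simp add: right_diff_distrib sum_subtractf)
    qed
    thus "\<exists>v'. \<forall>j<M. (\<Sum>i<N. real_of_int (v i) * a i j) - (\<Sum>i<N. real_of_int (v' i) * b i j) \<in> \<int>" by blast
  qed
  have sym: "b - a \<in> \<int>" if "a - b \<in> \<int>" for a b :: real using Ints_minus[OF that] by simp
  show ?thesis using 1[of t t'] 1[of t' t] assms sym by blast
qed

lemma rg_left_subset: "rg N M (\<lambda>i j. \<Sum>l<N. real_of_int (b i l) * t l j) \<subseteq> rg N M t"
proof (rule rg_subset_I)
  fix v :: "nat \<Rightarrow> int"
  have "(\<Sum>i<N. real_of_int (v i) * (\<Sum>l<N. real_of_int (b i l) * t l j))
    = (\<Sum>l<N. real_of_int (\<Sum>i<N. v i * b i l) * t l j)" for j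
    by (simp add: sum_distrib_left sum_distrib_right mult.assoc) (rule sum.swap)
  thus "\<exists>v'. \<forall>j<M. (\<Sum>i<N. real_of_int (v i) * (\<Sum>l<N. real_of_int (b i l) * t l j))
    - (\<Sum>i<N. real_of_int (v' i) * t i j) \<in> \<int>"
    by (intro exI[of _ "\<lambda>l. \<Sum>i<N. v i * b i l"]) simp
qed

text \<open>The difference from the identity matrix is divisible by \<open>q\<close>, and
  \<open>q\<close> clears the denominators of \<open>x\<close>.\<close>

lemma cong_id_sum:
  fixes N :: nat
  assumes "\<And>i l. i < N ==> l < N ==> q dvd (e i l - (if i = l then 1 else 0))"
    and "\<And>l. l < N ==> real_of_int q * x l \<in> \<int>" and "i < N"
  shows "(\<Sum>l<N. real_of_int (e i l) * x l) - x i \<in> \<int>"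
proof -
  have "(\<Sum>l<N. real_of_int (e i l) * x l) - x i
    = (\<Sum>l<N. real_of_int (e i l) * x l) - (\<Sum>l<N. real_of_int (if i = l then 1 else 0) * x l)"
  proof -
    have "(\<Sum>l<N. real_of_int (if i = l then 1 else 0) * x l) = (\<Sum>l<N. if i = l then x l else 0)"
      by (rule sum.cong) auto
    thus ?thesis using assms(3) by simp
  qed
  also have "\<dots> = (\<Sum>l<N. real_of_int (e i l - (if i = l then 1 else 0)) * x l)"
    by (simp add: sum_subtractf left_diff_distrib)
  also have "\<dots> \<in> \<int>"
  proof (rule Ints_sum)
    fix l assume l: "l \<in> {..<N}"
    then obtain m where "e i l - (if i = l then 1 else 0) = m * q"
      using assms(1)[OF assms(3), of l] by (metis dvd_def lessThan_iff mult.commute)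
    hence "real_of_int (e i l - (if i = l then 1 else 0)) * x l = real_of_int m * (real_of_int q * x l)"
      by simp
    thus "real_of_int (e i l - (if i = l then 1 else 0)) * x l \<in> \<int>"
      using assms(2) l by (metis Ints_mult Ints_of_int lessThan_iff)
  qed
  finally show ?thesis .
qed

text \<open>Left multiplication by an integer matrix can only shrink the row group. Applying the
  inverse modulo \<open>q\<close> afterwards shows that nothing was lost.\<close>

lemma rg_left_eq:
  assumes "\<And>i l. i < N ==> l < N ==> q dvd ((\<Sum>a<N. b' i a * b a l) - (if i = l then 1 else 0))"
    and "\<And>l j. l < N ==> j < M ==> real_of_int q * t l j \<in> \<int>"
  shows "rg N M (\<lambda>i j. \<Sum>l<N. real_of_int (b i l) * t l j) = rg N M t"
proof
  have "rg N M t = rg N M (\<lambda>i j. \<Sum>l<N. real_of_int (\<Sum>a<N. b' i a * b a l) * t l j)"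
    by (rule rg_cong[symmetric], rule cong_id_sum[where q = q]) (use assms in auto)
  also have "\<dots> = rg N M (\<lambda>i j. \<Sum>a<N. real_of_int (b' i a) * (\<Sum>l<N. real_of_int (b a l) * t l j))"
  proof -
    have "(\<Sum>l<N. real_of_int (\<Sum>a<N. b' i a * b a l) * t l j)
      = (\<Sum>a<N. real_of_int (b' i a) * (\<Sum>l<N. real_of_int (b a l) * t l j))" for i j
      by (simp add: sum_distrib_left sum_distrib_right mult.assoc) (rule sum.swap)
    thus ?thesis by simp
  qed
  also have "\<dots> \<subseteq> rg N M (\<lambda>i j. \<Sum>l<N. real_of_int (b i l) * t l j)" by (rule rg_left_subset)
  finally show "rg N M t \<subseteq> rg N M (\<lambda>i j. \<Sum>l<N. real_of_int (b i l) * t l j)" .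
qed (rule rg_left_subset)

lemma rg_right_image:
  "rg N M (\<lambda>i j. \<Sum>l<M. t i l * real_of_int (c l j))
    = (\<lambda>w j. if j < M then frac (\<Sum>l<M. w l * real_of_int (c l j)) else 0) ` rg N M t"
proof -
  have "frac (\<Sum>i<N. real_of_int (v i) * (\<Sum>l<M. t i l * real_of_int (c l j)))
    = frac (\<Sum>l<M. frac (\<Sum>i<N. real_of_int (v i) * t i l) * real_of_int (c l j))" for v j
  proof -
    have "(\<Sum>i<N. real_of_int (v i) * (\<Sum>l<M. t i l * real_of_int (c l j)))
      = (\<Sum>l<M. (\<Sum>i<N. real_of_int (v i) * t i l) * real_of_int (c l j))"
      by (simp add: sum_distrib_left sum_distrib_right mult.assoc) (rule sum.swap)
    moreover have "(\<Sum>l<M. (\<Sum>i<N. real_of_int (v i) * t i l) * real_of_int (c l j))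
       - (\<Sum>l<M. frac (\<Sum>i<N. real_of_int (v i) * t i l) * real_of_int (c l j))
      = (\<Sum>l<M. real_of_int (\<lfloor>\<Sum>i<N. real_of_int (v i) * t i l\<rfloor> * c l j))"
      by (simp add: sum_subtractf[symmetric] frac_def left_diff_distrib)
    ultimately show ?thesis by (simp only: frac_eq_iff_diff) auto
  qed
  thus ?thesis unfolding rg_def image_image by (simp cong: if_cong)
qed

text \<open>Coefficients matter only modulo the common denominator \<open>q\<close>.\<close>

lemma rg_finite:
  assumes "\<And>i j. i < N ==> j < M ==> real_of_int q * t i j \<in> \<int>" "q > 0"
  shows "finite (rg N M t)"
proof -
  have "rg N M t \<subseteq> (\<lambda>v j. if j < M then frac (\<Sum>i<N. real_of_int (v i) * t i j) else 0) ` (PiE {..<N} (\<lambda>_. {0..<q}))"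
  proof
    fix w assume "w \<in> rg N M t"
    then obtain v where v: "w = (\<lambda>j. if j < M then frac (\<Sum>i<N. real_of_int (v i) * t i j) else 0)" by (auto simp: rg_def)
    define u where "u = restrict (\<lambda>i. v i mod q) {..<N}"
    have "frac (\<Sum>i<N. real_of_int (v i) * t i j) = frac (\<Sum>i<N. real_of_int (u i) * t i j)" if "j < M" for j
    proof -
      have "(\<Sum>i<N. real_of_int (v i) * t i j) - (\<Sum>i<N. real_of_int (u i) * t i j)
         = (\<Sum>i<N. real_of_int (v i div q) * (real_of_int q * t i j))"
      proof -
        have "real_of_int (v i) = real_of_int (v i div q) * real_of_int q + real_of_int (v i mod q)" for i
          by (metis div_mult_mod_eq of_int_add of_int_mult)
        thus ?thesis by (simp add: u_def sum_subtractf[symmetric] algebra_simps)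
      qed
      also have "\<dots> \<in> \<int>" by (rule Ints_sum_mult) (use assms that in auto)
      finally show ?thesis by (simp add: frac_eq_iff_diff)
    qed
    hence "w = (\<lambda>j. if j < M then frac (\<Sum>i<N. real_of_int (u i) * t i j) else 0)" using v by auto
    moreover have "u \<in> PiE {..<N} (\<lambda>_. {0..<q})" using assms(2) by (auto simp: u_def)
    ultimately show "w \<in> (\<lambda>v j. if j < M then frac (\<Sum>i<N. real_of_int (v i) * t i j) else 0) ` (PiE {..<N} (\<lambda>_. {0..<q}))"
      by blast
  qed
  thus ?thesis by (rule finite_subset) (intro finite_imageI finite_PiE, simp_all)
qed

text \<open>Right multiplication moves the row group to another subgroup, so only its order
  survives. The matrices \<open>c\<close> and \<open>c'\<close> map the two groups onto each other,
  which gives both inequalities.\<close>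

lemma rg_right_card:
  assumes "\<And>i l. i < M ==> l < M ==> q dvd ((\<Sum>a<M. c i a * c' a l) - (if i = l then 1 else 0))"
    and q: "\<And>i j. i < N ==> j < M ==> real_of_int q * t i j \<in> \<int>" "q > 0"
  shows "card (rg N M (\<lambda>i j. \<Sum>l<M. t i l * real_of_int (c l j))) = card (rg N M t)"
proof (rule antisym)
  let ?tc = "\<lambda>i j. \<Sum>l<M. t i l * real_of_int (c l j)"
  have fin: "finite (rg N M t)" using rg_finite q by blast
  thus "card (rg N M ?tc) \<le> card (rg N M t)" unfolding rg_right_image by (rule card_image_le)
  have fin': "finite (rg N M ?tc)" unfolding rg_right_image using fin by simp
  have "rg N M t = rg N M (\<lambda>i j. \<Sum>a<M. ?tc i a * real_of_int (c' a j))"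
  proof (rule rg_cong[symmetric])
    fix i j assume ij: "i < N" "j < M"
    have "(\<Sum>a<M. ?tc i a * real_of_int (c' a j)) = (\<Sum>l<M. real_of_int (\<Sum>a<M. c l a * c' a j) * t i l)"
      by (simp add: sum_distrib_left sum_distrib_right algebra_simps) (rule sum.swap)
    moreover have "(\<Sum>l<M. real_of_int ((\<lambda>j l. \<Sum>a<M. c l a * c' a j) j l) * t i l) - t i j \<in> \<int>"
    proof (rule cong_id_sum[where q = q])
      show "q dvd (\<Sum>a<M. c l a * c' a j) - (if j = l then 1 else 0)" if "j < M" "l < M" for j l
        using assms(1)[of l j] that by (simp add: eq_commute[of j l])
    qed (use q ij in auto)
    ultimately show "(\<Sum>a<M. ?tc i a * real_of_int (c' a j)) - t i j \<in> \<int>" by simp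
  qed
  thus "card (rg N M t) \<le> card (rg N M ?tc)" unfolding rg_right_image[of N M ?tc] using fin' by (simp add: card_image_le)
qed

text \<open>The row group is the product of the cyclic groups generated by \<open>1 / d i\<close> in
  the separate coordinates.\<close>

lemma rg_diag_card:
  assumes "\<And>i. i < N ==> d i > 0"
  shows "card (rg N N (\<lambda>i j. if i = j then 1 / real (d i) else 0)) = (\<Prod>i<N. d i)"
proof -
  let ?t = "\<lambda>i j. if i = j then 1 / real (d i) else 0"
  have s: "(\<Sum>i<N. real_of_int (v i) * ?t i j) = real_of_int (v j) / real (d j)" if "j < N" for v j
  proof -
    have "(\<Sum>i<N. real_of_int (v i) * ?t i j) = (\<Sum>i<N. if i = j then real_of_int (v i) / real (d i) else 0)"
      by (rule sum.cong) auto
    thus ?thesis using that by simp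
  qed
  let ?F = "\<lambda>j. (\<lambda>a. real a / real (d j)) ` {..<d j}"
  let ?g = "\<lambda>w j. if j < N then w j else (0::real)"
  have "rg N N ?t = ?g ` (PiE {..<N} ?F)"
  proof (intro equalityI subsetI)
    fix w assume "w \<in> rg N N ?t"
    then obtain v where v: "w = (\<lambda>j. if j < N then frac (\<Sum>i<N. real_of_int (v i) * ?t i j) else 0)" by (auto simp: rg_def)
    have "frac (real_of_int (v j) / real (d j)) \<in> ?F j" if "j < N" for j
    proof -
      have dj: "int (d j) > 0" using assms that by simp
      obtain b where b: "int b = v j mod int (d j)" using dj by (metis nonneg_int_cases pos_mod_sign)
      have "real_of_int (v j) = real_of_int (v j div int (d j)) * real (d j) + real b"
        using b by (metis div_mult_mod_eq of_int_add of_int_mult of_int_of_nat_eq)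
      hence e: "real_of_int (v j) / real (d j) - real b / real (d j) = real_of_int (v j div int (d j))"
        using dj by (simp add: field_simps)
      have lt: "b < d j" using b dj by (metis of_nat_less_iff pos_mod_bound)
      have "frac (real_of_int (v j) / real (d j)) = frac (real b / real (d j))"
        unfolding frac_eq_iff_diff e by simp
      also have "\<dots> = real b / real (d j)" using lt dj by (simp add: frac_eq)
      finally show ?thesis using lt by auto
    qed
    hence "restrict w {..<N} \<in> PiE {..<N} ?F" using v s by auto
    moreover have "w = ?g (restrict w {..<N})" using v by auto
    ultimately show "w \<in> ?g ` (PiE {..<N} ?F)" by blast
  next
    fix w assume "w \<in> ?g ` (PiE {..<N} ?F)"
    then obtain u where u: "u \<in> PiE {..<N} ?F" "w = ?g u" by blast
    have "\<exists>a. \<forall>j<N. u j = real (a j) / real (d j) \<and> a j < d j"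
      using u(1) by (intro choice_iff[THEN iffD1] allI) (auto simp: PiE_def Pi_def image_def)
    then obtain a where a: "\<And>j. j < N ==> u j = real (a j) / real (d j) \<and> a j < d j" by blast
    show "w \<in> rg N N ?t"
    proof (rule rgI[where v = "\<lambda>i. int (a i)"])
      fix j show "w j = (if j < N then frac (\<Sum>i<N. real_of_int (int (a i)) * ?t i j) else 0)"
        using a[of j] u(2) s[of j "\<lambda>i. int (a i)"] by (auto simp: frac_eq)
    qed
  qed
  moreover have "inj_on ?g (PiE {..<N} ?F)"
  proof (rule inj_onI)
    fix x y assume xy: "x \<in> PiE {..<N} ?F" "y \<in> PiE {..<N} ?F" "?g x = ?g y"
    show "x = y"
    proof (rule PiE_ext[OF xy(1,2)])
      fix i assume "i \<in> {..<N}" thus "x i = y i" using fun_cong[OF xy(3), of i] by simp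
    qed
  qed
  ultimately have "card (rg N N ?t) = card (PiE {..<N} ?F)" by (simp add: card_image)
  also have "\<dots> = (\<Prod>j<N. card (?F j))" by (simp add: card_PiE)
  also have "\<dots> = (\<Prod>j<N. d j)"
  proof (rule prod.cong[OF refl])
    fix j assume "j \<in> {..<N}"
    hence "inj_on (\<lambda>a. real a / real (d j)) {..<d j}" using assms by (auto simp: inj_on_def)
    thus "card (?F j) = d j" by (simp add: card_image)
  qed
  finally show ?thesis .
qed

section \<open>Singular numbers: existence, uniqueness, and the order of the row group\<close>

context padic
begin

lift_definition padics_of :: "qp \<Rightarrow> padics" is "\<lambda>x q. if q = p \<and> x \<in> Qp p then x else qp_zero"
  by (simp only: mem_Collect_eq, rule padic_familyI) (auto simp: padic.qp_zero_Qp padicI prime_p)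

definition at_p :: "padics \<Rightarrow> qp" where "at_p f = Rep_padics f p"

lemma at_p_Qp: "at_p f \<in> Qp p"
  using padic_familyD(1)[OF _ prime_p] Rep_padics unfolding at_p_def by blast

lemma at_p_padics_of: "x \<in> Qp p ==> at_p (padics_of x) = x" by (simp add: at_p_def padics_of.rep_eq)

lemma at_p_mult: "at_p (f * g) = qp_mult p (at_p f) (at_p g)"
  by (simp add: at_p_def times_padics.rep_eq prime_p)

lemma at_p_add: "at_p (f + g) = qp_add p (at_p f) (at_p g)"
  by (simp add: at_p_def plus_padics.rep_eq prime_p)

lemma at_p_zero: "at_p 0 = qp_zero" by (simp add: at_p_def zero_padics.rep_eq)
lemma at_p_one: "at_p 1 = qp_one" by (simp add: at_p_def one_padics.rep_eq prime_p)

lemma at_p_sum: "at_p (\<Sum>l<n. f l) = qp_sum p (\<lambda>l. at_p (f l)) n"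
proof -
  have "at_p (\<Sum>l\<leftarrow>xs. f l) = foldr (\<lambda>l acc. qp_add p (at_p (f l)) acc) xs qp_zero" for xs
    by (induction xs) (simp_all add: at_p_zero at_p_add)
  moreover have "(\<Sum>l<n. f l) = (\<Sum>l\<leftarrow>[0..<n]. f l)"
    by (simp add: interv_sum_list_conv_sum_set_nat atLeast0LessThan)
  ultimately show ?thesis by (simp add: qp_sum_def)
qed

text \<open>\<open>pR\<close> constrains only the component at \<open>p\<close>, so that it contains
  the 1 of the product ring. \<open>pF\<close> is the part supported at \<open>p\<close>, a copy of
  Q_p whose own unit differs from that of the ring.\<close>

definition pR :: "padics set" where "pR = {f. at_p f \<in> Zp p}"
definition pF :: "padics set" where "pF = {f. \<forall>q. q \<noteq> p \<longrightarrow> Rep_padics f q = qp_zero}"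
definition pD :: "padics set" where "pD = padics_of ` qp_ppow p ` Zbar"

lemma pF_eq: "f \<in> pF ==> f = padics_of (at_p f)"
  using at_p_Qp[of f]
  by (intro Rep_padics_inject[THEN iffD1] ext) (auto simp: pF_def at_p_def padics_of.rep_eq)

lemma padics_of_pF: "padics_of x \<in> pF" by (simp add: pF_def padics_of.rep_eq)

lemma mult_zero_other: "prime q ==> x \<in> Qp q ==> qp_mult q x qp_zero = qp_zero"
  using padic.qp_mult_zero[OF padicI] padic.qp_mult_commute[OF padicI] by metis

lemma pF_mult: assumes "g \<in> pF" shows "f * g \<in> pF"
  unfolding pF_def
proof (intro CollectI allI impI)
  fix q assume q: "q \<noteq> p"
  have "Rep_padics g q = qp_zero" using assms q by (simp add: pF_def)
  moreover have "prime q ==> Rep_padics f q \<in> Qp q" using padic_familyD(1) Rep_padics by blast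
  ultimately show "Rep_padics (f * g) q = qp_zero" by (simp add: times_padics.rep_eq mult_zero_other)
qed

lemma pF_add: assumes "f \<in> pF" "g \<in> pF" shows "f + g \<in> pF"
  unfolding pF_def
proof (intro CollectI allI impI)
  fix q assume q: "q \<noteq> p"
  show "Rep_padics (f + g) q = qp_zero"
    using assms q padic.qp_add_zero[OF padicI padic.qp_zero_Qp[OF padicI]]
    by (simp add: plus_padics.rep_eq pF_def)
qed

lemma padics_of_mult: assumes "x \<in> Qp p" "y \<in> Qp p" shows "padics_of (qp_mult p x y) = padics_of x * padics_of y"
proof -
  have "padics_of x * padics_of y = padics_of (at_p (padics_of x * padics_of y))" by (intro pF_eq pF_mult padics_of_pF)
  thus ?thesis using assms by (simp add: at_p_mult at_p_padics_of)
qed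

text \<open>Padding with 1 at the other primes, where \<open>padics_of\<close> has 0, turns units of
  Z_p into units of the product ring.\<close>

lift_definition unit_of_qp :: "qp \<Rightarrow> padics" is
  "\<lambda>x q. if prime q then (if q = p \<and> x \<in> Qp p then x else qp_one) else qp_zero"
  by (simp only: mem_Collect_eq, rule padic_familyI) (auto simp: padic.qp_one_Qp padicI)

lemma at_p_unit_of_qp: "x \<in> Qp p ==> at_p (unit_of_qp x) = x" by (simp add: at_p_def unit_of_qp.rep_eq prime_p)

lemma unit_of_qp_mult: assumes "x \<in> Qp p" "y \<in> Qp p" "qp_mult p x y = qp_one" shows "unit_of_qp x * unit_of_qp y = 1"
proof (rule Rep_padics_inject[THEN iffD1], rule ext)
  fix q show "Rep_padics (unit_of_qp x * unit_of_qp y) q = Rep_padics 1 q"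
    using assms padic.qp_mult_one[OF padicI padic.qp_one_Qp[OF padicI]]
    by (simp add: times_padics.rep_eq unit_of_qp.rep_eq one_padics.rep_eq)
qed

lemma pF_unit_form: assumes "x \<in> pF" "x \<noteq> 0"
  shows "\<exists>v. \<exists>u\<in>pR. \<exists>u'\<in>pR. u * u' = 1 \<and> x = u * padics_of (mon v)"
proof -
  have xe: "x = padics_of (at_p x)" by (rule pF_eq[OF assms(1)])
  have "at_p x \<noteq> qp_zero"
  proof
    assume "at_p x = qp_zero"
    moreover have "padics_of qp_zero = 0" by (rule Rep_padics_inject[THEN iffD1]) (auto simp: padics_of.rep_eq zero_padics.rep_eq)
    ultimately show False using xe assms(2) by simp
  qed
  then obtain v u u' where u: "u \<in> Zp p" "u' \<in> Zp p" "qp_mult p u u' = qp_one" "at_p x = qp_mult p (mon v) u"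
    using val_unit[OF at_p_Qp] by blast
  have Q: "u \<in> Qp p" "u' \<in> Qp p" using u Zp_Qp by auto
  have "unit_of_qp u * padics_of (mon v) = padics_of (at_p (unit_of_qp u * padics_of (mon v)))" by (intro pF_eq pF_mult padics_of_pF)
  also have "at_p (unit_of_qp u * padics_of (mon v)) = at_p x"
    using u(4) Q mon_Qp by (simp add: at_p_mult at_p_padics_of at_p_unit_of_qp qp_mult_commute)
  finally have "x = unit_of_qp u * padics_of (mon v)" using xe by simp
  moreover have "unit_of_qp u \<in> pR" "unit_of_qp u' \<in> pR" using u Q by (simp_all add: pR_def at_p_unit_of_qp)
  moreover have "unit_of_qp u * unit_of_qp u' = 1" using unit_of_qp_mult Q u(3) by blast
  ultimately show ?thesis by blast
qed

lemma padics_of_mon_pD: "padics_of (mon v) \<in> pD"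
proof -
  have "mon v = qp_ppow p (ereal (real_of_int (- v)))" by (simp only: ppow_mon minus_minus)
  thus ?thesis unfolding pD_def Zbar_def by blast
qed

lemma zero_pD: "0 \<in> pD"
proof -
  have "padics_of (qp_ppow p (-\<infinity>)) = 0"
    by (rule Rep_padics_inject[THEN iffD1]) (auto simp: padics_of.rep_eq zero_padics.rep_eq qp_ppow_def)
  moreover have "-\<infinity> \<in> Zbar" by (simp add: Zbar_def)
  ultimately show ?thesis unfolding pD_def by (metis image_eqI)
qed

sublocale sm: smith pR pF pD
proof
  show one: "1 \<in> pR" by (simp add: pR_def at_p_one qp_one_Zp)
  show add: "a + b \<in> pR" if "a \<in> pR" "b \<in> pR" for a b
    using that by (simp add: pR_def at_p_add qp_add_Zp)
  show mult: "a * b \<in> pR" if "a \<in> pR" "b \<in> pR" for a b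
    using that by (simp add: pR_def at_p_mult qp_mult_Zp)
  show "- a \<in> pR" if "a \<in> pR" for a
    using that by (simp add: pR_def at_p_def uminus_padics.rep_eq prime_p qp_neg_Zp)
  show "x + y \<in> pF" if "x \<in> pF" "y \<in> pF" for x y using pF_add that .
  show "a * x \<in> pF" if "x \<in> pF" for a x using pF_mult that .
  show "\<exists>u\<in>pR. \<exists>u'\<in>pR. u * u' = 1 \<and> u * x \<in> pD" if xF: "x \<in> pF" for x
  proof (cases "x = 0")
    case True
    have "1 * (1::padics) = 1" by simp
    thus ?thesis using True zero_pD one by (intro bexI[of _ 1]) simp_all
  next
    case False
    then obtain v u u' where u: "u \<in> pR" "u' \<in> pR" "u * u' = 1" "x = u * padics_of (mon v)"
      using pF_unit_form xF by blast
    have "u' * x = (u * u') * padics_of (mon v)" unfolding u(4) by (simp only: mult.assoc mult.commute mult.left_commute)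
    hence "u' * x \<in> pD" using u(3) padics_of_mon_pD by simp
    moreover have "u' * u = 1" using u(3) by (simp add: mult.commute)
    ultimately show ?thesis using u(1,2) by blast
  qed
  show "\<exists>m\<in>pR. x = m * y \<or> y = m * x" if xy: "x \<in> pF" "y \<in> pF" for x y
  proof (cases "x = 0 \<or> y = 0")
    case True
    have "(0::padics) \<in> pR" by (simp add: pR_def at_p_zero qp_zero_Zp)
    thus ?thesis using True by (intro bexI[of _ 0]) auto
  next
    case False
    have dvd: "\<exists>m\<in>pR. u * padics_of (mon v) = m * (w * padics_of (mon v'))"
      if u: "u \<in> pR" and w: "w' \<in> pR" "w * w' = 1" and le: "v' \<le> v" for u w w' v v'
    proof -
      have "padics_of (mon v) = padics_of (mon (v - v')) * padics_of (mon v')"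
        using padics_of_mult[OF mon_Qp mon_Qp, of "v - v'" v'] by (simp add: mon_mult)
      hence "u * padics_of (mon v) = (u * padics_of (mon (v - v'))) * padics_of (mon v') * (w * w')"
        using w by (simp add: mult.assoc)
      also have "\<dots> = (u * padics_of (mon (v - v')) * w') * (w * padics_of (mon v'))"
        by (simp only: mult.assoc mult.commute mult.left_commute)
      finally have "u * padics_of (mon v) = (u * padics_of (mon (v - v')) * w') * (w * padics_of (mon v'))" .
      moreover have "padics_of (mon (v - v')) \<in> pR" using mon_Zp le mon_Qp by (simp add: pR_def at_p_padics_of)
      ultimately show ?thesis using mult u w by blast
    qed
    obtain v u u' where u: "u \<in> pR" "u' \<in> pR" "u * u' = 1" "x = u * padics_of (mon v)"
      using pF_unit_form xy False by blast
    obtain v' w w' where w: "w \<in> pR" "w' \<in> pR" "w * w' = 1" "y = w * padics_of (mon v')"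
      using pF_unit_form xy False by blast
    show ?thesis
    proof (cases "v' \<le> v")
      case True thus ?thesis using dvd[OF u(1) w(2,3)] u(4) w(4) by blast
    next
      case False
      hence "v \<le> v'" by simp
      thus ?thesis using dvd[OF w(1) u(2,3)] u(4) w(4) by blast
    qed
  qed
qed

lemma at_p_dl: "at_p (dl i j) = idm (i, j)"
  by (simp add: dl_def idm_def at_p_zero at_p_one)

lemma at_p_mm: "at_p (mm N A B i j) = matmul p N (\<lambda>(i, j). at_p (A i j)) (\<lambda>(i, j). at_p (B i j)) (i, j)"
  by (simp add: mm_def matmul_def at_p_sum at_p_mult)

lemma matmul_cong: "(\<And>l. l < N ==> A (i, l) = A' (i, l)) ==> (\<And>l. l < N ==> B (l, j) = B' (l, j)) ==>
   matmul p N A B (i, j) = matmul p N A' B' (i, j)"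
proof -
  assume a: "\<And>l. l < N ==> A (i, l) = A' (i, l)" "\<And>l. l < N ==> B (l, j) = B' (l, j)"
  show ?thesis unfolding matmul_def qp_sum_def prod.case by (rule foldr_cong) (simp_all add: a)
qed

lemma gl_inGL: assumes "sm.gl N U U'" shows "inGL p N (\<lambda>(i, j). at_p (U i j))"
proof -
  have "matmul p N (\<lambda>(i, j). at_p (U i j)) (\<lambda>(i, j). at_p (U' i j)) (i, j) = idm (i, j)
    \<and> matmul p N (\<lambda>(i, j). at_p (U' i j)) (\<lambda>(i, j). at_p (U i j)) (i, j) = idm (i, j)"
    if "i < N" "j < N" for i j
    using assms that unfolding sm.gl_def at_p_mm[symmetric] at_p_dl[symmetric] by auto
  moreover have "at_p (U i j) \<in> Zp p" "at_p (U' i j) \<in> Zp p" if "i < N" "j < N" for i j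
  proof -
    have "U i j \<in> pR" "U' i j \<in> pR" using assms that unfolding sm.gl_def by blast+
    thus "at_p (U i j) \<in> Zp p" "at_p (U' i j) \<in> Zp p" by (simp_all add: pR_def)
  qed
  ultimately show ?thesis unfolding inGL_def by (intro conjI exI[of _ "\<lambda>(i, j). at_p (U' i j)"]) auto
qed

text \<open>The normal form is computed in the product ring and read at the component
  \<open>p\<close>.\<close>

theorem is_sing_exists:
  assumes "\<And>i j. i < N ==> j < N ==> Z (i, j) \<in> Qp p"
  shows "\<exists>k. is_sing p N Z k"
proof -
  let ?Z = "\<lambda>i j. padics_of (Z (i, j))"
  obtain Y where Y: "sm.eqv N ?Z Y" "\<forall>i<N. \<forall>j<N. Y i j = (if i = j then Y i i else 0)" "\<forall>i<N. Y i i \<in> pD"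
     "\<forall>i j. i \<le> j \<longrightarrow> j < N \<longrightarrow> (\<exists>m\<in>pR. Y j j = m * Y i i)"
    using sm.smith_normal_form[of N ?Z, OF padics_of_pF] by (elim exE conjE) (rule that)
  obtain U U' V V' where UV: "sm.gl N U U'" "sm.gl N V V'" "\<forall>i<N. \<forall>j<N. Y i j = mm N (mm N U ?Z) V i j"
    using Y(1) unfolding sm.eqv_def by blast
  \<comment> \<open>The normal form is \<open>U Z V\<close>, while \<open>is_sing\<close> asks for a
    factorization of \<open>Z\<close>; the inverse matrices are moved to the other side.\<close>
  have inv: "?Z i j = mm N (mm N U' Y) V' i j" if ij: "i < N" "j < N" for i j
  proof -
    have "mm N (mm N U' Y) V' i j = mm N (mm N U' (mm N (mm N U ?Z) V)) V' i j"
      by (rule mm_cong, rule mm_cong) (use UV(3) in auto)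
    also have "\<dots> = mm N (mm N (mm N U' U) ?Z) (mm N V V') i j" by (simp add: mm_assoc)
    also have "\<dots> = mm N (mm N dl ?Z) dl i j"
      by (rule mm_cong, rule mm_cong) (use UV(1,2) ij in \<open>auto simp: sm.gl_def\<close>)
    also have "\<dots> = ?Z i j" using ij by (simp add: mm_dl1 mm_dl2)
    finally show ?thesis by simp
  qed
  have "\<forall>i. \<exists>k. i < N \<longrightarrow> k \<in> Zbar \<and> Y i i = padics_of (qp_ppow p k)" using Y(3) unfolding pD_def by blast
  then obtain k0 where k0: "\<And>i. i < N ==> k0 i \<in> Zbar \<and> Y i i = padics_of (qp_ppow p (k0 i))" by metis
  define k where "k = (\<lambda>i. if i < N then k0 i else 0)"
  have k: "k i \<in> Zbar" "at_p (Y i i) = qp_ppow p (k i)" if "i < N" for i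
    using k0[OF that] that plim_Qp[OF plim_ppow] by (simp_all add: k_def at_p_padics_of)
  have "k j \<le> k i" if ij: "i \<le> j" "j < N" for i j
  proof -
    obtain m where m: "m \<in> pR" "Y j j = m * Y i i" using Y(4) ij by blast
    have eq: "qp_ppow p (k j) = qp_mult p (at_p m) (qp_ppow p (k i))"
      using m(2) k(2)[of i] k(2)[of j] ij at_p_mult[of m "Y i i"] by simp
    show ?thesis
    proof (cases "k j = -\<infinity>")
      case False
      then obtain n where n: "k j = ereal (real_of_int n)" using k(1)[OF ij(2)] by (auto simp: Zbar_def)
      have "k i \<noteq> -\<infinity>"
      proof
        assume "k i = -\<infinity>"
        hence "mon (- n) = qp_mult p (at_p m) qp_zero" using eq n by (simp add: ppow_mon) (simp add: qp_ppow_def)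
        also have "\<dots> = qp_zero" using qp_mult_zero[OF at_p_Qp] by (simp add: qp_mult_commute)
        finally show False by (auto simp: mon_def qp_zero_def fun_eq_iff split: if_splits)
      qed
      then obtain n' where n': "k i = ereal (real_of_int n')" using k(1)[of i] ij by (auto simp: Zbar_def)
      have "mon (- n) = qp_mult p (at_p m) (mon (- n'))" using eq n n' by (simp only: ppow_mon)
      hence "- n' \<le> - n" using m(1) mon_dvd[of "at_p m" "- n" "- n'"] by (simp add: pR_def)
      thus ?thesis using n n' by simp
    qed simp
  qed
  moreover have "Z (i, j) = matmul p N (matmul p N (\<lambda>(i, j). at_p (U' i j)) (diagm p N k)) (\<lambda>(i, j). at_p (V' i j)) (i, j)"
    if ij: "i < N" "j < N" for i j
  proof -
    have "Z (i, j) = at_p (mm N (mm N U' Y) V' i j)" using inv[OF ij] assms[OF ij] at_p_padics_of by metis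
    also have "\<dots> = matmul p N (matmul p N (\<lambda>(i, j). at_p (U' i j)) (\<lambda>(i, j). at_p (Y i j))) (\<lambda>(i, j). at_p (V' i j)) (i, j)"
      by (subst at_p_mm, rule matmul_cong) (simp_all add: at_p_mm)
    also have "\<dots> = matmul p N (matmul p N (\<lambda>(i, j). at_p (U' i j)) (diagm p N k)) (\<lambda>(i, j). at_p (V' i j)) (i, j)"
    proof (rule matmul_cong)
      fix l assume l: "l < N"
      show "matmul p N (\<lambda>(i, j). at_p (U' i j)) (\<lambda>(i, j). at_p (Y i j)) (i, l)
        = matmul p N (\<lambda>(i, j). at_p (U' i j)) (diagm p N k) (i, l)"
      proof (rule matmul_cong)
        fix a assume a: "a < N"
        have "Y a l = (if a = l then Y a a else 0)" using Y(2) a l by blast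
        thus "(case (a, l) of (i, j) \<Rightarrow> at_p (Y i j)) = diagm p N k (a, l)"
          using k(2)[OF a] by (cases "a = l") (simp_all add: diagm_def at_p_zero)
      qed simp
    qed simp
    finally show ?thesis .
  qed
  moreover have "inGL p N (\<lambda>(i, j). at_p (U' i j))" "inGL p N (\<lambda>(i, j). at_p (V' i j))"
  proof -
    have sw: "sm.gl N A' A" if "sm.gl N A A'" for A A' using that by (auto simp: sm.gl_def)
    show "inGL p N (\<lambda>(i, j). at_p (U' i j))" "inGL p N (\<lambda>(i, j). at_p (V' i j))"
      using gl_inGL sw UV by blast+
  qed
  ultimately have "is_sing p N Z k" unfolding is_sing_def using k(1) by (auto simp: k_def)
  thus ?thesis by blast
qed

text \<open>The positive part of \<open>k - m\<close>, which is the exponent of the cyclic group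
  generated by \<open>p^m p^(-k)\<close> modulo Z_p.\<close>

definition posn :: "int \<Rightarrow> ereal \<Rightarrow> nat" where
  "posn m k = (if k = -\<infinity> then 0 else nat (\<lfloor>real_of_ereal k\<rfloor> - m))"

lemma eventually_all_less: "(\<And>i. i < (N::nat) ==> eventually (P i) F) ==> eventually (\<lambda>x. \<forall>i<N. P i x) F"
proof (induction N)
  case (Suc N)
  hence "eventually (\<lambda>x. \<forall>i<N. P i x) F" "eventually (P N) F" by auto
  thus ?case by eventually_elim (auto simp: less_Suc_eq)
qed simp

text \<open>All integrality statements about a factorization \<open>Z = B D C\<close> survive truncation of the
  entries of \<open>B\<close> and \<open>C\<close> to finitely many digits.\<close>

lemma inGL_approx: assumes "inGL p N B"
  shows "\<exists>b'. \<forall>\<^sub>F K in sequentially. \<forall>i<N. \<forall>j<N.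
    int (p ^ e) dvd (\<Sum>l<N. \<lfloor>tr p (B (i, l)) K\<rfloor> * b' K l j) - (if i = j then 1 else 0) \<and>
    int (p ^ e) dvd (\<Sum>l<N. b' K i l * \<lfloor>tr p (B (l, j)) K\<rfloor>) - (if i = j then 1 else 0)"
proof -
  obtain B' where B0: "\<forall>i<N. \<forall>j<N. B' (i, j) \<in> Zp p"
     "\<forall>i<N. \<forall>j<N. matmul p N B B' (i, j) = idm (i, j) \<and> matmul p N B' B (i, j) = idm (i, j)"
    using assms unfolding inGL_def by (elim conjE exE) (rule that)
  have B': "\<And>i j. i < N ==> j < N ==> B' (i, j) \<in> Zp p"
     "\<And>i j. i < N ==> j < N ==> matmul p N B B' (i, j) = idm (i, j)"
     "\<And>i j. i < N ==> j < N ==> matmul p N B' B (i, j) = idm (i, j)"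
    using B0 by simp_all
  have B: "\<And>i j. i < N ==> j < N ==> B (i, j) \<in> Zp p" using assms unfolding inGL_def by blast
  have fl: "real_of_int \<lfloor>tr p x K\<rfloor> = tr p x K" if "x \<in> Zp p" for x K
    using T_Zp[OF that] by (simp add: tr_eq_T)
  have key: "\<forall>\<^sub>F K in sequentially. int (p ^ e) dvd (\<Sum>l<N. \<lfloor>tr p (X (i, l)) K\<rfloor> * \<lfloor>tr p (Y (l, j)) K\<rfloor>) - (if i = j then 1 else 0)"
    if X: "\<And>i j. i < N ==> j < N ==> X (i, j) \<in> Zp p" and Y: "\<And>i j. i < N ==> j < N ==> Y (i, j) \<in> Zp p"
    and XY: "matmul p N X Y (i, j) = idm (i, j)" and ij: "i < N" "j < N" for X Y i j
  proof -
    have 1: "plim (\<lambda>K. \<Sum>l<N. tr p (X (i, l)) K * tr p (Y (l, j)) K) (idm (i, j))"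
      unfolding XY[symmetric] by (rule plim_matmul; rule plim_tr; rule Zp_Qp) (use X Y ij in auto)
    have 2: "plim (\<lambda>_. if i = j then 1 else 0) (idm (i, j))"
      using plim_one plim_zero by (simp add: idm_def)
    have "\<forall>\<^sub>F K in sequentially. (\<Sum>l<N. tr p (X (i, l)) K * tr p (Y (l, j)) K) - (if i = j then 1 else 0) \<in> PZ (int e)"
      by (rule plim_diff_null[OF 2 1])
    thus ?thesis
    proof eventually_elim
      case (elim K)
      have "(\<Sum>l<N. tr p (X (i, l)) K * tr p (Y (l, j)) K) - (if i = j then 1 else 0)
        = real_of_int ((\<Sum>l<N. \<lfloor>tr p (X (i, l)) K\<rfloor> * \<lfloor>tr p (Y (l, j)) K\<rfloor>) - (if i = j then 1 else 0))"
        using X Y ij by (simp add: fl)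
      thus ?case using elim by (simp only: PZ_of_int)
    qed
  qed
  show ?thesis
  proof (rule exI[of _ "\<lambda>K l j. \<lfloor>tr p (B' (l, j)) K\<rfloor>"], rule eventually_all_less, rule eventually_all_less, rule eventually_conj)
    fix i j assume "i < N" "j < N"
    thus "\<forall>\<^sub>F K in sequentially. int (p ^ e) dvd (\<Sum>l<N. \<lfloor>tr p (B (i, l)) K\<rfloor> * \<lfloor>tr p (B' (l, j)) K\<rfloor>) - (if i = j then 1 else 0)"
      "\<forall>\<^sub>F K in sequentially. int (p ^ e) dvd (\<Sum>l<N. \<lfloor>tr p (B' (i, l)) K\<rfloor> * \<lfloor>tr p (B (l, j)) K\<rfloor>) - (if i = j then 1 else 0)"
      using key[OF B B'(1) B'(2)] key[OF B'(1) B B'(3)] by simp_all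
  qed
qed

lemma ppow_real_posn: assumes "k \<in> Zbar"
  shows "real p powi m * ppow_real k - (if posn m k = 0 then 0 else 1 / real (p ^ posn m k)) \<in> \<int>"
proof (cases "k = -\<infinity>")
  case True thus ?thesis by (simp add: ppow_real_def posn_def)
next
  case False
  then obtain n where n: "k = ereal (real_of_int n)" using assms by (auto simp: Zbar_def)
  have e: "real p powi m * ppow_real k = real p powi (m - n)"
    using p_gt1 n by (simp add: ppow_real_def power_int_add[symmetric])
  show ?thesis
  proof (cases "n \<le> m")
    case True
    thus ?thesis using n e powi_Ints[of "m - n"] by (simp add: posn_def)
  next
    case False
    have "real p powi (m - n) = 1 / real (p ^ posn m k)"
    proof -
      have mn: "m - n = - int (posn m k)" using False n by (simp add: posn_def)
      show ?thesis unfolding mn by (simp add: power_int_minus inverse_eq_divide)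
    qed
    thus ?thesis using e n False by (simp add: posn_def)
  qed
qed

text \<open>The case \<open>m = 0\<close> evaluates gamma, and all \<open>m\<close> together
  determine the singular numbers. Modulo Z the scaled matrix is a diagonal matrix between integer
  truncations of \<open>B\<close> and \<open>C\<close>: the left factor keeps the row group, the
  right factor keeps its order.\<close>

lemma card_rg_sing:
  assumes sing: "is_sing p N Z k" and Z: "\<And>i j. i < N ==> j < N ==> Z (i, j) \<in> Qp p"
  shows "card (rg N N (\<lambda>i j. real p powi m * T (Z (i, j)) (- m))) = (\<Prod>j<N. p ^ posn m (k j))"
proof -
  obtain B C where BC: "inGL p N B" "inGL p N C"
     "\<And>i j. i < N ==> j < N ==> Z (i, j) = matmul p N (matmul p N B (diagm p N k)) C (i, j)"
  proof -
    obtain B C where "inGL p N B" "inGL p N C"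
      "\<forall>i<N. \<forall>j<N. Z (i, j) = matmul p N (matmul p N B (diagm p N k)) C (i, j)"
      using sing unfolding is_sing_def by (elim exE conjE) (rule that)
    thus ?thesis by (intro that[of B C]) simp_all
  qed
  have Zb: "\<And>j. j < N ==> k j \<in> Zbar" using sing by (simp add: is_sing_def)
  define d where "d = (\<lambda>j. real p powi m * ppow_real (k j))"
  \<comment> \<open>\<open>p^e\<close> clears the denominators of the diagonal, so invertibility of
    \<open>B\<close> and \<open>C\<close> is used only modulo \<open>p^e\<close>.\<close>
  define e where "e = Max (insert 0 ((\<lambda>j. posn m (k j)) ` {..<N}))"
  have e: "posn m (k j) \<le> e" if "j < N" for j unfolding e_def by (rule Max_ge) (use that in auto)
  have ped: "real_of_int (int (p ^ e)) * d j \<in> \<int>" if j: "j < N" for j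
  proof -
    have "real_of_int (int (p ^ e)) * (d j - (if posn m (k j) = 0 then 0 else 1 / real (p ^ posn m (k j)))) \<in> \<int>"
      using ppow_real_posn[OF Zb[OF j]] by (intro Ints_mult) (auto simp: d_def)
    moreover have "real_of_int (int (p ^ e)) * (if posn m (k j) = 0 then 0 else 1 / real (p ^ posn m (k j))) \<in> \<int>"
    proof -
      have "real (p ^ e) * (1 / real (p ^ posn m (k j))) = real (p ^ (e - posn m (k j)))"
      proof -
        have "real p ^ e = real p ^ (e - posn m (k j)) * real p ^ posn m (k j)"
          using e[OF j] by (simp flip: power_add)
        thus ?thesis using p_gt1 by (simp add: field_simps)
      qed
      thus ?thesis by simp
    qed
    ultimately show ?thesis by (metis (no_types, lifting) Ints_add diff_add_cancel distrib_left)
  qed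
  obtain b' where b': "\<forall>\<^sub>F K in sequentially. \<forall>i<N. \<forall>j<N.
    int (p ^ e) dvd (\<Sum>l<N. \<lfloor>tr p (B (i, l)) K\<rfloor> * b' K l j) - (if i = j then 1 else 0) \<and>
    int (p ^ e) dvd (\<Sum>l<N. b' K i l * \<lfloor>tr p (B (l, j)) K\<rfloor>) - (if i = j then 1 else 0)"
    using inGL_approx[OF BC(1), of e] by (elim exE) (rule that)
  obtain c' where c': "\<forall>\<^sub>F K in sequentially. \<forall>i<N. \<forall>j<N.
    int (p ^ e) dvd (\<Sum>l<N. \<lfloor>tr p (C (i, l)) K\<rfloor> * c' K l j) - (if i = j then 1 else 0) \<and>
    int (p ^ e) dvd (\<Sum>l<N. c' K i l * \<lfloor>tr p (C (l, j)) K\<rfloor>) - (if i = j then 1 else 0)"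
    using inGL_approx[OF BC(2), of e] by (elim exE) (rule that)
  have BZ: "\<And>i j. i < N ==> j < N ==> B (i, j) \<in> Zp p" and CZ: "\<And>i j. i < N ==> j < N ==> C (i, j) \<in> Zp p"
    using BC(1,2) unfolding inGL_def by simp_all
  have z: "\<forall>\<^sub>F K in sequentially. \<forall>i<N. \<forall>j<N.
      (\<Sum>l<N. (\<Sum>a<N. tr p (B (i, a)) K * (if a = l then ppow_real (k a) else 0)) * tr p (C (l, j)) K) - T (Z (i, j)) (- m) \<in> PZ (- m)"
  proof (rule eventually_all_less, rule eventually_all_less)
    fix i j assume ij: "i < N" "j < N"
    have "plim (\<lambda>K. \<Sum>l<N. (\<Sum>a<N. tr p (B (i, a)) K * (if a = l then ppow_real (k a) else 0)) * tr p (C (l, j)) K) (Z (i, j))"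
      unfolding BC(3)[OF ij]
    proof (rule plim_matmul, rule plim_matmul)
      show "plim (\<lambda>K. if l = l' then ppow_real (k l) else 0) (diagm p N k (l, l'))" for l l'
        using plim_ppow plim_zero by (auto simp: diagm_def)
    qed (use BZ CZ ij Zp_Qp plim_tr in blast)+
    thus "\<forall>\<^sub>F K in sequentially. (\<Sum>l<N. (\<Sum>a<N. tr p (B (i, a)) K * (if a = l then ppow_real (k a) else 0)) * tr p (C (l, j)) K)
       - T (Z (i, j)) (- m) \<in> PZ (- m)" by (simp add: plim_def)
  qed
  obtain K where K1: "\<And>i j. i < N ==> j < N ==> int (p ^ e) dvd (\<Sum>l<N. b' K i l * \<lfloor>tr p (B (l, j)) K\<rfloor>) - (if i = j then 1 else 0)"
    and K2: "\<And>i j. i < N ==> j < N ==> int (p ^ e) dvd (\<Sum>l<N. \<lfloor>tr p (C (i, l)) K\<rfloor> * c' K l j) - (if i = j then 1 else 0)"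
    and K3: "\<And>i j. i < N ==> j < N ==> (\<Sum>l<N. (\<Sum>a<N. tr p (B (i, a)) K * (if a = l then ppow_real (k a) else 0)) * tr p (C (l, j)) K) - T (Z (i, j)) (- m) \<in> PZ (- m)"
  proof -
    obtain K where K: "(\<forall>i<N. \<forall>j<N.
      int (p ^ e) dvd (\<Sum>l<N. \<lfloor>tr p (B (i, l)) K\<rfloor> * b' K l j) - (if i = j then 1 else 0) \<and>
      int (p ^ e) dvd (\<Sum>l<N. b' K i l * \<lfloor>tr p (B (l, j)) K\<rfloor>) - (if i = j then 1 else 0))"
      "(\<forall>i<N. \<forall>j<N.
      int (p ^ e) dvd (\<Sum>l<N. \<lfloor>tr p (C (i, l)) K\<rfloor> * c' K l j) - (if i = j then 1 else 0) \<and>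
      int (p ^ e) dvd (\<Sum>l<N. c' K i l * \<lfloor>tr p (C (l, j)) K\<rfloor>) - (if i = j then 1 else 0))"
      "\<forall>i<N. \<forall>j<N.
      (\<Sum>l<N. (\<Sum>a<N. tr p (B (i, a)) K * (if a = l then ppow_real (k a) else 0)) * tr p (C (l, j)) K) - T (Z (i, j)) (- m) \<in> PZ (- m)"
      using eventually_happens'[OF trivial_limit_sequentially eventually_conj[OF b' eventually_conj[OF c' z]]]
      by (elim exE conjE) (rule that)
    show ?thesis by (rule that[of K]) (use K in simp_all)
  qed
  have fl: "real_of_int \<lfloor>tr p x K\<rfloor> = tr p x K" if "x \<in> Zp p" for x
    using T_Zp[OF that] by (simp add: tr_eq_T)
  define b where "b = (\<lambda>i l. \<lfloor>tr p (B (i, l)) K\<rfloor>)"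
  define c where "c = (\<lambda>i l. \<lfloor>tr p (C (i, l)) K\<rfloor>)"
  let ?D = "\<lambda>i j. if i = j then d i else (0::real)"
  let ?DC = "\<lambda>i j. \<Sum>l<N. ?D i l * real_of_int (c l j)"
  have DC: "?DC i j = d i * real_of_int (c i j)" if "i < N" for i j
  proof -
    have "?DC i j = (\<Sum>l<N. if i = l then d i * real_of_int (c l j) else 0)" by (rule sum.cong) auto
    thus ?thesis using that by simp
  qed
  have "rg N N (\<lambda>i j. real p powi m * T (Z (i, j)) (- m)) = rg N N (\<lambda>i j. \<Sum>l<N. real_of_int (b i l) * ?DC l j)"
  proof (rule rg_cong)
    fix i j assume ij: "i < N" "j < N"
    have "(\<Sum>l<N. (\<Sum>a<N. tr p (B (i, a)) K * (if a = l then ppow_real (k a) else 0)) * tr p (C (l, j)) K)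
      = (\<Sum>l<N. tr p (B (i, l)) K * ppow_real (k l) * tr p (C (l, j)) K)"
    proof (rule sum.cong[OF refl])
      fix l assume l: "l \<in> {..<N}"
      have "(\<Sum>a<N. tr p (B (i, a)) K * (if a = l then ppow_real (k a) else 0))
        = (\<Sum>a<N. if a = l then tr p (B (i, a)) K * ppow_real (k a) else 0)" by (rule sum.cong) auto
      thus "(\<Sum>a<N. tr p (B (i, a)) K * (if a = l then ppow_real (k a) else 0)) * tr p (C (l, j)) K
        = tr p (B (i, l)) K * ppow_real (k l) * tr p (C (l, j)) K" using l by simp
    qed
    hence "(\<Sum>l<N. tr p (B (i, l)) K * ppow_real (k l) * tr p (C (l, j)) K) - T (Z (i, j)) (- m) \<in> PZ (- m)"
      using K3[OF ij] by simp
    hence "real p powi m * (T (Z (i, j)) (- m) - (\<Sum>l<N. tr p (B (i, l)) K * ppow_real (k l) * tr p (C (l, j)) K)) \<in> PZ (m + - m)"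
      by (intro PZ_mult powi_PZ) (rule PZ_diff_commute)
    moreover have "(\<Sum>l<N. real_of_int (b i l) * ?DC l j) = real p powi m * (\<Sum>l<N. tr p (B (i, l)) K * ppow_real (k l) * tr p (C (l, j)) K)"
    proof -
      have "real_of_int (b i l) * ?DC l j = real p powi m * (tr p (B (i, l)) K * ppow_real (k l) * tr p (C (l, j)) K)"
        if l: "l < N" for l
        unfolding DC[OF l] using BZ[OF ij(1) l] CZ[OF l ij(2)] by (simp add: b_def c_def d_def fl)
      hence "(\<Sum>l<N. real_of_int (b i l) * ?DC l j)
        = (\<Sum>l<N. real p powi m * (tr p (B (i, l)) K * ppow_real (k l) * tr p (C (l, j)) K))"
        by (intro sum.cong[OF refl]) simp
      thus ?thesis by (simp only: sum_distrib_left)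
    qed
    ultimately show "real p powi m * T (Z (i, j)) (- m) - (\<Sum>l<N. real_of_int (b i l) * ?DC l j) \<in> \<int>"
      by (simp add: right_diff_distrib PZ_zero_eq)
  qed
  also have "\<dots> = rg N N ?DC"
  proof (rule rg_left_eq[where q = "int (p ^ e)" and b' = "b' K"])
    show "int (p ^ e) dvd (\<Sum>a<N. b' K i a * b a l) - (if i = l then 1 else 0)" if "i < N" "l < N" for i l
      using K1[OF that] by (simp add: b_def)
    show "real_of_int (int (p ^ e)) * ?DC l j \<in> \<int>" if "l < N" for l j
      unfolding DC[OF that] using Ints_mult[OF ped[OF that] Ints_of_int[of "c l j"]] by (simp add: mult.assoc)
  qed
  also have "card \<dots> = card (rg N N ?D)"
  proof (rule rg_right_card[where q = "int (p ^ e)" and c' = "c' K"])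
    show "int (p ^ e) dvd (\<Sum>a<N. c i a * c' K a l) - (if i = l then 1 else 0)" if "i < N" "l < N" for i l
      using K2[OF that] by (simp add: c_def)
    show "real_of_int (int (p ^ e)) * ?D i j \<in> \<int>" if "i < N" for i j
      using ped[OF that] by (cases "i = j") simp_all
  qed (use p_gt1 in simp)
  also have "rg N N ?D = rg N N (\<lambda>i j. if i = j then 1 / real (p ^ posn m (k i)) else 0)"
  proof (rule rg_cong)
    fix i j assume ij: "i < N" "j < N"
    show "?D i j - (if i = j then 1 / real (p ^ posn m (k i)) else 0) \<in> \<int>"
      using ppow_real_posn[OF Zb[OF ij(1)], of m] by (cases "posn m (k i) = 0") (auto simp: d_def)
  qed
  also have "card \<dots> = (\<Prod>j<N. p ^ posn m (k j))"
    by (rule rg_diag_card) (use p_gt1 in simp)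
  finally show ?thesis .
qed

lemma posn_Suc: "posn m k = posn (m + 1) k + (if k \<noteq> -\<infinity> \<and> m < \<lfloor>real_of_ereal k\<rfloor> then 1 else 0)"
  by (auto simp: posn_def)

text \<open>Comparing the orders for \<open>m\<close> and \<open>m + 1\<close> gives the number of
  \<open>j\<close> with \<open>k j > m\<close>. Since \<open>k\<close> is decreasing these indices
  form an initial segment, so their number determines them.\<close>

lemma is_sing_unique:
  assumes Z: "\<And>i j. i < N ==> j < N ==> Z (i, j) \<in> Qp p"
    and k: "is_sing p N Z k" and k': "is_sing p N Z k'"
  shows "k = k'"
proof -
  define gt where "gt = (\<lambda>m (x::ereal). x \<noteq> -\<infinity> \<and> m < \<lfloor>real_of_ereal x\<rfloor>)"
  have S: "(\<Sum>j<N. posn m (k j)) = (\<Sum>j<N. posn m (k' j))" for m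
  proof -
    have "p ^ (\<Sum>j<N. posn m (k j)) = p ^ (\<Sum>j<N. posn m (k' j))"
      using card_rg_sing[OF k Z, of m] card_rg_sing[OF k' Z, of m] by (simp add: power_sum)
    thus ?thesis using p_gt1 by (simp add: power_inject_exp)
  qed
  have C: "card {j. j < N \<and> gt m (k j)} = card {j. j < N \<and> gt m (k' j)}" for m
  proof -
    have c: "(\<Sum>j<N. posn m (x j)) = (\<Sum>j<N. posn (m + 1) (x j)) + card {j. j < N \<and> gt m (x j)}" for x :: "nat \<Rightarrow> ereal"
    proof -
      have "(\<Sum>j<N. posn m (x j)) = (\<Sum>j<N. posn (m + 1) (x j)) + (\<Sum>j<N. if gt m (x j) then 1 else 0)"
        by (subst posn_Suc) (simp add: sum.distrib gt_def)
      also have "(\<Sum>j<N. if gt m (x j) then 1 else 0) = card ({..<N} \<inter> {j. gt m (x j)})"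
        by (simp add: sum.If_cases)
      also have "{..<N} \<inter> {j. gt m (x j)} = {j. j < N \<and> gt m (x j)}" by auto
      finally show ?thesis .
    qed
    show ?thesis using c[of k] c[of k'] S[of m] S[of "m + 1"] by simp
  qed
  have init: "{j. j < N \<and> gt m (x j)} = {..<card {j. j < N \<and> gt m (x j)}}" if x: "is_sing p N Z x" for x m
  proof (rule ccontr)
    let ?A = "{j. j < N \<and> gt m (x j)}"
    assume ne: "?A \<noteq> {..<card ?A}"
    have down: "i \<in> ?A" if "j \<in> ?A" "i \<le> j" for i j
    proof -
      have le: "x j \<le> x i" "x i \<in> Zbar" "x j \<in> Zbar" using x that unfolding is_sing_def by auto
      thus ?thesis using that by (auto simp: gt_def Zbar_def)
    qed
    have fin: "finite ?A" by simp
    have "?A \<subseteq> {..<card ?A}"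
    proof
      fix j assume j: "j \<in> ?A"
      hence "{..j} \<subseteq> ?A" using down by blast
      hence "card {..j} \<le> card ?A" using fin card_mono by blast
      thus "j \<in> {..<card ?A}" by simp
    qed
    moreover have "card ?A = card {..<card ?A}" by simp
    ultimately show False using ne card_subset_eq[of "{..<card ?A}" ?A] by simp
  qed
  have gteq: "gt m (k j) = gt m (k' j)" if "j < N" for m j
  proof -
    have "{j. j < N \<and> gt m (k j)} = {..<card {j. j < N \<and> gt m (k' j)}}"
      using init[OF k, of m] unfolding C .
    hence "{j. j < N \<and> gt m (k j)} = {j. j < N \<and> gt m (k' j)}"
      by (rule trans) (rule init[OF k', symmetric])
    thus ?thesis using that by blast
  qed
  have "k j = k' j" if j: "j < N" for j
  proof -
    have kz: "k j \<in> Zbar" "k' j \<in> Zbar" using k k' j by (auto simp: is_sing_def)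
    have inf: "x = -\<infinity> \<longleftrightarrow> (\<forall>m. \<not> gt m x)" if "x \<in> Zbar" for x
      using that lt_ex by (auto simp: gt_def Zbar_def)
    show ?thesis
    proof (cases "k j = -\<infinity>")
      case True thus ?thesis using inf[OF kz(1)] inf[OF kz(2)] gteq[OF j] by auto
    next
      case False
      hence "k' j \<noteq> -\<infinity>" using inf[OF kz(1)] inf[OF kz(2)] gteq[OF j] by auto
      then obtain n n' where n: "k j = ereal (real_of_int n)" "k' j = ereal (real_of_int n')"
        using False kz by (auto simp: Zbar_def)
      hence "m < n \<longleftrightarrow> m < n'" for m using gteq[OF j, of m] by (simp add: gt_def)
      thus ?thesis using n by (metis linorder_neqE_linordered_idom less_irrefl)
    qed
  qed
  moreover have "k j = k' j" if "\<not> j < N" for j using k k' that by (simp add: is_sing_def)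
  ultimately show ?thesis by blast
qed

text \<open>Replaces the definite description of the singular numbers by a count that depends only
  on the fractional parts of the entries.\<close>

theorem gamma_mat_eq:
  assumes Z: "\<And>i j. i < N ==> j < N ==> Z (i, j) \<in> Qp p"
  shows "gamma_mat p N Z = real (card (rg N N (\<lambda>i j. T (Z (i, j)) 0)))"
proof -
  obtain k where k: "is_sing p N Z k" using is_sing_exists Z by blast
  have sn: "singnum p N Z = k" unfolding singnum_def
    by (rule the_equality[of "is_sing p N Z", OF k]) (rule is_sing_unique[OF Z _ k])
  have "real (card (rg N N (\<lambda>i j. T (Z (i, j)) 0))) = (\<Prod>j<N. real p ^ posn 0 (k j))"
    using card_rg_sing[OF k Z, of 0] by simp
  also have "\<dots> = (\<Prod>j\<in>{j. j < N \<and> k j > 0}. real p powr real_of_ereal (k j))"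
  proof (rule prod.mono_neutral_cong_right)
    show "\<forall>i\<in>{..<N} - {j. j < N \<and> 0 < k j}. real p ^ posn 0 (k i) = 1"
    proof
      fix i assume i: "i \<in> {..<N} - {j. j < N \<and> 0 < k j}"
      hence "k i \<in> Zbar" "\<not> 0 < k i" using k by (auto simp: is_sing_def)
      hence "posn 0 (k i) = 0" by (auto simp: posn_def Zbar_def)
      thus "real p ^ posn 0 (k i) = 1" by simp
    qed
    fix j assume j: "j \<in> {j. j < N \<and> 0 < k j}"
    then obtain n where n: "k j = ereal (real_of_int n)" using k by (auto simp: is_sing_def Zbar_def)
    have "n > 0" using j n by simp
    thus "real p ^ posn 0 (k j) = real p powr real_of_ereal (k j)"
      using n p_gt1 by (simp add: posn_def powr_realpow[symmetric])
  qed auto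
  finally show ?thesis by (simp add: gamma_mat_def sn)
qed

end

section \<open>Cylinders and Haar measure\<close>

context padic
begin

lemma space_qp: "space (qp_space p) = Qp p"
  unfolding qp_space_def by (rule space_measure_of) auto

lemma sets_qp: "sets (qp_space p) = sigma_sets (Qp p) {{d \<in> Qp p. d i = c} | i c. True}"
  unfolding qp_space_def by (rule sets_measure_of) auto

lemma digit_sets: "{d \<in> Qp p. d i = c} \<in> sets (qp_space p)"
  unfolding sets_qp by (rule sigma_sets.Basic) auto

lemma digit_measurable [measurable]: "(\<lambda>x. x i) \<in> measurable (qp_space p) (count_space UNIV)"
proof (rule measurable_count_space_eq_countable[THEN iffD2], simp, intro conjI ballI)
  fix a :: nat
  have "(\<lambda>x. x i) -` {a} \<inter> space (qp_space p) = {d \<in> Qp p. d i = a}" by (auto simp: space_qp)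
  thus "(\<lambda>x. x i) -` {a} \<inter> space (qp_space p) \<in> sets (qp_space p)" using digit_sets by simp
qed auto

lemma measurable_qpI:
  assumes "\<And>w. w \<in> space M ==> X w \<in> Qp p" "\<And>i c. {w \<in> space M. X w i = c} \<in> sets M"
  shows "X \<in> measurable M (qp_space p)"
  unfolding qp_space_def
proof (rule measurable_measure_of)
  show "X \<in> space M \<rightarrow> Qp p" using assms(1) by auto
  fix A assume "A \<in> {{d \<in> Qp p. d i = c} | i c. True}"
  then obtain i c where A: "A = {d \<in> Qp p. d i = c}" by blast
  have "X -` A \<inter> space M = {w \<in> space M. X w i = c}" using assms(1) A by auto
  thus "X -` A \<inter> space M \<in> sets M" using assms(2) by simp
qed auto

definition cyl :: "qp \<Rightarrow> int \<Rightarrow> qp set" where "cyl x e = {y \<in> Qp p. \<forall>i<e. y i = x i}"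

lemma cyl_sets [measurable]: "cyl x e \<in> sets (qp_space p)"
proof -
  have "{y \<in> space (qp_space p). \<forall>i::int. i < e \<longrightarrow> y i = x i} \<in> sets (qp_space p)" by measurable
  thus ?thesis by (simp add: cyl_def space_qp)
qed

lemma cyl_iff: assumes "y \<in> Qp p" "x \<in> Qp p" shows "y \<in> cyl x e \<longleftrightarrow> T y e - T x e \<in> PZ e"
  using T_cong_iff[OF assms, of e] assms by (simp add: cyl_def)

lemma cyl_Int: assumes "e \<le> f" shows "cyl x e \<inter> cyl y f = (if \<forall>i<e. x i = y i then cyl y f else {})"
  using assms by (auto simp: cyl_def)

definition reps :: "qp set" where "reps = of_pfrac ` (\<Union>m. PZ m)"

lemma countable_PZ: "countable (PZ e)"
proof -
  have "PZ e = range (\<lambda>n. of_int n * real p powi e)" by (auto simp: PZ_def)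
  thus ?thesis by simp
qed

lemma countable_reps: "countable reps" unfolding reps_def using countable_PZ by auto

lemma reps_Qp: "reps \<subseteq> Qp p" unfolding reps_def using of_pfrac by auto

lemma in_cyl_reps: assumes "y \<in> Qp p" shows "\<exists>z\<in>reps. y \<in> cyl z e"
proof -
  obtain m where m: "T y e \<in> PZ m" using T_bounded[OF assms] by blast
  let ?z = "of_pfrac (T y e)"
  have "?z \<in> reps" using m by (auto simp: reps_def)
  moreover have "y \<in> cyl ?z e" using cyl_iff[OF assms of_pfrac(1)[OF m]] of_pfrac(3)[OF m] by blast
  ultimately show ?thesis by blast
qed

text \<open>Balls with exponents \<open>e \<ge> 0\<close> generate the sigma-algebra, and on each of
  them the fractional part \<open>T _ 0\<close> is constant, which makes the densities constant on
  boxes.\<close>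

definition cyls :: "qp set set" where "cyls = insert {} {cyl z (int e) | z e. z \<in> Qp p}"

lemma cyl_cyls: "z \<in> Qp p ==> cyl z (int e) \<in> cyls" unfolding cyls_def by blast
lemma empty_cyls: "{} \<in> cyls" by (simp add: cyls_def)

lemma cyls_Pow: "cyls \<subseteq> Pow (Qp p)" by (auto simp: cyls_def cyl_def)

text \<open>Two balls of an ultrametric space are nested or disjoint.\<close>

lemma cyls_Int: assumes "A \<in> cyls" "B \<in> cyls" shows "A \<inter> B \<in> cyls"
proof -
  have *: "cyl x (int e) \<inter> cyl y (int f) \<in> cyls" if "x \<in> Qp p" "y \<in> Qp p" for x y e f
  proof (cases "e \<le> f")
    case True
    thus ?thesis using cyl_Int[of "int e" "int f" x y] cyl_cyls[OF that(2)] empty_cyls by simp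
  next
    case False
    thus ?thesis using cyl_Int[of "int f" "int e" y x] cyl_cyls[OF that(1)] empty_cyls
      by (subst Int_commute) simp
  qed
  consider "A = {} \<or> B = {}" | x e y f where "A = cyl x (int e)" "B = cyl y (int f)" "x \<in> Qp p" "y \<in> Qp p"
    using assms unfolding cyls_def by blast
  thus ?thesis
  proof cases
    case 1
    hence "A \<inter> B = {}" by blast
    thus ?thesis using empty_cyls by simp
  next
    case 2
    thus ?thesis using * by simp
  qed
qed

text \<open>A digit event is a countable union of balls with centres in \<open>reps\<close>.\<close>

lemma sets_qp_cyls: "sets (qp_space p) = sigma_sets (Qp p) cyls"
proof
  have "cyls \<subseteq> sets (qp_space p)" by (auto simp: cyls_def)
  thus "sigma_sets (Qp p) cyls \<subseteq> sets (qp_space p)"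
    using sets.sigma_sets_subset[of cyls "qp_space p"] by (simp add: space_qp)
  have "{d \<in> Qp p. d i = c} \<in> sigma_sets (Qp p) cyls" for i c
  proof -
    let ?e = "int (nat (i + 1))"
    have "{d \<in> Qp p. d i = c} = (\<Union>z\<in>{z \<in> reps. z i = c}. cyl z ?e)"
    proof (intro equalityI subsetI)
      fix d assume d: "d \<in> {d \<in> Qp p. d i = c}"
      then obtain z where z: "z \<in> reps" "d \<in> cyl z ?e" using in_cyl_reps by blast
      thus "d \<in> (\<Union>z\<in>{z \<in> reps. z i = c}. cyl z ?e)" using d by (auto simp: cyl_def)
    qed (auto simp: cyl_def)
    moreover have "(\<Union>z\<in>{z \<in> reps. z i = c}. cyl z ?e) \<in> sigma_sets (Qp p) cyls"
    proof (rule sigma_sets_UNION)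
      show "countable ((\<lambda>z. cyl z ?e) ` {z \<in> reps. z i = c})"
        by (intro countable_image countable_subset[OF _ countable_reps]) auto
      fix b assume "b \<in> (\<lambda>z. cyl z ?e) ` {z \<in> reps. z i = c}"
      then obtain z where "z \<in> reps" "b = cyl z ?e" by blast
      thus "b \<in> sigma_sets (Qp p) cyls" using reps_Qp cyl_cyls by (intro sigma_sets.Basic) blast
    qed
    ultimately show ?thesis by simp
  qed
  thus "sets (qp_space p) \<subseteq> sigma_sets (Qp p) cyls"
    unfolding sets_qp by (intro sigma_sets_mono) auto
qed

lemma cyls_cover: "\<exists>S\<subseteq>cyls. countable S \<and> Qp p = \<Union>S"
proof (intro exI conjI)
  let ?S = "(\<lambda>z. cyl z (int 0)) ` reps"
  show "?S \<subseteq> cyls" using reps_Qp unfolding cyls_def by blast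
  show "countable ?S" using countable_reps by simp
  show "Qp p = \<Union>?S" using in_cyl_reps by (auto simp: cyl_def)
qed

lemma sets_PiM_qp: assumes "finite I"
  shows "sets (PiM I (\<lambda>_. qp_space p)) = sigma_sets (I \<rightarrow>\<^sub>E Qp p) {Pi\<^sub>E I A | A. A \<in> I \<rightarrow> cyls}"
proof -
  have eq: "qp_space p = sigma (Qp p) cyls"
  proof (rule measure_eqI)
    show "sets (qp_space p) = sets (sigma (Qp p) cyls)"
      unfolding sets_qp_cyls using cyls_Pow by (simp add: sets_measure_of)
    show "emeasure (qp_space p) A = emeasure (sigma (Qp p) cyls) A" for A
      unfolding qp_space_def by (simp add: emeasure_sigma)
  qed
  have "sets (PiM I (\<lambda>_. sigma (Qp p) cyls))
    = sets (sigma (I \<rightarrow>\<^sub>E Qp p) {{f \<in> I \<rightarrow>\<^sub>E Qp p. \<forall>i\<in>j. f i \<in> A i} | A j. j \<in> {I} \<and> A \<in> Pi j (\<lambda>_. cyls)})"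
    by (rule sets_PiM_sigma) (use cyls_cover cyls_Pow assms in auto)
  also have "{{f \<in> I \<rightarrow>\<^sub>E Qp p. \<forall>i\<in>j. f i \<in> A i} | A j. j \<in> {I} \<and> A \<in> Pi j (\<lambda>_. cyls)} = {Pi\<^sub>E I A | A. A \<in> I \<rightarrow> cyls}"
  proof -
    have "{f \<in> I \<rightarrow>\<^sub>E Qp p. \<forall>i\<in>I. f i \<in> A i} = Pi\<^sub>E I A" if "A \<in> I \<rightarrow> cyls" for A
      using that cyls_Pow by (auto simp: PiE_def Pi_def) 
    thus ?thesis by (auto) (metis (no_types, lifting))+
  qed
  also have "sets (sigma (I \<rightarrow>\<^sub>E Qp p) {Pi\<^sub>E I A | A. A \<in> I \<rightarrow> cyls}) = sigma_sets (I \<rightarrow>\<^sub>E Qp p) {Pi\<^sub>E I A | A. A \<in> I \<rightarrow> cyls}"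
    by (rule sets_measure_of) (use cyls_Pow in \<open>auto simp: PiE_def Pi_def\<close>)
  finally show ?thesis by (simp add: eq)
qed

text \<open>Measures on finite matrices are compared on products of balls. Countably many unit boxes
  cover the space, so finiteness on boxes suffices for uniqueness.\<close>

lemma box_measure_eqI:
  assumes fin: "finite I" and sM: "sets M = sets (PiM I (\<lambda>_. qp_space p))" and sN: "sets N = sets (PiM I (\<lambda>_. qp_space p))"
    and eq: "\<And>z e. (\<And>i. i \<in> I ==> z i \<in> Qp p) ==> emeasure M (\<Pi>\<^sub>E i\<in>I. cyl (z i) (int (e i))) = emeasure N (\<Pi>\<^sub>E i\<in>I. cyl (z i) (int (e i)))"
    and fm: "\<And>z e. (\<And>i. i \<in> I ==> z i \<in> Qp p) ==> emeasure M (\<Pi>\<^sub>E i\<in>I. cyl (z i) (int (e i))) \<noteq> \<infinity>"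
  shows "M = N"
proof (rule measure_eqI_generator_eq_countable)
  let ?E = "{Pi\<^sub>E I A | A. A \<in> I \<rightarrow> cyls}"
  show "Int_stable ?E"
  proof (rule Int_stableI)
    fix X Y assume "X \<in> ?E" "Y \<in> ?E"
    then obtain A B where AB: "X = Pi\<^sub>E I A" "Y = Pi\<^sub>E I B" "A \<in> I \<rightarrow> cyls" "B \<in> I \<rightarrow> cyls" by blast
    have "X \<inter> Y = Pi\<^sub>E I (\<lambda>i. A i \<inter> B i)" using AB by (simp add: PiE_Int)
    moreover have "(\<lambda>i. A i \<inter> B i) \<in> I \<rightarrow> cyls" using AB cyls_Int by (auto simp: Pi_def)
    ultimately show "X \<inter> Y \<in> ?E" by blast
  qed
  show "?E \<subseteq> Pow (I \<rightarrow>\<^sub>E Qp p)" using cyls_Pow by (auto simp: PiE_def Pi_def)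
  show "sets M = sigma_sets (I \<rightarrow>\<^sub>E Qp p) ?E" "sets N = sigma_sets (I \<rightarrow>\<^sub>E Qp p) ?E"
    using sets_PiM_qp[OF fin] sM sN by auto
  show "emeasure M X = emeasure N X" if XE: "X \<in> ?E" for X
  proof -
    obtain A where A: "X = Pi\<^sub>E I A" "A \<in> I \<rightarrow> cyls" using XE by blast
    show ?thesis
    proof (cases "\<exists>i\<in>I. A i = {}")
      case True
      hence "X = {}" using A(1) by auto
      thus ?thesis by simp
    next
      case False
      have "\<exists>z e. i \<in> I \<longrightarrow> z \<in> Qp p \<and> A i = cyl z (int e)" for i
      proof (cases "i \<in> I")
        case True
        hence "A i \<in> cyls" "A i \<noteq> {}" using A(2) False by (auto simp: Pi_def)
        thus ?thesis unfolding cyls_def by blast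
      qed simp
      then obtain z e where ze: "\<And>i. i \<in> I ==> z i \<in> Qp p \<and> A i = cyl (z i) (int (e i))" by metis
      hence "X = (\<Pi>\<^sub>E i\<in>I. cyl (z i) (int (e i)))" unfolding A(1) by (intro PiE_cong) auto
      thus ?thesis using eq ze by auto
    qed
  qed
  let ?C = "(\<lambda>z. \<Pi>\<^sub>E i\<in>I. cyl (z i) (int 0)) ` (I \<rightarrow>\<^sub>E reps)"
  show "?C \<subseteq> ?E"
  proof
    fix X assume "X \<in> ?C"
    then obtain z where z: "X = (\<Pi>\<^sub>E i\<in>I. cyl (z i) (int 0))" "z \<in> I \<rightarrow>\<^sub>E reps" by blast
    have "(\<lambda>i. cyl (z i) (int 0)) \<in> I \<rightarrow> cyls" 
    proof (rule Pi_I)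
      fix i assume "i \<in> I"
      hence "z i \<in> Qp p" using z(2) reps_Qp by auto
      thus "cyl (z i) (int 0) \<in> cyls" by (rule cyl_cyls)
    qed
    thus "X \<in> ?E" using z(1) by blast
  qed
  show "\<Union>?C = I \<rightarrow>\<^sub>E Qp p"
  proof (intro equalityI subsetI)
    fix f assume f: "f \<in> I \<rightarrow>\<^sub>E Qp p"
    have "\<forall>i. \<exists>z. i \<in> I \<longrightarrow> z \<in> reps \<and> f i \<in> cyl z (int 0)" using f in_cyl_reps by (metis PiE_mem)
    then obtain z where z: "\<And>i. i \<in> I ==> z i \<in> reps \<and> f i \<in> cyl (z i) (int 0)" by metis
    have "f \<in> (\<Pi>\<^sub>E i\<in>I. cyl (restrict z I i) (int 0))" using f z by (intro PiE_I) (auto simp: PiE_def extensional_def)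
    moreover have "restrict z I \<in> I \<rightarrow>\<^sub>E reps" using z by auto
    ultimately show "f \<in> \<Union>?C" by blast
  qed (auto simp: cyl_def PiE_def Pi_def)
  show "countable ?C" using fin countable_reps by (intro countable_image countable_PiE) auto
  fix X assume "X \<in> ?C"
  then obtain z where z: "X = (\<Pi>\<^sub>E i\<in>I. cyl (z i) (int 0))" "z \<in> I \<rightarrow>\<^sub>E reps" by blast
  have "\<And>i. i \<in> I ==> z i \<in> Qp p" using z(2) reps_Qp by auto
  thus "emeasure M X \<noteq> \<infinity>" unfolding z(1) by (rule fm[where e = "\<lambda>_. 0"])
qed

text \<open>The lowest digit position depends on \<open>x\<close>, so \<open>T\<close> is treated as
  a pointwise limit of finite sums, each eventually exact.\<close>

lemma T_measurable [measurable]: "(\<lambda>x. T x e) \<in> borel_measurable (qp_space p)"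
proof (rule borel_measurable_LIMSEQ_real)
  show "(\<lambda>n. \<Sum>i\<in>{- int n..<e}. real (x i) * real p powi i) \<longlonglongrightarrow> T x e" if "x \<in> space (qp_space p)" for x
  proof (rule tendsto_eventually)
    have "x \<in> Qp p" using that by (simp add: space_qp)
    then obtain N where N: "\<forall>i<N. x i = 0" using Qp_low by blast
    have "(\<Sum>i\<in>{- int n..<e}. real (x i) * real p powi i) = T x e" if "n \<ge> nat (- N)" for n
      using T_interval[of "- int n" x e] N that by auto
    thus "\<forall>\<^sub>F n in sequentially. (\<Sum>i\<in>{- int n..<e}. real (x i) * real p powi i) = T x e"
      unfolding eventually_sequentially by blast
  qed
qed measurable

text \<open>A digit of the limit is the eventual digit of the approximations, so its level sets are
  countable combinations of measurable sets.\<close>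

lemma plim_measurable:
  assumes r: "\<And>K. (\<lambda>w. r K w) \<in> borel_measurable M" and X: "\<And>w. w \<in> space M ==> plim (\<lambda>K. r K w) (X w)"
  shows "X \<in> measurable M (qp_space p)"
proof (rule measurable_qpI)
  show "X w \<in> Qp p" if "w \<in> space M" for w using X[OF that] plim_Qp by blast
  fix i c
  have "X w i = c \<longleftrightarrow> (\<exists>K0. \<forall>K\<ge>K0. dig p (r K w) i = c)" if w: "w \<in> space M" for w
  proof -
    have XQ: "X w \<in> Qp p" using X[OF w] plim_Qp by blast
    have "\<forall>\<^sub>F K in sequentially. r K w - T (X w) (i + 1) \<in> PZ (i + 1)" using X[OF w] by (simp add: plim_def)
    hence "\<forall>\<^sub>F K in sequentially. dig p (r K w) i = X w i" by eventually_elim (rule dig_eq[OF XQ])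
    then obtain K1 where K1: "\<And>K. K \<ge> K1 ==> dig p (r K w) i = X w i" by (auto simp: eventually_sequentially)
    show ?thesis
    proof
      assume "X w i = c" thus "\<exists>K0. \<forall>K\<ge>K0. dig p (r K w) i = c" using K1 by blast
    next
      assume "\<exists>K0. \<forall>K\<ge>K0. dig p (r K w) i = c"
      then obtain K0 where "\<And>K. K \<ge> K0 ==> dig p (r K w) i = c" by blast
      thus "X w i = c" using K1[of "max K0 K1"] by (metis max.cobounded1 max.cobounded2)
    qed
  qed
  hence "{w \<in> space M. X w i = c} = {w \<in> space M. \<exists>K0. \<forall>K\<ge>K0. dig p (r K w) i = c}" by auto
  also have "\<dots> \<in> sets M"
  proof -
    have [measurable]: "(\<lambda>w. dig p (r K w) i) \<in> measurable M (count_space UNIV)" for K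
    proof -
      note [measurable] = r
      have "(\<lambda>w. \<lfloor>r K w / real p powi i\<rfloor>) \<in> measurable M (count_space UNIV)" by measurable
      thus ?thesis unfolding dig_def by (rule measurable_compose) simp
    qed
    show ?thesis by measurable
  qed
  finally show "{w \<in> space M. X w i = c} \<in> sets M" .
qed

section \<open>Measurability of the p-adic operations\<close>

lemma measurable_Qp: "X \<in> measurable M (qp_space p) ==> w \<in> space M ==> X w \<in> Qp p"
  using measurable_space[of X M "qp_space p"] by (simp add: space_qp)

lemma qp_add_measurable [measurable]:
  assumes [measurable]: "X \<in> measurable M (qp_space p)" "Y \<in> measurable M (qp_space p)"
  shows "(\<lambda>w. qp_add p (X w) (Y w)) \<in> measurable M (qp_space p)"
proof (rule plim_measurable)
  show "(\<lambda>w. T (X w) (int K) + T (Y w) (int K)) \<in> borel_measurable M" for K by measurable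
  fix w assume "w \<in> space M"
  hence "X w \<in> Qp p" "Y w \<in> Qp p" using measurable_Qp[OF assms(1)] measurable_Qp[OF assms(2)] by simp_all
  thus "plim (\<lambda>K. T (X w) (int K) + T (Y w) (int K)) (qp_add p (X w) (Y w))"
    unfolding tr_eq_T[symmetric] by (intro plim_add plim_tr)
qed

lemma qp_mult_measurable [measurable]:
  assumes [measurable]: "X \<in> measurable M (qp_space p)" "Y \<in> measurable M (qp_space p)"
  shows "(\<lambda>w. qp_mult p (X w) (Y w)) \<in> measurable M (qp_space p)"
proof (rule plim_measurable)
  show "(\<lambda>w. T (X w) (int K) * T (Y w) (int K)) \<in> borel_measurable M" for K by measurable
  fix w assume "w \<in> space M"
  hence "X w \<in> Qp p" "Y w \<in> Qp p" using measurable_Qp[OF assms(1)] measurable_Qp[OF assms(2)] by simp_all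
  thus "plim (\<lambda>K. T (X w) (int K) * T (Y w) (int K)) (qp_mult p (X w) (Y w))"
    unfolding tr_eq_T[symmetric] by (intro plim_mult plim_tr)
qed

lemma qp_const_measurable: "x \<in> Qp p ==> (\<lambda>_. x) \<in> measurable M (qp_space p)"
  by (rule measurable_const) (simp add: space_qp)

lemma qp_sum_measurable:
  assumes "\<And>l. l < n ==> f l \<in> measurable M (qp_space p)"
  shows "(\<lambda>w. qp_sum p (\<lambda>l. f l w) n) \<in> measurable M (qp_space p)"
proof -
  have "(\<lambda>w. foldr (\<lambda>l acc. qp_add p (f l w) acc) xs qp_zero) \<in> measurable M (qp_space p)"
    if "\<And>l. l \<in> set xs ==> f l \<in> measurable M (qp_space p)" for xs
    using that by (induction xs) (auto intro!: qp_add_measurable qp_const_measurable qp_zero_Qp)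
  thus ?thesis unfolding qp_sum_def using assms by auto
qed

end

lemma emeasure_zero_cong:
  assumes "A \<in> sets M" "B \<in> sets M" "C \<in> sets M" "emeasure M (space M - C) = 0" "A \<inter> C = B \<inter> C"
  shows "emeasure M A = emeasure M B"
proof (rule emeasure_eq_AE)
  have "AE x in M. x \<in> C"
    by (rule AE_I[of _ _ "space M - C"]) (use assms in auto)
  thus "AE x in M. x \<in> A \<longleftrightarrow> x \<in> B"
    by eventually_elim (use assms(5) in auto)
qed (use assms in auto)

section \<open>Haar measure as independent uniform digits\<close>

context padic
begin

definition digits :: "(nat \<Rightarrow> nat) measure" where
  "digits = PiM UNIV (\<lambda>_. uniform_count_measure {..<p})"

lemma prob_space_ucm: "prob_space (uniform_count_measure {..<p})"
  by (rule prob_space_uniform_count_measure) (use p_gt1 in auto)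

lemma prob_space_digits: "prob_space digits"
  unfolding digits_def by (rule prob_space_PiM) (rule prob_space_ucm)

lemma space_digits: "f \<in> space digits ==> f n < p"
  by (auto simp: digits_def space_PiM space_uniform_count_measure)

lemma digits_coord_sets: "{f \<in> space digits. f n = c} \<in> sets digits"
proof -
  have m: "(\<lambda>f. f n) \<in> measurable digits (uniform_count_measure {..<p})"
    unfolding digits_def by (rule measurable_component_singleton) simp
  have "{f \<in> space digits. f n = c} = (\<lambda>f. f n) -` ({c} \<inter> {..<p}) \<inter> space digits"
    using space_digits by auto
  also have "\<dots> \<in> sets digits"
    by (rule measurable_sets[OF m]) (auto simp: sets_uniform_count_measure)
  finally show ?thesis .
qed

lemma emeasure_digits:
  assumes "finite J" "\<And>j. j \<in> J ==> c j < p"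
  shows "emeasure digits {f \<in> space digits. \<forall>j\<in>J. f j = c j} = ennreal (1 / real p ^ card J)"
proof -
  interpret product_prob_space "\<lambda>_. uniform_count_measure {..<p}" "UNIV :: nat set"
    using prob_space_ucm by (simp add: product_prob_space_def product_prob_space_axioms_def product_sigma_finite_def prob_space_imp_sigma_finite)
  have "emeasure digits {f \<in> space digits. \<forall>j\<in>J. f j \<in> {c j}} = (\<Prod>j\<in>J. emeasure (uniform_count_measure {..<p}) {c j})"
    unfolding digits_def by (rule emeasure_PiM_Collect) (use assms in \<open>auto simp: sets_uniform_count_measure\<close>)
  also have "\<dots> = (\<Prod>j\<in>J. ennreal (1 / real p))"
  proof (rule prod.cong[OF refl])
    fix j assume "j \<in> J"
    hence "{c j} \<subseteq> {..<p}" using assms by auto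
    thus "emeasure (uniform_count_measure {..<p}) {c j} = ennreal (1 / real p)"
      by (subst emeasure_uniform_count_measure) auto
  qed
  also have "\<dots> = ennreal (1 / real p ^ card J)"
    by (simp add: ennreal_power power_one_over)
  finally show ?thesis by simp
qed

definition haar_map :: "int \<Rightarrow> (nat \<Rightarrow> nat) \<Rightarrow> qp" where
  "haar_map m f = (\<lambda>i. if i < - m then 0 else f (nat (i + m)))"

lemma haar_shift_eq: "haar_shift p m = distr digits (qp_space p) (haar_map m)"
  by (simp add: haar_shift_def digits_def haar_map_def[abs_def])

lemma haar_map_measurable [measurable]: "haar_map m \<in> measurable digits (qp_space p)"
proof (rule measurable_qpI)
  fix f assume f: "f \<in> space digits"
  show "haar_map m f \<in> Qp p"
    unfolding Qp_def haar_map_def using space_digits[OF f] p_gt1 by auto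
next
  fix i c
  show "{f \<in> space digits. haar_map m f i = c} \<in> sets digits"
    using digits_coord_sets[of "nat (i + m)" c] by (cases "i < - m"; cases "c = 0") (auto simp: haar_map_def)
qed

lemma sets_haar [simp, measurable_cong]: "sets (haar_shift p m) = sets (qp_space p)"
  by (simp add: haar_shift_eq)

lemma space_haar [simp]: "space (haar_shift p m) = Qp p"
  by (simp add: haar_shift_eq space_qp)

lemma prob_space_haar: "prob_space (haar_shift p m)"
  unfolding haar_shift_eq by (rule prob_space.prob_space_distr[OF prob_space_digits haar_map_measurable])

text \<open>The digits at positions from \<open>-m\<close> to \<open>e - 1\<close> are random and
  must match the centre; below \<open>-m\<close> they vanish, so the centre must vanish there
  too.\<close>

lemma emeasure_haar_cyl:
  assumes z: "z \<in> Qp p"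
  shows "emeasure (haar_shift p m) (cyl z e) =
    (if \<forall>i. i < e \<and> i < - m \<longrightarrow> z i = 0 then ennreal (1 / real p ^ nat (e + m)) else 0)"
proof -
  have "emeasure (haar_shift p m) (cyl z e) = emeasure digits (haar_map m -` cyl z e \<inter> space digits)"
    unfolding haar_shift_eq by (rule emeasure_distr) auto
  also have "haar_map m -` cyl z e \<inter> space digits = (if \<forall>i. i < e \<and> i < - m \<longrightarrow> z i = 0 then
      {f \<in> space digits. \<forall>j\<in>{..<nat (e + m)}. f j = z (int j - m)} else {})"
  proof -
    have Q: "haar_map m f \<in> Qp p" if "f \<in> space digits" for f
      using measurable_space[OF haar_map_measurable that] by (simp add: space_qp)
    have 1: "(\<forall>i<e. haar_map m f i = z i) \<longleftrightarrow> (\<forall>i. i < e \<and> i < - m \<longrightarrow> z i = 0) \<and> (\<forall>j<nat (e + m). f j = z (int j - m))" for f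
    proof
      assume a: "\<forall>i<e. haar_map m f i = z i"
      have "z i = 0" if "i < e" "i < - m" for i using a[rule_format, OF that(1)] that(2) by (simp add: haar_map_def)
      moreover have "f j = z (int j - m)" if "j < nat (e + m)" for j
        using a[rule_format, of "int j - m"] that by (simp add: haar_map_def)
      ultimately show "(\<forall>i. i < e \<and> i < - m \<longrightarrow> z i = 0) \<and> (\<forall>j<nat (e + m). f j = z (int j - m))" by blast
    next
      assume a: "(\<forall>i. i < e \<and> i < - m \<longrightarrow> z i = 0) \<and> (\<forall>j<nat (e + m). f j = z (int j - m))"
      show "\<forall>i<e. haar_map m f i = z i"
      proof (intro allI impI)
        fix i assume i: "i < e"
        show "haar_map m f i = z i"
        proof (cases "i < - m")
          case True thus ?thesis using a i by (simp add: haar_map_def)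
        next
          case False
          hence "f (nat (i + m)) = z (int (nat (i + m)) - m)" using a i by auto
          thus ?thesis using False by (simp add: haar_map_def)
        qed
      qed
    qed
    show ?thesis using 1 Q by (auto simp: cyl_def)
  qed
  also have "emeasure digits \<dots> = (if \<forall>i. i < e \<and> i < - m \<longrightarrow> z i = 0 then ennreal (1 / real p ^ nat (e + m)) else 0)"
  proof (cases "\<forall>i. i < e \<and> i < - m \<longrightarrow> z i = 0")
    case True
    show ?thesis unfolding if_P[OF True]
      using emeasure_digits[of "{..<nat (e + m)}" "\<lambda>j. z (int j - m)"] QpD[OF z] by simp
  next
    case False
    show ?thesis unfolding if_not_P[OF False] by simp
  qed
  finally show ?thesis .
qed

lemma Zp_cyl: "Zp p = cyl qp_zero 0" by (auto simp: Zp_def cyl_def qp_zero_def)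

lemma Zp_sets [measurable]: "Zp p \<in> sets (qp_space p)" by (simp add: Zp_cyl)

lemma haarZp_eq: "haarZp p = haar_shift p 0" by (simp add: haarZp_def)

lemma sets_haarZp [simp, measurable_cong]: "sets (haarZp p) = sets (qp_space p)" by (simp add: haarZp_eq)
lemma space_haarZp [simp]: "space (haarZp p) = Qp p" by (simp add: haarZp_eq)
lemma prob_space_haarZp: "prob_space (haarZp p)" by (simp add: haarZp_eq prob_space_haar)

lemma emeasure_haarZp_cyl: assumes "z \<in> Zp p"
  shows "emeasure (haarZp p) (cyl z (int e)) = ennreal (1 / real p ^ e)"
  using emeasure_haar_cyl[of z 0 "int e"] assms by (simp add: haarZp_eq Zp_def)

lemma emeasure_haarZp_Zp: "emeasure (haarZp p) (Qp p - Zp p) = 0"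
proof -
  interpret prob_space "haarZp p" by (rule prob_space_haarZp)
  have "emeasure (haarZp p) (Zp p) = 1"
    using emeasure_haarZp_cyl[OF qp_zero_Zp, of 0] by (simp add: Zp_cyl)
  thus ?thesis using emeasure_compl[of "Zp p" "haarZp p"] emeasure_space_1 by simp
qed

lemma emeasure_haarZp_cong: assumes "A \<in> sets (qp_space p)" "B \<in> sets (qp_space p)" "A \<inter> Zp p = B \<inter> Zp p"
  shows "emeasure (haarZp p) A = emeasure (haarZp p) B"
  by (rule emeasure_zero_cong[where C = "Zp p"]) (use assms emeasure_haarZp_Zp in auto)

text \<open>Since \<open>b\<close> is integral, \<open>b + c\<close> reaches only balls whose centre
  is congruent to \<open>c\<close> modulo Z_p. For these the event is a ball around the integral
  difference of \<open>y\<close> and \<open>c\<close>.\<close>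

lemma haar_affine:
  assumes c: "c \<in> Qp p" and y: "y \<in> Qp p"
  shows "emeasure (haarZp p) {b \<in> Qp p. qp_add p b c \<in> cyl y (int f)} =
    (if T c 0 - T y 0 \<in> \<int> then ennreal (1 / real p ^ f) else 0)"
proof -
  let ?A = "{b \<in> Qp p. qp_add p b c \<in> cyl y (int f)}"
  have "(\<lambda>b. qp_add p b c) \<in> measurable (qp_space p) (qp_space p)"
    by (intro qp_add_measurable measurable_ident_sets[OF refl] qp_const_measurable c)
  from measurable_sets[OF this cyl_sets[of y "int f"]] have A: "?A \<in> sets (qp_space p)"
    by (simp add: space_qp vimage_def Int_def conj_commute)
  have mem: "b \<in> ?A \<longleftrightarrow> T b (int f) - (T y (int f) - T c (int f)) \<in> PZ (int f)" if b: "b \<in> Qp p" for b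
  proof -
    have e: "T (qp_add p b c) (int f) - (T b (int f) + T c (int f)) \<in> PZ (int f)" by (rule T_add[OF b c])
    have "qp_add p b c \<in> cyl y (int f) \<longleftrightarrow> T (qp_add p b c) (int f) - T y (int f) \<in> PZ (int f)"
      by (rule cyl_iff[OF qp_add_Qp[OF b c] y])
    also have "\<dots> \<longleftrightarrow> (T b (int f) + T c (int f)) - T y (int f) \<in> PZ (int f)"
      using PZ_trans[OF e] PZ_trans[OF PZ_diff_commute[OF e]] by blast
    finally show ?thesis using b by (simp add: algebra_simps)
  qed
  have red: "T c (int f) - T c 0 \<in> PZ 0" "T y (int f) - T y 0 \<in> PZ 0" using T_diff c y by auto
  have r: "T y (int f) - T c (int f) \<in> \<int> \<longleftrightarrow> T c 0 - T y 0 \<in> \<int>"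
  proof -
    have "(T y (int f) - T c (int f)) + (T c 0 - T y 0) \<in> \<int>"
      using PZ_diff[OF red(2,1)] by (simp add: PZ_zero_eq algebra_simps)
    thus ?thesis by (metis Ints_diff add_diff_cancel_left' add_diff_cancel_right')
  qed
  show ?thesis
  proof (cases "T c 0 - T y 0 \<in> \<int>")
    case True
    hence rz: "T y (int f) - T c (int f) \<in> PZ 0" using r by (simp add: PZ_zero_eq)
    define z where "z = of_pfrac (T y (int f) - T c (int f))"
    have z: "z \<in> Qp p" "\<forall>i<0. z i = 0" "\<And>e. T y (int f) - T c (int f) - T z e \<in> PZ e"
      using of_pfrac[OF rz] by (auto simp: z_def)
    have "emeasure (haarZp p) ?A = emeasure (haarZp p) (cyl z (int f))"
    proof (rule emeasure_haarZp_cong[OF A cyl_sets])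
      have "b \<in> ?A \<longleftrightarrow> b \<in> cyl z (int f)" if "b \<in> Zp p" for b
        using mem[OF Zp_Qp[OF that]] cyl_iff[OF Zp_Qp[OF that] z(1), of "int f"] z(3)[of "int f"] PZ_trans PZ_diff_commute
        by blast
      thus "?A \<inter> Zp p = cyl z (int f) \<inter> Zp p" by blast
    qed
    thus ?thesis using emeasure_haarZp_cyl[of z f] z True by (simp add: Zp_def)
  next
    case False
    have "emeasure (haarZp p) ?A = emeasure (haarZp p) {}"
    proof (rule emeasure_haarZp_cong[OF A])
      have "b \<notin> ?A" if b: "b \<in> Zp p" for b
      proof
        assume "b \<in> ?A"
        hence "T b (int f) - (T y (int f) - T c (int f)) \<in> PZ (int f)" using mem[OF Zp_Qp[OF b]] by blast
        hence "T b (int f) - (T y (int f) - T c (int f)) \<in> \<int>" using PZ_monoD[of _ "int f" 0] by (simp add: PZ_zero_eq)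
        hence "T y (int f) - T c (int f) \<in> \<int>" using T_Zp[OF b, of "int f"] by (metis Ints_diff diff_diff_eq2 add_diff_cancel_left')
        thus False using r False by blast
      qed
      thus "?A \<inter> Zp p = {} \<inter> Zp p" by blast
    qed simp
    thus ?thesis using False by simp
  qed
qed

lemma rs_less_Qp: assumes "x \<in> Qp p" shows "rs K x < p ^ K"
proof (induction K)
  case (Suc K)
  have "x (int K) * p ^ K \<le> (p - 1) * p ^ K" using QpD[OF assms, of "int K"] by (intro mult_right_mono) auto
  moreover have "rs (Suc K) x = rs K x + x (int K) * p ^ K" by (simp add: rs_def)
  ultimately have "rs (Suc K) x < p ^ K + (p - 1) * p ^ K" using Suc by linarith
  also have "\<dots> = p ^ Suc K" using p_gt1 by (simp add: algebra_simps)
  finally show ?case .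
qed (simp add: rs_def)

lemma rs_measurable [measurable]: "rs K \<in> measurable (qp_space p) (count_space UNIV)"
proof (induction K)
  case 0 show ?case by (simp add: rs_def[abs_def])
next
  case (Suc K)
  have "(\<lambda>x. i + x (int K) * p ^ K) \<in> measurable (qp_space p) (count_space UNIV)" for i
    by (rule measurable_compose[OF digit_measurable]) simp
  from measurable_compose_countable[OF this Suc] show ?case by (simp add: rs_def[abs_def])
qed

lemma emeasure_haarZp_rs: assumes "v < p ^ K"
  shows "emeasure (haarZp p) {x \<in> Qp p. rs K x = v} = ennreal (1 / real p ^ K)"
proof -
  have v0: "real v \<in> PZ 0" by (simp add: PZ_zero_eq)
  define z where "z = of_pfrac (real v)"
  have z: "z \<in> Zp p" "\<And>e. real v - T z e \<in> PZ e" using of_pfrac[OF v0] by (auto simp: z_def Zp_def)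
  have Tz: "T z (int K) = real v"
  proof -
    have "real v - T z (int K) = 0"
    proof (rule PZ_small[OF z(2)])
      have "real v < real p ^ K" using assms by (metis of_nat_less_iff of_nat_power)
      thus "\<bar>real v - T z (int K)\<bar> < real p powi int K"
        using T_nonneg[of z "int K"] T_less[OF Zp_Qp[OF z(1)], of "int K"]
        unfolding power_int_of_nat abs_less_iff by linarith
    qed
    thus ?thesis by simp
  qed
  have "{x \<in> space (qp_space p). rs K x = v} \<in> sets (qp_space p)" by measurable
  hence A: "{x \<in> Qp p. rs K x = v} \<in> sets (qp_space p)" by (simp add: space_qp)
  have "emeasure (haarZp p) {x \<in> Qp p. rs K x = v} = emeasure (haarZp p) (cyl z (int K))"
  proof (rule emeasure_haarZp_cong[OF A cyl_sets])
    have "x \<in> {x \<in> Qp p. rs K x = v} \<longleftrightarrow> x \<in> cyl z (int K)" if x: "x \<in> Zp p" for x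
    proof -
      have "x \<in> cyl z (int K) \<longleftrightarrow> T x (int K) = T z (int K)"
        using cyl_iff[OF Zp_Qp[OF x] Zp_Qp[OF z(1)]] T_eq_iff[OF Zp_Qp[OF x] Zp_Qp[OF z(1)]] by blast
      thus ?thesis using Tz T_rs[OF x, of K] Zp_Qp[OF x] by simp
    qed
    thus "{x \<in> Qp p. rs K x = v} \<inter> Zp p = cyl z (int K) \<inter> Zp p" by blast
  qed
  thus ?thesis using emeasure_haarZp_cyl[OF z(1)] by simp
qed

lemma product_prob_haarZp: "product_prob_space (\<lambda>_. haarZp p)"
  using prob_space_haarZp by (simp add: product_prob_space_def product_prob_space_axioms_def product_sigma_finite_def prob_space_imp_sigma_finite)

text \<open>Residues modulo \<open>p^K\<close> of finitely many coordinates are independent and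
  uniform, so the probability of an event about them is a proportion in a finite set. This is the
  bridge from Haar measure to counting.\<close>

lemma residue_law:
  fixes I :: "'i set"
  assumes J: "J \<subseteq> I" "finite J"
  shows "{w \<in> space (PiM I (\<lambda>_. haarZp p)). Q (restrict (\<lambda>j. rs K (w j)) J)} \<in> sets (PiM I (\<lambda>_. haarZp p))"
    and "measure (PiM I (\<lambda>_. haarZp p)) {w \<in> space (PiM I (\<lambda>_. haarZp p)). Q (restrict (\<lambda>j. rs K (w j)) J)}
      = real (card {v \<in> J \<rightarrow>\<^sub>E {..<p ^ K}. Q v}) / real p ^ (K * card J)"
proof -
  interpret product_prob_space "\<lambda>_. haarZp p" I by (rule product_prob_haarZp)
  let ?M = "PiM I (\<lambda>_. haarZp p)"
  let ?V = "{v \<in> J \<rightarrow>\<^sub>E {..<p ^ K}. Q v}"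
  let ?E = "\<lambda>v. {w \<in> space ?M. \<forall>j\<in>J. w j \<in> {x \<in> Qp p. rs K x = v j}}"
  have fin: "finite ?V" using J by (intro finite_subset[OF _ finite_PiE[of J "\<lambda>_. {..<p ^ K}"]]) auto
  have sp: "w j \<in> Qp p" if "w \<in> space ?M" "j \<in> J" for w j
    using that J by (auto simp: space_PiM PiE_def Pi_def)
  have A: "{x \<in> Qp p. rs K x = c} \<in> sets (haarZp p)" for c
  proof -
    have "{x \<in> space (qp_space p). rs K x = c} \<in> sets (qp_space p)" by measurable
    thus ?thesis by (simp add: space_qp)
  qed
  have Emeas: "?E v \<in> sets ?M" for v
  proof (rule sets.sets_Collect_finite_All[OF _ J(2)])
    fix j assume "j \<in> J"
    hence "(\<lambda>w. w j) \<in> measurable ?M (haarZp p)" using J by (intro measurable_component_singleton) auto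
    from measurable_sets[OF this A] show "{w \<in> space ?M. w j \<in> {x \<in> Qp p. rs K x = v j}} \<in> sets ?M"
      by (simp only: vimage_def Int_def mem_Collect_eq conj_commute)
  qed
  have eq: "{w \<in> space ?M. Q (restrict (\<lambda>j. rs K (w j)) J)} = (\<Union>v\<in>?V. ?E v)"
  proof (intro equalityI subsetI)
    fix w assume w: "w \<in> {w \<in> space ?M. Q (restrict (\<lambda>j. rs K (w j)) J)}"
    hence "restrict (\<lambda>j. rs K (w j)) J \<in> ?V" using sp rs_less_Qp by auto
    moreover have "w \<in> ?E (restrict (\<lambda>j. rs K (w j)) J)" using w sp by auto
    ultimately show "w \<in> (\<Union>v\<in>?V. ?E v)" by blast
  next
    fix w assume "w \<in> (\<Union>v\<in>?V. ?E v)"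
    then obtain v where v: "v \<in> ?V" "w \<in> ?E v" by blast
    have "restrict (\<lambda>j. rs K (w j)) J = v"
    proof (rule ext)
      fix j show "restrict (\<lambda>j. rs K (w j)) J j = v j" using v by (cases "j \<in> J") (auto simp: PiE_def extensional_def)
    qed
    thus "w \<in> {w \<in> space ?M. Q (restrict (\<lambda>j. rs K (w j)) J)}" using v by simp
  qed
  show "{w \<in> space ?M. Q (restrict (\<lambda>j. rs K (w j)) J)} \<in> sets ?M"
    unfolding eq using fin Emeas by (intro sets.finite_UN) auto
  have disj: "disjoint_family_on ?E ?V"
    unfolding disjoint_family_on_def
  proof (intro ballI impI)
    fix v v' assume "v \<in> ?V" "v' \<in> ?V" "v \<noteq> v'"
    hence v: "v \<in> J \<rightarrow>\<^sub>E {..<p ^ K}" "v' \<in> J \<rightarrow>\<^sub>E {..<p ^ K}" "v \<noteq> v'" by auto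
    then obtain j where "j \<in> J" "v j \<noteq> v' j" using PiE_ext[OF v(1,2)] by blast
    thus "?E v \<inter> ?E v' = {}" by force
  qed
  have mE: "measure ?M (?E v) = 1 / real p ^ (K * card J)" if v: "v \<in> ?V" for v
  proof -
    have "emeasure ?M (?E v) = (\<Prod>j\<in>J. emeasure (haarZp p) {x \<in> Qp p. rs K x = v j})"
      by (rule emeasure_PiM_Collect) (use J A in auto)
    also have "\<dots> = (\<Prod>j\<in>J. ennreal (1 / real p ^ K))"
      by (intro prod.cong refl emeasure_haarZp_rs) (use v in auto)
    also have "\<dots> = ennreal (1 / real p ^ (K * card J))"
      by (simp add: ennreal_power power_one_over power_mult)
    finally show ?thesis by (simp add: measure_def)
  qed
  have "measure ?M (\<Union>v\<in>?V. ?E v) = (\<Sum>v\<in>?V. measure ?M (?E v))"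
    by (rule finite_measure_finite_Union[OF fin _ disj]) (use Emeas in auto)
  also have "\<dots> = (\<Sum>v\<in>?V. 1 / real p ^ (K * card J))" by (rule sum.cong[OF refl]) (rule mE)
  finally show "measure ?M {w \<in> space ?M. Q (restrict (\<lambda>j. rs K (w j)) J)} = real (card ?V) / real p ^ (K * card J)"
    unfolding eq by simp
qed

lemma AE_Zp: assumes "countable I" shows "AE w in PiM I (\<lambda>_. haarZp p). \<forall>i\<in>I. w i \<in> Zp p"
proof -
  interpret product_prob_space "\<lambda>_. haarZp p" I by (rule product_prob_haarZp)
  have "AE x in haarZp p. x \<in> Zp p"
    by (rule AE_I[of _ _ "Qp p - Zp p"]) (use emeasure_haarZp_Zp Zp_sets sets.compl_sets[of "Zp p" "qp_space p"] in \<open>auto simp: space_qp\<close>)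
  thus ?thesis unfolding AE_ball_countable[OF assms] using AE_component by blast
qed

end

section \<open>Counting in row groups\<close>

text \<open>Membership of \<open>x\<close> modulo Z in the row group, for an arbitrary real
  representative; \<open>rg\<close> itself stores fractional parts.\<close>

definition in_span :: "nat \<Rightarrow> nat \<Rightarrow> (nat \<Rightarrow> nat \<Rightarrow> real) \<Rightarrow> (nat \<Rightarrow> real) \<Rightarrow> bool" where
  "in_span N M t x \<longleftrightarrow> (\<exists>v. \<forall>j<M. (\<Sum>i<N. real_of_int (v i) * t i j) - x j \<in> \<int>)"

lemma in_span_add: assumes "in_span N M t x" "in_span N M t y" shows "in_span N M t (\<lambda>j. x j + y j)"
proof -
  obtain v u where vu: "\<forall>j<M. (\<Sum>i<N. real_of_int (v i) * t i j) - x j \<in> \<int>" "\<forall>j<M. (\<Sum>i<N. real_of_int (u i) * t i j) - y j \<in> \<int>"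
    using assms by (auto simp: in_span_def)
  have "(\<Sum>i<N. real_of_int (v i + u i) * t i j) - (x j + y j) \<in> \<int>" if "j < M" for j
    using Ints_add[OF vu(1)[rule_format, OF that] vu(2)[rule_format, OF that]]
    by (simp add: distrib_right sum.distrib algebra_simps)
  thus ?thesis unfolding in_span_def by (intro exI[of _ "\<lambda>i. v i + u i"]) blast
qed

lemma in_span_scale: assumes "in_span N M t x" shows "in_span N M t (\<lambda>j. real_of_int c * x j)"
proof -
  obtain v where v: "\<forall>j<M. (\<Sum>i<N. real_of_int (v i) * t i j) - x j \<in> \<int>"
    using assms by (auto simp: in_span_def)
  have "(\<Sum>i<N. real_of_int (c * v i) * t i j) - real_of_int c * x j \<in> \<int>" if "j < M" for j
  proof -
    have "real_of_int c * ((\<Sum>i<N. real_of_int (v i) * t i j) - x j) \<in> \<int>"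
      using v that by (intro Ints_mult) auto
    thus ?thesis by (simp add: right_diff_distrib sum_distrib_left mult.assoc)
  qed
  thus ?thesis unfolding in_span_def by (intro exI[of _ "\<lambda>i. c * v i"]) blast
qed

lemma in_span_cong: assumes "in_span N M t x" "\<And>j. j < M ==> x j - y j \<in> \<int>" shows "in_span N M t y"
proof -
  obtain v where v: "\<forall>j<M. (\<Sum>i<N. real_of_int (v i) * t i j) - x j \<in> \<int>"
    using assms by (auto simp: in_span_def)
  have "(\<Sum>i<N. real_of_int (v i) * t i j) - y j \<in> \<int>" if "j < M" for j
    using Ints_add[OF v[rule_format, OF that] assms(2)[OF that]] by simp
  thus ?thesis unfolding in_span_def by blast
qed

lemma in_span_zero: "(\<And>j. j < M ==> x j \<in> \<int>) ==> in_span N M t x"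
  unfolding in_span_def by (rule exI[of _ "\<lambda>_. 0"]) simp

lemma in_span_rg: "in_span N M t x \<longleftrightarrow> (\<lambda>j. if j < M then frac (x j) else 0) \<in> rg N M t"
proof
  assume "in_span N M t x"
  then obtain v where v: "\<And>j. j < M ==> (\<Sum>i<N. real_of_int (v i) * t i j) - x j \<in> \<int>" by (auto simp: in_span_def)
  show "(\<lambda>j. if j < M then frac (x j) else 0) \<in> rg N M t"
    by (rule rgI[where v = v]) (simp add: v[unfolded frac_eq_iff_diff[symmetric]])
next
  assume "(\<lambda>j. if j < M then frac (x j) else 0) \<in> rg N M t"
  then obtain v where v: "\<forall>j. (if j < M then frac (x j) else 0) = (if j < M then frac (\<Sum>i<N. real_of_int (v i) * t i j) else 0)"
    by (auto simp: rg_mem)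
  have "(\<Sum>i<N. real_of_int (v i) * t i j) - x j \<in> \<int>" if "j < M" for j
    using v[rule_format, of j] that by (simp flip: frac_eq_iff_diff)
  thus "in_span N M t x" unfolding in_span_def by blast
qed

lemma rg_frac: "h \<in> rg N M t ==> (\<lambda>j. if j < M then frac (h j) else 0) = h"
  unfolding rg_mem by auto

lemma rg_in_span: "h \<in> rg N M t ==> in_span N M t h"
  using rg_frac[of h N M t] in_span_rg by metis

lemma card_rg_pos: assumes "\<And>i j. i < N ==> j < M ==> real_of_int q * t i j \<in> \<int>" "q > 0"
  shows "card (rg N M t) > 0"
proof -
  have "rg N M t \<noteq> {}" by (simp add: rg_def)
  thus ?thesis using rg_finite[OF assms] by (simp add: card_gt_0_iff)
qed

text \<open>A fibre of the homomorphism from (Z/q)^N that sends coefficients to the combination of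
  the rows modulo Z.\<close>

definition fiber :: "nat \<Rightarrow> nat \<Rightarrow> nat \<Rightarrow> (nat \<Rightarrow> nat \<Rightarrow> real) \<Rightarrow> (nat \<Rightarrow> real) \<Rightarrow> (nat \<Rightarrow> nat) set" where
  "fiber q N M t x = {v \<in> {..<N} \<rightarrow>\<^sub>E {..<q}. \<forall>j<M. (\<Sum>i<N. real (v i) * t i j) - x j \<in> \<int>}"

lemma finite_fiber: "finite (fiber q N M t x)"
  unfolding fiber_def by (rule finite_subset[of _ "{..<N} \<rightarrow>\<^sub>E {..<q}"]) (auto intro: finite_PiE)

text \<open>Adding a solution \<open>u\<close> for \<open>y - x\<close> and reducing modulo
  \<open>q\<close> injects one fibre into the other. As \<open>q t\<close> is integral, the
  reduction is invisible modulo Z.\<close>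

lemma card_fiber_le:
  assumes q: "q > 0" "\<And>i j. i < N ==> j < M ==> real q * t i j \<in> \<int>"
    and sp: "in_span N M t (\<lambda>j. y j - x j)"
  shows "card (fiber q N M t x) \<le> card (fiber q N M t y)"
proof -
  obtain u where u: "\<And>j. j < M ==> (\<Sum>i<N. real_of_int (u i) * t i j) - (y j - x j) \<in> \<int>" using sp by (auto simp: in_span_def)
  define f where "f = (\<lambda>v. restrict (\<lambda>i. nat ((int (v i) + u i) mod int q)) {..<N})"
  have fi: "int (f v i) = (int (v i) + u i) mod int q" if "i < N" for v i using that q by (simp add: f_def)
  have "inj_on f (fiber q N M t x)"
  proof (rule inj_onI)
    fix v w assume v: "v \<in> fiber q N M t x" and w: "w \<in> fiber q N M t x" and eq: "f v = f w"
    show "v = w"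
    proof (rule PiE_ext)
      show "v \<in> {..<N} \<rightarrow>\<^sub>E {..<q}" "w \<in> {..<N} \<rightarrow>\<^sub>E {..<q}" using v w by (auto simp: fiber_def)
      fix i assume "i \<in> {..<N}"
      hence i: "i < N" by simp
      have lt: "v i < q" "w i < q" using v w i by (auto simp: fiber_def)
      have "(int (v i) + u i) mod int q = (int (w i) + u i) mod int q" using fi[OF i] eq by metis
      hence "int q dvd (int (v i) + u i) - (int (w i) + u i)" by (simp only: mod_eq_dvd_iff)
      hence "int q dvd int (v i) - int (w i)" by simp
      hence "int (v i) mod int q = int (w i) mod int q" by (simp only: mod_eq_dvd_iff)
      thus "v i = w i" using lt by simp
    qed
  qed
  moreover have "f ` fiber q N M t x \<subseteq> fiber q N M t y"
  proof
    fix w assume "w \<in> f ` fiber q N M t x"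
    then obtain v where v: "v \<in> fiber q N M t x" "w = f v" by blast
    have "f v \<in> {..<N} \<rightarrow>\<^sub>E {..<q}" using q by (auto simp: f_def nat_less_iff)
    moreover have "(\<Sum>i<N. real (f v i) * t i j) - y j \<in> \<int>" if j: "j < M" for j
    proof -
      have "(\<Sum>i<N. real (f v i) * t i j) = (\<Sum>i<N. real (v i) * t i j) + (\<Sum>i<N. real_of_int (u i) * t i j)
          - (\<Sum>i<N. real_of_int ((int (v i) + u i) div int q) * (real q * t i j))"
      proof -
        have "real (f v i) * t i j = real (v i) * t i j + real_of_int (u i) * t i j - real_of_int ((int (v i) + u i) div int q) * (real q * t i j)"
          if i: "i < N" for i
        proof -
          have "int (v i) + u i = ((int (v i) + u i) div int q) * int q + int (f v i)" using fi[OF i] by simp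
          hence "real_of_int (int (v i) + u i) = real_of_int (((int (v i) + u i) div int q) * int q + int (f v i))" by simp
          hence fr: "real (f v i) = real (v i) + real_of_int (u i) - real_of_int ((int (v i) + u i) div int q) * real q" by simp
          show ?thesis unfolding fr by (simp add: algebra_simps)
        qed
        thus ?thesis by (simp add: sum.distrib sum_subtractf)
      qed
      moreover have D: "(\<Sum>i<N. real_of_int ((int (v i) + u i) div int q) * (real q * t i j)) \<in> \<int>"
        by (rule Ints_sum_mult) (use q j in auto)
      moreover have V: "(\<Sum>i<N. real (v i) * t i j) - x j \<in> \<int>" using v j by (simp add: fiber_def)
      ultimately have e: "(\<Sum>i<N. real (f v i) * t i j) - y j
          = ((\<Sum>i<N. real (v i) * t i j) - x j) + ((\<Sum>i<N. real_of_int (u i) * t i j) - (y j - x j))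
            - (\<Sum>i<N. real_of_int ((int (v i) + u i) div int q) * (real q * t i j))" by simp
      show ?thesis unfolding e by (intro Ints_add Ints_diff D V u[OF j])
    qed
    ultimately show "w \<in> fiber q N M t y" using v(2) by (simp add: fiber_def)
  qed
  ultimately show ?thesis using finite_fiber by (rule card_inj_on_le)
qed

text \<open>All nonempty fibres of a homomorphism have the same size, and together they exhaust the
  \<open>q^N\<close> coefficient vectors.\<close>

lemma card_fiber:
  assumes q: "q > 0" "\<And>i j. i < N ==> j < M ==> real q * t i j \<in> \<int>"
  shows "real (card (fiber q N M t x)) = (if in_span N M t x then real q ^ N / real (card (rg N M t)) else 0)"
proof (cases "in_span N M t x")
  case False
  have "fiber q N M t x = {}"
  proof (rule ccontr)
    assume "fiber q N M t x \<noteq> {}"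
    then obtain v where "\<forall>j<M. (\<Sum>i<N. real (v i) * t i j) - x j \<in> \<int>" by (auto simp: fiber_def)
    hence "in_span N M t x" unfolding in_span_def by (intro exI[of _ "\<lambda>i. int (v i)"]) simp
    thus False using False by blast
  qed
  thus ?thesis using False by simp
next
  case True
  let ?H = "rg N M t"
  have qi: "\<And>i j. i < N ==> j < M ==> real_of_int (int q) * t i j \<in> \<int>" using q by simp
  have finH: "finite ?H" using rg_finite[OF qi] q by simp
  have posH: "card ?H > 0" using card_rg_pos[OF qi] q by simp
  have same: "card (fiber q N M t h) = card (fiber q N M t x)" if "h \<in> ?H" for h
  proof (rule antisym; rule card_fiber_le[OF q])
    have h: "in_span N M t h" by (rule rg_in_span[OF that])
    show "in_span N M t (\<lambda>j. x j - h j)" using in_span_add[OF True in_span_scale[OF h, of "-1"]] by simp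
    show "in_span N M t (\<lambda>j. h j - x j)" using in_span_add[OF h in_span_scale[OF True, of "-1"]] by simp
  qed auto
  have un: "{..<N} \<rightarrow>\<^sub>E {..<q} = (\<Union>h\<in>?H. fiber q N M t h)"
  proof (intro equalityI subsetI)
    fix v assume v: "v \<in> {..<N} \<rightarrow>\<^sub>E {..<q}"
    let ?h = "\<lambda>j. if j < M then frac (\<Sum>i<N. real_of_int (int (v i)) * t i j) else 0"
    have "?h \<in> ?H" by (rule rgI) (rule refl)
    moreover have "v \<in> fiber q N M t ?h" using v by (simp add: fiber_def frac_def)
    ultimately show "v \<in> (\<Union>h\<in>?H. fiber q N M t h)" by blast
  qed (auto simp: fiber_def)
  have disj: "fiber q N M t h \<inter> fiber q N M t h' = {}" if hh: "h \<in> ?H" "h' \<in> ?H" "h \<noteq> h'" for h h'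
  proof (rule ccontr)
    assume "fiber q N M t h \<inter> fiber q N M t h' \<noteq> {}"
    then obtain v where v: "\<forall>j<M. (\<Sum>i<N. real (v i) * t i j) - h j \<in> \<int>" "\<forall>j<M. (\<Sum>i<N. real (v i) * t i j) - h' j \<in> \<int>"
      by (auto simp: fiber_def)
    have "h j = h' j" for j
    proof (cases "j < M")
      case True
      have "h j - h' j \<in> \<int>" using Ints_diff[OF v(2)[rule_format, OF True] v(1)[rule_format, OF True]] by simp
      hence "frac (h j) = frac (h' j)" by (simp add: frac_eq_iff_diff)
      thus ?thesis using fun_cong[OF rg_frac[OF hh(1)], of j] fun_cong[OF rg_frac[OF hh(2)], of j] True by simp
    next
      case False
      thus ?thesis using fun_cong[OF rg_frac[OF hh(1)], of j] fun_cong[OF rg_frac[OF hh(2)], of j] by simp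
    qed
    thus False using hh(3) by blast
  qed
  have "q ^ N = card ({..<N} \<rightarrow>\<^sub>E {..<q})" by (simp add: card_PiE)
  also have "\<dots> = (\<Sum>h\<in>?H. card (fiber q N M t h))"
    unfolding un by (rule card_UN_disjoint) (use finH finite_fiber disj in auto)
  also have "\<dots> = card ?H * card (fiber q N M t x)" using same by simp
  finally have "real q ^ N = real (card ?H) * real (card (fiber q N M t x))" by (metis of_nat_mult of_nat_power)
  thus ?thesis using True posH by (simp add: field_simps)
qed

text \<open>The index of the old row group in the new one is the order of the new row in the
  quotient. This order divides \<open>p^K\<close>, hence is \<open>p^r\<close> for the least
  \<open>r\<close> that brings the row into the old span.\<close>

lemma card_rg_Suc:
  assumes p: "prime p" and q: "\<And>i j. i < Suc N ==> j < M ==> real (p ^ K) * t i j \<in> \<int>"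
  shows "\<exists>r. (\<forall>n. in_span N M t (\<lambda>j. real (p ^ n) * t N j) \<longleftrightarrow> r \<le> n) \<and>
     card (rg (Suc N) M t) = p ^ r * card (rg N M t)"
proof -
  let ?S = "\<lambda>c::int. in_span N M t (\<lambda>j. real_of_int c * t N j)"
  have p0: "p > 0" using p prime_gt_0_nat by blast
  have SK: "?S (int (p ^ K))" by (rule in_span_zero) (use q[of N] in simp)
  define r where "r = (LEAST n. ?S (int (p ^ n)))"
  have r: "?S (int (p ^ r))" unfolding r_def by (rule LeastI[of "\<lambda>n. ?S (int (p ^ n))", OF SK])
  have Sadd: "?S (a + b)" if "?S a" "?S b" for a b using in_span_add[OF that] by (simp add: distrib_right)
  have Smul: "?S (b * a)" if "?S a" for a b using in_span_scale[OF that, of b] by (simp add: mult.assoc)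
  have Sr: "?S (int (p ^ n)) \<longleftrightarrow> r \<le> n" for n
  proof
    assume "r \<le> n"
    hence "int (p ^ n) = int (p ^ (n - r)) * int (p ^ r)" by (simp flip: power_add)
    thus "?S (int (p ^ n))" using Smul[OF r] by metis
  next
    assume "?S (int (p ^ n))" thus "r \<le> n" unfolding r_def by (rule Least_le)
  qed
  \<comment> \<open>The multipliers \<open>c\<close> with \<open>?S c\<close> form an ideal that
    contains \<open>p^r\<close>. By Bezout it contains the gcd of \<open>c\<close> and
    \<open>p^r\<close>, which is a power of \<open>p\<close>, and minimality of \<open>r\<close>
    makes it \<open>p^r\<close>.\<close>
  have Sdvd: "int (p ^ r) dvd c" if "?S c" for c
  proof -
    obtain a b where ab: "a * c + b * int (p ^ r) = gcd c (int (p ^ r))" using bezout_int by blast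
    have "?S (gcd c (int (p ^ r)))" using Sadd[OF Smul[OF that] Smul[OF r]] ab by metis
    moreover obtain i where i: "i \<le> r" "gcd c (int (p ^ r)) = int (p ^ i)"
    proof -
      have "nat (gcd c (int (p ^ r))) dvd p ^ r" by (metis gcd_dvd2 gcd_ge_0_int int_nat_eq of_nat_dvd_iff)
      then obtain i where "i \<le> r" "nat (gcd c (int (p ^ r))) = p ^ i" using divides_primepow_nat[OF p] by blast
      thus ?thesis using that by (metis gcd_ge_0_int int_nat_eq)
    qed
    ultimately have "i = r" using Sr by (metis le_antisym)
    thus ?thesis using i(2) by (metis gcd_dvd1)
  qed
  let ?H = "rg N M t"
  let ?f = "\<lambda>(h, c) j. if j < M then frac (h j + real c * t N j) else 0"
  have qi: "\<And>i j. i < N ==> j < M ==> real_of_int (int (p ^ K)) * t i j \<in> \<int>" using q by simp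
  have finH: "finite ?H" using rg_finite[OF qi] p0 by simp
  have "rg (Suc N) M t = ?f ` (?H \<times> {..<p ^ r})"
  proof (intro equalityI subsetI)
    fix w assume "w \<in> rg (Suc N) M t"
    then obtain v where v: "\<forall>j. w j = (if j < M then frac (\<Sum>i<Suc N. real_of_int (v i) * t i j) else 0)" by (auto simp: rg_mem)
    define c where "c = nat (v N mod int (p ^ r))"
    define d where "d = v N div int (p ^ r)"
    have "int c = v N mod int (p ^ r)" using p0 by (simp add: c_def)
    hence vN: "v N = d * int (p ^ r) + int c" by (simp only: d_def div_mult_mod_eq)
    have c: "c < p ^ r" using p0 by (simp add: c_def nat_less_iff)
    let ?x = "\<lambda>j. (\<Sum>i<N. real_of_int (v i) * t i j) + real_of_int (d * int (p ^ r)) * t N j"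
    have "in_span N M t (\<lambda>j. \<Sum>i<N. real_of_int (v i) * t i j)" unfolding in_span_def by (rule exI[of _ v]) simp
    from in_span_add[OF this Smul[OF r, of d]] have "in_span N M t ?x" .
    hence h: "(\<lambda>j. if j < M then frac (?x j) else 0) \<in> ?H" by (simp only: in_span_rg)
    have "w = ?f (\<lambda>j. if j < M then frac (?x j) else 0, c)"
    proof
      fix j show "w j = ?f (\<lambda>j. if j < M then frac (?x j) else 0, c) j"
      proof (cases "j < M")
        case True
        have "w j = frac (?x j + real c * t N j)" using v True by (simp add: vN distrib_right add.assoc)
        also have "\<dots> = frac (frac (?x j) + real c * t N j)"
          unfolding frac_eq_iff_diff by (simp add: frac_def)
        finally show ?thesis using True by simp
      qed (use v in simp)
    qed
    thus "w \<in> ?f ` (?H \<times> {..<p ^ r})" using h c by (intro image_eqI) auto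
  next
    fix w assume "w \<in> ?f ` (?H \<times> {..<p ^ r})"
    then obtain h c where hc: "h \<in> ?H" "w = ?f (h, c)" by blast
    obtain v where v: "\<forall>j. h j = (if j < M then frac (\<Sum>i<N. real_of_int (v i) * t i j) else 0)" using hc(1) by (auto simp: rg_mem)
    show "w \<in> rg (Suc N) M t"
    proof (rule rgI[where v = "v(N := int c)"])
      fix j
      have "(\<Sum>i<Suc N. real_of_int ((v(N := int c)) i) * t i j) = (\<Sum>i<N. real_of_int (v i) * t i j) + real c * t N j"
        by simp
      thus "w j = (if j < M then frac (\<Sum>i<Suc N. real_of_int ((v(N := int c)) i) * t i j) else 0)"
        using hc(2) v by (auto simp: frac_eq_iff_diff)
    qed
  qed
  moreover have "inj_on ?f (?H \<times> {..<p ^ r})"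
  proof (rule inj_onI)
    fix a b assume ab: "a \<in> ?H \<times> {..<p ^ r}" "b \<in> ?H \<times> {..<p ^ r}" "?f a = ?f b"
    obtain h c where a: "a = (h, c)" by (cases a)
    obtain h' c' where b: "b = (h', c')" by (cases b)
    have H: "h \<in> ?H" "h' \<in> ?H" "c < p ^ r" "c' < p ^ r" using ab a b by auto
    have e: "(h j + real c * t N j) - (h' j + real c' * t N j) \<in> \<int>" if "j < M" for j
      using fun_cong[OF ab(3), of j] that by (simp add: a b frac_eq_iff_diff)
    have "in_span N M t (\<lambda>j. h' j + real_of_int (-1) * h j)"
      by (intro in_span_add in_span_scale rg_in_span H)
    hence "?S (int c - int c')"
    proof (rule in_span_cong)
      fix j assume "j < M"
      from Ints_minus[OF e[OF this]]
      show "h' j + real_of_int (- 1) * h j - real_of_int (int c - int c') * t N j \<in> \<int>" by (simp add: algebra_simps)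
    qed
    hence "int (p ^ r) dvd int c - int c'" by (rule Sdvd)
    hence "int c mod int (p ^ r) = int c' mod int (p ^ r)" by (simp only: mod_eq_dvd_iff)
    hence cc: "c = c'" using H by (simp flip: of_nat_mod of_nat_power)
    have "h j = h' j" for j
      using fun_cong[OF rg_frac[OF H(1)], of j] fun_cong[OF rg_frac[OF H(2)], of j] e[of j] cc
      by (cases "j < M") (simp_all flip: frac_eq_iff_diff)
    thus "a = b" using a b cc by auto
  qed
  ultimately have "card (rg (Suc N) M t) = card (?H \<times> {..<p ^ r})" by (simp add: card_image)
  hence "card (rg (Suc N) M t) = p ^ r * card ?H" by (simp add: card_cartesian_product)
  thus ?thesis using Sr by (intro exI[of _ r]) simp
qed

section \<open>Construction of the measures on infinite matrices\<close>

lemma prod_if_all: "(\<Prod>m<M. if C m then u m else (0::'a::{comm_semiring_1})) = (if \<forall>m<(M::nat). C m then \<Prod>m<M. u m else 0)"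
  by (induction M) (auto simp: less_Suc_eq)

context padic
begin

lemma PZ_neg_iff: "x \<in> PZ (- int K) \<longleftrightarrow> real (p ^ K) * x \<in> \<int>"
proof
  assume "x \<in> PZ (- int K)"
  hence "real p powi int K * x \<in> PZ (int K + - int K)" by (intro PZ_mult powi_PZ)
  thus "real (p ^ K) * x \<in> \<int>" by (simp add: PZ_zero_eq)
next
  assume "real (p ^ K) * x \<in> \<int>"
  hence "real p powi (- int K) * (real (p ^ K) * x) \<in> PZ (- int K + 0)"
    by (intro PZ_mult powi_PZ) (simp add: PZ_zero_eq)
  thus "x \<in> PZ (- int K)" using p_gt1 by (simp add: power_int_minus mult.assoc[symmetric])
qed

lemma common_denominator:
  fixes N M :: nat
  assumes "\<And>i m. i < N ==> m < M ==> x i m \<in> Qp p"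
  shows "\<exists>K. \<forall>i<N. \<forall>m<M. T (x i m) 0 \<in> PZ (- int K)"
proof -
  have "\<forall>i m. \<exists>k::nat. i < N \<longrightarrow> m < M \<longrightarrow> T (x i m) 0 \<in> PZ (- int k)"
  proof (intro allI)
    fix i m
    show "\<exists>k::nat. i < N \<longrightarrow> m < M \<longrightarrow> T (x i m) 0 \<in> PZ (- int k)"
    proof (cases "i < N \<and> m < M")
      case True
      then obtain l where "T (x i m) 0 \<in> PZ l" using T_bounded assms by blast
      hence "T (x i m) 0 \<in> PZ (- int (nat (- l)))" using PZ_monoD by simp
      thus ?thesis by blast
    qed auto
  qed
  then obtain k where k: "\<And>i m. i < N ==> m < M ==> T (x i m) 0 \<in> PZ (- int (k i m))" by metis
  define K where "K = Max (insert 0 ((\<lambda>(i, m). k i m) ` ({..<N} \<times> {..<M})))"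
  have "k i m \<le> K" if "i < N" "m < M" for i m
    unfolding K_def by (rule Max_ge) (use that in auto)
  thus ?thesis using k PZ_monoD by (intro exI[of _ K] allI impI) (metis neg_le_iff_le of_nat_le_iff)
qed

text \<open>The \<open>x i\<close> have denominators at most \<open>p^K\<close>, so changing a
  coefficient by a multiple of \<open>p^K\<close> changes the combination by an integral element
  only.\<close>

lemma T_lincomb:
  assumes a: "\<And>i. i < N ==> a i \<in> Zp p" and x: "\<And>i. i < N ==> x i \<in> Qp p"
    and K: "\<And>i. i < N ==> T (x i) 0 \<in> PZ (- int K)"
  shows "T (qp_sum p (\<lambda>i. qp_mult p (a i) (x i)) N) 0 - (\<Sum>i<N. real (rs K (a i)) * T (x i) 0) \<in> \<int>"
proof -
  let ?c = "qp_sum p (\<lambda>i. qp_mult p (a i) (x i)) N"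
  have "plim (\<lambda>L. \<Sum>i<N. tr p (a i) L * tr p (x i) L) ?c"
    by (intro plim_sum plim_mult plim_tr x Zp_Qp a)
  hence "\<forall>\<^sub>F L in sequentially. (\<Sum>i<N. tr p (a i) L * tr p (x i) L) - T ?c 0 \<in> PZ 0" by (simp add: plim_def)
  then obtain L0 where L0: "\<forall>L\<ge>L0. (\<Sum>i<N. tr p (a i) L * tr p (x i) L) - T ?c 0 \<in> PZ 0"
    unfolding eventually_sequentially by (elim exE) (rule that)
  define L where "L = max K L0"
  have L: "L \<ge> K" "(\<Sum>i<N. tr p (a i) L * tr p (x i) L) - T ?c 0 \<in> PZ 0"
    using L0[rule_format, of L] by (simp_all add: L_def)
  have "(\<Sum>i<N. tr p (a i) L * tr p (x i) L - real (rs K (a i)) * T (x i) 0) \<in> PZ 0"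
  proof (rule PZ_sum)
    fix i assume "i \<in> {..<N}"
    hence i: "i < N" by simp
    have "tr p (x i) L - T (x i) 0 \<in> PZ 0" using T_diff[OF x[OF i]] by (simp add: tr_eq_T)
    hence 1: "tr p (a i) L * (tr p (x i) L - T (x i) 0) \<in> PZ 0"
      using T_Zp[OF a[OF i]] by (intro PZ_int_mult) (simp_all add: tr_eq_T)
    have "tr p (a i) L - real (rs K (a i)) \<in> PZ (int K)"
      using T_diff[OF Zp_Qp[OF a[OF i]], of "int K" "int L"] L(1) T_rs[OF a[OF i], of K] by (simp add: tr_eq_T)
    hence 2: "(tr p (a i) L - real (rs K (a i))) * T (x i) 0 \<in> PZ 0" using PZ_mult[OF _ K[OF i]] by fastforce
    show "tr p (a i) L * tr p (x i) L - real (rs K (a i)) * T (x i) 0 \<in> PZ 0"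
      using PZ_add[OF 1 2] by (simp add: algebra_simps)
  qed
  hence "(\<Sum>i<N. tr p (a i) L * tr p (x i) L) - (\<Sum>i<N. real (rs K (a i)) * T (x i) 0) \<in> PZ 0"
    by (simp add: sum_subtractf)
  thus ?thesis using PZ_trans[OF PZ_diff_commute[OF L(2)]] by (simp add: PZ_zero_eq)
qed

lemma shift_measurable:
  assumes "J \<in> measurable M (count_space UNIV)" "X \<in> measurable M (qp_space p)"
  shows "(\<lambda>w i. X w (i + int (J w))) \<in> measurable M (qp_space p)"
proof -
  have "(\<lambda>w i. X w (i + int j)) \<in> measurable M (qp_space p)" for j
  proof (rule measurable_qpI)
    show "(\<lambda>i. X w (i + int j)) \<in> Qp p" if "w \<in> space M" for w
      using shift_Qp[OF measurable_Qp[OF assms(2) that]] .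
    fix i c
    have "(\<lambda>w. X w (i + int j)) \<in> measurable M (count_space UNIV)"
      by (rule measurable_compose[OF assms(2) digit_measurable])
    from measurable_sets[OF this, of "{c}"] show "{w \<in> space M. X w (i + int j) = c} \<in> sets M"
      by (simp add: vimage_def Int_def conj_commute)
  qed
  from measurable_compose_countable[OF this assms(1)] show ?thesis .
qed

end

section \<open>A random matrix built row by row\<close>

locale hua = padic +
  fixes s :: real
  assumes s_gt: "s > -1"
begin

text \<open>The ratio of the geometric exponent in row \<open>n\<close>. On \<open>M\<close> columns
  the effective ratio is \<open>theta n / p^M = p^(-(s+n+1+M))\<close>, whose exponent is that of
  the density once row \<open>n\<close> has been added.\<close>

definition theta :: "nat \<Rightarrow> real" where "theta n = real p powr (- (s + real n + 1))"

lemma theta: "0 < theta n" "theta n < 1"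
proof -
  show "0 < theta n" using p_gt1 by (simp add: theta_def)
  have "- (s + real n + 1) < 0" using s_gt by simp
  hence "real p powr (- (s + real n + 1)) < real p powr 0" using p_gt1 by (intro powr_less_mono) auto
  thus "theta n < 1" using p_gt1 by (simp add: theta_def)
qed

definition HP :: "(nat \<Rightarrow> qp) measure" where "HP = PiM UNIV (\<lambda>_. haarZp p)"

text \<open>The randomness of one row: the denominator exponent, the coefficients of the previous
  rows, and an integral noise.\<close>

definition Blk :: "nat \<Rightarrow> (nat \<times> (nat \<Rightarrow> qp) \<times> (nat \<Rightarrow> qp)) measure" where
  "Blk n = measure_pmf (geometric_pmf (1 - theta n)) \<Otimes>\<^sub>M (HP \<Otimes>\<^sub>M HP)"

text \<open>Row \<open>n\<close> of the random matrix is \<open>p\<^sup>-\<^sup>j(b + \<Sum>\<^sub>i a\<^sub>i z\<^sub>i)\<close> with \<open>z\<^sub>i\<close> the previous rows; multiplication by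
  \<open>p\<^sup>-\<^sup>j\<close> is a shift of digits.\<close>

definition rowf :: "nat \<Rightarrow> nat \<times> (nat \<Rightarrow> qp) \<times> (nat \<Rightarrow> qp) \<Rightarrow> (nat \<Rightarrow> nat \<Rightarrow> qp) \<Rightarrow> nat \<Rightarrow> qp" where
  "rowf n \<xi> prev m = (\<lambda>i. qp_add p (snd (snd \<xi>) m) (qp_sum p (\<lambda>l. qp_mult p (fst (snd \<xi>) l) (prev l m)) n) (i + int (fst \<xi>)))"

primrec rows :: "(nat \<Rightarrow> nat \<times> (nat \<Rightarrow> qp) \<times> (nat \<Rightarrow> qp)) \<Rightarrow> nat \<Rightarrow> nat \<Rightarrow> nat \<Rightarrow> qp" where
  "rows \<omega> 0 = (\<lambda>_ _. qp_zero)"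
| "rows \<omega> (Suc n) = (rows \<omega> n)(n := rowf n (\<omega> n) (rows \<omega> n))"

lemma rows_cong: "(\<And>i. i < n ==> \<omega> i = \<omega>' i) ==> rows \<omega> n = rows \<omega>' n"
  by (induction n) auto

lemma rows_stable: "i < n ==> rows \<omega> n i = rows \<omega> (Suc i) i"
proof (induction n)
  case (Suc n) thus ?case by (cases "i = n") auto
qed simp

lemma prob_space_HP: "prob_space HP"
  unfolding HP_def by (rule prob_space_PiM) (rule prob_space_haarZp)

lemma prob_space_Blk: "prob_space (Blk n)"
proof -
  interpret H: prob_space HP by (rule prob_space_HP)
  interpret HH: pair_prob_space HP HP by unfold_locales
  interpret G: pair_prob_space "measure_pmf (geometric_pmf (1 - theta n))" "HP \<Otimes>\<^sub>M HP" by unfold_locales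
  show ?thesis unfolding Blk_def by unfold_locales
qed

lemma HP_component: "(\<lambda>a. a i) \<in> measurable HP (qp_space p)"
proof -
  have "(\<lambda>a. a i) \<in> measurable HP (haarZp p)" unfolding HP_def by (rule measurable_component_singleton) simp
  thus ?thesis by (simp add: measurable_def space_qp)
qed

lemma Blk_components:
  "fst \<in> measurable (Blk n) (count_space UNIV)"
  "(\<lambda>\<xi>. fst (snd \<xi>) i) \<in> measurable (Blk n) (qp_space p)"
  "(\<lambda>\<xi>. snd (snd \<xi>) i) \<in> measurable (Blk n) (qp_space p)"
proof -
  have "fst \<in> measurable (Blk n) (measure_pmf (geometric_pmf (1 - theta n)))" unfolding Blk_def by measurable
  thus "fst \<in> measurable (Blk n) (count_space UNIV)" by simp
  have "(\<lambda>\<xi>. fst (snd \<xi>)) \<in> measurable (Blk n) HP" "(\<lambda>\<xi>. snd (snd \<xi>)) \<in> measurable (Blk n) HP"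
    unfolding Blk_def by measurable
  from this[THEN measurable_compose, OF HP_component[of i]]
  show "(\<lambda>\<xi>. fst (snd \<xi>) i) \<in> measurable (Blk n) (qp_space p)"
    "(\<lambda>\<xi>. snd (snd \<xi>) i) \<in> measurable (Blk n) (qp_space p)" .
qed

lemma rowf_measurable:
  assumes \<xi>: "\<xi> \<in> measurable M (Blk n)" and prev: "\<And>l. l < n ==> (\<lambda>w. prev w l m) \<in> measurable M (qp_space p)"
  shows "(\<lambda>w. rowf n (\<xi> w) (prev w) m) \<in> measurable M (qp_space p)"
  unfolding rowf_def
proof (rule shift_measurable)
  show "(\<lambda>w. fst (\<xi> w)) \<in> measurable M (count_space UNIV)" by (rule measurable_compose[OF \<xi> Blk_components(1)])
  show "(\<lambda>w. qp_add p (snd (snd (\<xi> w)) m) (qp_sum p (\<lambda>l. qp_mult p (fst (snd (\<xi> w)) l) (prev w l m)) n)) \<in> measurable M (qp_space p)"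
  proof (intro qp_add_measurable qp_sum_measurable qp_mult_measurable)
    show "(\<lambda>w. snd (snd (\<xi> w)) m) \<in> measurable M (qp_space p)" by (rule measurable_compose[OF \<xi> Blk_components(3)])
    show "(\<lambda>w. fst (snd (\<xi> w)) l) \<in> measurable M (qp_space p)" for l by (rule measurable_compose[OF \<xi> Blk_components(2)])
  qed (rule prev)
qed

lemma rows_measurable: assumes "{..<n} \<subseteq> I" shows "(\<lambda>\<omega>. rows \<omega> n i m) \<in> measurable (PiM I Blk) (qp_space p)"
  using assms
proof (induction n arbitrary: i)
  case 0 thus ?case by (simp add: qp_const_measurable qp_zero_Qp)
next
  case (Suc n)
  have "{..<n} \<subseteq> I" "n \<in> I" using Suc.prems by auto
  thus ?case
    using Suc.IH rowf_measurable[of "\<lambda>\<omega>. \<omega> n" "PiM I Blk" n rows m for rows] measurable_component_singleton[of n I Blk]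
    by (cases "i = n") (auto intro!: rowf_measurable)
qed

lemma space_HP: "a \<in> space HP ==> a i \<in> Qp p"
  by (rule measurable_Qp[OF HP_component])

text \<open>With the exponent and the coefficients fixed, only the noise is random. A ball is hit
  with its Haar probability if its centre has the right residue modulo Z_p and never otherwise; the
  shift by \<open>j\<close> digits raises the precision from \<open>e\<close> to
  \<open>e + j\<close>.\<close>

lemma row_law_b:
  assumes prev: "\<And>i m. i < N ==> m < M ==> prev i m \<in> Qp p" and y: "\<And>m. m < M ==> y m \<in> Qp p"
    and K: "\<And>i m. i < N ==> m < M ==> T (prev i m) 0 \<in> PZ (- int K)"
    and a: "\<And>i. a i \<in> Zp p"
  shows "emeasure HP {b \<in> space HP. \<forall>m<M. rowf N (j, a, b) prev m \<in> cyl (y m) (int (e m))}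
    = ennreal (1 / real p ^ (\<Sum>m<M. e m + j)) *
      indicator {a. \<forall>m<M. (\<Sum>i<N. real (rs K (a i)) * T (prev i m) 0) - real (p ^ j) * T (y m) 0 \<in> \<int>} a"
proof -
  interpret product_prob_space "\<lambda>_. haarZp p" "UNIV :: nat set" by (rule product_prob_haarZp)
  define c where "c = (\<lambda>m. qp_sum p (\<lambda>l. qp_mult p (a l) (prev l m)) N)"
  define y' where "y' = (\<lambda>m i. y m (i - int j))"
  have c: "c m \<in> Qp p" if "m < M" for m
    unfolding c_def by (rule qp_sum_Qp, rule qp_mult_Qp) (use that prev a Zp_Qp in auto)
  have y': "y' m \<in> Qp p" if "m < M" for m using shift_Qp[OF y[OF that], of "- int j"] by (simp add: y'_def)
  have Ty': "T (y' m) 0 - real (p ^ j) * T (y m) 0 \<in> \<int>" if "m < M" for m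
  proof -
    have "T (y' m) 0 * real p powi (- int j) = T (y m) (- int j)"
      using T_shift[of "y m" "- int j" 0] by (simp add: y'_def)
    hence "T (y' m) 0 = real p powi int j * T (y m) (- int j)"
      using p_gt1 by (simp add: power_int_minus field_simps)
    moreover have "real p powi int j * (T (y m) (- int j) - T (y m) 0) \<in> PZ (int j + - int j)"
      by (intro PZ_mult powi_PZ) (rule PZ_diff_commute, rule T_diff[OF y[OF that]], simp)
    ultimately show ?thesis by (simp add: PZ_zero_eq right_diff_distrib)
  qed
  have cond: "T (c m) 0 - T (y' m) 0 \<in> \<int> \<longleftrightarrow> (\<Sum>i<N. real (rs K (a i)) * T (prev i m) 0) - real (p ^ j) * T (y m) 0 \<in> \<int>" if m: "m < M" for m
  proof -
    have 1: "T (c m) 0 - (\<Sum>i<N. real (rs K (a i)) * T (prev i m) 0) \<in> \<int>"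
      unfolding c_def by (rule T_lincomb) (use a prev K m in auto)
    show ?thesis using 1 Ty'[OF m] unfolding frac_eq_iff_diff[symmetric] by simp
  qed
  have ev: "rowf N (j, a, b) prev m \<in> cyl (y m) (int (e m)) \<longleftrightarrow> b m \<in> {b \<in> Qp p. qp_add p b (c m) \<in> cyl (y' m) (int (e m + j))}"
    if b: "b \<in> space HP" and m: "m < M" for b m
  proof -
    let ?x = "qp_add p (b m) (c m)"
    have bm: "b m \<in> Qp p" using space_HP b by blast
    have x: "?x \<in> Qp p" by (rule qp_add_Qp[OF bm c[OF m]])
    have "rowf N (j, a, b) prev m = (\<lambda>i. ?x (i + int j))" by (simp add: rowf_def c_def)
    moreover have "(\<forall>i<int (e m). ?x (i + int j) = y m i) \<longleftrightarrow> (\<forall>i<int (e m + j). ?x i = y m (i - int j))"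
    proof
      assume h: "\<forall>i<int (e m). ?x (i + int j) = y m i"
      show "\<forall>i<int (e m + j). ?x i = y m (i - int j)" using h[rule_format, of "i - int j" for i] by auto
    next
      assume h: "\<forall>i<int (e m + j). ?x i = y m (i - int j)"
      show "\<forall>i<int (e m). ?x (i + int j) = y m i" using h[rule_format, of "i + int j" for i] by auto
    qed
    ultimately show ?thesis using x bm shift_Qp[OF x, of "int j"] by (simp add: cyl_def y'_def)
  qed
  have meas: "{b \<in> Qp p. qp_add p b (c m) \<in> cyl (y' m) (int (e m + j))} \<in> sets (haarZp p)" if "m < M" for m
  proof -
    have "(\<lambda>b. qp_add p b (c m)) \<in> measurable (qp_space p) (qp_space p)"
      by (intro qp_add_measurable measurable_ident_sets[OF refl] qp_const_measurable c that)
    from measurable_sets[OF this cyl_sets[of "y' m" "int (e m + j)"]] show ?thesis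
      by (simp add: space_qp vimage_def Int_def conj_commute)
  qed
  have E: "{b \<in> space HP. \<forall>m<M. rowf N (j, a, b) prev m \<in> cyl (y m) (int (e m))}
    = {b \<in> space HP. \<forall>m\<in>{..<M}. b m \<in> {b \<in> Qp p. qp_add p b (c m) \<in> cyl (y' m) (int (e m + j))}}"
    using ev by blast
  have "emeasure HP {b \<in> space HP. \<forall>m\<in>{..<M}. b m \<in> {b \<in> Qp p. qp_add p b (c m) \<in> cyl (y' m) (int (e m + j))}} = (\<Prod>m<M. emeasure (haarZp p) {b \<in> Qp p. qp_add p b (c m) \<in> cyl (y' m) (int (e m + j))})"
    unfolding HP_def by (rule emeasure_PiM_Collect) (use meas in auto)
  also have "\<dots> = (\<Prod>m<M. if (\<Sum>i<N. real (rs K (a i)) * T (prev i m) 0) - real (p ^ j) * T (y m) 0 \<in> \<int> then ennreal (1 / real p ^ (e m + j)) else 0)"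
  proof (rule prod.cong[OF refl])
    fix m assume "m \<in> {..<M}"
    hence m: "m < M" by simp
    show "emeasure (haarZp p) {b \<in> Qp p. qp_add p b (c m) \<in> cyl (y' m) (int (e m + j))}
      = (if (\<Sum>i<N. real (rs K (a i)) * T (prev i m) 0) - real (p ^ j) * T (y m) 0 \<in> \<int> then ennreal (1 / real p ^ (e m + j)) else 0)"
      unfolding haar_affine[OF c[OF m] y'[OF m]] cond[OF m] by (rule refl)
  qed
  also have "\<dots> = (if \<forall>m<M. (\<Sum>i<N. real (rs K (a i)) * T (prev i m) 0) - real (p ^ j) * T (y m) 0 \<in> \<int> then \<Prod>m<M. ennreal (1 / real p ^ (e m + j)) else 0)"
    by (rule prod_if_all)
  also have "(\<Prod>m<M. ennreal (1 / real p ^ (e m + j))) = ennreal (1 / real p ^ (\<Sum>m<M. e m + j))"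
    by (simp add: prod_ennreal power_sum prod_dividef)
  finally show ?thesis unfolding E by simp
qed

lemma row_law_a:
  fixes e :: "nat \<Rightarrow> nat"
  assumes prev: "\<And>i m. i < N ==> m < M ==> prev i m \<in> Qp p" and y: "\<And>m. m < M ==> y m \<in> Qp p"
  defines "t \<equiv> \<lambda>i m. T (prev i m) 0"
  shows "emeasure (HP \<Otimes>\<^sub>M HP) {ab \<in> space (HP \<Otimes>\<^sub>M HP). \<forall>m<M. rowf N (j, ab) prev m \<in> cyl (y m) (int (e m))}
    = ennreal (if in_span N M t (\<lambda>m. real (p ^ j) * T (y m) 0) then 1 / real p ^ (\<Sum>m<M. e m + j) / real (card (rg N M t)) else 0)"
proof -
  interpret H: prob_space HP by (rule prob_space_HP)
  obtain K where K: "\<And>i m. i < N ==> m < M ==> T (prev i m) 0 \<in> PZ (- int K)"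
    using common_denominator[of N M prev] prev by blast
  let ?X = "{ab \<in> space (HP \<Otimes>\<^sub>M HP). \<forall>m<M. rowf N (j, ab) prev m \<in> cyl (y m) (int (e m))}"
  let ?Q = "\<lambda>v. \<forall>m<M. (\<Sum>i<N. real (v i) * t i m) - real (p ^ j) * T (y m) 0 \<in> \<int>"
  let ?A = "{a \<in> space HP. ?Q (\<lambda>i. rs K (a i))}"
  have pairm: "(\<lambda>ab. (j, ab)) \<in> measurable (HP \<Otimes>\<^sub>M HP) (Blk N)" unfolding Blk_def by measurable
  have X: "?X \<in> sets (HP \<Otimes>\<^sub>M HP)"
  proof -
    have "{ab \<in> space (HP \<Otimes>\<^sub>M HP). rowf N (j, ab) prev m \<in> cyl (y m) (int (e m))} \<in> sets (HP \<Otimes>\<^sub>M HP)" if "m < M" for m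
    proof -
      have "(\<lambda>ab. rowf N (j, ab) prev m) \<in> measurable (HP \<Otimes>\<^sub>M HP) (qp_space p)"
        by (rule rowf_measurable[OF pairm]) (use prev that qp_const_measurable in auto)
      from measurable_sets[OF this cyl_sets[of "y m" "int (e m)"]] show ?thesis
        by (simp add: vimage_def Int_def conj_commute)
    qed
    hence "{ab \<in> space (HP \<Otimes>\<^sub>M HP). \<forall>m\<in>{..<M}. rowf N (j, ab) prev m \<in> cyl (y m) (int (e m))} \<in> sets (HP \<Otimes>\<^sub>M HP)"
      by (intro sets.sets_Collect_finite_All) simp_all
    thus ?thesis by (simp only: Ball_def lessThan_iff)
  qed
  have R: "(\<Sum>i<N. real (restrict g {..<N} i) * t i m) = (\<Sum>i<N. real (g i) * t i m)" for g :: "nat \<Rightarrow> nat" and m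
    by (rule sum.cong) auto
  have res: "{a \<in> space HP. ?Q (restrict (\<lambda>i. rs K (a i)) {..<N})} \<in> sets HP"
    "measure HP {a \<in> space HP. ?Q (restrict (\<lambda>i. rs K (a i)) {..<N})} = real (card {v \<in> {..<N} \<rightarrow>\<^sub>E {..<p ^ K}. ?Q v}) / real p ^ (K * card {..<N})"
    unfolding HP_def
    using residue_law[where Q = ?Q and J = "{..<N}" and I = "UNIV :: nat set" and K = K] by blast+
  have A: "?A \<in> sets HP" using res(1) unfolding R .
  have mA: "emeasure HP ?A = ennreal (if in_span N M t (\<lambda>m. real (p ^ j) * T (y m) 0) then 1 / real (card (rg N M t)) else 0)"
  proof -
    have "real (card {v \<in> {..<N} \<rightarrow>\<^sub>E {..<p ^ K}. ?Q v}) = (if in_span N M t (\<lambda>m. real (p ^ j) * T (y m) 0) then real (p ^ K) ^ N / real (card (rg N M t)) else 0)"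
    proof -
      have "real (card (fiber (p ^ K) N M t (\<lambda>m. real (p ^ j) * T (y m) 0))) = (if in_span N M t (\<lambda>m. real (p ^ j) * T (y m) 0) then real (p ^ K) ^ N / real (card (rg N M t)) else 0)"
        by (rule card_fiber) (use K p_gt1 PZ_neg_iff in \<open>auto simp: t_def\<close>)
      thus ?thesis by (simp only: fiber_def)
    qed
    with res(2) have "measure HP ?A = (if in_span N M t (\<lambda>m. real (p ^ j) * T (y m) 0) then real (p ^ K) ^ N / real (card (rg N M t)) else 0) / real p ^ (K * N)"
      unfolding R by simp
    thus ?thesis using p_gt1 unfolding H.emeasure_eq_measure by (simp add: power_mult)
  qed
  have "AE a in HP. \<forall>i\<in>UNIV. a i \<in> Zp p" unfolding HP_def by (rule AE_Zp) simp
  hence AE: "AE a in HP. emeasure HP (Pair a -` ?X) = ennreal (1 / real p ^ (\<Sum>m<M. e m + j)) * indicator ?A a"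
  proof (rule AE_mp, intro AE_I2 impI)
    fix a assume a: "a \<in> space HP" "\<forall>i\<in>UNIV. a i \<in> Zp p"
    have E: "Pair a -` ?X = {b \<in> space HP. \<forall>m<M. rowf N (j, a, b) prev m \<in> cyl (y m) (int (e m))}"
      using a by (auto simp: space_pair_measure)
    have "emeasure HP {b \<in> space HP. \<forall>m<M. rowf N (j, a, b) prev m \<in> cyl (y m) (int (e m))} = ennreal (1 / real p ^ (\<Sum>m<M. e m + j)) *
      indicator {a. \<forall>m<M. (\<Sum>i<N. real (rs K (a i)) * T (prev i m) 0) - real (p ^ j) * T (y m) 0 \<in> \<int>} a"
      by (rule row_law_b) (use prev y K a in auto)
    thus "emeasure HP (Pair a -` ?X) = ennreal (1 / real p ^ (\<Sum>m<M. e m + j)) * indicator ?A a"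
      unfolding E using a by (simp add: t_def indicator_def)
  qed
  have "emeasure (HP \<Otimes>\<^sub>M HP) ?X = (\<integral>\<^sup>+a. emeasure HP (Pair a -` ?X) \<partial>HP)" by (rule H.emeasure_pair_measure_alt[OF X])
  also have "\<dots> = (\<integral>\<^sup>+a. ennreal (1 / real p ^ (\<Sum>m<M. e m + j)) * indicator ?A a \<partial>HP)"
    by (rule nn_integral_cong_AE[OF AE])
  also have "\<dots> = ennreal (1 / real p ^ (\<Sum>m<M. e m + j)) * emeasure HP ?A" by (rule nn_integral_cmult_indicator[OF A])
  also have "\<dots> = ennreal (if in_span N M t (\<lambda>m. real (p ^ j) * T (y m) 0) then 1 / real p ^ (\<Sum>m<M. e m + j) / real (card (rg N M t)) else 0)"
    unfolding mA using p_gt1 by (simp add: ennreal_mult[symmetric])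
  finally show ?thesis .
qed

end

lemma geometric_tail_sums:
  fixes x C :: real
  assumes "0 \<le> x" "x < 1"
  shows "(\<lambda>j. if r \<le> j then C * x ^ j else 0) sums (C * x ^ r / (1 - x))"
proof -
  have "(\<lambda>j. C * x ^ r * x ^ j) sums (C * x ^ r * (1 / (1 - x)))"
    by (intro sums_mult geometric_sums) (use assms in auto)
  hence "(\<lambda>j. (if r \<le> j + r then C * x ^ (j + r) else 0)) sums (C * x ^ r / (1 - x))"
    by (simp add: power_add mult.commute mult.left_commute mult.assoc)
  thus ?thesis
    by (subst (asm) sums_iff_shift) simp
qed

section \<open>Haar measure on Q_p and the densities of the corner laws\<close>

context padic
begin

lemma qp_measure_eqI:
  assumes sM: "sets M = sets (qp_space p)" and sN: "sets N = sets (qp_space p)"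
    and eq: "\<And>z e. z \<in> Qp p ==> emeasure M (cyl z (int e)) = emeasure N (cyl z (int e))"
    and fin: "\<And>z e. z \<in> Qp p ==> emeasure M (cyl z (int e)) \<noteq> \<infinity>"
  shows "M = N"
proof (rule measure_eqI_generator_eq_countable)
  show "Int_stable cyls" by (rule Int_stableI) (rule cyls_Int)
  show "cyls \<subseteq> Pow (Qp p)" by (rule cyls_Pow)
  show "sets M = sigma_sets (Qp p) cyls" "sets N = sigma_sets (Qp p) cyls" using sM sN sets_qp_cyls by auto
  show "emeasure M X = emeasure N X" if "X \<in> cyls" for X using that eq by (auto simp: cyls_def)
  let ?S = "(\<lambda>z. cyl z (int 0)) ` reps"
  show "?S \<subseteq> cyls" using reps_Qp cyl_cyls by blast
  show "countable ?S" using countable_reps by simp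
  show "\<Union>?S = Qp p" using in_cyl_reps by (auto simp: cyl_def)
  show "emeasure M a \<noteq> \<infinity>" if "a \<in> ?S" for a using that fin reps_Qp by blast
qed

text \<open>The measure at level \<open>m\<close> is \<open>p\<close> times the restriction of the
  one at level \<open>m + 1\<close> to \<open>p^(-m) Z_p\<close>, and dropping the restriction gives
  the inequality. It makes the supremum in \<open>vol_Qp\<close> an increasing one.\<close>

lemma haar_step:
  assumes A: "A \<in> sets (qp_space p)"
  shows "emeasure (haar_shift p (int m)) A \<le> of_nat p * emeasure (haar_shift p (int (Suc m))) A"
proof -
  let ?h = "haar_shift p (int (Suc m))"
  let ?C = "cyl qp_zero (- int m)"
  define N where "N = density ?h (\<lambda>x. of_nat p * indicator ?C x)"
  have N: "emeasure N X = of_nat p * emeasure ?h (?C \<inter> X)" if "X \<in> sets (qp_space p)" for X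
  proof -
    have "emeasure N X = (\<integral>\<^sup>+x. of_nat p * indicator (?C \<inter> X) x \<partial>?h)"
      unfolding N_def using that by (subst emeasure_density) (auto intro!: nn_integral_cong simp: indicator_def)
    also have "\<dots> = of_nat p * emeasure ?h (?C \<inter> X)"
      by (rule nn_integral_cmult_indicator) (use that in auto)
    finally show ?thesis .
  qed
  have "haar_shift p (int m) = N"
  proof (rule qp_measure_eqI)
    fix z e assume z: "z \<in> Qp p"
    have "emeasure N (cyl z (int e)) = of_nat p * emeasure ?h (if \<forall>i. i < - int m \<longrightarrow> z i = 0 then cyl z (int e) else {})"
    proof -
      have "(\<forall>i. i < - int m \<longrightarrow> qp_zero i = z i) \<longleftrightarrow> (\<forall>i. i < - int m \<longrightarrow> z i = 0)"
        unfolding qp_zero_def by (intro all_cong1 imp_cong refl) (rule eq_commute)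
      thus ?thesis using N[OF cyl_sets] cyl_Int[of "- int m" "int e" qp_zero z] by simp
    qed
    also have "\<dots> = emeasure (haar_shift p (int m)) (cyl z (int e))"
    proof (cases "\<forall>i. i < - int m \<longrightarrow> z i = 0")
      case True
      have 1: "nat (int e + int (Suc m)) = Suc (e + m)" "nat (int e + int m) = e + m" by auto
      have "of_nat p * ennreal (1 / real p ^ Suc (e + m)) = ennreal (1 / real p ^ (e + m))"
        using p_gt1 by (simp add: ennreal_of_nat_eq_real_of_nat ennreal_mult[symmetric])
      thus ?thesis using True by (simp add: emeasure_haar_cyl[OF z] 1 del: power_Suc of_nat_Suc)
    next
      case False
      then obtain i where "i < - int m" "z i \<noteq> 0" by blast
      hence nc: "\<not> (\<forall>i. i < int e \<and> i < - int m \<longrightarrow> z i = 0)" by (intro notI) (auto dest: spec[of _ i])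
      show ?thesis unfolding if_not_P[OF False] emeasure_haar_cyl[OF z] if_not_P[OF nc] by simp
    qed
    finally show "emeasure (haar_shift p (int m)) (cyl z (int e)) = emeasure N (cyl z (int e))" by simp
    show "emeasure (haar_shift p (int m)) (cyl z (int e)) \<noteq> \<infinity>"
      unfolding emeasure_haar_cyl[OF z] by simp
  qed (simp_all add: N_def)
  hence "emeasure (haar_shift p (int m)) A = of_nat p * emeasure ?h (?C \<inter> A)" using N[OF A] by simp
  also have "\<dots> \<le> of_nat p * emeasure ?h A" by (intro mult_left_mono emeasure_mono) (use A in auto)
  finally show ?thesis .
qed

lemma vol_incseq: assumes "A \<in> sets (qp_space p)"
  shows "incseq (\<lambda>m. of_nat (p ^ m) * emeasure (haar_shift p (int m)) A)"
proof (rule incseq_SucI)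
  fix m
  have "of_nat (p ^ m) * emeasure (haar_shift p (int m)) A \<le> of_nat (p ^ m) * (of_nat p * emeasure (haar_shift p (int (Suc m))) A)"
    by (intro mult_left_mono haar_step assms) auto
  also have "\<dots> = of_nat (p ^ Suc m) * emeasure (haar_shift p (int (Suc m))) A"
    by (simp add: mult.assoc mult.commute mult.left_commute)
  finally show "of_nat (p ^ m) * emeasure (haar_shift p (int m)) A \<le> of_nat (p ^ Suc m) * emeasure (haar_shift p (int (Suc m))) A" .
qed

lemma sets_vol [simp, measurable_cong]: "sets (vol_Qp p) = sets (qp_space p)"
  unfolding vol_Qp_def by (rule sets.sets_measure_of_eq[of "qp_space p", unfolded space_qp])

lemma space_vol [simp]: "space (vol_Qp p) = Qp p"
  using sets_eq_imp_space_eq[OF sets_vol] by (simp add: space_qp)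

text \<open>The supremum of an increasing sequence of measures is a measure, because monotone
  suprema commute with countable sums.\<close>

lemma emeasure_vol: assumes "A \<in> sets (qp_space p)"
  shows "emeasure (vol_Qp p) A = (SUP m::nat. of_nat (p ^ m) * emeasure (haar_shift p (int m)) A)"
proof (rule emeasure_measure_of[OF vol_Qp_def])
  show "sets (qp_space p) \<subseteq> Pow (Qp p)" using sets.space_closed[of "qp_space p"] by (simp add: space_qp)
  show "positive (sets (vol_Qp p)) (\<lambda>A. SUP m::nat. of_nat (p ^ m) * emeasure (haar_shift p (int m)) A)"
    by (simp add: positive_def)
  show "countably_additive (sets (vol_Qp p)) (\<lambda>A. SUP m::nat. of_nat (p ^ m) * emeasure (haar_shift p (int m)) A)"
    unfolding countably_additive_def sets_vol
  proof (intro allI impI)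
    fix A :: "nat \<Rightarrow> qp set"
    assume A: "range A \<subseteq> sets (qp_space p)" "disjoint_family A" "(\<Union>i. A i) \<in> sets (qp_space p)"
    have "(\<Sum>i. SUP m::nat. of_nat (p ^ m) * emeasure (haar_shift p (int m)) (A i))
       = (SUP m::nat. \<Sum>i. of_nat (p ^ m) * emeasure (haar_shift p (int m)) (A i))"
    proof (rule ennreal_suminf_SUP_eq_directed)
      fix N :: "nat set" and i j :: nat
      have "of_nat (p ^ i) * emeasure (haar_shift p (int i)) (A n) \<le> of_nat (p ^ max i j) * emeasure (haar_shift p (int (max i j))) (A n)"
        "of_nat (p ^ j) * emeasure (haar_shift p (int j)) (A n) \<le> of_nat (p ^ max i j) * emeasure (haar_shift p (int (max i j))) (A n)" for n
        using incseqD[OF vol_incseq, of "A n"] A(1) by (simp_all only: range_subsetD max.cobounded1 max.cobounded2)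
      thus "\<exists>k\<in>UNIV. \<forall>n\<in>N. of_nat (p ^ i) * emeasure (haar_shift p (int i)) (A n) \<le> of_nat (p ^ k) * emeasure (haar_shift p (int k)) (A n) \<and>
          of_nat (p ^ j) * emeasure (haar_shift p (int j)) (A n) \<le> of_nat (p ^ k) * emeasure (haar_shift p (int k)) (A n)"
        by (intro bexI[of _ "max i j"]) auto
    qed
    also have "(\<lambda>m. \<Sum>i. of_nat (p ^ m) * emeasure (haar_shift p (int m)) (A i)) = (\<lambda>m. of_nat (p ^ m) * emeasure (haar_shift p (int m)) (\<Union>i. A i))"
    proof
      fix m
      have "(\<Sum>i. emeasure (haar_shift p (int m)) (A i)) = emeasure (haar_shift p (int m)) (\<Union>i. A i)"
        by (rule suminf_emeasure) (use A in auto)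
      thus "(\<Sum>i. of_nat (p ^ m) * emeasure (haar_shift p (int m)) (A i)) = of_nat (p ^ m) * emeasure (haar_shift p (int m)) (\<Union>i. A i)"
        by simp
    qed
    finally show "(\<Sum>i. SUP m::nat. of_nat (p ^ m) * emeasure (haar_shift p (int m)) (A i)) = (SUP m::nat. of_nat (p ^ m) * emeasure (haar_shift p (int m)) (\<Union>i. A i))" .
  qed
  show "A \<in> sets (vol_Qp p)" using assms by simp
qed

lemma emeasure_vol_cyl: assumes z: "z \<in> Qp p"
  shows "emeasure (vol_Qp p) (cyl z (int e)) = ennreal (1 / real p ^ e)"
proof -
  have v: "of_nat (p ^ m) * emeasure (haar_shift p (int m)) (cyl z (int e))
     = (if \<forall>i. i < int e \<and> i < - int m \<longrightarrow> z i = 0 then ennreal (1 / real p ^ e) else 0)" for m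
  proof -
    have "nat (int e + int m) = e + m" by simp
    moreover have "of_nat (p ^ m) * ennreal (1 / real p ^ (e + m)) = ennreal (1 / real p ^ e)"
      using p_gt1 by (simp add: ennreal_of_nat_eq_real_of_nat ennreal_mult[symmetric] power_add flip: of_nat_power)
    ultimately have *: "of_nat (p ^ m) * ennreal (1 / real p ^ nat (int e + int m)) = ennreal (1 / real p ^ e)" by simp
    show ?thesis
    proof (cases "\<forall>i. i < int e \<and> i < - int m \<longrightarrow> z i = 0")
      case True
      show ?thesis unfolding emeasure_haar_cyl[OF z] if_P[OF True] by (rule *)
    next
      case False
      show ?thesis unfolding emeasure_haar_cyl[OF z] if_not_P[OF False] by simp
    qed
  qed
  obtain N where N: "\<forall>i<N. z i = 0" using Qp_low z by blast
  show ?thesis unfolding emeasure_vol[OF cyl_sets] v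
  proof (rule antisym)
    show "(SUP m::nat. if \<forall>i. i < int e \<and> i < - int m \<longrightarrow> z i = 0 then ennreal (1 / real p ^ e) else 0) \<le> ennreal (1 / real p ^ e)"
      by (rule SUP_least) simp
    have "\<forall>i. i < int e \<and> i < - int (nat (- N)) \<longrightarrow> z i = 0" using N by auto
    thus "ennreal (1 / real p ^ e) \<le> (SUP m::nat. if \<forall>i. i < int e \<and> i < - int m \<longrightarrow> z i = 0 then ennreal (1 / real p ^ e) else 0)"
      by (intro SUP_upper2[of "nat (- N)"]) auto
  qed
qed

lemma sigma_finite_vol: "sigma_finite_measure (vol_Qp p)"
proof
  have "(\<lambda>z. cyl z (int 0)) ` reps \<subseteq> sets (vol_Qp p)" by auto
  moreover have "\<Union>((\<lambda>z. cyl z (int 0)) ` reps) = space (vol_Qp p)" using in_cyl_reps by (auto simp: cyl_def)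
  moreover have "emeasure (vol_Qp p) a \<noteq> \<infinity>" if "a \<in> (\<lambda>z. cyl z (int 0)) ` reps" for a
    using that reps_Qp emeasure_vol_cyl[of _ 0] by auto
  ultimately show "\<exists>A. countable A \<and> A \<subseteq> sets (vol_Qp p) \<and> \<Union>A = space (vol_Qp p) \<and> (\<forall>a\<in>A. emeasure (vol_Qp p) a \<noteq> \<infinity>)"
    using countable_reps by (intro exI[of _ "(\<lambda>z. cyl z (int 0)) ` reps"]) blast
qed

lemma cyl_T0: assumes "x \<in> cyl z (int e)" shows "T x 0 = T z 0"
proof -
  have "\<forall>i<0. x i = z i" using assms by (auto simp: cyl_def)
  thus ?thesis unfolding T_def by (intro sum.cong) auto
qed

abbreviation sq :: "nat \<Rightarrow> (nat \<times> nat) set" where "sq N \<equiv> {..<N} \<times> {..<N}"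

definition gma :: "nat \<Rightarrow> (nat \<times> nat \<Rightarrow> qp) \<Rightarrow> real" where
  "gma N Z = real (card (rg N N (\<lambda>i j. T (Z (i, j)) 0)))"

lemma gma_eq: "(\<And>i j. i < N ==> j < N ==> T (Z (i, j)) 0 = T (Z' (i, j)) 0) ==> gma N Z = gma N Z'"
  unfolding gma_def by (subst rg_cong[of N N _ "\<lambda>i j. T (Z' (i, j)) 0"]) auto

lemma gma_ge1: assumes "\<And>i j. i < N ==> j < N ==> Z (i, j) \<in> Qp p" shows "gma N Z \<ge> 1"
proof -
  obtain K where K: "\<And>i m. i < N ==> m < N ==> T (Z (i, m)) 0 \<in> PZ (- int K)"
    using common_denominator[of N N "\<lambda>i j. Z (i, j)"] assms by blast
  have "card (rg N N (\<lambda>i j. T (Z (i, j)) 0)) > 0"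
    by (rule card_rg_pos[where q = "int (p ^ K)"]) (use K p_gt1 PZ_neg_iff in auto)
  thus ?thesis unfolding gma_def by simp
qed

text \<open>\<open>gma\<close> depends on the fractional parts of finitely many entries, and these
  take only countably many values; the map factors through a countable discrete space.\<close>

lemma gma_measurable:
  assumes sM: "sets M = sets (PiM (sq N) (\<lambda>_. qp_space p))"
  shows "gma N \<in> borel_measurable M"
proof -
  let ?B = "sq N \<rightarrow>\<^sub>E (\<Union>m. PZ m)"
  define F where "F = (\<lambda>Z. restrict (\<lambda>q. T (Z q) 0) (sq N))"
  have comp: "(\<lambda>Z. T (Z q) 0) \<in> borel_measurable M" if "q \<in> sq N" for q
  proof -
    have "(\<lambda>Z. Z q) \<in> measurable M (qp_space p)"
      unfolding measurable_cong_sets[OF sM refl] by (rule measurable_component_singleton[OF that])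
    thus ?thesis by (rule measurable_compose[OF _ T_measurable])
  qed
  have spQ: "Z q \<in> Qp p" if "Z \<in> space M" "q \<in> sq N" for Z q
    using that sets_eq_imp_space_eq[OF sM] by (auto simp: space_PiM space_qp PiE_def Pi_def)
  have "countable ?B" using countable_PZ by (intro countable_PiE) auto
  hence "F \<in> measurable M (count_space ?B)"
  proof (rule measurable_count_space_eq_countable[THEN iffD2], intro conjI ballI)
    show "F \<in> space M \<rightarrow> ?B"
    proof (rule Pi_I)
      fix Z assume Z: "Z \<in> space M"
      show "F Z \<in> ?B" unfolding F_def restrict_PiE_iff
      proof
        fix q assume "q \<in> sq N"
        then obtain m where "T (Z q) 0 \<in> PZ m" using T_bounded[OF spQ[OF Z]] by blast
        thus "T (Z q) 0 \<in> (\<Union>m. PZ m)" by (rule UN_I[OF UNIV_I])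
      qed
    qed
    fix f assume f: "f \<in> ?B"
    have "F -` {f} \<inter> space M = {Z \<in> space M. \<forall>q\<in>sq N. T (Z q) 0 = f q}"
      using f unfolding F_def by (auto simp: fun_eq_iff PiE_def extensional_def)
    also have "\<dots> \<in> sets M"
    proof (rule sets.sets_Collect_finite_All)
      fix q assume "q \<in> sq N"
      from measurable_sets[OF comp[OF this], of "{f q}"] show "{Z \<in> space M. T (Z q) 0 = f q} \<in> sets M"
        by (simp add: vimage_def Int_def conj_commute)
    qed simp
    finally show "F -` {f} \<inter> space M \<in> sets M" .
  qed
  hence "(\<lambda>Z. (\<lambda>f. real (card (rg N N (\<lambda>i j. f (i, j))))) (F Z)) \<in> borel_measurable M"
    by (rule measurable_compose) simp
  moreover have "gma N Z = real (card (rg N N (\<lambda>i j. F Z (i, j))))" for Z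
    unfolding gma_def by (subst rg_cong[of N N _ "\<lambda>i j. F Z (i, j)"]) (auto simp: F_def)
  ultimately show ?thesis by (simp add: gma_def[abs_def])
qed

lemma sets_matvol: "sets (matvol p N) = sets (PiM (sq N) (\<lambda>_. qp_space p))"
  unfolding matvol_def by (rule sets_PiM_cong) auto

definition cN :: "real \<Rightarrow> nat \<Rightarrow> real" where
  "cN s N = qpoch (real p powr (-1 - s)) (1 / real p) N ^ 2 / qpoch (real p powr (-1 - s)) (1 / real p) (2 * N)"

lemma MN_eq: "MN p s N = density (matvol p N) (\<lambda>Z. ennreal (cN s N * gma N Z powr (- s - 2 * real N)))"
  unfolding MN_def
proof (rule density_cong)
  have g: "gma N \<in> borel_measurable (matvol p N)" by (rule gma_measurable[OF sets_matvol])
  have spQ: "Z (i, j) \<in> Qp p" if "Z \<in> space (matvol p N)" "i < N" "j < N" for Z i j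
    using that sets_eq_imp_space_eq[OF sets_matvol] by (auto simp: space_PiM space_qp PiE_def Pi_def)
  have eq: "gamma_mat p N Z = gma N Z" if "Z \<in> space (matvol p N)" for Z
    unfolding gma_def by (rule gamma_mat_eq) (rule spQ[OF that])
  show "AE Z in matvol p N. ennreal (qpoch (real p powr (-1 - s)) (1 / real p) N ^ 2
                   / qpoch (real p powr (-1 - s)) (1 / real p) (2 * N)
                   * gamma_mat p N Z powr (- s - 2 * real N)) = ennreal (cN s N * gma N Z powr (- s - 2 * real N))"
    by (rule AE_I2) (simp add: eq cN_def)
  show 2: "(\<lambda>Z. ennreal (cN s N * gma N Z powr (- s - 2 * real N))) \<in> borel_measurable (matvol p N)"
    using g by measurable
  show "(\<lambda>Z. ennreal (qpoch (real p powr (-1 - s)) (1 / real p) N ^ 2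
                   / qpoch (real p powr (-1 - s)) (1 / real p) (2 * N)
                   * gamma_mat p N Z powr (- s - 2 * real N))) \<in> borel_measurable (matvol p N)"
    using 2 by (rule measurable_cong[THEN iffD1, rotated]) (simp add: eq cN_def)
qed

text \<open>On a box the fractional parts of all entries are fixed, so the density is constant
  there.\<close>

lemma emeasure_MN_box:
  assumes z: "\<And>q. q \<in> sq N ==> z q \<in> Qp p" and c: "cN s N \<ge> 0"
  shows "emeasure (MN p s N) (\<Pi>\<^sub>E q\<in>sq N. cyl (z q) (int (e q)))
    = ennreal (cN s N * gma N z powr (- s - 2 * real N) / real p ^ (\<Sum>q\<in>sq N. e q))"
proof -
  interpret product_sigma_finite "\<lambda>_. vol_Qp p" using sigma_finite_vol by (simp add: product_sigma_finite_def)
  let ?B = "\<Pi>\<^sub>E q\<in>sq N. cyl (z q) (int (e q))"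
  have B: "?B \<in> sets (matvol p N)" unfolding matvol_def by (rule sets_PiM_I_finite) auto
  have g: "gma N \<in> borel_measurable (matvol p N)" by (rule gma_measurable[OF sets_matvol])
  have "emeasure (MN p s N) ?B = (\<integral>\<^sup>+Z. ennreal (cN s N * gma N Z powr (- s - 2 * real N)) * indicator ?B Z \<partial>matvol p N)"
    unfolding MN_eq by (rule emeasure_density) (use g B in measurable)
  also have "\<dots> = (\<integral>\<^sup>+Z. ennreal (cN s N * gma N z powr (- s - 2 * real N)) * indicator ?B Z \<partial>matvol p N)"
  proof (rule nn_integral_cong)
    fix Z
    have "gma N Z = gma N z" if "Z \<in> ?B"
    proof (rule gma_eq)
      fix i j assume "i < N" "j < N"
      hence "Z (i, j) \<in> cyl (z (i, j)) (int (e (i, j)))" using that by auto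
      thus "T (Z (i, j)) 0 = T (z (i, j)) 0" by (rule cyl_T0)
    qed
    thus "ennreal (cN s N * gma N Z powr (- s - 2 * real N)) * indicator ?B Z
       = ennreal (cN s N * gma N z powr (- s - 2 * real N)) * indicator ?B Z"
      by (cases "Z \<in> ?B") simp_all
  qed
  also have "\<dots> = ennreal (cN s N * gma N z powr (- s - 2 * real N)) * emeasure (matvol p N) ?B"
    by (rule nn_integral_cmult_indicator[OF B])
  also have "emeasure (matvol p N) ?B = (\<Prod>q\<in>sq N. emeasure (vol_Qp p) (cyl (z q) (int (e q))))"
    unfolding matvol_def by (rule emeasure_PiM) auto
  also have "\<dots> = (\<Prod>q\<in>sq N. ennreal (1 / real p ^ e q))"
    by (rule prod.cong[OF refl]) (rule emeasure_vol_cyl[OF z])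
  also have "\<dots> = ennreal (1 / real p ^ (\<Sum>q\<in>sq N. e q))"
    by (simp add: prod_ennreal power_sum prod_dividef)
  also have "ennreal (cN s N * gma N z powr (- s - 2 * real N)) * ennreal (1 / real p ^ (\<Sum>q\<in>sq N. e q))
     = ennreal (cN s N * gma N z powr (- s - 2 * real N) / real p ^ (\<Sum>q\<in>sq N. e q))"
    using c by (simp add: ennreal_mult[symmetric])
  finally show ?thesis .
qed

end

section \<open>Laws of the rows and of the corners\<close>

context hua
begin

text \<open>The exponent \<open>j\<close> contributes only if \<open>p^j\<close> times the target
  row lies in the old row group, that is for \<open>j \<ge> r\<close>. The tail of the geometric
  series from \<open>r\<close> on gives the power \<open>r\<close>.\<close>

lemma row_law:
  fixes e :: "nat \<Rightarrow> nat"
  assumes prev: "\<And>i m. i < N ==> m < M ==> prev i m \<in> Qp p" and y: "\<And>m. m < M ==> y m \<in> Qp p"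
  defines "t \<equiv> \<lambda>i m. T (prev i m) 0"
  assumes r: "\<And>j. in_span N M t (\<lambda>m. real (p ^ j) * T (y m) 0) \<longleftrightarrow> r \<le> j"
  shows "emeasure (Blk N) {\<xi> \<in> space (Blk N). \<forall>m<M. rowf N \<xi> prev m \<in> cyl (y m) (int (e m))}
    = ennreal ((1 - theta N) / (1 - theta N / real p ^ M) * (theta N / real p ^ M) ^ r / real (card (rg N M t)) / real p ^ (\<Sum>m<M. e m))"
proof -
  let ?G = "measure_pmf (geometric_pmf (1 - theta N))"
  let ?HH = "HP \<Otimes>\<^sub>M HP"
  interpret H: prob_space HP by (rule prob_space_HP)
  interpret HH: pair_prob_space HP HP by unfold_locales
  let ?X = "{\<xi> \<in> space (Blk N). \<forall>m<M. rowf N \<xi> prev m \<in> cyl (y m) (int (e m))}"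
  let ?x = "theta N / real p ^ M"
  have X: "?X \<in> sets (?G \<Otimes>\<^sub>M ?HH)"
  proof -
    have "{\<xi> \<in> space (Blk N). rowf N \<xi> prev m \<in> cyl (y m) (int (e m))} \<in> sets (Blk N)" if "m < M" for m
    proof -
      have "(\<lambda>\<xi>. rowf N \<xi> prev m) \<in> measurable (Blk N) (qp_space p)"
        by (rule rowf_measurable[OF measurable_ident_sets[OF refl]]) (use prev that qp_const_measurable in auto)
      from measurable_sets[OF this cyl_sets[of "y m" "int (e m)"]] show ?thesis
        by (simp add: vimage_def Int_def conj_commute)
    qed
    hence "{\<xi> \<in> space (Blk N). \<forall>m\<in>{..<M}. rowf N \<xi> prev m \<in> cyl (y m) (int (e m))} \<in> sets (Blk N)"
      by (intro sets.sets_Collect_finite_All) simp_all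
    thus ?thesis by (simp only: Ball_def lessThan_iff Blk_def)
  qed
  have sec: "emeasure ?HH (Pair j -` ?X) = ennreal (if r \<le> j then 1 / real p ^ (\<Sum>m<M. e m + j) / real (card (rg N M t)) else 0)" for j
  proof -
    have E: "Pair j -` ?X = {ab \<in> space ?HH. \<forall>m<M. rowf N (j, ab) prev m \<in> cyl (y m) (int (e m))}"
      by (auto simp: Blk_def space_pair_measure)
    show ?thesis unfolding E using row_law_a[where N = N and M = M and prev = prev and y = y and e = e and j = j, OF prev y] r unfolding t_def by simp
  qed
  have th: "0 < theta N" "theta N < 1" using theta by auto
  have x: "0 \<le> ?x" "?x < 1"
  proof -
    have "1 \<le> real p ^ M" using p_gt1 by (simp add: one_le_power)
    thus "?x < 1" using th by (simp add: divide_less_eq)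
  qed (use th p_gt1 in simp)
  let ?C = "(1 - theta N) / real (card (rg N M t)) / real p ^ (\<Sum>m<M. e m)"
  have "emeasure (Blk N) ?X = (\<integral>\<^sup>+j. emeasure ?HH (Pair j -` ?X) \<partial>?G)"
    unfolding Blk_def by (rule HH.emeasure_pair_measure_alt[OF X[unfolded Blk_def]])
  also have "\<dots> = (\<integral>\<^sup>+j. ennreal (if r \<le> j then 1 / real p ^ (\<Sum>m<M. e m + j) / real (card (rg N M t)) else 0) \<partial>?G)"
    unfolding sec ..
  also have "\<dots> = (\<integral>\<^sup>+j. ennreal (pmf (geometric_pmf (1 - theta N)) j) * ennreal (if r \<le> j then 1 / real p ^ (\<Sum>m<M. e m + j) / real (card (rg N M t)) else 0) \<partial>count_space UNIV)"
    by (rule nn_integral_measure_pmf)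
  also have "\<dots> = (\<integral>\<^sup>+j. ennreal (if r \<le> j then ?C * ?x ^ j else 0) \<partial>count_space UNIV)"
  proof (rule nn_integral_cong)
    fix j
    have "pmf (geometric_pmf (1 - theta N)) j * (1 / real p ^ (\<Sum>m<M. e m + j) / real (card (rg N M t))) = ?C * ?x ^ j"
      using th by (simp add: sum.distrib power_add power_mult power_divide ac_simps)
    thus "ennreal (pmf (geometric_pmf (1 - theta N)) j) * ennreal (if r \<le> j then 1 / real p ^ (\<Sum>m<M. e m + j) / real (card (rg N M t)) else 0)
      = ennreal (if r \<le> j then ?C * ?x ^ j else 0)"
      by (subst ennreal_mult[symmetric]) (auto simp del: pmf_geometric)
  qed
  also have "\<dots> = (\<Sum>j. ennreal (if r \<le> j then ?C * ?x ^ j else 0))" by (rule nn_integral_count_space_nat)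
  also have "\<dots> = ennreal (?C * ?x ^ r / (1 - ?x))"
  proof (rule suminf_ennreal_eq)
    have "?C \<ge> 0" using th p_gt1 by simp
    hence "0 \<le> ?C * ?x ^ j" for j using x(1) by (intro mult_nonneg_nonneg zero_le_power)
    thus "0 \<le> (if r \<le> j then ?C * ?x ^ j else 0)" for j by (simp only: if_split) simp
    show "(\<lambda>j. if r \<le> j then ?C * ?x ^ j else 0) sums (?C * ?x ^ r / (1 - ?x))"
      by (rule geometric_tail_sums[OF x])
  qed
  also have "?C * ?x ^ r / (1 - ?x) = (1 - theta N) / (1 - ?x) * ?x ^ r / real (card (rg N M t)) / real p ^ (\<Sum>m<M. e m)"
    by simp
  finally show ?thesis .
qed

definition kap :: "nat \<Rightarrow> nat \<Rightarrow> real" where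
  "kap N M = (\<Prod>n<N. (1 - theta n) / (1 - theta n / real p ^ M))"

lemma theta_M: "theta n / real p ^ M < 1"
proof -
  have "1 \<le> real p ^ M" using p_gt1 by (simp add: one_le_power)
  thus ?thesis using theta[of n] by (simp add: divide_less_eq)
qed

lemma kap_pos: "kap N M > 0"
  unfolding kap_def by (rule prod_pos) (use theta theta_M in \<open>auto intro!: divide_pos_pos\<close>)

lemma product_prob_Blk: "product_prob_space Blk"
  using prob_space_Blk by (simp add: product_prob_space_def product_prob_space_axioms_def product_sigma_finite_def prob_space_imp_sigma_finite)

definition boxev :: "nat \<Rightarrow> nat \<Rightarrow> (nat \<Rightarrow> nat \<Rightarrow> qp) \<Rightarrow> (nat \<Rightarrow> nat \<Rightarrow> nat) \<Rightarrow> (nat \<Rightarrow> nat \<times> (nat \<Rightarrow> qp) \<times> (nat \<Rightarrow> qp)) set" where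
  "boxev N M z e = {\<omega> \<in> space (PiM {..<N} Blk). \<forall>i<N. \<forall>m<M. rows \<omega> N i m \<in> cyl (z i m) (int (e i m))}"

lemma boxev_sets: "boxev N M z e \<in> sets (PiM {..<N} Blk)"
proof -
  have "{\<omega> \<in> space (PiM {..<N} Blk). rows \<omega> N i m \<in> cyl (z i m) (int (e i m))} \<in> sets (PiM {..<N} Blk)" for i m
    using measurable_sets[OF rows_measurable[OF order_refl] cyl_sets[of "z i m" "int (e i m)"]]
    by (simp add: vimage_def Int_def conj_commute)
  hence "{\<omega> \<in> space (PiM {..<N} Blk). \<forall>i\<in>{..<N}. \<forall>m\<in>{..<M}. rows \<omega> N i m \<in> cyl (z i m) (int (e i m))} \<in> sets (PiM {..<N} Blk)"
    by (intro sets.sets_Collect_finite_All) simp_all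
  thus ?thesis by (simp only: boxev_def Ball_def lessThan_iff)
qed

text \<open>Rows are added one at a time while the number \<open>M\<close> of columns stays fixed.
  With \<open>u = s + N + 1 + M\<close>, a new row multiplies the order of the row group by
  \<open>p^r\<close> and the probability by a constant times \<open>p^(-r u)\<close> over the old
  order. Dividing by the old order also moves its exponent from \<open>s + N + M\<close> to
  \<open>u\<close>.\<close>

theorem box_law:
  assumes z: "\<And>i m. i < N ==> m < M ==> z i m \<in> Qp p"
  shows "emeasure (PiM {..<N} Blk) (boxev N M z e) =
    ennreal (kap N M * real (card (rg N M (\<lambda>i m. T (z i m) 0))) powr (- (s + real N + real M)) / real p ^ (\<Sum>i<N. \<Sum>m<M. e i m))"
  using z
proof (induction N)
  case 0
  interpret product_prob_space Blk "{}" by (rule product_prob_Blk)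
  have "rg 0 M (\<lambda>i m. T (z i m) 0) = {\<lambda>_. 0}" by (simp add: rg_def cong: if_cong)
  moreover have "boxev 0 M z e = space (PiM {} Blk)" by (simp add: boxev_def)
  ultimately show ?case using P.emeasure_space_1 by (simp add: kap_def)
next
  case (Suc N)
  interpret product_prob_space Blk "{..<Suc N}" by (rule product_prob_Blk)
  let ?t = "\<lambda>i m. T (z i m) 0"
  have zN: "z i m \<in> Qp p" if "i < Suc N" "m < M" for i m using Suc.prems that by blast
  obtain K where K: "\<And>i m. i < Suc N ==> m < M ==> ?t i m \<in> PZ (- int K)"
    using common_denominator[of "Suc N" M z] zN by blast
  obtain r where r: "\<And>n. in_span N M ?t (\<lambda>j. real (p ^ n) * ?t N j) \<longleftrightarrow> r \<le> n"
      "card (rg (Suc N) M ?t) = p ^ r * card (rg N M ?t)"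
    using card_rg_Suc[OF prime_p, of N M K ?t] K PZ_neg_iff by blast
  let ?R = "(1 - theta N) / (1 - theta N / real p ^ M) * (theta N / real p ^ M) ^ r / real (card (rg N M ?t)) / real p ^ (\<Sum>m<M. e N m)"
  let ?Y = "\<lambda>prev. {\<xi> \<in> space (Blk N). \<forall>m<M. rowf N \<xi> prev m \<in> cyl (z N m) (int (e N m))}"
  have ins: "{..<Suc N} = insert N {..<N}" by auto
  have fm: "indicator (boxev (Suc N) M z e) \<in> borel_measurable (PiM (insert N {..<N}) Blk)"
    using boxev_sets[of "Suc N" M z e] unfolding ins by simp
  have rowsN: "rows (fun_upd \<omega> N \<xi>) N = rows \<omega> N" for \<omega> \<xi> by (rule rows_cong) simp
  have ind: "indicator (boxev (Suc N) M z e) (fun_upd \<omega> N \<xi>) = (indicator (boxev N M z e) \<omega> * indicator (?Y (rows \<omega> N)) \<xi> :: ennreal)"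
    if w: "\<omega> \<in> space (PiM {..<N} Blk)" "\<xi> \<in> space (Blk N)" for \<omega> \<xi>
  proof -
    have sp: "fun_upd \<omega> N \<xi> \<in> space (PiM {..<Suc N} Blk)"
      using w unfolding ins space_PiM by (auto intro!: PiE_fun_upd)
    have "fun_upd \<omega> N \<xi> \<in> boxev (Suc N) M z e \<longleftrightarrow> \<omega> \<in> boxev N M z e \<and> \<xi> \<in> ?Y (rows \<omega> N)"
      using w sp by (auto simp: boxev_def rowsN less_Suc_eq)
    thus ?thesis by (auto simp: indicator_def)
  qed
  have inner: "emeasure (Blk N) (?Y (rows \<omega> N)) = ennreal ?R" if w: "\<omega> \<in> boxev N M z e" for \<omega>
  proof -
    have mem: "rows \<omega> N i m \<in> cyl (z i m) (int (e i m))" if "i < N" "m < M" for i m using w that by (simp add: boxev_def)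
    have Q: "rows \<omega> N i m \<in> Qp p" if "i < N" "m < M" for i m using mem[OF that] by (simp add: cyl_def)
    have Teq: "T (rows \<omega> N i m) 0 = ?t i m" if "i < N" "m < M" for i m using cyl_T0[OF mem[OF that]] .
    have rgeq: "rg N M (\<lambda>i m. T (rows \<omega> N i m) 0) = rg N M ?t" by (rule rg_cong) (simp add: Teq)
    have sp: "in_span N M (\<lambda>i m. T (rows \<omega> N i m) 0) x \<longleftrightarrow> in_span N M ?t x" for x
      unfolding in_span_rg rgeq ..
    have "emeasure (Blk N) (?Y (rows \<omega> N)) = ennreal ((1 - theta N) / (1 - theta N / real p ^ M) * (theta N / real p ^ M) ^ r / real (card (rg N M (\<lambda>i m. T (rows \<omega> N i m) 0))) / real p ^ (\<Sum>m<M. e N m))"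
      by (rule row_law) (use Q zN r sp in auto)
    thus ?thesis unfolding rgeq .
  qed
  have "emeasure (PiM {..<Suc N} Blk) (boxev (Suc N) M z e) = (\<integral>\<^sup>+\<omega>. indicator (boxev (Suc N) M z e) \<omega> \<partial>PiM (insert N {..<N}) Blk)"
    using boxev_sets[of "Suc N" M z e] unfolding ins by simp
  also have "\<dots> = (\<integral>\<^sup>+\<omega>. (\<integral>\<^sup>+\<xi>. indicator (boxev (Suc N) M z e) (fun_upd \<omega> N \<xi>) \<partial>Blk N) \<partial>PiM {..<N} Blk)"
    by (rule product_nn_integral_insert) (use fm in auto)
  also have "\<dots> = (\<integral>\<^sup>+\<omega>. ennreal ?R * indicator (boxev N M z e) \<omega> \<partial>PiM {..<N} Blk)"
  proof (rule nn_integral_cong)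
    fix \<omega> assume w: "\<omega> \<in> space (PiM {..<N} Blk)"
    have "(\<integral>\<^sup>+\<xi>. indicator (boxev (Suc N) M z e) (fun_upd \<omega> N \<xi>) \<partial>Blk N) = (\<integral>\<^sup>+\<xi>. indicator (boxev N M z e) \<omega> * indicator (?Y (rows \<omega> N)) \<xi> \<partial>Blk N)"
      by (rule nn_integral_cong) (rule ind[OF w])
    also have "\<dots> = ennreal ?R * indicator (boxev N M z e) \<omega>"
    proof (cases "\<omega> \<in> boxev N M z e")
      case True
      have Ym: "?Y (rows \<omega> N) \<in> sets (Blk N)"
      proof -
        have "{\<xi> \<in> space (Blk N). rowf N \<xi> (rows \<omega> N) m \<in> cyl (z N m) (int (e N m))} \<in> sets (Blk N)" if m: "m < M" for m
        proof -
          have "(\<lambda>\<xi>. rowf N \<xi> (rows \<omega> N) m) \<in> measurable (Blk N) (qp_space p)"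
          proof (rule rowf_measurable[OF measurable_ident_sets[OF refl]])
            fix l assume "l < N"
            hence "rows \<omega> N l m \<in> Qp p" using True m by (simp add: boxev_def cyl_def)
            thus "(\<lambda>w. rows \<omega> N l m) \<in> measurable (Blk N) (qp_space p)" by (rule qp_const_measurable)
          qed
          from measurable_sets[OF this cyl_sets[of "z N m" "int (e N m)"]] show ?thesis
            by (simp add: vimage_def Int_def conj_commute)
        qed
        hence "{\<xi> \<in> space (Blk N). \<forall>m\<in>{..<M}. rowf N \<xi> (rows \<omega> N) m \<in> cyl (z N m) (int (e N m))} \<in> sets (Blk N)"
          by (intro sets.sets_Collect_finite_All) simp_all
        thus ?thesis by (simp only: Ball_def lessThan_iff)
      qed
      have i1: "indicator (boxev N M z e) \<omega> = (1::ennreal)" using True by simp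
      show ?thesis unfolding i1 mult_1_left mult_1_right nn_integral_indicator[OF Ym] by (rule inner[OF True])
    next
      case False
      hence i0: "indicator (boxev N M z e) \<omega> = (0::ennreal)" by simp
      show ?thesis unfolding i0 mult_zero_left mult_zero_right by simp
    qed
    finally show "(\<integral>\<^sup>+\<xi>. indicator (boxev (Suc N) M z e) (fun_upd \<omega> N \<xi>) \<partial>Blk N) = ennreal ?R * indicator (boxev N M z e) \<omega>" .
  qed
  also have "\<dots> = ennreal ?R * emeasure (PiM {..<N} Blk) (boxev N M z e)"
    by (rule nn_integral_cmult_indicator[OF boxev_sets])
  also have "\<dots> = ennreal ?R * ennreal (kap N M * real (card (rg N M ?t)) powr (- (s + real N + real M)) / real p ^ (\<Sum>i<N. \<Sum>m<M. e i m))"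
    by (subst Suc.IH) (use zN in auto)
  also have "\<dots> = ennreal (?R * (kap N M * real (card (rg N M ?t)) powr (- (s + real N + real M)) / real p ^ (\<Sum>i<N. \<Sum>m<M. e i m)))"
  proof (rule ennreal_mult[symmetric])
    show "0 \<le> ?R" using theta[of N] theta_M[of N M] p_gt1 by (intro divide_nonneg_nonneg mult_nonneg_nonneg) auto
    show "0 \<le> kap N M * real (card (rg N M ?t)) powr (- (s + real N + real M)) / real p ^ (\<Sum>i<N. \<Sum>m<M. e i m)"
      using kap_pos[of N M] p_gt1 by simp
  qed
  also have "?R * (kap N M * real (card (rg N M ?t)) powr (- (s + real N + real M)) / real p ^ (\<Sum>i<N. \<Sum>m<M. e i m))
    = kap (Suc N) M * real (card (rg (Suc N) M ?t)) powr (- (s + real (Suc N) + real M)) / real p ^ (\<Sum>i<Suc N. \<Sum>m<M. e i m)"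
  proof -
    let ?c = "real (card (rg N M ?t))"
    define u where "u = s + real (Suc N) + real M"
    have cpos: "?c > 0" using card_rg_pos[of N M "int (p ^ K)" ?t] K p_gt1 PZ_neg_iff by simp
    have thu: "theta N / real p ^ M = real p powr (- u)"
    proof -
      have "real p ^ M = real p powr (real M)" using p_gt1 by (simp add: powr_realpow)
      hence "theta N / real p ^ M = real p powr (- (s + real N + 1) - real M)" by (simp only: theta_def powr_diff)
      moreover have "- (s + real N + 1) - real M = - u" by (simp add: u_def)
      ultimately show ?thesis by (simp only:)
    qed
    have "(theta N / real p ^ M) ^ r = (real (p ^ r)) powr (- u)"
      unfolding thu using p_gt1 by (simp add: powr_realpow[symmetric] powr_powr mult.commute)
    moreover have "?c powr (- (s + real N + real M)) / ?c = ?c powr (- u)"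
    proof -
      have "?c powr (- (s + real N + real M) - 1) = ?c powr (- (s + real N + real M)) / ?c powr 1" by (rule powr_diff)
      moreover have "- (s + real N + real M) - 1 = - u" by (simp add: u_def)
      ultimately show ?thesis using cpos by simp
    qed
    moreover have "real (card (rg (Suc N) M ?t)) powr (- u) = real (p ^ r) powr (- u) * ?c powr (- u)"
      unfolding r(2) of_nat_mult by (rule powr_mult)
    ultimately have key: "(theta N / real p ^ M) ^ r * (?c powr (- (s + real N + real M)) / ?c) = real (card (rg (Suc N) M ?t)) powr (- u)"
      by simp
    have kS: "kap (Suc N) M = kap N M * ((1 - theta N) / (1 - theta N / real p ^ M))" by (simp add: kap_def)
    have "?R * (kap N M * ?c powr (- (s + real N + real M)) / real p ^ (\<Sum>i<N. \<Sum>m<M. e i m))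
      = (kap N M * ((1 - theta N) / (1 - theta N / real p ^ M))) * ((theta N / real p ^ M) ^ r * (?c powr (- (s + real N + real M)) / ?c))
         / (real p ^ (\<Sum>m<M. e N m) * real p ^ (\<Sum>i<N. \<Sum>m<M. e i m))"
      by (simp add: ac_simps)
    also have "\<dots> = kap (Suc N) M * real (card (rg (Suc N) M ?t)) powr (- u) / real p ^ (\<Sum>i<Suc N. \<Sum>m<M. e i m)"
      unfolding key kS by (simp add: power_add mult.commute)
    finally show ?thesis unfolding u_def .
  qed
  finally show ?case .
qed

text \<open>With \<open>a = p^(-1-s)\<close> and \<open>q = 1/p\<close>, \<open>theta n\<close> is
  \<open>a q^n\<close> and \<open>theta n / p^N\<close> is \<open>a q^(N+n)\<close>. Numerator and
  denominator of \<open>kap N N\<close> are therefore the two halves of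
  \<open>(a; q)_(2N)\<close>.\<close>

lemma kap_cN: "kap N N = cN s N"
proof -
  let ?a = "real p powr (-1 - s)" let ?q = "1 / real p"
  have th: "theta n = ?a * ?q ^ n" for n
  proof -
    have "theta n = real p powr ((-1 - s) - real n)" unfolding theta_def by (rule arg_cong2[of _ _ _ _ "(powr)"]) auto
    also have "\<dots> = ?a / real p powr real n" by (rule powr_diff)
    also have "real p powr real n = real p ^ n" using p_gt1 by (simp add: powr_realpow)
    finally show ?thesis by (simp add: power_one_over)
  qed
  have thN: "theta n / real p ^ N = ?a * ?q ^ (N + n)" for n
    unfolding th by (simp add: power_add power_one_over)
  have pos: "0 < 1 - ?a * ?q ^ n" for n using theta(2)[of n] th by simp
  have split: "qpoch ?a ?q (N + L) = qpoch ?a ?q N * (\<Prod>n<L. 1 - ?a * ?q ^ (N + n))" for L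
    by (induction L) (simp_all add: qpoch_def)
  have ne: "qpoch ?a ?q n > 0" for n unfolding qpoch_def by (rule prod_pos) (use pos in auto)
  have "kap N N = qpoch ?a ?q N / (\<Prod>n<N. 1 - ?a * ?q ^ (N + n))"
    unfolding kap_def thN by (simp add: prod_dividef qpoch_def th)
  also have "\<dots> = cN s N"
    unfolding cN_def mult_2 split using ne[of N] by (simp add: power2_eq_square)
  finally show ?thesis .
qed

lemma cN_pos: "cN s N > 0" using kap_cN kap_pos by metis

text \<open>A row is final once it is written, so row \<open>i\<close> is read at stage
  \<open>Suc i\<close>.\<close>

definition Zmat :: "(nat \<Rightarrow> nat \<times> (nat \<Rightarrow> qp) \<times> (nat \<Rightarrow> qp)) \<Rightarrow> nat \<times> nat \<Rightarrow> qp" where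
  "Zmat \<omega> = (\<lambda>(i, j). rows \<omega> (Suc i) i j)"

definition Mh :: "(nat \<times> nat \<Rightarrow> qp) measure" where "Mh = distr (PiM UNIV Blk) (matinf p) Zmat"

lemma Zmat_measurable: "Zmat \<in> measurable (PiM UNIV Blk) (matinf p)"
  unfolding matinf_def
proof (rule measurable_PiM_single')
  show m: "(\<lambda>\<omega>. Zmat \<omega> q) \<in> measurable (PiM UNIV Blk) (qp_space p)" for q
    by (cases q) (simp add: Zmat_def rows_measurable del: rows.simps)
  show "Zmat \<in> space (PiM UNIV Blk) \<rightarrow> (\<Pi>\<^sub>E i\<in>UNIV. space (qp_space p))"
    using measurable_space[OF m] by (intro Pi_I PiE_I) simp_all
qed

lemma prob_space_Mh: "prob_space Mh"
proof -
  have "prob_space (PiM UNIV Blk)" by (rule prob_space_PiM) (rule prob_space_Blk)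
  thus ?thesis unfolding Mh_def by (rule prob_space.prob_space_distr) (rule Zmat_measurable)
qed

end

lemma (in padic) corner_measurable: "corner N \<in> measurable (matinf p) (PiM (sq N) (\<lambda>_. qp_space p))"
  unfolding corner_def[abs_def] matinf_def by (rule measurable_restrict_subset) simp

context hua
begin

text \<open>Both sides are explicit on boxes: one by \<open>box_law\<close>, the other by the
  constant density.\<close>

lemma distr_Mh_corner: "distr Mh (PiM (sq N) (\<lambda>_. qp_space p)) (corner N) = MN p s N"
proof (rule box_measure_eqI[of "sq N"])
  interpret product_prob_space Blk "UNIV :: nat set" by (rule product_prob_Blk)
  fix z e assume z: "\<And>i. i \<in> sq N ==> z i \<in> Qp p"
  let ?B = "\<Pi>\<^sub>E q\<in>sq N. cyl (z q) (int (e q))"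
  let ?Z = "\<lambda>i j. z (i, j)" and ?e = "\<lambda>i j. (e (i, j) :: nat)"
  have B: "?B \<in> sets (PiM (sq N) (\<lambda>_. qp_space p))" by (rule sets_PiM_I_finite) auto
  have cM: "corner N \<in> measurable Mh (PiM (sq N) (\<lambda>_. qp_space p))" using corner_measurable by (simp add: Mh_def)
  have "emeasure (distr Mh (PiM (sq N) (\<lambda>_. qp_space p)) (corner N)) ?B = emeasure Mh (corner N -` ?B \<inter> space Mh)"
    by (rule emeasure_distr[OF cM B])
  also have "\<dots> = emeasure (PiM UNIV Blk) (Zmat -` (corner N -` ?B \<inter> space Mh) \<inter> space (PiM UNIV Blk))"
    unfolding Mh_def by (rule emeasure_distr[OF Zmat_measurable]) (use measurable_sets[OF cM B] in \<open>simp add: Mh_def\<close>)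
  also have "Zmat -` (corner N -` ?B \<inter> space Mh) \<inter> space (PiM UNIV Blk) = prod_emb UNIV Blk {..<N} (boxev N N ?Z ?e)"
  proof (intro equalityI subsetI)
    fix \<omega> assume w: "\<omega> \<in> Zmat -` (corner N -` ?B \<inter> space Mh) \<inter> space (PiM UNIV Blk)"
    have r: "rows (restrict \<omega> {..<N}) N = rows \<omega> N" by (rule rows_cong) simp
    have "corner N (Zmat \<omega>) \<in> ?B" using w by simp
    have "rows \<omega> N i m \<in> cyl (z (i, m)) (int (e (i, m)))" if im: "i < N" "m < N" for i m
    proof -
      have "corner N (Zmat \<omega>) (i, m) \<in> cyl (z (i, m)) (int (e (i, m)))"
        using PiE_mem[OF \<open>corner N (Zmat \<omega>) \<in> ?B\<close>, of "(i, m)"] im by simp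
      moreover have "corner N (Zmat \<omega>) (i, m) = rows \<omega> N i m"
        using im unfolding rows_stable[OF im(1)] by (simp add: corner_def Zmat_def del: rows.simps)
      ultimately show ?thesis by simp
    qed
    moreover have "restrict \<omega> {..<N} \<in> space (PiM {..<N} Blk)" using w by (auto simp: space_PiM)
    ultimately show "\<omega> \<in> prod_emb UNIV Blk {..<N} (boxev N N ?Z ?e)"
      using w r by (auto simp: prod_emb_def boxev_def space_PiM)
  next
    fix \<omega> assume w: "\<omega> \<in> prod_emb UNIV Blk {..<N} (boxev N N ?Z ?e)"
    have r: "rows (restrict \<omega> {..<N}) N = rows \<omega> N" by (rule rows_cong) simp
    have sp: "\<omega> \<in> space (PiM UNIV Blk)" using w by (auto simp: prod_emb_def space_PiM)
    have "restrict \<omega> {..<N} \<in> boxev N N ?Z ?e" using w by (simp add: prod_emb_def)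
    hence mem: "rows \<omega> N i m \<in> cyl (z (i, m)) (int (e (i, m)))" if "i < N" "m < N" for i m
      using that by (simp add: boxev_def r)
    have "corner N (Zmat \<omega>) \<in> ?B"
    proof (rule PiE_I)
      fix q assume q: "q \<in> sq N"
      obtain i m where im: "q = (i, m)" by (cases q)
      thus "corner N (Zmat \<omega>) q \<in> cyl (z q) (int (e q))"
        using q mem[of i m] rows_stable[of i N \<omega>] by (simp add: corner_def Zmat_def del: rows.simps)
    qed (simp add: corner_def)
    moreover have "Zmat \<omega> \<in> space Mh" using measurable_space[OF Zmat_measurable sp] by (simp add: Mh_def)
    ultimately show "\<omega> \<in> Zmat -` (corner N -` ?B \<inter> space Mh) \<inter> space (PiM UNIV Blk)" using sp by simp
  qed
  also have "emeasure (PiM UNIV Blk) (prod_emb UNIV Blk {..<N} (boxev N N ?Z ?e)) = emeasure (PiM {..<N} Blk) (boxev N N ?Z ?e)"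
    by (rule emeasure_PiM_emb') (auto simp: boxev_sets)
  also have "\<dots> = ennreal (kap N N * real (card (rg N N (\<lambda>i m. T (z (i, m)) 0))) powr (- (s + real N + real N)) / real p ^ (\<Sum>i<N. \<Sum>m<N. e (i, m)))"
    by (rule box_law) (use z in auto)
  finally have 1: "emeasure (distr Mh (PiM (sq N) (\<lambda>_. qp_space p)) (corner N)) ?B =
     ennreal (kap N N * real (card (rg N N (\<lambda>i m. T (z (i, m)) 0))) powr (- (s + real N + real N)) / real p ^ (\<Sum>i<N. \<Sum>m<N. e (i, m)))" .
  have "- (s + real N + real N) = - s - 2 * real N" by simp
  hence 2: "emeasure (distr Mh (PiM (sq N) (\<lambda>_. qp_space p)) (corner N)) ?B =
     ennreal (cN s N * gma N z powr (- s - 2 * real N) / real p ^ (\<Sum>q\<in>sq N. e q))"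
    unfolding 1 kap_cN gma_def by (simp only: sum.cartesian_product) simp
  show "emeasure (distr Mh (PiM (sq N) (\<lambda>_. qp_space p)) (corner N)) ?B = emeasure (MN p s N) ?B"
    unfolding 2 using emeasure_MN_box[of N z s e] z cN_pos[of N] by simp
  show "emeasure (distr Mh (PiM (sq N) (\<lambda>_. qp_space p)) (corner N)) ?B \<noteq> \<infinity>" unfolding 2 by simp
qed (simp_all add: MN_eq sets_matvol)

text \<open>Finitely many coordinates lie in a common corner, so the corner laws fix all
  finite-dimensional distributions.\<close>

lemma Ms_spec:
  assumes "sets M = sets (matinf p)" "prob_space M" "\<forall>N\<ge>1. distr M (PiM (sq N) (\<lambda>_. qp_space p)) (corner N) = MN p s N"
    and "sets M' = sets (matinf p)" "\<forall>N\<ge>1. distr M' (PiM (sq N) (\<lambda>_. qp_space p)) (corner N) = MN p s N"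
  shows "M = M'"
proof (rule measure_eqI_PiM_infinite[where I = UNIV and M = "\<lambda>_. qp_space p"])
  show "sets M = sets (PiM UNIV (\<lambda>_. qp_space p))" "sets M' = sets (PiM UNIV (\<lambda>_. qp_space p))"
    using assms by (simp_all add: matinf_def)
  show "finite_measure M" using assms(2) by (simp add: prob_space_def)
  fix A and J :: "(nat \<times> nat) set" assume J: "finite J" "J \<subseteq> UNIV" and A: "\<And>i. i \<in> J ==> A i \<in> sets (qp_space p)"
  define N where "N = Suc (Max (insert 0 (fst ` J \<union> snd ` J)))"
  have JN: "J \<subseteq> sq N"
  proof
    fix q assume "q \<in> J"
    hence "fst q \<le> Max (insert 0 (fst ` J \<union> snd ` J))" "snd q \<le> Max (insert 0 (fst ` J \<union> snd ` J))"
      using J by (auto intro!: Max_ge)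
    thus "q \<in> sq N" by (cases q) (simp add: N_def)
  qed
  let ?P = "prod_emb (sq N) (\<lambda>_. qp_space p) J (Pi\<^sub>E J A)"
  have P: "?P \<in> sets (PiM (sq N) (\<lambda>_. qp_space p))" by (rule sets_PiM_I) (use J JN A in auto)
  have *: "emeasure L (prod_emb UNIV (\<lambda>_. qp_space p) J (Pi\<^sub>E J A)) = emeasure (MN p s N) ?P"
    if L: "sets L = sets (matinf p)" "\<forall>N\<ge>1. distr L (PiM (sq N) (\<lambda>_. qp_space p)) (corner N) = MN p s N" for L
  proof -
    have "corner N \<in> measurable L (PiM (sq N) (\<lambda>_. qp_space p))"
      using corner_measurable measurable_cong_sets[OF L(1) refl] by blast
    from emeasure_distr[OF this P] have "emeasure (MN p s N) ?P = emeasure L (corner N -` ?P \<inter> space L)"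
      using L(2) by (simp add: N_def)
    moreover have "corner N -` ?P \<inter> space L = prod_emb UNIV (\<lambda>_. qp_space p) J (Pi\<^sub>E J A)"
      using sets_eq_imp_space_eq[OF L(1)] JN
      by (auto simp: prod_emb_def corner_def matinf_def space_PiM restrict_restrict Int_absorb1 Int_absorb2 PiE_iff)
    ultimately show ?thesis by simp
  qed
  show "emeasure M (prod_emb UNIV (\<lambda>_. qp_space p) J (Pi\<^sub>E J A)) = emeasure M' (prod_emb UNIV (\<lambda>_. qp_space p) J (Pi\<^sub>E J A))"
    using *[of M] *[of M'] assms by simp
qed

theorem Ms_eq: "Ms p s = Mh"
  unfolding Ms_def
proof (rule the_equality)
  show "sets Mh = sets (matinf p) \<and> prob_space Mh \<and> (\<forall>N\<ge>1. distr Mh (PiM (sq N) (\<lambda>_. qp_space p)) (corner N) = MN p s N)"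
    using prob_space_Mh distr_Mh_corner by (simp add: Mh_def)
  fix M assume "sets M = sets (matinf p) \<and> prob_space M \<and> (\<forall>N\<ge>1. distr M (PiM (sq N) (\<lambda>_. qp_space p)) (corner N) = MN p s N)"
  thus "M = Mh" using distr_Mh_corner by (intro Ms_spec) (simp_all add: Mh_def)
qed

lemma sets_Ms: "sets (Ms p s) = sets (matinf p)" by (simp add: Ms_eq Mh_def)
lemma prob_space_Ms: "prob_space (Ms p s)" by (simp add: Ms_eq prob_space_Mh)
lemma distr_Ms_corner: "distr (Ms p s) (PiM (sq N) (\<lambda>_. qp_space p)) (corner N) = MN p s N"
  by (simp add: Ms_eq distr_Mh_corner)

end

section \<open>The ergodic measures\<close>

context padic
begin

text \<open>\<open>qp_suminf\<close> cuts the number of terms and their digits at the same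
  \<open>K\<close>. A common denominator and a uniformly small tail make this diagonal scheme
  converge.\<close>

lemma plim_suminf:
  assumes f: "\<And>n. f n \<in> Qp p" and bdd: "\<And>n K. T (f n) K \<in> PZ m"
    and tail: "\<And>e. \<exists>N0. \<forall>n\<ge>N0. \<forall>K. T (f n) K \<in> PZ e"
  shows "plim (\<lambda>K. \<Sum>n<K. tr p (f n) K) (qp_suminf p f)"
proof -
  let ?r = "\<lambda>K. \<Sum>n<K. tr p (f n) K"
  have "pcauchy ?r" unfolding pcauchy_def
  proof (intro conjI allI)
    show "\<exists>m. \<forall>K. ?r K \<in> PZ m" using bdd by (intro exI[of _ m] allI PZ_sum) (simp add: tr_eq_T)
    fix e
    obtain N0 where N0: "\<forall>n\<ge>N0. \<forall>K. T (f n) K \<in> PZ e" using tail by blast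
    define K0 where "K0 = max N0 (nat e)"
    have "?r K - ?r K0 \<in> PZ e" if K: "K \<ge> K0" for K
    proof -
      have "?r K = (\<Sum>n<K0. tr p (f n) K) + (\<Sum>n\<in>{K0..<K}. tr p (f n) K)"
        using K by (simp add: lessThan_atLeast0 sum.atLeastLessThan_concat)
      hence "?r K - ?r K0 = (\<Sum>n<K0. tr p (f n) K - tr p (f n) K0) + (\<Sum>n\<in>{K0..<K}. tr p (f n) K)"
        by (simp add: sum_subtractf)
      moreover have "(\<Sum>n<K0. tr p (f n) K - tr p (f n) K0) \<in> PZ e"
      proof (rule PZ_sum)
        fix n
        have "T (f n) (int K) - T (f n) (int K0) \<in> PZ (int K0)" using T_diff[OF f, of "int K0" "int K"] K by simp
        thus "tr p (f n) K - tr p (f n) K0 \<in> PZ e"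
          using PZ_monoD[of _ "int K0" e] by (simp add: tr_eq_T K0_def)
      qed
      moreover have "(\<Sum>n\<in>{K0..<K}. tr p (f n) K) \<in> PZ e"
        using N0 by (intro PZ_sum) (simp add: tr_eq_T K0_def)
      ultimately show ?thesis using PZ_add by simp
    qed
    thus "\<exists>K0. \<forall>K\<ge>K0. ?r K - ?r K0 \<in> PZ e" by blast
  qed
  then obtain x where x: "plim ?r x" using pcauchy_plim by blast
  have "qp_suminf p f = x" unfolding qp_suminf_def by (rule plim_qp_lim[OF x])
  thus ?thesis using x by simp
qed

text \<open>Terms in \<open>PZ e\<close> from \<open>N0\<close> on do not show modulo
  \<open>p^e\<close>, which leaves a finite sum.\<close>

lemma T_suminf_finite:
  assumes f: "\<And>n. f n \<in> Qp p" and bdd: "\<And>n K. T (f n) K \<in> PZ m"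
    and tail: "\<And>e. \<exists>N0. \<forall>n\<ge>N0. \<forall>K. T (f n) K \<in> PZ e"
    and N0: "\<And>n K. n \<ge> N0 ==> T (f n) K \<in> PZ e"
  shows "T (qp_suminf p f) e - (\<Sum>n<N0. T (f n) e) \<in> PZ e"
proof -
  have "\<forall>\<^sub>F K in sequentially. (\<Sum>n<K. tr p (f n) K) - T (qp_suminf p f) e \<in> PZ e"
    using plim_suminf[OF f bdd tail] by (simp add: plim_def)
  then obtain K1 where K1: "\<forall>K\<ge>K1. (\<Sum>n<K. tr p (f n) K) - T (qp_suminf p f) e \<in> PZ e"
    unfolding eventually_sequentially by (elim exE) (rule that)
  define K where "K = max (max K1 N0) (nat e)"
  have "(\<Sum>n<K. tr p (f n) K) - T (qp_suminf p f) e \<in> PZ e"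
    by (rule K1[rule_format]) (simp add: K_def)
  hence 1: "T (qp_suminf p f) e - (\<Sum>n<K. tr p (f n) K) \<in> PZ e" by (rule PZ_diff_commute)
  have "(\<Sum>n<K. tr p (f n) K) = (\<Sum>n<N0. tr p (f n) K) + (\<Sum>n\<in>{N0..<K}. tr p (f n) K)"
    by (simp add: K_def lessThan_atLeast0 sum.atLeastLessThan_concat)
  hence "(\<Sum>n<K. tr p (f n) K) - (\<Sum>n<N0. T (f n) e) = (\<Sum>n<N0. tr p (f n) K - T (f n) e) + (\<Sum>n\<in>{N0..<K}. tr p (f n) K)"
    by (simp add: sum_subtractf)
  moreover have "(\<Sum>n<N0. tr p (f n) K - T (f n) e) \<in> PZ e"
    by (rule PZ_sum) (use T_diff[OF f, of e "int K"] in \<open>simp add: tr_eq_T K_def\<close>)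
  moreover have "(\<Sum>n\<in>{N0..<K}. tr p (f n) K) \<in> PZ e"
    by (rule PZ_sum) (use N0 in \<open>simp add: tr_eq_T\<close>)
  ultimately have "(\<Sum>n<K. tr p (f n) K) - (\<Sum>n<N0. T (f n) e) \<in> PZ e" using PZ_add by simp
  thus ?thesis using PZ_trans[OF 1] by blast
qed

lemma T_mult_PZ:
  assumes "x \<in> Qp p" "y \<in> Qp p" "\<And>K. T x K \<in> PZ a" "\<And>K. T y K \<in> PZ b"
  shows "T (qp_mult p x y) K \<in> PZ (a + b)"
proof -
  let ?z = "qp_mult p x y"
  have z: "?z \<in> Qp p" using assms qp_mult_Qp by blast
  have pl: "plim (\<lambda>K. tr p x K * tr p y K) ?z" by (intro plim_mult plim_tr assms)
  have key: "T ?z (a + b) \<in> PZ (a + b)"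
  proof -
    have "\<forall>\<^sub>F K in sequentially. tr p x K * tr p y K - T ?z (a + b) \<in> PZ (a + b)" using pl by (simp add: plim_def)
    then obtain K where "tr p x K * tr p y K - T ?z (a + b) \<in> PZ (a + b)" by (auto simp: eventually_sequentially)
    moreover have "tr p x K * tr p y K \<in> PZ (a + b)" using assms(3,4) by (intro PZ_mult) (simp_all add: tr_eq_T)
    ultimately show ?thesis using PZ_diff by fastforce
  qed
  have "T ?z (a + b) - T qp_zero (a + b) \<in> PZ (a + b)" using key by simp
  hence "\<forall>i<a + b. ?z i = qp_zero i" using T_cong_iff[OF z qp_zero_Qp] by blast
  thus ?thesis by (intro T_PZ) (simp add: qp_zero_def)
qed

lemma T_ppow: "T (qp_ppow p k) K = (if k \<noteq> -\<infinity> \<and> - \<lfloor>real_of_ereal k\<rfloor> < K then ppow_real k else 0)"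
  using T_monom[of "qp_ppow p k" "- \<lfloor>real_of_ereal k\<rfloor>" K] by (auto simp: qp_ppow_def ppow_real_def)

lemma qp_ppow_Qp: "qp_ppow p k \<in> Qp p" using plim_Qp[OF plim_ppow] .

lemma T_ppow_PZ: assumes "k \<in> Zbar" "k \<le> ereal (real_of_int c)" shows "T (qp_ppow p k) K \<in> PZ (- c)"
proof (cases "k = -\<infinity>")
  case False
  then obtain n where n: "k = ereal (real_of_int n)" using assms by (auto simp: Zbar_def)
  hence "n \<le> c" using assms by simp
  thus ?thesis using n PZ_monoD[OF powi_PZ, of "- c" "- n"] by (simp add: T_ppow ppow_real_def)
qed (simp add: T_ppow)

lemma T_Zp_PZ: "x \<in> Zp p ==> T x K \<in> PZ 0"
  using T_Zp by (simp add: PZ_zero_eq)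

lemma ppow_real_PZ: assumes "k \<in> Zbar" "k \<le> ereal (real_of_int c)" shows "ppow_real k \<in> PZ (- c)"
proof (cases "k = -\<infinity>")
  case False
  then obtain n where n: "k = ereal (real_of_int n)" using assms by (auto simp: Zbar_def)
  hence "n \<le> c" using assms by simp
  thus ?thesis using n PZ_monoD[OF powi_PZ, of "- c" "- n"] by (simp add: ppow_real_def)
qed (simp add: ppow_real_def)

lemma rs_diff: assumes "x \<in> Zp p" "K \<le> L" shows "tr p x L - real (rs K x) \<in> PZ (int K)"
  using T_diff[OF Zp_Qp[OF assms(1)], of "int K" "int L"] assms T_rs[OF assms(1), of K] by (simp add: tr_eq_T)

text \<open>The factor \<open>ppow_real k\<close> has denominator at most \<open>p^K\<close>, so
  modulo Z only the residue of \<open>z\<close> modulo \<open>p^K\<close> counts.\<close>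

lemma T_ppow_mult:
  assumes k: "k \<in> Zbar" "k \<le> ereal (real_of_int (int K))" and z: "z \<in> Zp p"
  shows "T (qp_mult p (qp_ppow p k) z) 0 - ppow_real k * real (rs K z) \<in> \<int>"
proof -
  have "plim (\<lambda>L. ppow_real k * tr p z L) (qp_mult p (qp_ppow p k) z)"
    by (intro plim_mult plim_ppow plim_tr Zp_Qp z)
  hence "\<forall>\<^sub>F L in sequentially. ppow_real k * tr p z L - T (qp_mult p (qp_ppow p k) z) 0 \<in> PZ 0" by (simp add: plim_def)
  then obtain L0 where "\<forall>L\<ge>L0. ppow_real k * tr p z L - T (qp_mult p (qp_ppow p k) z) 0 \<in> PZ 0"
    unfolding eventually_sequentially by (elim exE) (rule that)
  hence 1: "ppow_real k * tr p z (max L0 K) - T (qp_mult p (qp_ppow p k) z) 0 \<in> PZ 0" by simp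
  have "ppow_real k * (tr p z (max L0 K) - real (rs K z)) \<in> PZ (- int K + int K)"
    by (intro PZ_mult ppow_real_PZ k rs_diff z) simp
  hence "ppow_real k * tr p z (max L0 K) - ppow_real k * real (rs K z) \<in> PZ 0" by (simp add: right_diff_distrib)
  thus ?thesis using PZ_trans[OF PZ_diff_commute[OF 1]] by (simp add: PZ_zero_eq)
qed

lemma rs_mult: assumes x: "x \<in> Zp p" and y: "y \<in> Zp p"
  shows "real (rs K (qp_mult p x y)) - real (rs K x) * real (rs K y) \<in> PZ (int K)"
proof -
  have xy: "qp_mult p x y \<in> Zp p" by (rule qp_mult_Zp[OF x y])
  have "plim (\<lambda>L. tr p x L * tr p y L) (qp_mult p x y)" by (intro plim_mult plim_tr Zp_Qp x y)
  hence "\<forall>\<^sub>F L in sequentially. tr p x L * tr p y L - T (qp_mult p x y) (int K) \<in> PZ (int K)" by (simp add: plim_def)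
  then obtain L0 where "\<forall>L\<ge>L0. tr p x L * tr p y L - T (qp_mult p x y) (int K) \<in> PZ (int K)"
    unfolding eventually_sequentially by (elim exE) (rule that)
  hence 1: "tr p x (max L0 K) * tr p y (max L0 K) - real (rs K (qp_mult p x y)) \<in> PZ (int K)"
    using T_rs[OF xy, of K] by simp
  let ?a = "tr p x (max L0 K)" and ?b = "tr p y (max L0 K)"
  have ab: "?a - real (rs K x) \<in> PZ (int K)" "?b - real (rs K y) \<in> PZ (int K)" using rs_diff x y by auto
  have "(?a - real (rs K x)) * ?b \<in> PZ (int K)"
    using PZ_int_mult[OF T_Zp[OF y, of "int (max L0 K)"] ab(1)] by (simp add: tr_eq_T mult.commute)
  moreover have "real (rs K x) * (?b - real (rs K y)) \<in> PZ (int K)" by (rule PZ_int_mult[OF _ ab(2)]) simp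
  ultimately have "(?a - real (rs K x)) * ?b + real (rs K x) * (?b - real (rs K y)) \<in> PZ (int K)" by (rule PZ_add)
  hence "?a * ?b - real (rs K x) * real (rs K y) \<in> PZ (int K)" by (simp add: algebra_simps)
  thus ?thesis using PZ_trans[OF PZ_diff_commute[OF 1]] by blast
qed

lemma T_ppow_mult2:
  assumes k: "k \<in> Zbar" "k \<le> ereal (real_of_int (int K))" and x: "x \<in> Zp p" and y: "y \<in> Zp p"
  shows "T (qp_mult p (qp_ppow p k) (qp_mult p x y)) 0 - ppow_real k * (real (rs K x) * real (rs K y)) \<in> \<int>"
proof -
  have "ppow_real k * (real (rs K (qp_mult p x y)) - real (rs K x) * real (rs K y)) \<in> PZ (- int K + int K)"
    by (intro PZ_mult ppow_real_PZ k rs_mult x y)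
  hence "ppow_real k * real (rs K (qp_mult p x y)) - ppow_real k * (real (rs K x) * real (rs K y)) \<in> \<int>"
    by (simp add: right_diff_distrib PZ_zero_eq)
  from Ints_add[OF T_ppow_mult[OF k qp_mult_Zp[OF x y]] this] show ?thesis by simp
qed

definition Aterm :: "(nat \<Rightarrow> ereal) \<Rightarrow> (nat \<times> nat \<times> nat \<Rightarrow> qp) \<Rightarrow> nat \<Rightarrow> nat \<Rightarrow> nat \<Rightarrow> qp" where
  "Aterm k w i j N = (if k N > klim k then qp_mult p (qp_ppow p (k N)) (qp_mult p (w (0, N, i)) (w (1, N, j))) else qp_zero)"

lemma Amat_Aterm: "Amat p k w (i, j) = qp_add p (qp_suminf p (Aterm k w i j)) (qp_mult p (qp_ppow p (klim k)) (w (2, i, j)))"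
  by (simp add: Amat_def Aterm_def[abs_def])

lemma Delta_Zbar: "k \<in> Delta ==> k N \<in> Zbar" by (simp add: Delta_def)
lemma Delta_mono: "k \<in> Delta ==> M \<le> N ==> k N \<le> k M" by (simp add: Delta_def decseq_def)

lemma klim_le: "klim k \<le> k N" unfolding klim_def by (rule INF_lower) simp

text \<open>A decreasing integer sequence that is bounded below is eventually constant; any other
  decreasing sequence in \<open>Zbar\<close> falls below every integer.\<close>

lemma klim_cases:
  assumes k: "k \<in> Delta"
  shows "(klim k = -\<infinity> \<and> (\<forall>c::int. \<exists>N. \<forall>n\<ge>N. k n \<le> ereal (real_of_int c)))
    \<or> (\<exists>c::int. klim k = ereal (real_of_int c) \<and> (\<exists>N. \<forall>n\<ge>N. k n = klim k))"
proof (cases "\<exists>c::int. \<forall>n. ereal (real_of_int c) \<le> k n")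
  case False
  have le: "\<exists>N. \<forall>n\<ge>N. k n \<le> ereal (real_of_int c)" for c :: int
  proof -
    obtain N where "\<not> ereal (real_of_int c) \<le> k N" using False by blast
    hence "k N \<le> ereal (real_of_int c)" by simp
    thus ?thesis using Delta_mono[OF k] order_trans by blast
  qed
  have "klim k = -\<infinity>"
  proof (rule ereal_bot)
    fix B :: real
    obtain N where "\<forall>n\<ge>N. k n \<le> ereal (real_of_int \<lfloor>B\<rfloor>)" using le by blast
    hence "k N \<le> ereal (real_of_int \<lfloor>B\<rfloor>)" by blast
    also have "\<dots> \<le> ereal B" by simp
    finally show "klim k \<le> ereal B" using klim_le order_trans by blast
  qed
  thus ?thesis using le by blast
next
  case True
  then obtain c where c: "\<And>n. ereal (real_of_int c) \<le> k n" by blast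
  have ex: "\<exists>m. k n = ereal (real_of_int m)" for n
  proof -
    have "k n \<noteq> -\<infinity>" using c[of n] by auto
    thus ?thesis using Delta_Zbar[OF k, of n] by (auto simp: Zbar_def)
  qed
  then obtain m where m: "\<And>n. k n = ereal (real_of_int (m n))" by metis
  have "\<exists>d n. m n - c = int d" using c m by (metis ereal_less_eq(3) int_nat_eq of_int_le_iff diff_ge_0_iff_ge)
  \<comment> \<open>The least term is found through its distance to the lower bound
    \<open>c\<close>, which is a natural number.\<close>
  define D where "D = (LEAST d. \<exists>n. nat (m n - c) = d)"
  have "\<exists>n. nat (m n - c) = D" unfolding D_def by (rule LeastI[of _ "nat (m 0 - c)"]) blast
  then obtain n0 where n0: "nat (m n0 - c) = D" by blast
  have mc: "m n \<ge> c" for n using c[of n] m by simp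
  have min: "m n0 \<le> m n" for n
  proof -
    have "D \<le> nat (m n - c)" unfolding D_def by (rule Least_le) blast
    thus ?thesis using n0 mc[of n] mc[of n0] by linarith
  qed
  have eq: "k n = k n0" if "n \<ge> n0" for n using Delta_mono[OF k that] min[of n] m by simp
  have "klim k = k n0" unfolding klim_def
    by (rule antisym, rule INF_lower, simp, rule INF_greatest) (use min m in simp)
  thus ?thesis using eq m by metis
qed

text \<open>The tail is small in both cases of \<open>klim_cases\<close>: if \<open>k\<close> falls
  to \<open>-\<infinity>\<close>, because of the powers of \<open>p\<close>; if \<open>k\<close> is
  eventually constant, because terms with \<open>k N = klim k\<close> are replaced by 0.\<close>

lemma Aterm_props:
  assumes k: "k \<in> Delta" and w: "\<And>q. w q \<in> Zp p" and k0: "k 0 \<le> ereal (real_of_int c)"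
  shows "Aterm k w i j N \<in> Qp p" "T (Aterm k w i j N) K \<in> PZ (- c)"
    "\<exists>N0. \<forall>n\<ge>N0. \<forall>K. T (Aterm k w i j n) K \<in> PZ e"
    "k N \<le> ereal (real_of_int d) ==> T (Aterm k w i j N) K \<in> PZ (- d)"
proof -
  show Q: "Aterm k w i j N \<in> Qp p" for N
    unfolding Aterm_def by (auto intro!: qp_mult_Qp qp_ppow_Qp Zp_Qp[OF w] qp_zero_Qp)
  show P: "T (Aterm k w i j N) K \<in> PZ (- d)" if "k N \<le> ereal (real_of_int d)" for N K d
  proof -
    have "T (qp_mult p (qp_ppow p (k N)) (qp_mult p (w (0, N, i)) (w (1, N, j)))) K \<in> PZ (- d + 0)"
      by (intro T_mult_PZ qp_ppow_Qp Zp_Qp qp_mult_Zp w T_ppow_PZ that Delta_Zbar k T_Zp_PZ)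
    thus ?thesis by (simp add: Aterm_def)
  qed
  show "T (Aterm k w i j N) K \<in> PZ (- c)" using P Delta_mono[OF k, of 0 N] k0 order_trans by blast
  show "\<exists>N0. \<forall>n\<ge>N0. \<forall>K. T (Aterm k w i j n) K \<in> PZ e"
    using klim_cases[OF k]
  proof
    assume "klim k = -\<infinity> \<and> (\<forall>c::int. \<exists>N. \<forall>n\<ge>N. k n \<le> ereal (real_of_int c))"
    then obtain N where "\<forall>n\<ge>N. k n \<le> ereal (real_of_int (- e))" by blast
    thus ?thesis using P[of _ "- e"] by (intro exI[of _ N]) simp
  next
    assume "\<exists>c::int. klim k = ereal (real_of_int c) \<and> (\<exists>N. \<forall>n\<ge>N. k n = klim k)"
    then obtain N where "\<forall>n\<ge>N. k n = klim k" by blast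
    thus ?thesis by (intro exI[of _ N]) (simp add: Aterm_def)
  qed
qed

lemma Delta_bound: assumes "k \<in> Delta" shows "\<exists>K::nat. k 0 \<le> ereal (real_of_int (int K))"
proof (cases "k 0 = -\<infinity>")
  case False
  then obtain n where "k 0 = ereal (real_of_int n)" using Delta_Zbar[OF assms, of 0] by (auto simp: Zbar_def)
  thus ?thesis by (intro exI[of _ "nat n"]) simp
qed simp

lemma Amat_Qp: assumes k: "k \<in> Delta" and w: "\<And>q. w q \<in> Zp p" shows "Amat p k w (i, j) \<in> Qp p"
proof -
  obtain K :: nat where K: "k 0 \<le> ereal (real_of_int (int K))" using Delta_bound[OF k] by blast
  note pr = Aterm_props[OF k w K]
  have "qp_suminf p (Aterm k w i j) \<in> Qp p"
    using plim_Qp[OF plim_suminf[of "Aterm k w i j", OF pr(1,2,3)]] .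
  thus ?thesis unfolding Amat_Aterm by (intro qp_add_Qp qp_mult_Qp qp_ppow_Qp Zp_Qp[OF w])
qed

lemma klim_Zbar: "k \<in> Delta ==> klim k \<in> Zbar"
  using klim_cases[of k] by (auto simp: Zbar_def)

text \<open>Expresses an entry modulo Z_p by finitely many residues modulo \<open>p^K\<close>, so
  that \<open>residue_law\<close> applies to corner events.\<close>

lemma Amat_T0:
  assumes k: "k \<in> Delta" and w: "\<And>q. w q \<in> Zp p" and K: "k 0 \<le> ereal (real_of_int (int K))"
    and N0: "\<And>n. n \<ge> N0 ==> k n = klim k"
  shows "T (Amat p k w (i, j)) 0 - ((\<Sum>n<N0. if k n > klim k then ppow_real (k n) * (real (rs K (w (0, n, i))) * real (rs K (w (1, n, j)))) else 0)
     + ppow_real (klim k) * real (rs K (w (2, i, j)))) \<in> \<int>"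
proof -
  let ?S = "qp_suminf p (Aterm k w i j)" and ?Z = "qp_mult p (qp_ppow p (klim k)) (w (2, i, j))"
  note pr = Aterm_props[OF k w K]
  have SQ: "?S \<in> Qp p" using plim_Qp[OF plim_suminf[of "Aterm k w i j", OF pr(1,2,3)]] .
  have ZQ: "?Z \<in> Qp p" by (intro qp_mult_Qp qp_ppow_Qp Zp_Qp w)
  have 1: "T (Amat p k w (i, j)) 0 - (T ?S 0 + T ?Z 0) \<in> PZ 0" unfolding Amat_Aterm by (rule T_add[OF SQ ZQ])
  have 2: "T ?S 0 - (\<Sum>n<N0. T (Aterm k w i j n) 0) \<in> PZ 0"
    by (rule T_suminf_finite[OF pr(1,2,3)]) (use N0 in \<open>simp add: Aterm_def\<close>)
  have 3: "(\<Sum>n<N0. T (Aterm k w i j n) 0 - (if k n > klim k then ppow_real (k n) * (real (rs K (w (0, n, i))) * real (rs K (w (1, n, j)))) else 0)) \<in> PZ 0"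
  proof (rule PZ_sum)
    fix n
    have "k n \<le> ereal (real_of_int (int K))" using Delta_mono[OF k, of 0 n] K order_trans by blast
    from T_ppow_mult2[OF Delta_Zbar[OF k] this w w]
    show "T (Aterm k w i j n) 0 - (if k n > klim k then ppow_real (k n) * (real (rs K (w (0, n, i))) * real (rs K (w (1, n, j)))) else 0) \<in> PZ 0"
      by (simp add: Aterm_def PZ_zero_eq)
  qed
  have "klim k \<le> ereal (real_of_int (int K))" using klim_le K order_trans by blast
  from T_ppow_mult[OF klim_Zbar[OF k] this w]
  have 4: "T ?Z 0 - ppow_real (klim k) * real (rs K (w (2, i, j))) \<in> PZ 0" by (simp add: PZ_zero_eq)
  have eq: "T (Amat p k w (i, j)) 0 - ((\<Sum>n<N0. if k n > klim k then ppow_real (k n) * (real (rs K (w (0, n, i))) * real (rs K (w (1, n, j)))) else 0)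
     + ppow_real (klim k) * real (rs K (w (2, i, j))))
    = (T (Amat p k w (i, j)) 0 - (T ?S 0 + T ?Z 0)) + ((T ?S 0 - (\<Sum>n<N0. T (Aterm k w i j n) 0))
      + ((\<Sum>n<N0. T (Aterm k w i j n) 0 - (if k n > klim k then ppow_real (k n) * (real (rs K (w (0, n, i))) * real (rs K (w (1, n, j)))) else 0))
      + (T ?Z 0 - ppow_real (klim k) * real (rs K (w (2, i, j))))))"
    unfolding sum_subtractf by linarith
  show ?thesis unfolding eq PZ_zero_eq[symmetric] by (intro PZ_add 1 2 3 4)
qed

text \<open>From \<open>R\<close> on the terms are divisible by \<open>p\<close> because
  \<open>k n \<le> -1\<close>. The first \<open>R\<close> terms have denominators at most
  \<open>p^K\<close>, which the factor \<open>p^(K+1)\<close> in the row variables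
  outweighs.\<close>

lemma Amat_small:
  assumes k: "k \<in> Delta" and w: "\<And>q. w q \<in> Zp p" and K: "k 0 \<le> ereal (real_of_int (int K))"
    and R: "k R \<le> ereal (real_of_int (-1))" and div: "\<And>n. n < R ==> w (0, n, i) \<in> cyl qp_zero (int (Suc K))"
  shows "Amat p k w (i, j) \<in> cyl qp_zero 1"
proof -
  let ?S = "qp_suminf p (Aterm k w i j)" and ?Z = "qp_mult p (qp_ppow p (klim k)) (w (2, i, j))"
  note pr = Aterm_props[OF k w K]
  have SQ: "?S \<in> Qp p" using plim_Qp[OF plim_suminf[of "Aterm k w i j", OF pr(1,2,3)]] .
  have ZQ: "?Z \<in> Qp p" by (intro qp_mult_Qp qp_ppow_Qp Zp_Qp w)
  have trm: "T (Aterm k w i j n) L \<in> PZ 1" for n L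
  proof (cases "n < R")
    case True
    have kn: "k n \<le> ereal (real_of_int (int K))" using Delta_mono[OF k, of 0 n] K order_trans by blast
    have "T (w (0, n, i)) L \<in> PZ (int (Suc K))" for L
      by (rule T_PZ) (use div[OF True] in \<open>simp add: cyl_def qp_zero_def\<close>)
    hence "T (qp_mult p (w (0, n, i)) (w (1, n, j))) L \<in> PZ (int (Suc K) + 0)" for L
      by (intro T_mult_PZ Zp_Qp w T_Zp_PZ)
    moreover have "qp_mult p (w (0, n, i)) (w (1, n, j)) \<in> Qp p" by (intro qp_mult_Qp Zp_Qp[OF w])
    ultimately have "T (qp_mult p (qp_ppow p (k n)) (qp_mult p (w (0, n, i)) (w (1, n, j)))) L \<in> PZ (- int K + (int (Suc K) + 0))"
      using T_mult_PZ[OF qp_ppow_Qp _ T_ppow_PZ[OF Delta_Zbar[OF k] kn]] by blast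
    thus ?thesis by (simp add: Aterm_def)
  next
    case False
    hence "k n \<le> ereal (real_of_int (-1))" using Delta_mono[OF k, of R n] R order_trans by (meson not_less)
    from pr(4)[OF this] show ?thesis by simp
  qed
  have "T ?S 1 - (\<Sum>n<0. T (Aterm k w i j n) 1) \<in> PZ 1"
    by (rule T_suminf_finite[OF pr(1,2,3)]) (rule trm)
  hence S1: "T ?S 1 \<in> PZ 1" by simp
  have "klim k \<le> ereal (real_of_int (-1))" using klim_le R order_trans by blast
  hence "T ?Z 1 \<in> PZ (- (-1) + 0)"
    by (intro T_mult_PZ qp_ppow_Qp Zp_Qp w T_ppow_PZ klim_Zbar k T_Zp_PZ)
  hence Z1: "T ?Z 1 \<in> PZ 1" by simp
  have "T (Amat p k w (i, j)) 1 - (T ?S 1 + T ?Z 1) \<in> PZ 1" unfolding Amat_Aterm by (rule T_add[OF SQ ZQ])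
  from PZ_add[OF this PZ_add[OF S1 Z1]] have "T (Amat p k w (i, j)) 1 - T qp_zero 1 \<in> PZ 1" by simp
  moreover have "Amat p k w (i, j) \<in> Qp p" by (rule Amat_Qp[OF k w])
  ultimately show ?thesis using cyl_iff[OF _ qp_zero_Qp] by blast
qed

text \<open>\<open>distr\<close> along a map that is not measurable may be the zero measure. Mass 1
  is what identifies \<open>mu p k\<close> with the image measure, see
  \<open>proper_emeasure\<close>.\<close>

definition proper :: "(nat \<Rightarrow> ereal) \<Rightarrow> bool" where
  "proper k \<longleftrightarrow> measure (mu p k) (space (matinf p)) = 1"

lemma space_matinf: "space (matinf p) = UNIV \<rightarrow>\<^sub>E Qp p" by (simp add: matinf_def space_PiM space_qp)

lemma sets_mu [simp]: "sets (mu p k) = sets (matinf p)" by (simp add: mu_def)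
lemma space_mu [simp]: "space (mu p k) = space (matinf p)" by (simp add: mu_def)

lemma prob_space_Omega: "prob_space (Omega p)"
  unfolding Omega_def by (rule prob_space_PiM) (rule prob_space_haarZp)

text \<open>If the image formula is not a measure, \<open>measure_of\<close> falls back to 0; in
  either case the mass is at most 1.\<close>

lemma emeasure_mu_conv:
  "emeasure (mu p k) A = (if A \<in> sets (matinf p) \<and> measure_space (space (matinf p)) (sets (matinf p))
      (\<lambda>A. emeasure (Omega p) (Amat p k -` A \<inter> space (Omega p)))
    then emeasure (Omega p) (Amat p k -` A \<inter> space (Omega p)) else 0)"
  unfolding mu_def distr_def
  by (subst emeasure_measure_of_conv) (simp_all add: sets.sigma_sets_eq sets.space_closed)

lemma emeasure_mu_le: "emeasure (mu p k) A \<le> 1"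
proof -
  interpret prob_space "Omega p" by (rule prob_space_Omega)
  show ?thesis unfolding emeasure_mu_conv by (simp add: emeasure_le_1)
qed

lemma finite_measure_mu: "finite_measure (mu p k)"
  by (rule finite_measureI) (use emeasure_mu_le[of k "space (mu p k)"] in \<open>auto simp: top_unique\<close>)

lemma measure_mu_le: "measure (mu p k) A \<le> 1"
  using emeasure_mu_le[of k A] finite_measure.emeasure_eq_measure[OF finite_measure_mu, of k A] by simp

lemma proper_emeasure: assumes "proper k" "A \<in> sets (matinf p)"
  shows "emeasure (mu p k) A = emeasure (Omega p) (Amat p k -` A \<inter> space (Omega p))"
proof -
  have "emeasure (mu p k) (space (matinf p)) \<noteq> 0" using assms(1) by (auto simp: proper_def measure_def)
  thus ?thesis using assms(2) unfolding emeasure_mu_conv by (auto split: if_splits)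
qed

text \<open>Bounds pass through a measurable event \<open>D\<close> of the underlying space, since
  the preimage of \<open>A\<close> under \<open>Amat\<close> may fail to be measurable; in that case
  its \<open>emeasure\<close> is 0.\<close>

lemma mu_upper:
  assumes "proper k" "A \<in> sets (matinf p)" "D \<in> sets (Omega p)" "AE w in Omega p. Amat p k w \<in> A \<longrightarrow> w \<in> D"
  shows "measure (mu p k) A \<le> measure (Omega p) D"
proof -
  interpret O: prob_space "Omega p" by (rule prob_space_Omega)
  interpret F: finite_measure "mu p k" by (rule finite_measure_mu)
  have "emeasure (mu p k) A \<le> emeasure (Omega p) D"
    unfolding proper_emeasure[OF assms(1,2)]
  proof (cases "Amat p k -` A \<inter> space (Omega p) \<in> sets (Omega p)")
    case True
    show "emeasure (Omega p) (Amat p k -` A \<inter> space (Omega p)) \<le> emeasure (Omega p) D"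
      by (rule emeasure_mono_AE[OF _ assms(3)]) (use assms(4) in \<open>auto elim: AE_mp\<close>)
  qed (simp add: emeasure_notin_sets)
  thus ?thesis by (simp add: O.emeasure_eq_measure F.emeasure_eq_measure)
qed

text \<open>The upper bound for the complement, as both total masses are 1.\<close>

lemma mu_lower:
  assumes "proper k" "A \<in> sets (matinf p)" "D \<in> sets (Omega p)" "AE w in Omega p. w \<in> D \<longrightarrow> Amat p k w \<in> A"
  shows "measure (Omega p) D \<le> measure (mu p k) A"
proof -
  interpret O: prob_space "Omega p" by (rule prob_space_Omega)
  interpret F: finite_measure "mu p k" by (rule finite_measure_mu)
  have "measure (mu p k) (space (matinf p) - A) \<le> measure (Omega p) (space (Omega p) - D)"
    by (rule mu_upper[OF assms(1)]) (use assms AE_space[of "Omega p"] in \<open>auto elim!: AE_mp\<close>)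
  moreover have "measure (mu p k) (space (matinf p) - A) = 1 - measure (mu p k) A"
    using F.finite_measure_compl[of A] assms by (simp add: proper_def)
  moreover have "measure (Omega p) (space (Omega p) - D) = 1 - measure (Omega p) D"
    using O.prob_compl[OF assms(3)] .
  ultimately show ?thesis by simp
qed

lemma AE_Omega_Zp: "AE w in Omega p. \<forall>q. w q \<in> Zp p"
  using AE_Zp[of "UNIV :: (nat \<times> nat \<times> nat) set", OF countableI_type] unfolding Omega_def ball_UNIV .

end

section \<open>Corner events\<close>

lemma qpoch_inf_limit:
  assumes "0 \<le> a" "a < 1" "0 < q" "q < 1"
  shows "qpoch a q \<longlonglongrightarrow> qpoch_inf a q" "qpoch_inf a q > 0"
proof -
  let ?f = "\<lambda>j. 1 - a * q ^ j"
  have pos: "0 < ?f j" for j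
  proof -
    have "a * q ^ j \<le> a * 1" using assms by (intro mult_left_mono power_le_one) auto
    thus ?thesis using assms by simp
  qed
  have "summable (\<lambda>j. norm (?f j - 1))" using assms by (simp add: abs_mult power_abs summable_mult summable_geometric)
  hence "abs_convergent_prod ?f" by (rule summable_imp_abs_convergent_prod)
  hence cp: "convergent_prod ?f" by (rule abs_convergent_prod_imp_convergent_prod)
  have "(\<lambda>n. \<Prod>j\<le>n. ?f j) \<longlonglongrightarrow> prodinf ?f" by (rule convergent_prod_LIMSEQ[OF cp])
  hence "(\<lambda>n. qpoch a q (Suc n)) \<longlonglongrightarrow> qpoch_inf a q"
    by (simp add: qpoch_def qpoch_inf_def lessThan_Suc_atMost)
  thus lim: "qpoch a q \<longlonglongrightarrow> qpoch_inf a q" by (rule LIMSEQ_imp_Suc)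
  have "qpoch_inf a q \<noteq> 0" unfolding qpoch_inf_def using prodinf_nonzero[OF cp] pos by (metis less_irrefl)
  moreover have "0 \<le> qpoch a q n" for n unfolding qpoch_def by (rule prod_nonneg) (use pos in \<open>simp add: less_imp_le\<close>)
  hence "0 \<le> qpoch_inf a q" by (intro LIMSEQ_le_const[OF lim]) auto
  ultimately show "qpoch_inf a q > 0" by simp
qed

context hua
begin

lemma a_bounds: "0 < real p powr (-1 - s)" "real p powr (-1 - s) < 1"
proof -
  have "real p powr (-1 - s) = theta 0" unfolding theta_def by (rule arg_cong2[of _ _ _ _ "(powr)"]) auto
  thus "0 < real p powr (-1 - s)" "real p powr (-1 - s) < 1" using theta[of 0] by auto
qed

lemma q_bounds: "0 < 1 / real p" "1 / real p < 1" using p_gt1 by auto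

lemma kap_le1: "kap N M \<le> 1"
proof -
  have "(1 - theta n) / (1 - theta n / real p ^ M) \<le> 1" for n
  proof -
    have "1 \<le> real p ^ M" using p_gt1 by (simp add: one_le_power)
    hence "theta n / real p ^ M \<le> theta n" using theta[of n] p_gt1 by (intro divide_left_mono[of 1 "real p ^ M" "theta n", simplified]) auto
    thus ?thesis using theta_M[of n M] by simp
  qed
  moreover have "0 \<le> (1 - theta n) / (1 - theta n / real p ^ M)" for n using theta[of n] theta_M[of n M] by simp
  ultimately show ?thesis unfolding kap_def by (intro prod_le_1) auto
qed

lemma cN_le1: "cN s N \<le> 1" using kap_le1 kap_cN by metis

text \<open>Both \<open>(a; q)_N\<close> and \<open>(a; q)_(2N)\<close> tend to the infinite
  product, so the square in the numerator leaves one copy.\<close>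

lemma cN_limit: "cN s \<longlonglongrightarrow> qpoch_inf (real p powr (-1 - s)) (1 / real p)"
proof -
  let ?a = "real p powr (-1 - s)" and ?q = "1 / real p"
  have lim: "qpoch ?a ?q \<longlonglongrightarrow> qpoch_inf ?a ?q" and pos: "qpoch_inf ?a ?q > 0"
    using qpoch_inf_limit[of ?a ?q] a_bounds q_bounds by auto
  have lim2: "(\<lambda>N. qpoch ?a ?q (2 * N)) \<longlonglongrightarrow> qpoch_inf ?a ?q"
    using LIMSEQ_subseq_LIMSEQ[OF lim, of "\<lambda>N. 2 * N"] by (simp add: strict_mono_def o_def)
  have "(\<lambda>N. qpoch ?a ?q N ^ 2 / qpoch ?a ?q (2 * N)) \<longlonglongrightarrow> qpoch_inf ?a ?q ^ 2 / qpoch_inf ?a ?q"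
    by (intro tendsto_divide tendsto_power lim lim2) (use pos in simp)
  thus ?thesis using pos by (simp add: cN_def[abs_def] power2_eq_square)
qed

definition boxset :: "nat \<Rightarrow> (nat \<times> nat \<Rightarrow> qp) \<Rightarrow> nat \<Rightarrow> (nat \<times> nat \<Rightarrow> qp) set" where
  "boxset N z e = {Z \<in> space (matinf p). \<forall>i<N. \<forall>j<N. Z (i, j) \<in> cyl (z (i, j)) (int e)}"

lemma boxset_corner: "boxset N z e = corner N -` (\<Pi>\<^sub>E q\<in>sq N. cyl (z q) (int e)) \<inter> space (matinf p)"
  by (auto simp: boxset_def corner_def PiE_def Pi_def)

lemma boxset_sets [simp]: "boxset N z e \<in> sets (matinf p)"
  unfolding boxset_corner by (rule measurable_sets[OF corner_measurable]) (rule sets_PiM_I_finite, auto)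

lemma Ms_corner_measure:
  assumes "B \<in> sets (PiM (sq N) (\<lambda>_. qp_space p))"
  shows "measure (Ms p s) (corner N -` B \<inter> space (matinf p)) = measure (MN p s N) B"
proof -
  have "corner N \<in> measurable (Ms p s) (PiM (sq N) (\<lambda>_. qp_space p))"
    using corner_measurable measurable_cong_sets[OF sets_Ms refl] by blast
  from measure_distr[OF this, of B] show ?thesis
    using assms sets_eq_imp_space_eq[OF sets_Ms] by (simp add: distr_Ms_corner)
qed

lemma Ms_boxset:
  assumes z: "\<And>q. q \<in> sq N ==> z q \<in> Qp p"
  shows "measure (Ms p s) (boxset N z e) = cN s N * gma N z powr (- s - 2 * real N) / real p ^ (N * N * e)"
proof -
  have "measure (Ms p s) (boxset N z e) = measure (MN p s N) (\<Pi>\<^sub>E q\<in>sq N. cyl (z q) (int e))"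
    unfolding boxset_corner by (rule Ms_corner_measure) (rule sets_PiM_I_finite, auto)
  also have "\<dots> = cN s N * gma N z powr (- s - 2 * real N) / real p ^ (\<Sum>q\<in>sq N. e)"
    using emeasure_MN_box[of N z s "\<lambda>_. e"] z cN_pos[of N] by (simp add: measure_def)
  finally show ?thesis by simp
qed

lemma emeasure_MN_space: "emeasure (MN p s N) (space (MN p s N)) = 1"
proof -
  have c: "corner N \<in> measurable (Ms p s) (PiM (sq N) (\<lambda>_. qp_space p))"
    using corner_measurable measurable_cong_sets[OF sets_Ms refl] by blast
  interpret prob_space "MN p s N"
    unfolding distr_Ms_corner[symmetric] by (rule prob_space.prob_space_distr[OF prob_space_Ms c])
  show ?thesis by (rule emeasure_space_1)
qed

text \<open>Comparing the densities for \<open>s\<close> and \<open>s' < s\<close> bounds the tail of \<open>\<gamma>\<close>.\<close>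

lemma MN_tail:
  assumes s': "s' > -1" "s' < s" and N: "N \<ge> 1"
  shows "measure (MN p s N) {Z \<in> space (MN p s N). gma N Z \<ge> real N} \<le> real N powr (- (s - s')) / cN s' N"
proof -
  interpret S: hua p s' by unfold_locales (use s' in auto)
  let ?B = "{Z \<in> space (MN p s N). gma N Z \<ge> real N}"
  have spMN: "space (MN p s'' N) = space (matvol p N)" "sets (MN p s'' N) = sets (matvol p N)" for s'' by (simp_all add: MN_eq)
  have g [measurable]: "gma N \<in> borel_measurable (matvol p N)" by (rule gma_measurable[OF sets_matvol])
  have B: "?B \<in> sets (matvol p N)" unfolding spMN by measurable
  have c: "0 < cN s' N" "0 < cN s N" "cN s N \<le> 1" using S.cN_pos cN_pos cN_le1 by auto
  have "emeasure (MN p s N) ?B = (\<integral>\<^sup>+Z. ennreal (cN s N * gma N Z powr (- s - 2 * real N)) * indicator ?B Z \<partial>matvol p N)"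
    unfolding MN_eq[of s N] by (rule emeasure_density) (use B in \<open>simp_all add: spMN MN_eq[of s N]\<close>)
  also have "\<dots> \<le> (\<integral>\<^sup>+Z. ennreal (real N powr (- (s - s')) / cN s' N) * ennreal (cN s' N * gma N Z powr (- s' - 2 * real N)) \<partial>matvol p N)"
  proof (rule nn_integral_mono)
    fix Z
    show "ennreal (cN s N * gma N Z powr (- s - 2 * real N)) * indicator ?B Z
      \<le> ennreal (real N powr (- (s - s')) / cN s' N) * ennreal (cN s' N * gma N Z powr (- s' - 2 * real N))"
    proof (cases "Z \<in> ?B")
      case True
      hence gN: "gma N Z \<ge> real N" by simp
      have "- s - 2 * real N = - (s - s') + (- s' - 2 * real N)" by simp
      hence "gma N Z powr (- s - 2 * real N) = gma N Z powr (- (s - s')) * gma N Z powr (- s' - 2 * real N)"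
        by (simp only: powr_add)
      moreover have "gma N Z powr (- (s - s')) \<le> real N powr (- (s - s'))"
        using gN N s' by (intro powr_mono2') auto
      ultimately have "cN s N * gma N Z powr (- s - 2 * real N) \<le> 1 * (real N powr (- (s - s')) * gma N Z powr (- s' - 2 * real N))"
        using c by (intro mult_mono) (auto intro: mult_right_mono)
      also have "\<dots> = real N powr (- (s - s')) / cN s' N * (cN s' N * gma N Z powr (- s' - 2 * real N))" using c by simp
      finally show ?thesis using True c by (simp add: ennreal_mult[symmetric] ennreal_leI)
    qed simp
  qed
  also have "\<dots> = ennreal (real N powr (- (s - s')) / cN s' N) * (\<integral>\<^sup>+Z. ennreal (cN s' N * gma N Z powr (- s' - 2 * real N)) \<partial>matvol p N)"
    by (rule nn_integral_cmult) measurable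
  also have "(\<integral>\<^sup>+Z. ennreal (cN s' N * gma N Z powr (- s' - 2 * real N)) \<partial>matvol p N) = emeasure (MN p s' N) (space (MN p s' N))"
    unfolding MN_eq[of s' N] by (subst emeasure_density) (auto intro!: nn_integral_cong)
  also have "\<dots> = 1" by (rule S.emeasure_MN_space)
  finally have "emeasure (MN p s N) ?B \<le> ennreal (real N powr (- (s - s')) / cN s' N)" by simp
  thus ?thesis unfolding measure_def using c by (intro enn2real_leI) auto
qed

text \<open>The digits at negative positions make up the fractional part, so two rows agree modulo
  Z_p in the first \<open>N\<close> columns.\<close>

definition eqrows :: "nat \<Rightarrow> (nat \<times> nat \<Rightarrow> qp) set" where
  "eqrows N = {Z \<in> space (matinf p). \<exists>i<N. \<exists>i'<i. \<forall>j<N. \<forall>d::int. d < 0 \<longrightarrow> Z (i, j) d = Z (i', j) d}"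

lemma coord_measurable: "(\<lambda>Z. Z q) \<in> measurable (matinf p) (qp_space p)"
  unfolding matinf_def by (rule measurable_component_singleton) simp

lemma eqrows_sets: "eqrows N \<in> sets (matinf p)"
proof -
  have [measurable]: "(\<lambda>Z. Z q d) \<in> measurable (matinf p) (count_space UNIV)" for q d
    by (rule measurable_compose[OF coord_measurable digit_measurable])
  show ?thesis unfolding eqrows_def by measurable
qed

text \<open>Pigeonhole: \<open>N\<close> rows in a row group with fewer than \<open>N\<close>
  elements.\<close>

lemma eqrows_of_small:
  assumes Z: "Z \<in> space (matinf p)" and small: "gma N (corner N Z) < real N"
  shows "Z \<in> eqrows N"
proof -
  let ?t = "\<lambda>i j. T (Z (i, j)) 0"
  have ZQ: "Z q \<in> Qp p" for q using Z by (auto simp: space_matinf)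
  have rg: "rg N N (\<lambda>i j. T (corner N Z (i, j)) 0) = rg N N ?t" by (rule rg_cong) (simp add: corner_def)
  define row where "row = (\<lambda>i j. if j < N then frac (?t i j) else 0)"
  have mem: "row i \<in> rg N N ?t" if i: "i < N" for i
  proof (rule rgI[where v = "\<lambda>l. if l = i then 1 else 0"])
    fix j
    have "(\<Sum>l<N. real_of_int (if l = i then 1 else 0) * ?t l j) = (\<Sum>l<N. if l = i then ?t l j else 0)"
      by (rule sum.cong) auto
    thus "row i j = (if j < N then frac (\<Sum>l<N. real_of_int (if l = i then 1 else 0) * ?t l j) else 0)"
      using i by (simp add: row_def)
  qed
  have fin: "finite (rg N N ?t)"
  proof -
    obtain K where "\<And>i m. i < N ==> m < N ==> ?t i m \<in> PZ (- int K)" using common_denominator[of N N "\<lambda>i j. Z (i, j)"] ZQ by blast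
    thus ?thesis using PZ_neg_iff p_gt1 by (intro rg_finite[where q = "int (p ^ K)"]) auto
  qed
  have "\<not> inj_on row {..<N}"
  proof
    assume "inj_on row {..<N}"
    hence "card {..<N} \<le> card (rg N N ?t)" using mem fin by (intro card_inj_on_le[of row]) auto
    thus False using small by (simp add: gma_def rg)
  qed
  then obtain i i' where ii: "i < N" "i' < N" "i \<noteq> i'" "row i = row i'" by (auto simp: inj_on_def)
  have *: "\<forall>j<N. \<forall>d::int. d < 0 \<longrightarrow> Z (a, j) d = Z (b, j) d" if ab: "row a = row b" for a b
  proof (intro allI impI)
    fix j and d :: int assume j: "j < N" "d < 0"
    have "frac (?t a j) = frac (?t b j)" using fun_cong[OF ab, of j] j by (simp add: row_def)
    hence "?t a j - ?t b j \<in> PZ 0" by (simp add: frac_eq_iff_diff PZ_zero_eq)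
    thus "Z (a, j) d = Z (b, j) d" using T_cong_iff[OF ZQ ZQ] j by blast
  qed
  show ?thesis
  proof (cases "i' < i")
    case True thus ?thesis using ii *[OF ii(4)] Z unfolding eqrows_def by blast
  next
    case False
    hence "i < i'" using ii by simp
    thus ?thesis using ii *[OF ii(4)[symmetric]] Z unfolding eqrows_def by blast
  qed
qed

text \<open>By pigeonhole it suffices that gamma of the corner is below \<open>N\<close> with
  probability tending to 1, and \<open>MN_tail\<close> bounds the opposite event.\<close>

lemma Ms_eqrows: "(\<lambda>N. measure (Ms p s) (eqrows N)) \<longlonglongrightarrow> 1"
proof -
  interpret M: prob_space "Ms p s" by (rule prob_space_Ms)
  \<comment> \<open>The midpoint of -1 and \<open>s\<close>: an admissible parameter strictly below
    \<open>s\<close>.\<close>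
  define s' where "s' = (s - 1) / 2"
  have s': "s' > -1" "s' < s" using s_gt by (auto simp: s'_def)
  interpret S: hua p s' by unfold_locales (use s' in auto)
  have spM: "space (Ms p s) = space (matinf p)" by (rule sets_eq_imp_space_eq[OF sets_Ms])
  have low: "1 - real N powr (- (s - s')) / cN s' N \<le> measure (Ms p s) (eqrows N)" if N: "N \<ge> 1" for N
  proof -
    let ?B = "{Z \<in> space (MN p s N). gma N Z \<ge> real N}"
    have sMN: "sets (MN p s N) = sets (PiM (sq N) (\<lambda>_. qp_space p))" by (simp add: MN_eq sets_matvol)
    have g [measurable]: "gma N \<in> borel_measurable (MN p s N)" by (rule gma_measurable[OF sMN])
    have "?B \<in> sets (MN p s N)" by measurable
    hence B: "?B \<in> sets (PiM (sq N) (\<lambda>_. qp_space p))" using sMN by simp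
    have C: "corner N -` ?B \<inter> space (matinf p) \<in> sets (Ms p s)"
      using measurable_sets[OF corner_measurable B] by (simp add: sets_Ms)
    have sub: "space (Ms p s) - (corner N -` ?B \<inter> space (matinf p)) \<subseteq> eqrows N"
    proof
      fix Z assume Z: "Z \<in> space (Ms p s) - (corner N -` ?B \<inter> space (matinf p))"
      hence Zs: "Z \<in> space (matinf p)" by (simp add: spM)
      have "corner N Z \<in> space (MN p s N)"
        using measurable_space[OF corner_measurable Zs] sets_eq_imp_space_eq[OF sMN] by simp
      hence "gma N (corner N Z) < real N" using Z Zs by auto
      thus "Z \<in> eqrows N" by (rule eqrows_of_small[OF Zs])
    qed
    have "1 - measure (Ms p s) (corner N -` ?B \<inter> space (matinf p)) = measure (Ms p s) (space (Ms p s) - (corner N -` ?B \<inter> space (matinf p)))"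
      using M.prob_compl[OF C] by simp
    also have "\<dots> \<le> measure (Ms p s) (eqrows N)"
      by (rule M.finite_measure_mono[OF sub]) (simp add: sets_Ms eqrows_sets)
    finally show ?thesis using Ms_corner_measure[OF B] MN_tail[OF s' N] by simp
  qed
  have lim: "(\<lambda>N. 1 - real N powr (- (s - s')) / cN s' N) \<longlonglongrightarrow> 1 - 0 / qpoch_inf (real p powr (-1 - s')) (1 / real p)"
  proof (intro tendsto_diff tendsto_const tendsto_divide S.cN_limit)
    show "(\<lambda>N. real N powr (- (s - s'))) \<longlonglongrightarrow> 0"
      by (rule tendsto_neg_powr) (use s' filterlim_real_sequentially in auto)
    show "qpoch_inf (real p powr (-1 - s')) (1 / real p) \<noteq> 0"
      using qpoch_inf_limit(2)[of "real p powr (-1 - s')" "1 / real p"] S.a_bounds q_bounds by auto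
  qed
  show ?thesis
  proof (rule tendsto_sandwich)
    show "(\<lambda>N. 1 - real N powr (- (s - s')) / cN s' N) \<longlonglongrightarrow> 1" using lim by simp
    show "\<forall>\<^sub>F N in sequentially. 1 - real N powr (- (s - s')) / cN s' N \<le> measure (Ms p s) (eqrows N)"
      using low unfolding eventually_sequentially by blast
    show "\<forall>\<^sub>F N in sequentially. measure (Ms p s) (eqrows N) \<le> 1" by simp
  qed simp
qed

end

section \<open>Support of the decomposing measure\<close>

lemma space_delta: "space delta_space = Delta" by (auto simp: delta_space_def space_restrict_space space_PiM Delta_def)

lemma delta_coord_sets: "{k \<in> Delta. P (k j)} \<in> sets delta_space"
proof -
  have "(\<lambda>k. k j) \<in> measurable delta_space (count_space Zbar)"
    unfolding delta_space_def by (rule measurable_restrict_space1) (rule measurable_component_singleton, simp)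
  from measurable_sets[OF this, of "{x \<in> Zbar. P x}"]
  have "(\<lambda>k. k j) -` {x \<in> Zbar. P x} \<inter> space delta_space \<in> sets delta_space" by simp
  also have "(\<lambda>k. k j) -` {x \<in> Zbar. P x} \<inter> space delta_space = {k \<in> Delta. P (k j)}" by (auto simp: space_delta Delta_def)
  finally show ?thesis .
qed

lemma delta_all_sets: "{k \<in> Delta. \<forall>j. P j (k j)} \<in> sets delta_space"
proof -
  have "{k \<in> Delta. \<forall>j. P j (k j)} = (\<Inter>j. {k \<in> Delta. P j (k j)})" by auto
  also have "\<dots> \<in> sets delta_space" by (rule sets.countable_INT) (auto intro: delta_coord_sets)
  finally show ?thesis .
qed

lemma delta_singleton_sets: "k \<in> Delta ==> {k} \<in> sets delta_space"
proof -
  assume "k \<in> Delta"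
  hence "{k} = {k' \<in> Delta. \<forall>j. k' j = k j}" by auto
  thus ?thesis using delta_all_sets[of "\<lambda>j x. x = k j"] by simp
qed

locale decomp = hua +
  fixes \<nu> :: "(nat \<Rightarrow> ereal) measure"
  assumes prob_nu: "prob_space \<nu>" and sets_nu: "sets \<nu> = sets delta_space"
    and decomposition: "\<forall>F :: (nat \<times> nat \<Rightarrow> qp) \<Rightarrow> real. F \<in> borel_measurable (matinf p) \<and> bounded (F ` space (matinf p)) \<longrightarrow>
           (\<integral>Z. F Z \<partial>Ms p s) = (\<integral>k. (\<integral>Z. F Z \<partial>mu p k) \<partial>\<nu>)"
begin

sublocale N: prob_space \<nu> by (rule prob_nu)

lemma space_nu: "space \<nu> = Delta" using sets_eq_imp_space_eq[OF sets_nu] space_delta by simp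

lemma Ms_decomp: assumes A: "A \<in> sets (matinf p)"
  shows "measure (Ms p s) A = (\<integral>k. measure (mu p k) A \<partial>\<nu>)"
proof -
  have "(indicator A :: _ \<Rightarrow> real) \<in> borel_measurable (matinf p)" using A by simp
  moreover have "bounded ((indicator A :: _ \<Rightarrow> real) ` space (matinf p))"
    by (rule bounded_subset[of "{0, 1}"]) (auto simp: indicator_def)
  ultimately have "(\<integral>Z. indicator A Z \<partial>Ms p s) = (\<integral>k. (\<integral>Z. (indicator A Z :: real) \<partial>mu p k) \<partial>\<nu>)" using decomposition by blast
  moreover have "A \<inter> space (Ms p s) = A" "A \<inter> space (mu p k) = A" for k
    using sets.sets_into_space[OF A] sets_eq_imp_space_eq[OF sets_Ms] by auto
  ultimately show ?thesis by simp
qed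

text \<open>A non-integrable function has Bochner integral \<open>0\<close>, so no measurability of \<open>\<mu>\<^sub>k\<close> in \<open>k\<close> is needed.\<close>

lemma integrable_mu: assumes "A \<in> sets (matinf p)" "measure (Ms p s) A > 0"
  shows "integrable \<nu> (\<lambda>k. measure (mu p k) A)"
  using Ms_decomp[OF assms(1)] assms(2) not_integrable_integral_eq by fastforce

text \<open>The masses of the measures \<open>\<mu>\<^sub>k\<close> are at most 1 and integrate to
  1, so almost all of them equal 1.\<close>

lemma AE_proper: "AE k in \<nu>. proper k"
proof -
  let ?S = "space (matinf p)"
  interpret M: prob_space "Ms p s" by (rule prob_space_Ms)
  have 1: "measure (Ms p s) ?S = 1" using M.prob_space sets_eq_imp_space_eq[OF sets_Ms] by simp
  have i: "integrable \<nu> (\<lambda>k. measure (mu p k) ?S)" by (rule integrable_mu) (use 1 in auto)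
  have i': "integrable \<nu> (\<lambda>k. 1 - measure (mu p k) ?S)" using i by simp
  have "(\<integral>k. 1 - measure (mu p k) ?S \<partial>\<nu>) = 0" using i 1 Ms_decomp[of ?S] N.prob_space by simp
  hence "AE k in \<nu>. 1 - measure (mu p k) ?S = 0"
    using integral_nonneg_eq_0_iff_AE[OF i'] measure_mu_le by simp
  thus ?thesis by (rule AE_mp) (simp add: proper_def)
qed

lemma decomp_lower:
  assumes A: "A \<in> sets (matinf p)" "measure (Ms p s) A > 0" and B: "B \<in> sets delta_space"
    and le: "\<And>k. k \<in> B ==> proper k ==> c \<le> measure (mu p k) A"
  shows "c * measure \<nu> B \<le> measure (Ms p s) A"
proof -
  have "c * measure \<nu> B = (\<integral>k. c * indicator B k \<partial>\<nu>)" using sets.sets_into_space[OF B] by (simp add: space_nu space_delta Int_absorb2)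
  also have "\<dots> \<le> (\<integral>k. measure (mu p k) A \<partial>\<nu>)"
  proof (rule integral_mono_AE)
    show "integrable \<nu> (\<lambda>k. c * indicator B k)" using B sets_nu by (intro integrable_mult_right integrable_real_indicator) (auto simp: N.emeasure_eq_measure)
    show "integrable \<nu> (\<lambda>k. measure (mu p k) A)" by (rule integrable_mu[OF A])
    show "AE k in \<nu>. c * indicator B k \<le> measure (mu p k) A"
      using AE_proper by (rule AE_mp) (use le in \<open>auto simp: indicator_def\<close>)
  qed
  finally show ?thesis using Ms_decomp[OF A(1)] by simp
qed

text \<open>On \<open>B\<close> the event has probability at most \<open>c\<close>, elsewhere at
  most 1. If \<open>A\<close> has mass near 1 and \<open>c\<close> is small, then \<open>B\<close>
  must have small mass.\<close>

lemma decomp_upper: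
  assumes A: "A \<in> sets (matinf p)" "measure (Ms p s) A > 0" and B: "B \<in> sets delta_space" and c: "0 \<le> c"
    and le: "\<And>k. k \<in> B ==> proper k ==> measure (mu p k) A \<le> c"
  shows "measure (Ms p s) A + measure \<nu> B \<le> 1 + c"
proof -
  have iB: "integrable \<nu> (\<lambda>k. indicator B k :: real)" using B sets_nu by (intro integrable_real_indicator) (auto simp: N.emeasure_eq_measure)
  have "(\<integral>k. measure (mu p k) A \<partial>\<nu>) \<le> (\<integral>k. (1 + c) - indicator B k \<partial>\<nu>)"
  proof (rule integral_mono_AE)
    show "integrable \<nu> (\<lambda>k. (1 + c) - indicator B k)" using iB by simp
    show "integrable \<nu> (\<lambda>k. measure (mu p k) A)" by (rule integrable_mu[OF A])
    show "AE k in \<nu>. measure (mu p k) A \<le> (1 + c) - indicator B k"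
      using AE_proper
    proof (rule AE_mp, intro AE_I2 impI)
      fix k assume "proper k"
      thus "measure (mu p k) A \<le> (1 + c) - indicator B k"
        using le[of k] measure_mu_le[of k A] c by (auto simp: indicator_def)
    qed
  qed
  also have "\<dots> = 1 + c - measure \<nu> B"
    using iB N.prob_space sets.sets_into_space[OF B] by (simp add: space_nu space_delta Int_absorb2)
  finally show ?thesis using Ms_decomp[OF A(1)] by simp
qed

text \<open>It is enough that in each of the \<open>n\<close> rows the first \<open>R\<close> row
  variables are divisible by \<open>p^(K+1)\<close>: these are \<open>R n\<close> independent
  conditions of probability \<open>p^(-(K+1))\<close> each.\<close>

lemma mu_small:
  assumes k: "k \<in> Delta" "proper k" and K: "k 0 \<le> ereal (real_of_int (int K))" and R: "k R \<le> ereal (real_of_int (-1))"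
  shows "1 / real p ^ (Suc K * (R * n)) \<le> measure (mu p k) (boxset n (\<lambda>_. qp_zero) 1)"
proof -
  interpret P: product_prob_space "\<lambda>_. haarZp p" "UNIV :: (nat \<times> nat \<times> nat) set" by (rule product_prob_haarZp)
  let ?J = "{0::nat} \<times> {..<R} \<times> {..<n}"
  let ?D = "{w \<in> space (Omega p). \<forall>j\<in>?J. w j \<in> cyl qp_zero (int (Suc K))}"
  have D: "?D \<in> sets (Omega p)"
  proof -
    have "{w \<in> space (Omega p). w j \<in> cyl qp_zero (int (Suc K))} \<in> sets (Omega p)" for j
      using measurable_sets[OF measurable_component_singleton[of j UNIV "\<lambda>_. haarZp p"], of "cyl qp_zero (int (Suc K))"]
      by (simp add: Omega_def vimage_def Int_def conj_commute)
    thus ?thesis by (intro sets.sets_Collect_finite_All) auto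
  qed
  have "emeasure (Omega p) ?D = (\<Prod>j\<in>?J. emeasure (haarZp p) (cyl qp_zero (int (Suc K))))"
    unfolding Omega_def by (rule P.emeasure_PiM_Collect) auto
  also have "\<dots> = ennreal (1 / real p ^ Suc K) ^ (R * n)" by (simp only: emeasure_haarZp_cyl[OF qp_zero_Zp] prod_constant) simp
  also have "\<dots> = ennreal (1 / real p ^ (Suc K * (R * n)))" by (simp add: ennreal_power power_divide power_mult[symmetric] del: power_Suc)
  finally have "measure (Omega p) ?D = 1 / real p ^ (Suc K * (R * n))" by (simp add: measure_def del: power_Suc)
  moreover have "measure (Omega p) ?D \<le> measure (mu p k) (boxset n (\<lambda>_. qp_zero) 1)"
  proof (rule mu_lower[OF k(2) boxset_sets D], rule AE_mp[OF AE_Omega_Zp], intro AE_I2 impI)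
    fix w assume w: "\<forall>q. w q \<in> Zp p" and wD: "w \<in> ?D"
    have "Amat p k w (i, j) \<in> cyl qp_zero 1" if "i < n" for i j
      by (rule Amat_small[OF k(1) _ K R]) (use w wD that in auto)
    moreover have "Amat p k w \<in> space (matinf p)" using Amat_Qp[OF k(1)] w by (auto simp: space_matinf)
    ultimately show "Amat p k w \<in> boxset n (\<lambda>_. qp_zero) 1" by (auto simp: boxset_def)
  qed
  ultimately show ?thesis by simp
qed

text \<open>The corner lies in \<open>p Z_p\<close> with probability at most
  \<open>p^(-n\<^sup>2)\<close> under \<open>M\<^sup>(\<^sup>s\<^sup>)\<close>, but at least
  \<open>p^(-(K+1)Rn)\<close> under \<open>\<mu>\<^sub>k\<close>: a quadratic against a linear
  exponent. The bound on \<open>k 0\<close> makes the second estimate uniform.\<close>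

lemma negative_null:
  fixes R K :: nat
  shows "measure \<nu> {k \<in> Delta. k R \<le> ereal (real_of_int (-1)) \<and> k 0 \<le> ereal (real_of_int (int K))} = 0" (is "measure \<nu> ?D = 0")
proof -
  have D: "?D \<in> sets delta_space"
  proof -
    have "?D = {k \<in> Delta. k R \<le> ereal (real_of_int (-1))} \<inter> {k \<in> Delta. k 0 \<le> ereal (real_of_int (int K))}" by auto
    also have "\<dots> \<in> sets delta_space" by (intro sets.Int delta_coord_sets)
    finally show ?thesis .
  qed
  have le: "measure \<nu> ?D \<le> (1 / real p) ^ m" if m: "m \<ge> 1" for m
  proof -
    \<comment> \<open>With this size \<open>n\<^sup>2 - (K+1)Rn\<close> equals \<open>m n\<close>,
      which is at least \<open>m\<close>.\<close>
    define n where "n = Suc K * R + m"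
    have n1: "n \<ge> 1" using m by (simp add: n_def)
    have g: "gma n (\<lambda>_. qp_zero) \<ge> 1" by (rule gma_ge1) (simp add: qp_zero_Qp)
    have "gma n (\<lambda>_. qp_zero) powr (- s - 2 * real n) \<le> gma n (\<lambda>_. qp_zero) powr 0"
      by (rule powr_mono) (use g s_gt n1 in auto)
    hence g1: "gma n (\<lambda>_. qp_zero) powr (- s - 2 * real n) \<le> 1" using g by simp
    have M: "measure (Ms p s) (boxset n (\<lambda>_. qp_zero) 1) = cN s n * gma n (\<lambda>_. qp_zero) powr (- s - 2 * real n) / real p ^ (n * n)"
      using Ms_boxset[of n "\<lambda>_. qp_zero" 1] by (simp add: qp_zero_Qp)
    have pos: "measure (Ms p s) (boxset n (\<lambda>_. qp_zero) 1) > 0"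
      unfolding M using cN_pos[of n] g p_gt1 by simp
    have "cN s n * gma n (\<lambda>_. qp_zero) powr (- s - 2 * real n) \<le> 1 * 1"
      by (rule mult_mono) (use cN_le1 g1 in auto)
    hence M1: "measure (Ms p s) (boxset n (\<lambda>_. qp_zero) 1) \<le> 1 / real p ^ (n * n)"
      unfolding M using p_gt1 by (intro divide_right_mono) auto
    have "1 / real p ^ (Suc K * (R * n)) * measure \<nu> ?D \<le> measure (Ms p s) (boxset n (\<lambda>_. qp_zero) 1)"
      by (rule decomp_lower[OF boxset_sets pos D]) (use mu_small in auto)
    hence "1 / real p ^ (Suc K * (R * n)) * measure \<nu> ?D \<le> 1 / real p ^ (n * n)" using M1 by (rule order_trans)
    hence "measure \<nu> ?D \<le> real p ^ (Suc K * (R * n)) * (1 / real p ^ (n * n))"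
      using p_gt1 by (simp add: divide_le_eq mult.commute del: mult_Suc)
    also have "n * n = Suc K * (R * n) + m * n" by (simp add: n_def algebra_simps)
    also have "real p ^ (Suc K * (R * n)) * (1 / real p ^ (Suc K * (R * n) + m * n)) = (1 / real p) ^ (m * n)"
      using p_gt1 by (simp add: power_add power_divide del: mult_Suc)
    also have "\<dots> \<le> (1 / real p) ^ m" by (rule power_decreasing) (use n1 p_gt1 in auto)
    finally show ?thesis .
  qed
  have "(\<lambda>m. (1 / real p) ^ m) \<longlonglongrightarrow> 0" by (rule LIMSEQ_realpow_zero) (use p_gt1 in auto)
  hence "measure \<nu> ?D \<le> 0" by (rule LIMSEQ_le_const) (use le in blast)
  thus ?thesis by (simp add: measure_le_0_iff)
qed

lemma AE_not_mem: assumes "B \<in> sets delta_space" "measure \<nu> B = 0" shows "AE k in \<nu>. k \<notin> B"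
  by (rule AE_I[of _ _ B]) (use assms sets_nu N.emeasure_eq_measure in auto)

lemma Zbar_neg: "x \<in> Zbar ==> \<not> 0 \<le> x ==> x \<le> ereal (real_of_int (-1))"
  by (auto simp: Zbar_def)

text \<open>Every \<open>k 0\<close> lies below some natural number, so countably many null sets
  exhaust the sequences with a negative term.\<close>

lemma AE_nonneg: "AE k in \<nu>. \<forall>R. 0 \<le> k R"
proof -
  have "AE k in \<nu>. k \<notin> {k \<in> Delta. k R \<le> ereal (real_of_int (-1)) \<and> k 0 \<le> ereal (real_of_int (int K))}" for R K :: nat
  proof (rule AE_not_mem[OF _ negative_null])
    have "{k \<in> Delta. k R \<le> ereal (real_of_int (-1)) \<and> k 0 \<le> ereal (real_of_int (int K))}
      = {k \<in> Delta. k R \<le> ereal (real_of_int (-1))} \<inter> {k \<in> Delta. k 0 \<le> ereal (real_of_int (int K))}" by auto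
    also have "\<dots> \<in> sets delta_space" by (intro sets.Int delta_coord_sets)
    finally show "{k \<in> Delta. k R \<le> ereal (real_of_int (-1)) \<and> k 0 \<le> ereal (real_of_int (int K))} \<in> sets delta_space" .
  qed
  hence "AE k in \<nu>. \<forall>R K. k \<notin> {k \<in> Delta. k R \<le> ereal (real_of_int (-1)) \<and> k 0 \<le> ereal (real_of_int (int K))}"
    by (simp only: AE_all_countable) blast
  thus ?thesis
  proof (rule AE_mp, intro AE_I2 impI allI)
    fix k R assume "k \<in> space \<nu>" and nm: "\<forall>R K. k \<notin> {k \<in> Delta. k R \<le> ereal (real_of_int (-1)) \<and> k 0 \<le> ereal (real_of_int (int K))}"
    hence kD: "k \<in> Delta" by (simp add: space_nu)
    obtain K :: nat where "k 0 \<le> ereal (real_of_int (int K))" using Delta_bound[OF kD] by blast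
    hence "\<not> k R \<le> ereal (real_of_int (-1))" using nm kD by blast
    thus "0 \<le> k R" using Zbar_neg[OF Delta_Zbar[OF kD]] by blast
  qed
qed

end

text \<open>Once the coordinates outside \<open>S\<close> are fixed, only the quotient of
  \<open>v j\<close> by \<open>p^c\<close> is free for \<open>j\<close> in \<open>S\<close>; each
  such coordinate loses a factor \<open>p^c\<close>.\<close>

lemma card_determined:
  fixes p c K :: nat
  assumes J: "finite J" "S \<subseteq> J" and c: "c \<le> K" and p: "p > 0"
    and det: "\<And>v v'. v \<in> J \<rightarrow>\<^sub>E {..<p ^ K} ==> v' \<in> J \<rightarrow>\<^sub>E {..<p ^ K} ==> Q v ==> Q v' ==> (\<And>j. j \<notin> S ==> v j = v' j)
      ==> \<forall>j\<in>S. v j mod p ^ c = v' j mod p ^ c"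
  shows "real (card {v \<in> J \<rightarrow>\<^sub>E {..<p ^ K}. Q v}) \<le> real p ^ (K * card J) / real p ^ (c * card S)"
proof -
  let ?V = "{v \<in> J \<rightarrow>\<^sub>E {..<p ^ K}. Q v}"
  let ?W = "((J - S) \<rightarrow>\<^sub>E {..<p ^ K}) \<times> (S \<rightarrow>\<^sub>E {..<p ^ (K - c)})"
  let ?f = "\<lambda>v. (restrict v (J - S), restrict (\<lambda>j. v j div p ^ c) S)"
  have pK: "p ^ K = p ^ (K - c) * p ^ c" using c by (simp add: power_add[symmetric])
  have fS: "finite S" using J finite_subset by blast
  have "inj_on ?f ?V"
  proof (rule inj_onI)
    fix v v' assume v: "v \<in> ?V" and v': "v' \<in> ?V" and eq: "?f v = ?f v'"
    have e1: "v j = v' j" if "j \<in> J - S" for j using eq that by (metis (no_types, lifting) Pair_inject restrict_apply')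
    have e2: "v j div p ^ c = v' j div p ^ c" if "j \<in> S" for j
    proof -
      have "restrict (\<lambda>j. v j div p ^ c) S j = restrict (\<lambda>j. v' j div p ^ c) S j" using eq by (metis (no_types, lifting) Pair_inject)
      thus ?thesis using that by simp
    qed
    have out: "v j = v' j" if "j \<notin> S" for j
    proof (cases "j \<in> J")
      case False thus ?thesis using v v' by (simp add: PiE_def extensional_def)
    qed (use e1 that in auto)
    have m: "\<forall>j\<in>S. v j mod p ^ c = v' j mod p ^ c" by (rule det) (use v v' out in auto)
    show "v = v'"
    proof
      fix j show "v j = v' j"
      proof (cases "j \<in> S")
        case True
        have "v j = v j div p ^ c * p ^ c + v j mod p ^ c" by (simp only: div_mult_mod_eq)
        also have "\<dots> = v' j div p ^ c * p ^ c + v' j mod p ^ c" using e2[OF True] m True by (simp only:)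
        finally show ?thesis by (simp only: div_mult_mod_eq)
      qed (rule out)
    qed
  qed
  moreover have "?f ` ?V \<subseteq> ?W"
  proof (rule image_subsetI)
    fix v assume v: "v \<in> ?V"
    have b: "v j < p ^ K" if "j \<in> J" for j using v that by (auto simp: PiE_iff)
    have "v j div p ^ c < p ^ (K - c)" if "j \<in> S" for j
      using b[of j] that J(2) p by (intro less_mult_imp_div_less) (auto simp: pK)
    thus "?f v \<in> ?W" using b by auto
  qed
  moreover have "finite ?W" using J fS by (intro finite_cartesian_product finite_PiE) auto
  ultimately have "card ?V \<le> card ?W" by (rule card_inj_on_le)
  also have "card ?W = p ^ (K * card (J - S)) * p ^ ((K - c) * card S)"
    using J fS by (simp add: card_PiE card_cartesian_product power_mult)
  finally have "card ?V \<le> p ^ (K * card (J - S)) * p ^ ((K - c) * card S)" .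
  moreover have "K * card J = K * card (J - S) + (K - c) * card S + c * card S"
  proof -
    have "card J = card (J - S) + card S" using J fS by (simp add: card_Diff_subset card_mono)
    moreover have "K * card S = (K - c) * card S + c * card S" using c by (simp add: add_mult_distrib[symmetric])
    ultimately show ?thesis by (simp add: add_mult_distrib2)
  qed
  hence "p ^ (K * card J) = p ^ (K * card (J - S)) * p ^ ((K - c) * card S) * p ^ (c * card S)" by (simp add: power_add)
  ultimately have "card ?V * p ^ (c * card S) \<le> p ^ (K * card J)" by simp
  hence "real (card ?V) * real p ^ (c * card S) \<le> real p ^ (K * card J)" by (metis of_nat_le_iff of_nat_mult of_nat_power)
  thus ?thesis using p by (simp add: field_simps)
qed

context padic
begin

lemma dvd_of_ppow: assumes "real_of_int a * real p powi (- int c) \<in> \<int>" shows "int (p ^ c) dvd a"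
proof -
  have "real p powi (- int c) = 1 / real (p ^ c)" by (simp add: power_int_minus divide_inverse)
  moreover obtain n where n: "real_of_int a * real p powi (- int c) = of_int n" using assms by (auto simp: Ints_def)
  ultimately have "real_of_int a / real (p ^ c) = of_int n" by simp
  hence "real_of_int a = of_int (n * int (p ^ c))" using p_gt1 by (simp add: divide_eq_eq)
  hence "a = n * int (p ^ c)" by (simp only: of_int_eq_iff)
  thus ?thesis by simp
qed

lemma mod_eq_of_ppow: assumes "(real a - real b) * real p powi (- int c) \<in> \<int>" shows "a mod p ^ c = b mod p ^ c"
proof -
  have "int (p ^ c) dvd int a - int b" by (rule dvd_of_ppow) (use assms in simp)
  hence "int a mod int (p ^ c) = int b mod int (p ^ c)" by (simp add: mod_eq_dvd_iff)
  thus ?thesis by (metis of_nat_eq_iff zmod_int)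
qed

end

context hua
begin

text \<open>Here \<open>klim k = c\<close> with \<open>c \<ge> 1\<close>, so the term
  \<open>p^(-c) Z_ij\<close> is visible modulo Z_p. For two given rows, agreement in column
  \<open>j\<close> determines \<open>Z_ij\<close> modulo \<open>p^c\<close> from the other
  variables. Over \<open>N\<close> columns this has probability at most \<open>p^(-N)\<close>, and
  there are at most \<open>N\<^sup>2\<close> pairs of rows.\<close>

lemma mu_eqrows:
  assumes k: "k \<in> Delta" "proper k" and pos: "\<And>R. 1 \<le> k R"
  shows "measure (mu p k) (eqrows N) \<le> real N ^ 2 / real p ^ N"
proof -
  have "\<not> (\<forall>c::int. \<exists>N. \<forall>n\<ge>N. k n \<le> ereal (real_of_int c))"
  proof
    assume "\<forall>c::int. \<exists>N. \<forall>n\<ge>N. k n \<le> ereal (real_of_int c)"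
    then obtain n where "k n \<le> ereal (real_of_int 0)" by blast
    thus False using pos[of n] by (metis ereal_less_eq(3) ereal_less_eq(5) not_one_le_zero of_int_0 one_ereal_def order_trans)
  qed
  then obtain c :: int and N0 where c: "klim k = ereal (real_of_int c)" and N0: "\<And>n. n \<ge> N0 ==> k n = klim k"
    using klim_cases[OF k(1)] by blast
  have c1: "c \<ge> 1" using pos[of N0] N0[of N0] c by (simp add: one_ereal_def)
  define c0 where "c0 = nat c"
  have c0: "c = int c0" "c0 \<ge> 1" using c1 by (auto simp: c0_def)
  obtain K :: nat where K: "k 0 \<le> ereal (real_of_int (int K))" using Delta_bound[OF k(1)] by blast
  have cK: "c0 \<le> K" using order_trans[OF klim_le[of k 0] K] by (simp add: c c0(1))
  \<comment> \<open>The middle index is the summation index, below \<open>N0\<close>, for the first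
    two families and a row index, below \<open>N\<close>, for the third; the maximum covers
    both.\<close>
  define J :: "(nat \<times> nat \<times> nat) set" where "J = {..<3} \<times> {..<max N N0} \<times> {..<N}"
  have fJ: "finite J" by (simp add: J_def)
  define E :: "(nat \<times> nat \<times> nat \<Rightarrow> nat) \<Rightarrow> nat \<Rightarrow> nat \<Rightarrow> real" where
    "E v i j = (\<Sum>n<N0. if k n > klim k then ppow_real (k n) * (real (v (0, n, i)) * real (v (1, n, j))) else 0)
      + ppow_real (klim k) * real (v (2, i, j))" for v i j
  define Q where "Q v \<longleftrightarrow> (\<exists>i<N. \<exists>i'<i. \<forall>j<N. E v i j - E v i' j \<in> \<int>)" for v
  let ?D = "{w \<in> space (Omega p). Q (restrict (\<lambda>j. rs K (w j)) J)}"
  have D: "?D \<in> sets (Omega p)" unfolding Omega_def by (rule residue_law(1)) (use fJ in auto)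
  have mD: "measure (Omega p) ?D = real (card {v \<in> J \<rightarrow>\<^sub>E {..<p ^ K}. Q v}) / real p ^ (K * card J)"
    unfolding Omega_def by (rule residue_law(2)) (use fJ in auto)
  have "measure (mu p k) (eqrows N) \<le> measure (Omega p) ?D"
  proof (rule mu_upper[OF k(2) eqrows_sets D], rule AE_mp[OF AE_Omega_Zp], intro AE_I2 impI)
    fix w assume wS: "w \<in> space (Omega p)" and w: "\<forall>q. w q \<in> Zp p" and ev: "Amat p k w \<in> eqrows N"
    from ev obtain i i' where ii: "i < N" "i' < i" and eq: "\<forall>j<N. \<forall>d::int. d < 0 \<longrightarrow> Amat p k w (i, j) d = Amat p k w (i', j) d"
      unfolding eqrows_def by (elim CollectE conjE exE) (rule that)
    let ?v = "restrict (\<lambda>j. rs K (w j)) J"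
    have AE: "T (Amat p k w (l, j)) 0 - E ?v l j \<in> \<int>" if "l < N" "j < N" for l j
    proof -
      have "E ?v l j = (\<Sum>n<N0. if k n > klim k then ppow_real (k n) * (real (rs K (w (0, n, l))) * real (rs K (w (1, n, j)))) else 0)
          + ppow_real (klim k) * real (rs K (w (2, l, j)))"
        unfolding E_def by (intro arg_cong2[of _ _ _ _ "(+)"] sum.cong if_cong refl) (use that in \<open>auto simp: J_def\<close>)
      thus ?thesis by (simp only:) (rule Amat_T0[OF k(1) _ K N0], use w in auto)
    qed
    have "E ?v i j - E ?v i' j \<in> \<int>" if j: "j < N" for j
    proof -
      have "T (Amat p k w (i, j)) 0 = T (Amat p k w (i', j)) 0"
        unfolding T_def by (intro sum.cong) (use eq j in auto)
      moreover have "T (Amat p k w (i, j)) 0 - E ?v i j \<in> \<int>" "T (Amat p k w (i', j)) 0 - E ?v i' j \<in> \<int>"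
        using AE ii j by auto
      hence "(T (Amat p k w (i', j)) 0 - E ?v i' j) - (T (Amat p k w (i, j)) 0 - E ?v i j) \<in> \<int>" by (rule Ints_diff[rotated])
      ultimately show ?thesis by simp
    qed
    hence "Q ?v" unfolding Q_def using ii by blast
    thus "w \<in> ?D" using wS by simp
  qed
  also have "\<dots> \<le> real N ^ 2 / real p ^ N"
  proof -
    let ?Q = "\<lambda>i i' v. \<forall>j<N. E v i j - E v i' j \<in> \<int>"
    let ?P = "{..<N} \<times> {..<N}"
    have one: "real (card {v \<in> J \<rightarrow>\<^sub>E {..<p ^ K}. ?Q i i' v}) \<le> real p ^ (K * card J) / real p ^ N" if ii: "i < N" "i' < i" for i i'
    proof -
      let ?S = "{2::nat} \<times> {i} \<times> {..<N}"
      have "real (card {v \<in> J \<rightarrow>\<^sub>E {..<p ^ K}. ?Q i i' v}) \<le> real p ^ (K * card J) / real p ^ (c0 * card ?S)"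
      proof (rule card_determined[OF fJ _ cK])
        show "?S \<subseteq> J" using ii by (auto simp: J_def)
        show "p > 0" using p_gt1 by simp
        fix v v' assume Qv: "?Q i i' v" "?Q i i' v'" and out: "\<And>j. j \<notin> ?S ==> v j = v' j"
        have "v (2, i, j) mod p ^ c0 = v' (2, i, j) mod p ^ c0" if j: "j < N" for j
        proof (rule mod_eq_of_ppow)
          have o: "v (0, n, i) = v' (0, n, i)" "v (1, n, j) = v' (1, n, j)" "v (0, n, i') = v' (0, n, i')" "v (2, i', j) = v' (2, i', j)" for n
            using out ii by auto
          have "(E v i j - E v i' j) - (E v' i j - E v' i' j) \<in> \<int>" by (rule Ints_diff) (use Qv j in auto)
          moreover have "(E v i j - E v i' j) - (E v' i j - E v' i' j) = ppow_real (klim k) * (real (v (2, i, j)) - real (v' (2, i, j)))"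
            unfolding E_def o by (simp add: algebra_simps)
          ultimately show "(real (v (2, i, j)) - real (v' (2, i, j))) * real p powi (- int c0) \<in> \<int>"
            by (simp add: ppow_real_def c c0(1) mult.commute)
        qed
        thus "\<forall>j\<in>?S. v j mod p ^ c0 = v' j mod p ^ c0" by auto
      qed
      also have "\<dots> \<le> real p ^ (K * card J) / real p ^ N"
        using c0(2) p_gt1 by (intro divide_left_mono power_increasing) (auto simp: card_cartesian_product)
      finally show ?thesis .
    qed
    have "{v \<in> J \<rightarrow>\<^sub>E {..<p ^ K}. Q v} = (\<Union>q\<in>{q \<in> ?P. snd q < fst q}. {v \<in> J \<rightarrow>\<^sub>E {..<p ^ K}. ?Q (fst q) (snd q) v})" (is "?V = ?U")
    proof
      show "?V \<subseteq> ?U"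
      proof
        fix v assume v: "v \<in> ?V"
        then obtain i i' where ii: "i < N" "i' < i" "?Q i i' v" unfolding Q_def by (elim CollectE conjE exE) (rule that)
        show "v \<in> ?U" by (rule UN_I[of "(i, i')"]) (use ii v in auto)
      qed
      show "?U \<subseteq> ?V"
      proof
        fix v assume "v \<in> ?U"
        then obtain q where q: "q \<in> ?P" "snd q < fst q" and v: "v \<in> J \<rightarrow>\<^sub>E {..<p ^ K}" "?Q (fst q) (snd q) v" by (elim UN_E CollectE conjE) (rule that)
        have "Q v" unfolding Q_def by (rule exI[of _ "fst q"], intro conjI, use q in force, rule exI[of _ "snd q"], intro conjI) (fact q v)+
        thus "v \<in> ?V" using v by simp
      qed
    qed
    hence "real (card ?V) \<le> real (\<Sum>q\<in>{q \<in> ?P. snd q < fst q}. card {v \<in> J \<rightarrow>\<^sub>E {..<p ^ K}. ?Q (fst q) (snd q) v})"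
      by (simp only: of_nat_le_iff) (rule card_UN_le, simp)
    also have "\<dots> \<le> (\<Sum>q\<in>{q \<in> ?P. snd q < fst q}. real p ^ (K * card J) / real p ^ N)"
      unfolding of_nat_sum by (rule sum_mono) (use one in auto)
    also have "\<dots> \<le> (\<Sum>q\<in>?P. real p ^ (K * card J) / real p ^ N)" by (rule sum_mono2) auto
    also have "\<dots> = real N ^ 2 * (real p ^ (K * card J) / real p ^ N)" by (simp add: power2_eq_square)
    finally have "real (card ?V) \<le> real N ^ 2 * (real p ^ (K * card J) / real p ^ N)" .
    thus ?thesis unfolding mD using p_gt1 by (simp add: field_simps)
  qed
  finally show ?thesis .
qed

end

context decomp
begin

lemma positive_null: "measure \<nu> {k \<in> Delta. \<forall>R. 1 \<le> k R} = 0" (is "measure \<nu> ?B = 0")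
proof -
  have B: "?B \<in> sets delta_space" by (rule delta_all_sets)
  have le: "measure (Ms p s) (eqrows N) + measure \<nu> ?B \<le> 1 + real N ^ 2 / real p ^ N" if "measure (Ms p s) (eqrows N) > 0" for N
    by (rule decomp_upper[OF eqrows_sets that B]) (use mu_eqrows in auto)
  have ev: "\<forall>\<^sub>F N in sequentially. measure (Ms p s) (eqrows N) > 0"
    using order_tendstoD(1)[OF Ms_eqrows, of 0] by simp
  \<comment> \<open>Writes \<open>N\<^sup>2 / p^N\<close> as the square of
    \<open>N y^N\<close>.\<close>
  define y where "y = sqrt (1 / real p)"
  have y: "0 < y" "y < 1" using p_gt1 by (auto simp: y_def)
  have "(\<lambda>N. (real N * y ^ N) ^ 2) \<longlonglongrightarrow> 0 ^ 2" by (intro tendsto_power powser_times_n_limit_0) (use y in auto)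
  moreover have "(real N * y ^ N) ^ 2 = real N ^ 2 / real p ^ N" for N
  proof -
    have "(y ^ N) ^ 2 = (y ^ 2) ^ N" by (simp add: power_mult[symmetric] mult.commute)
    also have "y ^ 2 = 1 / real p" by (simp add: y_def)
    finally show ?thesis by (simp add: power_mult_distrib power_divide)
  qed
  ultimately have "(\<lambda>N. real N ^ 2 / real p ^ N) \<longlonglongrightarrow> 0" by simp
  hence l: "(\<lambda>N. 1 + real N ^ 2 / real p ^ N) \<longlonglongrightarrow> 1 + 0" by (intro tendsto_intros)
  have "1 + measure \<nu> ?B \<le> 1 + 0"
  proof (rule tendsto_le[OF _ l])
    show "(\<lambda>N. measure (Ms p s) (eqrows N) + measure \<nu> ?B) \<longlonglongrightarrow> 1 + measure \<nu> ?B" by (intro tendsto_intros Ms_eqrows)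
    show "\<forall>\<^sub>F N in sequentially. measure (Ms p s) (eqrows N) + measure \<nu> ?B \<le> 1 + real N ^ 2 / real p ^ N"
      using ev by (rule eventually_mono) (rule le)
  qed simp
  thus ?thesis using measure_nonneg[of \<nu> ?B] by linarith
qed

text \<open>A decreasing sequence of nonnegative integers, one of which is below 1, vanishes from
  that index on.\<close>

theorem AE_Delta0: "AE k in \<nu>. k \<in> Delta0"
  using AE_nonneg AE_not_mem[OF delta_all_sets positive_null]
proof (rule AE_mp[OF _ AE_mp], intro AE_I2 impI)
  fix k assume "k \<in> space \<nu>" and nn: "\<forall>R. 0 \<le> k R" and n1: "k \<notin> {k \<in> Delta. \<forall>R. 1 \<le> k R}"
  hence k: "k \<in> Delta" by (simp add: space_nu)
  then obtain R where R: "\<not> 1 \<le> k R" using n1 by blast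
  have "k j = 0" if "j \<ge> R" for j
  proof -
    have "k j \<le> k R" by (rule Delta_mono[OF k that])
    moreover have "k R = 0" using Delta_Zbar[OF k, of R] R nn[rule_format, of R] by (auto simp: Zbar_def one_ereal_def zero_ereal_def)
    ultimately show ?thesis using nn[rule_format, of j] by simp
  qed
  thus "k \<in> Delta0" using k nn unfolding Delta0_def by blast
qed

end

section \<open>Counting factorizations\<close>

lemma eq_cong: "a = b ==> [a = b] (mod m)" for a b m :: int by simp

text \<open>A row \<open>x\<close> is split into a remainder without column \<open>ls\<close> and a
  multiple of the distinguished row \<open>u\<close>; the second part collapses by the equation that
  \<open>u\<close> satisfies with \<open>y\<close>.\<close>

lemma peel_row:
  fixes Q c d :: int and e u x x' y :: "nat \<Rightarrow> int"
  assumes L: "finite L" "ls \<in> L" and x: "\<And>l. l \<in> L ==> [x l = (if l = ls then 0 else x' l) + c * u l] (mod Q)"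
    and Y: "[d * (\<Sum>l\<in>L. e l * u l * y l) = r] (mod Q)"
  shows "[(\<Sum>l\<in>L. d * e l * x l * y l) = d * (\<Sum>l\<in>L - {ls}. e l * x' l * y l) + c * r] (mod Q)"
proof -
  let ?x' = "\<lambda>l. if l = ls then 0 else x' l"
  have "[(\<Sum>l\<in>L. d * e l * x l * y l) = (\<Sum>l\<in>L. d * e l * (?x' l + c * u l) * y l)] (mod Q)"
    by (intro cong_sum cong_mult cong_refl x)
  also have "[(\<Sum>l\<in>L. d * e l * (?x' l + c * u l) * y l) = d * (\<Sum>l\<in>L. e l * ?x' l * y l) + c * (d * (\<Sum>l\<in>L. e l * u l * y l))] (mod Q)"
    apply (rule eq_cong) unfolding sum_distrib_left sum.distrib[symmetric] by (intro sum.cong refl) (simp only: algebra_simps)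
  also have "[d * (\<Sum>l\<in>L. e l * ?x' l * y l) + c * (d * (\<Sum>l\<in>L. e l * u l * y l)) = d * (\<Sum>l\<in>L - {ls}. e l * x' l * y l) + c * (d * (\<Sum>l\<in>L. e l * u l * y l))] (mod Q)"
    unfolding sum.remove[OF L, of "\<lambda>l. e l * ?x' l * y l"] by simp
  also have "[d * (\<Sum>l\<in>L - {ls}. e l * x' l * y l) + c * (d * (\<Sum>l\<in>L. e l * u l * y l)) = d * (\<Sum>l\<in>L - {ls}. e l * x' l * y l) + c * r] (mod Q)"
    by (intro cong_add cong_scalar_left cong_refl Y)
  finally show ?thesis .
qed

context padic
begin

text \<open>Factorizations \<open>\<Sum>\<^sub>l p\<^sup>-\<^sup>k\<^sup>l x\<^sub>l y\<^sub>l\<^sup>T \<equiv> diag(p\<^sup>-\<^sup>h\<^sup>i)\<close> modulo \<open>\<int>\<^sub>p\<close>, cleared of denominators, with \<open>x\<^sub>i\<^sub>l = v (0, l, i)\<close> and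
  \<open>y\<^sub>j\<^sub>l = v (1, l, j)\<close>.\<close>

definition Good :: "nat \<Rightarrow> nat set \<Rightarrow> nat set \<Rightarrow> (nat \<Rightarrow> nat) \<Rightarrow> (nat \<Rightarrow> nat) \<Rightarrow> (nat \<times> nat \<times> nat \<Rightarrow> nat) set" where
  "Good K I L k h = {v \<in> ({0, 1} \<times> L \<times> I) \<rightarrow>\<^sub>E {..<p ^ K}. \<forall>i\<in>I. \<forall>j\<in>I.
     [(\<Sum>l\<in>L. int (p ^ (K - k l)) * int (v (0, l, i)) * int (v (1, l, j))) = (if i = j then int (p ^ (K - h i)) else 0)] (mod int (p ^ K))}"

text \<open>Multiplication by \<open>p^H\<close> embeds Z/p^(K-H) into Z/p^K; hence the free
  parameters of a factorization can be recovered from it.\<close>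

lemma power_cong_cancel:
  assumes "[int (p ^ H) * int a = int (p ^ H) * int b] (mod int (p ^ K))" "a < p ^ (K - H)" "b < p ^ (K - H)" "H \<le> K"
  shows "a = b"
proof -
  have "int (p ^ K) = int (p ^ H) * int (p ^ (K - H))" using assms(4) by (simp flip: power_add)
  hence "[int a = int b] (mod int (p ^ (K - H)))"
    using assms(1) p_gt1 by (simp add: cong_iff_dvd_diff right_diff_distrib[symmetric])
  hence "[a = b] (mod p ^ (K - H))" by (simp only: cong_int_iff)
  thus ?thesis using assms(2,3) by (simp add: cong_def)
qed

text \<open>Row \<open>i0\<close> of \<open>x\<close> is the given \<open>u\<close>, and its unit \<open>u ls\<close> eliminates the other entries of column \<open>ls\<close>. A
  factorization is rebuilt from one without row \<open>i0\<close> and column \<open>ls\<close>, the remaining entries \<open>z\<close> of row \<open>i0\<close>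
  of \<open>y\<close>, and one element \<open>a j\<close> or \<open>b i\<close> of \<open>\<int>/p\<^sup>K\<^sup>-\<^sup>H\<close> for each of the \<open>2|I| - 1\<close> entries of column \<open>ls\<close> of \<open>y\<close> and \<open>x\<close>.\<close>

lemma peel_count:
  assumes fin: "finite I" "finite L" and i0: "i0 \<in> I" "h i0 = H" and ls: "ls \<in> L" "k ls = H" and HK: "H \<le> K"
    and kH: "\<And>l. l \<in> L ==> k l \<le> H" and u: "u \<in> L \<rightarrow>\<^sub>E {..<p ^ K}" "coprime (u ls) p"
  shows "(p ^ K) ^ (card L - 1) * p ^ ((K - H) * (2 * card I - 1)) * card (Good K (I - {i0}) (L - {ls}) k h)
    \<le> card {v \<in> Good K I L k h. \<forall>l\<in>L. v (0, l, i0) = u l}"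
proof -
  let ?pd = "int (p ^ (K - H))" and ?pH = "int (p ^ H)"
  define Q where "Q = int (p ^ K)"
  have Q0: "Q > 0" using p_gt1 by (simp add: Q_def)
  define I' L' where "I' = I - {i0}" and "L' = L - {ls}"
  have finL': "finite L'" using fin by (simp add: L'_def)
  have "coprime (int (u ls)) Q" using u(2) by (simp add: Q_def)
  then obtain ub where ub: "[int (u ls) * ub = 1] (mod Q)" using cong_solve_coprime_int by blast
  define e where "e l = int (p ^ (H - k l))" for l
  have els: "e ls = 1" by (simp add: e_def ls)
  have pe: "int (p ^ (K - k l)) = ?pd * e l" if "l \<in> L" for l
    using kH[OF that] HK by (simp add: e_def flip: power_add)
  have QH: "?pd * ?pH = Q" unfolding Q_def using HK by (simp flip: power_add)
  define S where "S z w i = (\<Sum>l\<in>L'. e l * int (w (0, l, i)) * int (z l))" for z :: "nat \<Rightarrow> nat" and w :: "nat \<times> nat \<times> nat \<Rightarrow> nat" and i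
  \<comment> \<open>The entry \<open>(i, i0)\<close> of the product must vanish. This fixes column
    \<open>ls\<close> of \<open>x\<close> modulo \<open>p^H\<close>, because the equation carries
    the factor \<open>p^(K-H)\<close>; \<open>b\<close> runs through the remaining freedom.\<close>
  define x1 where "x1 z w b i = (- int (u ls) * S z w i + ?pH * int (b i)) mod Q" for z w and b :: "nat \<Rightarrow> nat" and i
  define fx where "fx z w b i l = (if i = i0 then int (u l) else if l = ls then x1 z w b i else (int (w (0, l, i)) + x1 z w b i * ub * int (u l)) mod Q)" for z w b i l
  define gy where "gy z w j l = (if j = i0 then int (z l) else int (w (1, l, j)))" for z :: "nat \<Rightarrow> nat" and w :: "nat \<times> nat \<times> nat \<Rightarrow> nat" and j l
  \<comment> \<open>The equation for the entry \<open>(i0, j)\<close> is solved for column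
    \<open>ls\<close> of \<open>y\<close> with the inverse \<open>ub\<close> of the unit, again up
    to multiples of \<open>p^H\<close>, which \<open>a\<close> records.\<close>
  define fy where "fy z w a j l = (if l = ls then (ub * ((if j = i0 then 1 else 0) + ?pH * int (a j) - (\<Sum>l\<in>L'. e l * int (u l) * gy z w j l))) mod Q else gy z w j l)" for z w and a :: "nat \<Rightarrow> nat" and j l
  define \<Phi> where "\<Phi> = (\<lambda>(z, w, a, b). restrict (\<lambda>(t, l, i). nat (if t = (0::nat) then fx z w b i l else fy z w a i l)) ({0, 1} \<times> L \<times> I))"
  let ?P = "(L' \<rightarrow>\<^sub>E {..<p ^ K}) \<times> Good K I' L' k h \<times> (I \<rightarrow>\<^sub>E {..<p ^ (K - H)}) \<times> (I' \<rightarrow>\<^sub>E {..<p ^ (K - H)})"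
  let ?G = "{v \<in> Good K I L k h. \<forall>l\<in>L. v (0, l, i0) = u l}"
  have mQ: "0 \<le> n mod Q" "n mod Q < Q" for n using Q0 by auto
  have ul: "int (u l) < Q" if "l \<in> L" for l using u(1) that by (auto simp: Q_def PiE_iff)
  have wb: "int (w (t, l, i)) < Q" if "w \<in> Good K I' L' k h" "t \<in> {0, 1}" "l \<in> L'" "i \<in> I'" for w t l i
  proof -
    have "w \<in> ({0, 1} \<times> L' \<times> I') \<rightarrow>\<^sub>E {..<p ^ K}" using that(1) by (simp add: Good_def)
    hence "w (t, l, i) \<in> {..<p ^ K}" by (rule PiE_mem) (use that in auto)
    thus ?thesis by (simp add: Q_def del: of_nat_power)
  qed
  have zb: "int (z l) < Q" if "z \<in> L' \<rightarrow>\<^sub>E {..<p ^ K}" "l \<in> L'" for z l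
    using PiE_mem[OF that] by (simp add: Q_def del: of_nat_power)
  have x1b: "0 \<le> x1 z w b i" "x1 z w b i < Q" for z w b i using mQ by (auto simp: x1_def)
  have fxb: "0 \<le> fx z w b i l \<and> fx z w b i l < Q" if "l \<in> L" for z w b i l
    using that ul x1b mQ by (auto simp: fx_def)
  have gyb: "0 \<le> gy z w j l \<and> gy z w j l < Q" if "z \<in> L' \<rightarrow>\<^sub>E {..<p ^ K}" "w \<in> Good K I' L' k h" "l \<in> L'" "j \<in> I" for z w j l
    using that zb wb[of w 1 l j] by (auto simp: gy_def I'_def)
  have fyb: "0 \<le> fy z w a j l \<and> fy z w a j l < Q" if "z \<in> L' \<rightarrow>\<^sub>E {..<p ^ K}" "w \<in> Good K I' L' k h" "l \<in> L" "j \<in> I" for z w a j l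
    using gyb[OF that(1,2) _ that(4), of l] that(3) mQ by (auto simp: fy_def L'_def)
  have img: "\<Phi> r \<in> ?G" if r: "r \<in> ?P" for r
  proof -
    obtain z w a b where rr: "r = (z, w, a, b)" by (cases r)
    have z: "z \<in> L' \<rightarrow>\<^sub>E {..<p ^ K}" and w: "w \<in> Good K I' L' k h" using r by (auto simp: rr)
    let ?v = "\<Phi> r"
    have v0: "int (?v (0, l, i)) = fx z w b i l" if "l \<in> L" "i \<in> I" for l i
      using that fxb[OF that(1), of z w b i] by (simp add: \<Phi>_def rr)
    have v1: "int (?v (1, l, i)) = fy z w a i l" if "l \<in> L" "i \<in> I" for l i
      using that fyb[OF z w that, of a] by (simp add: \<Phi>_def rr)
    have vE: "?v \<in> ({0, 1} \<times> L \<times> I) \<rightarrow>\<^sub>E {..<p ^ K}"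
    proof (rule PiE_I)
      fix q :: "nat \<times> nat \<times> nat" assume q: "q \<in> {0, 1} \<times> L \<times> I"
      obtain t l i where qq: "q = (t, l, i)" by (cases q)
      have tli: "t = 0 \<or> t = 1" "l \<in> L" "i \<in> I" using q by (auto simp: qq)
      have "int (?v q) < Q"
        using tli(1) v0[OF tli(2,3)] v1[OF tli(2,3)] fxb[OF tli(2), of z w b i] fyb[OF z w tli(2,3), of a] by (elim disjE) (simp_all add: qq)
      thus "?v q \<in> {..<p ^ K}" by (simp add: Q_def del: of_nat_power)
    next
      fix q :: "nat \<times> nat \<times> nat" assume "q \<notin> {0, 1} \<times> L \<times> I"
      thus "?v q = undefined" by (simp add: \<Phi>_def rr del: insert_iff)
    qed
    have Y0: "[(\<Sum>l\<in>L. e l * int (u l) * fy z w a j l) = (if j = i0 then 1 else 0) + ?pH * int (a j)] (mod Q)" for j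
    proof -
      let ?c = "(if j = i0 then 1 else 0) + ?pH * int (a j)" and ?s = "\<Sum>l\<in>L'. e l * int (u l) * gy z w j l"
      have "[(\<Sum>l\<in>L. e l * int (u l) * fy z w a j l) = int (u ls) * ((ub * (?c - ?s)) mod Q) + ?s] (mod Q)"
        apply (rule eq_cong) unfolding sum.remove[OF fin(2) ls(1)] L'_def[symmetric]
        by (intro arg_cong2[of _ _ _ _ "(+)"] sum.cong refl) (auto simp: els fy_def L'_def)
      also have "[int (u ls) * ((ub * (?c - ?s)) mod Q) + ?s = int (u ls) * (ub * (?c - ?s)) + ?s] (mod Q)"
        by (intro cong_add cong_scalar_left cong_refl) (simp add: cong_def)
      also have "[int (u ls) * (ub * (?c - ?s)) + ?s = (int (u ls) * ub) * (?c - ?s) + ?s] (mod Q)" by (rule eq_cong) (simp only: mult.assoc)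
      also have "[(int (u ls) * ub) * (?c - ?s) + ?s = 1 * (?c - ?s) + ?s] (mod Q)"
        by (intro cong_add cong_scalar_right cong_refl ub)
      finally show ?thesis by simp
    qed
    have Y: "[?pd * (\<Sum>l\<in>L. e l * int (u l) * fy z w a j l) = (if j = i0 then ?pd else 0)] (mod Q)" for j
    proof -
      have "[?pd * (\<Sum>l\<in>L. e l * int (u l) * fy z w a j l) = ?pd * ((if j = i0 then 1 else 0) + ?pH * int (a j))] (mod Q)"
        by (rule cong_scalar_left[OF Y0])
      also have "[?pd * ((if j = i0 then 1 else 0) + ?pH * int (a j)) = (if j = i0 then ?pd else 0) + Q * int (a j)] (mod Q)"
      proof (rule eq_cong)
        have "Q * int (a j) = ?pd * (?pH * int (a j))" by (simp only: QH[symmetric] mult.assoc)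
        thus "?pd * ((if j = i0 then 1 else 0) + ?pH * int (a j)) = (if j = i0 then ?pd else 0) + Q * int (a j)"
          by (cases "j = i0") (simp_all only: distrib_left mult_1_right mult_zero_right if_True if_False simp_thms)
      qed
      also have "[(if j = i0 then ?pd else 0) + Q * int (a j) = (if j = i0 then ?pd else 0)] (mod Q)"
        by (simp add: cong_def)
      finally show ?thesis .
    qed
    have main: "[(\<Sum>l\<in>L. int (p ^ (K - k l)) * int (?v (0, l, i)) * int (?v (1, l, j))) = (if i = j then int (p ^ (K - h i)) else 0)] (mod Q)"
      if ij: "i \<in> I" "j \<in> I" for i j
    proof -
      have "(\<Sum>l\<in>L. int (p ^ (K - k l)) * int (?v (0, l, i)) * int (?v (1, l, j))) = (\<Sum>l\<in>L. ?pd * e l * fx z w b i l * fy z w a j l)"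
        by (intro sum.cong refl) (simp only: v0 v1 ij pe)
      moreover have "[(\<Sum>l\<in>L. ?pd * e l * fx z w b i l * fy z w a j l) = (if i = j then int (p ^ (K - h i)) else 0)] (mod Q)"
      proof (cases "i = i0")
        case True
        have "(\<Sum>l\<in>L. ?pd * e l * fx z w b i l * fy z w a j l) = ?pd * (\<Sum>l\<in>L. e l * int (u l) * fy z w a j l)"
          unfolding sum_distrib_left by (intro sum.cong refl) (simp add: fx_def True)
        thus ?thesis using Y[of j] True i0(2) by (cases "i0 = j") (simp_all del: of_nat_power)
      next
        case i: False
        have iI: "i \<in> I'" using ij i by (simp add: I'_def)
        let ?c = "x1 z w b i * ub"
        have "[(\<Sum>l\<in>L. ?pd * e l * fx z w b i l * fy z w a j l)
          = ?pd * (\<Sum>l\<in>L - {ls}. e l * int (w (0, l, i)) * fy z w a j l) + ?c * (if j = i0 then ?pd else 0)] (mod Q)"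
        proof (rule peel_row[OF fin(2) ls(1) _ Y])
          fix l assume l: "l \<in> L"
          show "[fx z w b i l = (if l = ls then 0 else int (w (0, l, i))) + ?c * int (u l)] (mod Q)"
          proof (cases "l = ls")
            case True
            have "[x1 z w b i * (int (u ls) * ub) = x1 z w b i * 1] (mod Q)" by (rule cong_scalar_left[OF ub])
            hence "[x1 z w b i = x1 z w b i * ub * int (u ls)] (mod Q)" by (simp add: cong_sym_eq mult.assoc mult.commute[of ub])
            thus ?thesis using True i by (simp add: fx_def)
          qed (simp add: fx_def i cong_def)
        qed
        moreover have "[?pd * (\<Sum>l\<in>L - {ls}. e l * int (w (0, l, i)) * fy z w a j l) + ?c * (if j = i0 then ?pd else 0)
           = (if i = j then int (p ^ (K - h i)) else 0)] (mod Q)"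
        proof (cases "j = i0")
          case True
          let ?x = "- int (u ls) * S z w i + ?pH * int (b i)"
          have "(\<Sum>l\<in>L - {ls}. e l * int (w (0, l, i)) * fy z w a j l) = S z w i"
            unfolding S_def L'_def by (intro sum.cong refl) (simp add: fy_def gy_def True)
          moreover have "[?pd * S z w i + ?c * ?pd = 0] (mod Q)"
          proof -
            have "[?pd * S z w i + ?c * ?pd = ?pd * S z w i + (?x * ub) * ?pd] (mod Q)"
              by (intro cong_add cong_scalar_right cong_refl) (simp add: x1_def cong_def)
            also have "[?pd * S z w i + (?x * ub) * ?pd
              = ?pd * S z w i + (int (u ls) * ub) * (- (?pd * S z w i)) + (?pd * ?pH) * (int (b i) * ub)] (mod Q)"
              by (rule eq_cong) (simp only: algebra_simps)
            also have "[?pd * S z w i + (int (u ls) * ub) * (- (?pd * S z w i)) + (?pd * ?pH) * (int (b i) * ub)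
              = ?pd * S z w i + 1 * (- (?pd * S z w i)) + 0] (mod Q)"
              unfolding QH by (intro cong_add cong_scalar_right cong_refl ub) (simp add: cong_def)
            finally show ?thesis by simp
          qed
          ultimately show ?thesis using True i by (simp del: of_nat_power)
        next
          case j: False
          have jI: "j \<in> I'" using ij j by (simp add: I'_def)
          have "?pd * (\<Sum>l\<in>L - {ls}. e l * int (w (0, l, i)) * fy z w a j l) = (\<Sum>l\<in>L'. int (p ^ (K - k l)) * int (w (0, l, i)) * int (w (1, l, j)))"
            unfolding L'_def sum_distrib_left
          proof (intro sum.cong refl)
            fix l assume l: "l \<in> L - {ls}"
            have fyl: "fy z w a j l = int (w (1, l, j))" using l j by (simp add: fy_def gy_def)
            show "?pd * (e l * int (w (0, l, i)) * fy z w a j l) = int (p ^ (K - k l)) * int (w (0, l, i)) * int (w (1, l, j))"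
              using l by (simp only: fyl pe[of l] DiffD1 mult.assoc)
          qed
          moreover have "[(\<Sum>l\<in>L'. int (p ^ (K - k l)) * int (w (0, l, i)) * int (w (1, l, j))) = (if i = j then int (p ^ (K - h i)) else 0)] (mod Q)"
            using w iI jI unfolding Good_def Q_def by blast
          ultimately show ?thesis using j by (simp only: if_False mult_zero_right add_0_right)
        qed
        ultimately show ?thesis by (rule cong_trans)
      qed
      ultimately show ?thesis by (simp only:)
    qed
    have row: "\<forall>l\<in>L. ?v (0, l, i0) = u l" using v0[OF _ i0(1)] by (simp add: fx_def)
    have "?v \<in> Good K I L k h"
      unfolding Good_def by (rule CollectI, rule conjI, rule vE, intro ballI, rule main[unfolded Q_def], assumption+)
    thus ?thesis using row by (intro CollectI conjI)
  qed
  have inj: "inj_on \<Phi> ?P"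
  proof (rule inj_onI)
    fix r r' assume r: "r \<in> ?P" and r': "r' \<in> ?P" and eq: "\<Phi> r = \<Phi> r'"
    obtain z w a b where rr: "r = (z, w, a, b)" by (cases r)
    obtain z' w' a' b' where rr': "r' = (z', w', a', b')" by (cases r')
    have z: "z \<in> L' \<rightarrow>\<^sub>E {..<p ^ K}" and w: "w \<in> Good K I' L' k h" and a: "a \<in> I \<rightarrow>\<^sub>E {..<p ^ (K - H)}" and b: "b \<in> I' \<rightarrow>\<^sub>E {..<p ^ (K - H)}"
      using r by (simp_all add: rr)
    have z': "z' \<in> L' \<rightarrow>\<^sub>E {..<p ^ K}" and w': "w' \<in> Good K I' L' k h" and a': "a' \<in> I \<rightarrow>\<^sub>E {..<p ^ (K - H)}" and b': "b' \<in> I' \<rightarrow>\<^sub>E {..<p ^ (K - H)}"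
      using r' by (simp_all add: rr')
    have ex: "fx z w b i l = fx z' w' b' i l" if "l \<in> L" "i \<in> I" for l i
    proof -
      have "\<Phi> r (0, l, i) = \<Phi> r' (0, l, i)" by (simp only: eq)
      hence "nat (fx z w b i l) = nat (fx z' w' b' i l)" using that by (simp add: \<Phi>_def rr rr')
      thus ?thesis using fxb[OF that(1), of z w b i] fxb[OF that(1), of z' w' b' i] by (metis eq_nat_nat_iff)
    qed
    have ey: "fy z w a i l = fy z' w' a' i l" if "l \<in> L" "i \<in> I" for l i
    proof -
      have "\<Phi> r (1, l, i) = \<Phi> r' (1, l, i)" by (simp only: eq)
      hence "nat (fy z w a i l) = nat (fy z' w' a' i l)" using that by (simp add: \<Phi>_def rr rr')
      thus ?thesis using fyb[OF z w that, of a] fyb[OF z' w' that, of a'] by (metis eq_nat_nat_iff)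
    qed
    have zz: "z = z'"
    proof (rule PiE_ext[OF z z'])
      fix l assume "l \<in> L'"
      thus "z l = z' l" using ey[of l i0] i0(1) by (simp add: fy_def gy_def L'_def)
    qed
    have ex1: "x1 z w b i = x1 z' w' b' i" if "i \<in> I'" for i
      using ex[OF ls(1), of i] that by (simp add: fx_def I'_def)
    have ww: "w = w'"
    proof -
      have W: "w \<in> ({0, 1} \<times> L' \<times> I') \<rightarrow>\<^sub>E {..<p ^ K}" "w' \<in> ({0, 1} \<times> L' \<times> I') \<rightarrow>\<^sub>E {..<p ^ K}" using w w' by (simp_all add: Good_def)
      show ?thesis
      proof (rule PiE_ext[OF W])
        fix q :: "nat \<times> nat \<times> nat" assume q: "q \<in> {0, 1} \<times> L' \<times> I'"
        obtain t l i where qq: "q = (t, l, i)" by (cases q)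
        have tli: "t = 0 \<or> t = 1" "l \<in> L'" "i \<in> I'" using q by (auto simp: qq)
        have lL: "l \<in> L" "l \<noteq> ls" "i \<in> I" "i \<noteq> i0" using tli by (auto simp: L'_def I'_def)
        have "w (0, l, i) = w' (0, l, i)"
        proof -
          let ?c = "x1 z' w' b' i * ub * int (u l)"
          have "(int (w (0, l, i)) + ?c) mod Q = (int (w' (0, l, i)) + ?c) mod Q"
            using ex[OF lL(1,3)] lL ex1[OF tli(3)] by (simp add: fx_def)
          hence "[int (w (0, l, i)) + ?c = int (w' (0, l, i)) + ?c] (mod Q)" by (simp add: cong_def)
          hence "[int (w (0, l, i)) = int (w' (0, l, i))] (mod Q)" by (simp only: cong_add_rcancel)
          thus ?thesis using wb[OF w _ tli(2,3), of 0] wb[OF w' _ tli(2,3), of 0] by (simp add: cong_def)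
        qed
        moreover have "w (1, l, i) = w' (1, l, i)" using ey[OF lL(1,3)] lL by (simp add: fy_def gy_def)
        ultimately show "w q = w' q" using tli(1) by (auto simp only: qq)
      qed
    qed
    have bb: "b = b'"
    proof (rule PiE_ext[OF b b'])
      fix i assume i: "i \<in> I'"
      have "[- int (u ls) * S z w i + ?pH * int (b i) = - int (u ls) * S z w i + ?pH * int (b' i)] (mod Q)"
        using ex1[OF i] by (simp add: x1_def zz ww cong_def)
      hence "[?pH * int (b i) = ?pH * int (b' i)] (mod Q)" by (simp only: cong_add_lcancel)
      thus "b i = b' i" unfolding Q_def by (rule power_cong_cancel) (use PiE_mem[OF b i] PiE_mem[OF b' i] HK in auto)
    qed
    have aa: "a = a'"
    proof (rule PiE_ext[OF a a'])
      fix j assume j: "j \<in> I"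
      let ?d = "if j = i0 then 1 else 0 :: int" and ?s = "\<Sum>l\<in>L'. e l * int (u l) * gy z w j l"
      have "[ub * (?d + ?pH * int (a j) - ?s) = ub * (?d + ?pH * int (a' j) - ?s)] (mod Q)"
        using ey[OF ls(1) j] by (simp add: fy_def zz ww cong_def)
      hence "[int (u ls) * (ub * (?d + ?pH * int (a j) - ?s)) = int (u ls) * (ub * (?d + ?pH * int (a' j) - ?s))] (mod Q)"
        by (rule cong_scalar_left)
      moreover have "[int (u ls) * (ub * n) = n] (mod Q)" for n
        using cong_scalar_right[OF ub, of n] by (simp add: mult.assoc)
      ultimately have "[?d + ?pH * int (a j) - ?s = ?d + ?pH * int (a' j) - ?s] (mod Q)"
        using cong_trans cong_sym by meson
      hence "[?pH * int (a j) = ?pH * int (a' j)] (mod Q)" by (simp add: cong_iff_dvd_diff)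
      thus "a j = a' j" unfolding Q_def by (rule power_cong_cancel) (use PiE_mem[OF a j] PiE_mem[OF a' j] HK in auto)
    qed
    show "r = r'" by (simp only: rr rr' zz ww aa bb)
  qed
  have finG: "finite ?G"
    by (rule finite_subset[of _ "({0, 1} \<times> L \<times> I) \<rightarrow>\<^sub>E {..<p ^ K}"]) (use fin in \<open>auto simp: Good_def intro!: finite_PiE\<close>)
  have "card ?P \<le> card ?G" by (rule card_inj_on_le[OF inj _ finG]) (use img in blast)
  moreover have "card ?P = (p ^ K) ^ (card L - 1) * card (Good K I' L' k h) * (p ^ (K - H)) ^ (card I + (card I - 1))"
  proof -
    have "card (L' \<rightarrow>\<^sub>E {..<p ^ K}) = (p ^ K) ^ (card L - 1)" "card (I \<rightarrow>\<^sub>E {..<p ^ (K - H)}) = (p ^ (K - H)) ^ card I"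
      "card (I' \<rightarrow>\<^sub>E {..<p ^ (K - H)}) = (p ^ (K - H)) ^ (card I - 1)"
      using fin ls i0 by (simp_all add: card_PiE L'_def I'_def)
    thus ?thesis by (simp only: card_cartesian_product power_add)
  qed
  moreover have "card I + (card I - 1) = 2 * card I - 1" using i0 fin card_gt_0_iff[of I] by (cases "card I") auto
  moreover have "(p ^ (K - H)) ^ (2 * card I - 1) = p ^ ((K - H) * (2 * card I - 1))" by (rule power_mult[symmetric])
  ultimately show ?thesis unfolding I'_def L'_def by (simp add: ac_simps)
qed

lemma card_multiples: assumes "K \<ge> 1" shows "card {a \<in> {..<p ^ K}. p dvd a} \<le> p ^ (K - 1)"
proof -
  have pK: "p ^ K = p * p ^ (K - 1)" using assms by (cases K) auto
  have "{a \<in> {..<p ^ K}. p dvd a} \<subseteq> (\<lambda>b. p * b) ` {..<p ^ (K - 1)}"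
  proof
    fix a assume "a \<in> {a \<in> {..<p ^ K}. p dvd a}"
    then obtain b where "a = p * b" "p * b < p * p ^ (K - 1)" using pK by (auto elim!: dvdE)
    thus "a \<in> (\<lambda>b. p * b) ` {..<p ^ (K - 1)}" by auto
  qed
  hence "card {a \<in> {..<p ^ K}. p dvd a} \<le> card ((\<lambda>b. p * b) ` {..<p ^ (K - 1)})" by (intro card_mono) auto
  also have "\<dots> \<le> card {..<p ^ (K - 1)}" by (rule card_image_le) simp
  finally show ?thesis by simp
qed

text \<open>In the complement all coordinates in \<open>M\<close> are divisible by \<open>p\<close>,
  which is a proportion of at most \<open>p^(-|M|)\<close>.\<close>

lemma card_units:
  assumes L: "finite L" "M \<subseteq> L" and K: "K \<ge> 1"
  shows "real (p ^ K) ^ card L * (1 - 1 / real p ^ card M) \<le> real (card {u \<in> L \<rightarrow>\<^sub>E {..<p ^ K}. \<exists>l\<in>M. coprime (u l) p})"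
proof -
  let ?A = "L \<rightarrow>\<^sub>E {..<p ^ K}" and ?U = "{u \<in> L \<rightarrow>\<^sub>E {..<p ^ K}. \<exists>l\<in>M. coprime (u l) p}"
  have fA: "finite ?A" using L by (intro finite_PiE) auto
  have fM: "finite M" using L finite_subset by blast
  have cop: "coprime a p \<longleftrightarrow> \<not> p dvd a" for a
    using prime_p prime_imp_coprime[of p a] by (metis coprime_commute coprime_absorb_left not_prime_unit)
  have "?A - ?U \<subseteq> PiE L (\<lambda>l. if l \<in> M then {a \<in> {..<p ^ K}. p dvd a} else {..<p ^ K})"
  proof
    fix u assume u: "u \<in> ?A - ?U"
    show "u \<in> PiE L (\<lambda>l. if l \<in> M then {a \<in> {..<p ^ K}. p dvd a} else {..<p ^ K})"
    proof (rule PiE_I)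
      fix l assume l: "l \<in> L"
      have "u l < p ^ K" using u l by (auto simp: PiE_iff)
      moreover have "p dvd u l" if "l \<in> M" using u that cop by blast
      ultimately show "u l \<in> (if l \<in> M then {a \<in> {..<p ^ K}. p dvd a} else {..<p ^ K})" by simp
    next
      fix l assume "l \<notin> L" thus "u l = undefined" using u by (auto simp: PiE_iff extensional_def)
    qed
  qed
  hence "card (?A - ?U) \<le> card (PiE L (\<lambda>l. if l \<in> M then {a \<in> {..<p ^ K}. p dvd a} else {..<p ^ K}))"
    by (rule card_mono[rotated]) (use L in \<open>auto intro!: finite_PiE\<close>)
  also have "\<dots> = (\<Prod>l\<in>L. card (if l \<in> M then {a \<in> {..<p ^ K}. p dvd a} else {..<p ^ K}))" using L by (simp add: card_PiE)
  also have "\<dots> \<le> (\<Prod>l\<in>L. if l \<in> M then p ^ (K - 1) else p ^ K)"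
    by (rule prod_mono) (use card_multiples[OF K] in auto)
  also have "\<dots> = (\<Prod>l\<in>M. p ^ (K - 1)) * (\<Prod>l\<in>L - M. p ^ K)"
  proof -
    have "(\<Prod>l\<in>L. if l \<in> M then p ^ (K - 1) else p ^ K) = (\<Prod>l\<in>L \<inter> M. p ^ (K - 1)) * (\<Prod>l\<in>L \<inter> - M. p ^ K)"
      using prod.If_cases[OF L(1), of "\<lambda>l. l \<in> M" "\<lambda>_. p ^ (K - 1)" "\<lambda>_. p ^ K"] by simp
    moreover have "L \<inter> M = M" "L \<inter> - M = L - M" using L by auto
    ultimately show ?thesis by simp
  qed
  also have "\<dots> = (p ^ (K - 1)) ^ card M * (p ^ K) ^ card (L - M)" by simp
  finally have C: "card (?A - ?U) \<le> (p ^ (K - 1)) ^ card M * (p ^ K) ^ card (L - M)" .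
  have "(p ^ (K - 1)) ^ card M * (p ^ K) ^ card (L - M) * p ^ card M = (p ^ K) ^ card L"
  proof -
    have "(p ^ (K - 1)) ^ card M * p ^ card M = (p ^ K) ^ card M"
      using K by (cases K) (simp_all add: power_mult_distrib mult.commute)
    moreover have "card L = card M + card (L - M)" using L fM by (simp add: card_Diff_subset card_mono)
    ultimately show ?thesis by (simp add: power_add ac_simps)
  qed
  hence "real ((p ^ (K - 1)) ^ card M * (p ^ K) ^ card (L - M)) * real p ^ card M = real (p ^ K) ^ card L"
    by (metis of_nat_mult of_nat_power)
  hence C2: "real ((p ^ (K - 1)) ^ card M * (p ^ K) ^ card (L - M)) = real (p ^ K) ^ card L / real p ^ card M"
    using p_gt1 by (simp add: field_simps)
  have "card ?A = card ?U + card (?A - ?U)" using fA by (subst card_Diff_subset) (auto simp: card_mono)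
  moreover have "card ?A = (p ^ K) ^ card L" using L by (simp add: card_PiE)
  ultimately have "(p ^ K) ^ card L = card ?U + card (?A - ?U)" by (simp only:)
  hence "real ((p ^ K) ^ card L) = real (card ?U + card (?A - ?U))" by (rule arg_cong)
  hence "real (p ^ K) ^ card L = real (card ?U) + real (card (?A - ?U))" by (simp only: of_nat_add of_nat_power)
  moreover have "real (card (?A - ?U)) \<le> real (p ^ K) ^ card L / real p ^ card M" using C unfolding C2[symmetric] by (simp only: of_nat_le_iff)
  ultimately show ?thesis by (simp add: right_diff_distrib)
qed

text \<open>Sums \<open>peel_count\<close> over the rows \<open>u\<close> that have a unit in some
  column of the maximal exponent \<open>H\<close>. The proportion of these rows gives the factor
  \<open>1 - 1 / p^card\<close>; the \<open>2 n + 1\<close> parameters that range over Z/p^(K-H)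
  instead of Z/p^K give \<open>p^(-H(2n+1))\<close>.\<close>

lemma Good_step:
  assumes fin: "finite I" "finite L" and n: "card I = Suc n" "card L = Suc n" and i0: "i0 \<in> I" "h i0 = H"
    and H: "1 \<le> H" "H \<le> K" and kH: "\<And>l. l \<in> L ==> k l \<le> H"
    and X: "\<And>l. l \<in> L ==> k l = H ==> D * real (p ^ K) ^ (2 * n\<^sup>2) \<le> real (card (Good K (I - {i0}) (L - {l}) k h))"
  shows "(1 - 1 / real p ^ card {l \<in> L. k l = H}) / real p ^ (H * (2 * n + 1)) * D * real (p ^ K) ^ (2 * (Suc n)\<^sup>2) \<le> real (card (Good K I L k h))"
proof -
  let ?M = "{l \<in> L. k l = H}" and ?q = "real (p ^ K)"
  let ?U = "{u \<in> L \<rightarrow>\<^sub>E {..<p ^ K}. \<exists>l\<in>?M. coprime (u l) p}"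
  let ?G = "\<lambda>u. {v \<in> Good K I L k h. \<forall>l\<in>L. v (0, l, i0) = u l}"
  have q0: "?q > 0" using p_gt1 by simp
  have finGood: "finite (Good K I L k h)"
    by (rule finite_subset[of _ "({0, 1} \<times> L \<times> I) \<rightarrow>\<^sub>E {..<p ^ K}"]) (use fin in \<open>auto simp: Good_def intro!: finite_PiE\<close>)
  have finU: "finite ?U" by (rule finite_subset[of _ "L \<rightarrow>\<^sub>E {..<p ^ K}"]) (use fin in \<open>auto intro!: finite_PiE\<close>)
  let ?c = "?q ^ n * real p ^ ((K - H) * (2 * n + 1)) * D * ?q ^ (2 * n\<^sup>2)"
  have lower: "?c \<le> real (card (?G u))" if u: "u \<in> ?U" for u
  proof -
    from u obtain ls where ls: "ls \<in> L" "k ls = H" "coprime (u ls) p" and uP: "u \<in> L \<rightarrow>\<^sub>E {..<p ^ K}" by auto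
    have "(p ^ K) ^ (card L - 1) * p ^ ((K - H) * (2 * card I - 1)) * card (Good K (I - {i0}) (L - {ls}) k h) \<le> card (?G u)"
      by (rule peel_count[where h = h and k = k and H = H]) (use fin i0 ls H kH uP in auto)
    hence "(p ^ K) ^ n * p ^ ((K - H) * (2 * n + 1)) * card (Good K (I - {i0}) (L - {ls}) k h) \<le> card (?G u)" by (simp add: n)
    hence "real ((p ^ K) ^ n * p ^ ((K - H) * (2 * n + 1)) * card (Good K (I - {i0}) (L - {ls}) k h)) \<le> real (card (?G u))" by (simp only: of_nat_le_iff)
    moreover have "?q ^ n * real p ^ ((K - H) * (2 * n + 1)) * (D * ?q ^ (2 * n\<^sup>2)) \<le> ?q ^ n * real p ^ ((K - H) * (2 * n + 1)) * real (card (Good K (I - {i0}) (L - {ls}) k h))"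
      by (intro mult_left_mono X ls) simp
    ultimately show ?thesis by (simp add: mult.assoc)
  qed
  have "(\<Sum>u\<in>?U. ?c) \<le> (\<Sum>u\<in>?U. real (card (?G u)))" by (rule sum_mono) (rule lower)
  also have "\<dots> = real (card (\<Union>u\<in>?U. ?G u))"
  proof -
    have "card (\<Union>u\<in>?U. ?G u) = (\<Sum>u\<in>?U. card (?G u))"
    proof (rule card_UN_disjoint[OF finU])
      show "\<forall>u\<in>?U. finite (?G u)" using finGood by simp
      show "\<forall>u\<in>?U. \<forall>u'\<in>?U. u \<noteq> u' \<longrightarrow> ?G u \<inter> ?G u' = {}"
      proof (intro ballI impI)
        fix u u' assume u: "u \<in> ?U" "u' \<in> ?U" and ne: "u \<noteq> u'"
        have P: "u \<in> L \<rightarrow>\<^sub>E {..<p ^ K}" "u' \<in> L \<rightarrow>\<^sub>E {..<p ^ K}" using u by auto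
        obtain l where "l \<in> L" "u l \<noteq> u' l" using PiE_ext[OF P] ne by blast
        thus "?G u \<inter> ?G u' = {}" by auto
      qed
    qed
    thus ?thesis by simp
  qed
  also have "\<dots> \<le> real (card (Good K I L k h))" unfolding of_nat_le_iff by (rule card_mono[OF finGood]) auto
  finally have 1: "real (card ?U) * ?c \<le> real (card (Good K I L k h))" by simp
  show ?thesis
  proof (cases "D \<ge> 0")
    case False
    have "(1 - 1 / real p ^ card ?M) / real p ^ (H * (2 * n + 1)) * D * ?q ^ (2 * (Suc n)\<^sup>2) \<le> 0"
      using False p_gt1 by (intro mult_nonpos_nonneg mult_nonneg_nonpos divide_nonneg_nonneg) (auto simp: one_le_power)
    thus ?thesis by (rule order_trans) simp
  next
    case True
    have "?q ^ Suc n * (1 - 1 / real p ^ card ?M) * ?c \<le> real (card ?U) * ?c"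
      by (intro mult_right_mono) (use card_units[OF fin(2), of ?M K] n H True in auto)
    also note 1
    finally have 2: "?q ^ Suc n * (1 - 1 / real p ^ card ?M) * ?c \<le> real (card (Good K I L k h))" .
    have "real p ^ ((K - H) * (2 * n + 1)) * real p ^ (H * (2 * n + 1)) = ?q ^ (2 * n + 1)"
      using H(2) by (simp add: power_add[symmetric] power_mult[symmetric] add_mult_distrib[symmetric] del: add_mult_distrib2)
    hence e: "real p ^ ((K - H) * (2 * n + 1)) = ?q ^ (2 * n + 1) / real p ^ (H * (2 * n + 1))" using p_gt1 by (simp add: eq_divide_eq)
    have "2 * (Suc n)\<^sup>2 = Suc n + n + (2 * n + 1) + 2 * n\<^sup>2" by (simp add: power2_eq_square)
    hence "?q ^ (2 * (Suc n)\<^sup>2) = ?q ^ Suc n * ?q ^ n * ?q ^ (2 * n + 1) * ?q ^ (2 * n\<^sup>2)" by (simp only: power_add)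
    hence "(1 - 1 / real p ^ card ?M) / real p ^ (H * (2 * n + 1)) * D * ?q ^ (2 * (Suc n)\<^sup>2)
      = ?q ^ Suc n * (1 - 1 / real p ^ card ?M) * ?c" unfolding e by simp
    thus ?thesis using 2 by simp
  qed
qed

text \<open>The exponents of the rows and of the columns agree as multisets. This is preserved,
  since the removed column has the exponent of the removed row. When only exponents 0 are left, all
  congruences hold trivially and every assignment counts.\<close>

lemma Good_lower:
  assumes h: "\<And>i j. i \<le> j ==> h j \<le> h i" and hK: "\<And>i. h i \<le> K" and hR: "\<And>i. i < R ==> h i \<ge> 1" "\<And>i. i \<ge> R ==> h i = 0" and RN: "R \<le> N"
  shows "r \<le> R ==> finite L ==> card L = N - r ==> (\<And>v. card {l \<in> L. k l = v} = card {i \<in> {r..<N}. h i = v}) ==>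
    (\<Prod>i\<in>{r..<R}. (1 - 1 / real p ^ card {j \<in> {i..<N}. h j = h i}) / real p ^ (h i * (2 * (N - i) - 1))) * real (p ^ K) ^ (2 * (N - r)\<^sup>2)
      \<le> real (card (Good K {r..<N} L k h))"
proof (induction "R - r" arbitrary: r L)
  case 0
  hence r: "r = R" by simp
  have k0: "k l = 0" if "l \<in> L" for l
  proof -
    have "card {l' \<in> L. k l' = k l} > 0" using that 0(3) by (subst card_gt_0_iff) auto
    hence "card {i \<in> {r..<N}. h i = k l} > 0" using 0(5)[of "k l"] by simp
    then obtain i where "i \<ge> R" "h i = k l" using r by (auto simp: card_gt_0_iff)
    thus ?thesis using hR(2)[of i] by simp
  qed
  have "Good K {r..<N} L k h = ({0, 1} \<times> L \<times> {r..<N}) \<rightarrow>\<^sub>E {..<p ^ K}"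
  proof -
    have "[(\<Sum>l\<in>L. int (p ^ (K - k l)) * int (v (0, l, i)) * int (v (1, l, j))) = (if i = j then int (p ^ (K - h i)) else 0)] (mod int (p ^ K))"
      if "i \<in> {r..<N}" for v :: "nat \<times> nat \<times> nat \<Rightarrow> nat" and i j
    proof -
      have "int (p ^ K) dvd (\<Sum>l\<in>L. int (p ^ (K - k l)) * int (v (0, l, i)) * int (v (1, l, j)))"
        by (rule dvd_sum) (simp add: k0 mult.assoc)
      moreover have "int (p ^ K) dvd (if i = j then int (p ^ (K - h i)) else 0)" using hR(2)[of i] that r by (cases "i = j") auto
      ultimately show ?thesis unfolding cong_iff_dvd_diff by (rule dvd_diff)
    qed
    thus ?thesis unfolding Good_def by blast
  qed
  moreover have "card (({0::nat, 1} \<times> L \<times> {r..<N}) \<rightarrow>\<^sub>E {..<p ^ K}) = (p ^ K) ^ (2 * (N - r)\<^sup>2)"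
  proof -
    have "card ({0::nat, 1} \<times> L \<times> {r..<N}) = 2 * (N - r)\<^sup>2" using 0(4) by (simp add: card_cartesian_product power2_eq_square)
    thus ?thesis using 0(3) by (simp add: card_PiE)
  qed
  ultimately show ?case by (simp add: r)
next
  case (Suc d)
  hence r: "r < R" by simp
  let ?I = "{r..<N}" and ?H = "h r"
  define n where "n = N - Suc r"
  have n: "N - r = Suc n" using r RN by (simp add: n_def)
  define D where "D = (\<Prod>i\<in>{Suc r..<R}. (1 - 1 / real p ^ card {j \<in> {i..<N}. h j = h i}) / real p ^ (h i * (2 * (N - i) - 1)))"
  have kH: "k l \<le> ?H" if "l \<in> L" for l
  proof -
    have "card {l' \<in> L. k l' = k l} > 0" using that Suc.prems(2) by (subst card_gt_0_iff) auto
    hence "card {i \<in> {r..<N}. h i = k l} > 0" using Suc.prems(4)[of "k l"] by simp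
    then obtain i where "i \<ge> r" "h i = k l" by (auto simp: card_gt_0_iff)
    thus ?thesis using h[of r i] by simp
  qed
  have I': "?I - {r} = {Suc r..<N}" by auto
  have "(1 - 1 / real p ^ card {l \<in> L. k l = ?H}) / real p ^ (?H * (2 * n + 1)) * D * real (p ^ K) ^ (2 * (Suc n)\<^sup>2) \<le> real (card (Good K ?I L k h))"
  proof (rule Good_step)
    show "finite ?I" "finite L" "card ?I = Suc n" "card L = Suc n" "r \<in> ?I" "?H = ?H" "1 \<le> ?H" "?H \<le> K"
      using Suc.prems n r hR(1)[OF r] hK RN by auto
    show "k l \<le> ?H" if "l \<in> L" for l by (rule kH[OF that])
    fix l assume l: "l \<in> L" "k l = ?H"
    show "D * real (p ^ K) ^ (2 * n\<^sup>2) \<le> real (card (Good K (?I - {r}) (L - {l}) k h))"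
      unfolding I' D_def n_def
    proof (rule Suc.hyps(1))
      show "d = R - Suc r" using Suc.hyps(2) by simp
      show "Suc r \<le> R" using r by simp
      show "finite (L - {l})" "card (L - {l}) = N - Suc r" using Suc.prems l by auto
      fix v
      have "{l' \<in> L - {l}. k l' = v} = {l' \<in> L. k l' = v} - {l}" by auto
      hence a: "card {l' \<in> L - {l}. k l' = v} = card {l' \<in> L. k l' = v} - (if v = ?H then 1 else 0)"
        using l Suc.prems(2) by (auto simp: card_Diff_singleton_if)
      have "{i \<in> {Suc r..<N}. h i = v} = {i \<in> {r..<N}. h i = v} - {r}" by auto
      hence b: "card {i \<in> {Suc r..<N}. h i = v} = card {i \<in> {r..<N}. h i = v} - (if v = ?H then 1 else 0)"
        using r RN by (auto simp: card_Diff_singleton_if)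
      show "card {l' \<in> L - {l}. k l' = v} = card {i \<in> {Suc r..<N}. h i = v}" unfolding a b Suc.prems(4) ..
    qed
  qed
  moreover have "(\<Prod>i\<in>{r..<R}. (1 - 1 / real p ^ card {j \<in> {i..<N}. h j = h i}) / real p ^ (h i * (2 * (N - i) - 1)))
    = (1 - 1 / real p ^ card {l \<in> L. k l = ?H}) / real p ^ (?H * (2 * n + 1)) * D"
    unfolding D_def prod.atLeast_Suc_lessThan[OF r] Suc.prems(4) by (simp add: n)
  ultimately show ?case by (simp only: n)
qed

end

section \<open>The upper bound for point masses\<close>

lemma Delta0_nat:
  assumes "k \<in> Delta0"
  obtains h :: "nat \<Rightarrow> nat" and R where "\<And>i. k i = ereal (real (h i))" "\<And>i j. i \<le> j ==> h j \<le> h i" "\<And>i. i < R ==> h i \<ge> 1" "\<And>i. i \<ge> R ==> h i = 0"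
proof -
  have kD: "k \<in> Delta" and nn: "\<And>j. 0 \<le> k j" using assms by (auto simp: Delta0_def)
  obtain n where n: "\<And>j. j \<ge> n ==> k j = 0" using assms by (auto simp: Delta0_def)
  define h where "h i = nat \<lfloor>real_of_ereal (k i)\<rfloor>" for i
  have kh: "k i = ereal (real (h i))" for i
  proof -
    have "k i \<in> Zbar" using kD by (simp add: Delta_def)
    thus ?thesis using nn[of i] by (auto simp: Zbar_def h_def)
  qed
  have anti: "h j \<le> h i" if "i \<le> j" for i j
  proof -
    have "k j \<le> k i" using kD that by (simp add: Delta_def decseq_def)
    thus ?thesis by (simp add: kh)
  qed
  define R where "R = (LEAST n. h n = 0)"
  have "h n = 0" using n[of n] kh[of n] by simp
  hence R: "h R = 0" unfolding R_def by (rule LeastI)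
  show ?thesis
  proof (rule that[of h R])
    show "h i \<ge> 1" if "i < R" for i using not_less_Least[of i "\<lambda>n. h n = 0"] that by (simp add: R_def)
    show "h i = 0" if "i \<ge> R" for i using anti[OF that] R by simp
  qed (use kh anti in auto)
qed

context hua
begin

context
  fixes k :: "nat \<Rightarrow> ereal" and h :: "nat \<Rightarrow> nat" and R :: nat
  assumes kh: "\<And>i. k i = ereal (real (h i))" and hR: "\<And>i. i < R ==> h i \<ge> 1" "\<And>i. i \<ge> R ==> h i = 0"
begin

lemma T_diagm: "T (diagm p N k (i, j)) 0 = (if i = j \<and> h i \<noteq> 0 then real p powi (- int (h i)) else 0)"
  using T_ppow[of "k i" 0] by (auto simp: diagm_def ppow_real_def kh)

lemma diagm_Qp: "diagm p N k q \<in> Qp p" using qp_ppow_Qp qp_zero_Qp by (cases q) (simp add: diagm_def)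

lemma gma_diag: assumes "R \<le> N" shows "gma N (diagm p N k) = real p ^ (\<Sum>i<R. h i)"
proof -
  have "rg N N (\<lambda>i j. T (diagm p N k (i, j)) 0) = rg N N (\<lambda>i j. if i = j then 1 / real (p ^ h i) else 0)"
    by (rule rg_cong) (auto simp: T_diagm power_int_minus divide_inverse)
  hence "gma N (diagm p N k) = real (\<Prod>i<N. p ^ h i)"
    unfolding gma_def by (simp only:) (subst rg_diag_card, use p_gt1 in auto)
  also have "(\<Prod>i<N. p ^ h i) = p ^ (\<Sum>i<N. h i)" by (simp add: power_sum)
  also have "(\<Sum>i<N. h i) = (\<Sum>i<R. h i)" by (rule sum.mono_neutral_right) (use assms hR(2) in auto)
  finally show ?thesis by simp
qed

text \<open>As \<open>klim k = 0\<close>, the term with \<open>Z_ij\<close> is integral, and modulo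
  Z_p the entry \<open>(i, j)\<close> is \<open>\<Sum>\<^sub>l p^(-h l) x_il y_jl\<close>. The event
  contains the one that the residues lie in \<open>Good\<close>.\<close>

lemma mu_boxset_lower:
  assumes k: "k \<in> Delta" "proper k" and RN: "R \<le> N"
  shows "(\<Prod>i\<in>{0..<R}. (1 - 1 / real p ^ card {j \<in> {i..<N}. h j = h i}) / real p ^ (h i * (2 * (N - i) - 1)))
    \<le> measure (mu p k) (boxset N (diagm p N k) 0)"
proof -
  have anti: "h j \<le> h i" if "i \<le> j" for i j using Delta_mono[OF k(1) that] by (simp add: kh)
  have kl: "klim k = 0"
  proof (rule antisym)
    show "klim k \<le> 0" using klim_le[of k R] hR(2)[of R] by (simp add: kh zero_ereal_def)
    show "0 \<le> klim k" unfolding klim_def by (rule INF_greatest) (simp add: kh)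
  qed
  define K where "K = max 1 (h 0)"
  have hK: "h i \<le> K" for i using anti[of 0 i] by (simp add: K_def)
  have K: "k 0 \<le> ereal (real_of_int (int K))" using hK[of 0] by (simp add: kh)
  let ?q = "real (p ^ K)"
  have q0: "?q > 0" using p_gt1 by simp
  let ?J = "{0, 1} \<times> {..<N} \<times> {0..<N} :: (nat \<times> nat \<times> nat) set"
  let ?Q = "\<lambda>v. v \<in> Good K {0..<N} {..<N} h h"
  let ?D = "{w \<in> space (Omega p). ?Q (restrict (\<lambda>j. rs K (w j)) ?J)}"
  have D: "?D \<in> sets (Omega p)" unfolding Omega_def by (rule residue_law(1)) auto
  have cJ: "card ?J = 2 * N\<^sup>2" by (simp add: card_cartesian_product power2_eq_square)
  have eG: "{v \<in> ?J \<rightarrow>\<^sub>E {..<p ^ K}. ?Q v} = Good K {0..<N} {..<N} h h"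
  proof (intro set_eqI iffI)
    fix v assume v: "v \<in> Good K {0..<N} {..<N} h h"
    hence "v \<in> ?J \<rightarrow>\<^sub>E {..<p ^ K}" unfolding Good_def by (elim CollectE conjE)
    thus "v \<in> {v \<in> ?J \<rightarrow>\<^sub>E {..<p ^ K}. ?Q v}" using v by (intro CollectI conjI)
  qed (elim CollectE conjE)
  have "measure (Omega p) ?D = real (card {v \<in> ?J \<rightarrow>\<^sub>E {..<p ^ K}. ?Q v}) / real p ^ (K * card ?J)"
    unfolding Omega_def by (rule residue_law(2)) auto
  hence mD: "measure (Omega p) ?D = real (card (Good K {0..<N} {..<N} h h)) / ?q ^ (2 * N\<^sup>2)"
    unfolding eG cJ by (simp add: power_mult)
  have "(\<Prod>i\<in>{0..<R}. (1 - 1 / real p ^ card {j \<in> {i..<N}. h j = h i}) / real p ^ (h i * (2 * (N - i) - 1))) * ?q ^ (2 * (N - 0)\<^sup>2)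
      \<le> real (card (Good K {0..<N} {..<N} h h))"
    by (rule Good_lower) (use anti hK hR RN in \<open>auto simp: lessThan_atLeast0\<close>)
  hence "(\<Prod>i\<in>{0..<R}. (1 - 1 / real p ^ card {j \<in> {i..<N}. h j = h i}) / real p ^ (h i * (2 * (N - i) - 1))) \<le> measure (Omega p) ?D"
    unfolding mD using q0 by (simp add: pos_le_divide_eq del: of_nat_power)
  also have "\<dots> \<le> measure (mu p k) (boxset N (diagm p N k) 0)"
  proof (rule mu_lower[OF k(2) boxset_sets D], rule AE_mp[OF AE_Omega_Zp], intro AE_I2 impI)
    fix w assume w: "\<forall>q. w q \<in> Zp p" and wD: "w \<in> ?D"
    have wG: "restrict (\<lambda>j. rs K (w j)) ?J \<in> Good K {0..<N} {..<N} h h" using wD by simp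
    have AQ: "Amat p k w (i, j) \<in> Qp p" for i j by (rule Amat_Qp[OF k(1)]) (use w in blast)
    have "Amat p k w (i, j) \<in> cyl (diagm p N k (i, j)) (int 0)" if ij: "i < N" "j < N" for i j
    proof -
      let ?x = "\<lambda>l. real (rs K (w (0, l, i))) * real (rs K (w (1, l, j)))"
      let ?S = "\<Sum>n<N. if k n > klim k then ppow_real (k n) * ?x n else 0"
      let ?X = "\<Sum>n<N. real p powi (- int (h n)) * ?x n"
      let ?d = "if i = j then real p powi (- int (h i)) else 0"
      have kN: "k n = klim k" if "n \<ge> N" for n using hR(2)[of n] that RN by (simp add: kl) (simp add: kh zero_ereal_def)
      have 1: "T (Amat p k w (i, j)) 0 - (?S + ppow_real (klim k) * real (rs K (w (2, i, j)))) \<in> \<int>"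
        by (rule Amat_T0[OF k(1) _ K kN]) (use w in auto)
      have 2: "ppow_real (klim k) * real (rs K (w (2, i, j))) \<in> \<int>" by (simp add: kl ppow_real_def)
      have 3: "?S - ?X \<in> \<int>" unfolding sum_subtractf[symmetric]
      proof (rule Ints_sum)
        fix n show "(if k n > klim k then ppow_real (k n) * ?x n else 0) - real p powi (- int (h n)) * ?x n \<in> \<int>"
          by (cases "h n = 0") (auto simp: kl kh ppow_real_def zero_ereal_def)
      qed
      have 4: "?X - ?d \<in> \<int>"
      proof -
        let ?v = "restrict (\<lambda>j. rs K (w j)) ?J"
        have "[(\<Sum>l\<in>{..<N}. int (p ^ (K - h l)) * int (?v (0, l, i)) * int (?v (1, l, j))) = (if i = j then int (p ^ (K - h i)) else 0)] (mod int (p ^ K))"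
          using wG ij unfolding Good_def by (elim CollectE conjE) (drule bspec[of _ _ i], simp, drule bspec[of _ _ j], simp, assumption)
        then obtain m where m: "(\<Sum>l\<in>{..<N}. int (p ^ (K - h l)) * int (?v (0, l, i)) * int (?v (1, l, j))) - (if i = j then int (p ^ (K - h i)) else 0) = int (p ^ K) * m"
          unfolding cong_iff_dvd_diff by (rule dvdE)
        have "(\<Sum>l\<in>{..<N}. int (p ^ (K - h l)) * int (?v (0, l, i)) * int (?v (1, l, j))) = (\<Sum>l\<in>{..<N}. int (p ^ (K - h l)) * int (rs K (w (0, l, i))) * int (rs K (w (1, l, j))))"
          by (rule sum.cong) (use ij in auto)
        hence "real_of_int ((\<Sum>l\<in>{..<N}. int (p ^ (K - h l)) * int (rs K (w (0, l, i))) * int (rs K (w (1, l, j)))) - (if i = j then int (p ^ (K - h i)) else 0)) = real_of_int (int (p ^ K) * m)"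
          using m by simp
        hence "(\<Sum>l<N. real p ^ (K - h l) * ?x l) - (if i = j then real p ^ (K - h i) else 0) = ?q * real_of_int m"
          by (cases "i = j") (simp_all add: mult.assoc)
        moreover have pw: "real p ^ (K - h l) = ?q * real p powi (- int (h l))" for l
          using hK[of l] p_gt1 by (simp add: power_int_minus power_diff divide_inverse)
        have "(\<Sum>l<N. real p ^ (K - h l) * ?x l) - (if i = j then real p ^ (K - h i) else 0) = ?q * (?X - ?d)"
          unfolding pw right_diff_distrib sum_distrib_left by (simp add: mult.assoc del: of_nat_power)
        ultimately have "?q * (?X - ?d) = ?q * real_of_int m" by (simp only:)
        moreover have "?q \<noteq> 0" using q0 by (rule less_imp_neq[symmetric])
        ultimately have "?X - ?d = real_of_int m" by (rule mult_left_cancel[THEN iffD1, rotated])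
        thus ?thesis by (simp only: Ints_of_int)
      qed
      have 5: "?d - T (diagm p N k (i, j)) 0 \<in> \<int>" by (auto simp: T_diagm)
      from Ints_add[OF Ints_add[OF Ints_add[OF 1 2] 3] Ints_add[OF 4 5]]
      have "T (Amat p k w (i, j)) 0 - T (diagm p N k (i, j)) 0 \<in> \<int>" by simp
      thus ?thesis by (subst cyl_iff[OF AQ diagm_Qp]) (simp add: PZ_zero_eq)
    qed
    thus "Amat p k w \<in> boxset N (diagm p N k) 0" using AQ by (auto simp: boxset_def space_matinf)
  qed
  finally show ?thesis .
qed

end

end

context decomp
begin

text \<open>Divides the probability of the box around the diagonal matrix by the lower bound for
  \<open>\<mu>\<^sub>k\<close>. The multiples of \<open>2 N\<close> in the exponents cancel, so only
  \<open>cN s N\<close> still depends on \<open>N\<close>, and it has a limit.\<close>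

lemma nu_singleton_le:
  assumes kD: "k \<in> Delta" and kh: "\<And>i. k i = ereal (real (h i))" and hR: "\<And>i. i < R ==> h i \<ge> 1" "\<And>i. i \<ge> R ==> h i = 0"
  shows "measure \<nu> {k} \<le> qpoch_inf (real p powr (-1 - s)) (1 / real p)
    * real p powr (- (\<Sum>i<R. (2 * real i + 1) * real (h i)) - s * (\<Sum>i<R. real (h i)))
    / (\<Prod>i<R. 1 - 1 / real p ^ card {j \<in> {i..<R}. h j = h i})" (is "_ \<le> ?a * ?b / ?c")
proof -
  have pos: "1 - 1 / real p ^ card {j \<in> {i..<R}. h j = h i} > 0" if "i < R" for i
  proof -
    have "card {j \<in> {i..<R}. h j = h i} > 0" using that by (subst card_gt_0_iff) auto
    hence "1 < real p ^ card {j \<in> {i..<R}. h j = h i}" using p_gt1 by (intro one_less_power) auto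
    thus ?thesis using p_gt1 by (subst diff_gt_0_iff_gt, subst divide_less_eq_1_pos) auto
  qed
  hence c0: "?c > 0" by (intro prod_pos) auto
  have le: "measure \<nu> {k} \<le> cN s N * (?b / ?c)" if N: "N \<ge> Suc R" for N
  proof -
    let ?A = "boxset N (diagm p N k) 0" and ?H = "\<Sum>i<R. h i"
    let ?P = "\<Prod>i\<in>{0..<R}. (1 - 1 / real p ^ card {j \<in> {i..<N}. h j = h i}) / real p ^ (h i * (2 * (N - i) - 1))"
    have RN: "R \<le> N" using N by simp
    have g: "gma N (diagm p N k) = real p ^ ?H" by (rule gma_diag[OF kh hR RN])
    have M: "measure (Ms p s) ?A = cN s N * (real p ^ ?H) powr (- s - 2 * real N)"
      using Ms_boxset[of N "diagm p N k" 0] diagm_Qp[OF kh hR] g by simp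
    have Mpos: "measure (Ms p s) ?A > 0" unfolding M using cN_pos[of N] p_gt1 by simp
    have "?P * measure \<nu> {k} \<le> measure (Ms p s) ?A"
      by (rule decomp_lower[OF boxset_sets Mpos delta_singleton_sets[OF kD]]) (use mu_boxset_lower[OF kh hR kD _ RN] in auto)
    moreover have P: "?P = ?c / real p powr (\<Sum>i<R. real (h i) * (2 * real N - 2 * real i - 1))"
    proof -
      have "?P = (\<Prod>i<R. (1 - 1 / real p ^ card {j \<in> {i..<R}. h j = h i}) / real p powr (real (h i) * (2 * real N - 2 * real i - 1)))"
        unfolding lessThan_atLeast0
      proof (rule prod.cong[OF refl])
        fix i assume i: "i \<in> {0..<R}"
        have "{j \<in> {i..<N}. h j = h i} = {j \<in> {i..<R}. h j = h i}" using i hR(1)[of i] hR(2) RN by (force simp: not_less[symmetric])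
        moreover have "real p ^ (h i * (2 * (N - i) - 1)) = real p powr real (h i * (2 * (N - i) - 1))" by (rule powr_realpow[symmetric]) (use p_gt1 in simp)
        moreover have "real (h i * (2 * (N - i) - 1)) = real (h i) * (2 * real N - 2 * real i - 1)"
          using i N by (simp add: of_nat_diff)
        ultimately show "(1 - 1 / real p ^ card {j \<in> {i..<N}. h j = h i}) / real p ^ (h i * (2 * (N - i) - 1))
          = (1 - 1 / real p ^ card {j \<in> {i..<R}. h j = h i}) / real p powr (real (h i) * (2 * real N - 2 * real i - 1))" by (simp only:)
      qed
      also have "\<dots> = ?c / (\<Prod>i<R. real p powr (real (h i) * (2 * real N - 2 * real i - 1)))" by (rule prod_dividef)
      also have "(\<Prod>i<R. real p powr (real (h i) * (2 * real N - 2 * real i - 1))) = real p powr (\<Sum>i<R. real (h i) * (2 * real N - 2 * real i - 1))"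
        using p_gt1 by (subst powr_sum) auto
      finally show ?thesis .
    qed
    ultimately have "measure \<nu> {k} * ?c \<le> measure (Ms p s) ?A * real p powr (\<Sum>i<R. real (h i) * (2 * real N - 2 * real i - 1))"
      unfolding P using p_gt1 by (simp add: field_simps)
    also have "\<dots> = cN s N * ?b"
    proof -
      have "(real p ^ ?H) powr (- s - 2 * real N) = real p powr ((\<Sum>i<R. real (h i)) * (- s - 2 * real N))"
        using p_gt1 by (simp add: powr_realpow[symmetric] powr_powr)
      moreover have "(\<Sum>i<R. real (h i)) * (- s - 2 * real N) + (\<Sum>i<R. real (h i) * (2 * real N - 2 * real i - 1))
        = - (\<Sum>i<R. (2 * real i + 1) * real (h i)) - s * (\<Sum>i<R. real (h i))"
        unfolding sum_distrib_left sum_distrib_right sum.distrib[symmetric] sum_negf[symmetric] sum_subtractf[symmetric]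
        by (intro sum.cong refl) (simp add: algebra_simps)
      ultimately show ?thesis unfolding M by (simp add: powr_add[symmetric])
    qed
    finally show ?thesis using c0 by (simp add: pos_le_divide_eq)
  qed
  have "(\<lambda>N. cN s N * (?b / ?c)) \<longlonglongrightarrow> ?a * (?b / ?c)" by (intro tendsto_intros cN_limit)
  hence "measure \<nu> {k} \<le> ?a * (?b / ?c)" by (rule LIMSEQ_le_const) (use le in blast)
  thus ?thesis by simp
qed

end

section \<open>The Markov chain\<close>

lemma qpoch_Suc: "qpoch a q (Suc n) = qpoch a q n * (1 - a * q ^ n)" by (simp add: qpoch_def)
lemma qpoch_0 [simp]: "qpoch a q 0 = 1" by (simp add: qpoch_def)

lemma qpoch_add: "qpoch a q (m + n) = qpoch a q m * qpoch (a * q ^ m) q n"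
  by (induction n) (simp_all add: qpoch_Suc power_add mult.assoc)

lemma qpoch_pos: assumes "0 < q" "q < 1" "0 < a" "a < 1" shows "qpoch a q n > 0"
proof (induction n)
  case (Suc n)
  have "a * q ^ n < 1 * 1" by (rule mult_less_le_imp_less) (use assms in \<open>auto simp: power_le_one\<close>)
  thus ?case using Suc by (simp add: qpoch_Suc)
qed simp

definition gauss_binom :: "real \<Rightarrow> nat \<Rightarrow> nat \<Rightarrow> real" where
  "gauss_binom q n k = (if k \<le> n then qpoch q q n / (qpoch q q k * qpoch q q (n - k)) else 0)"

lemma gauss_binom_0: assumes "0 < q" "q < 1" shows "gauss_binom q n 0 = 1"
  using qpoch_pos[OF assms assms, of n] by (simp add: gauss_binom_def)

lemma gauss_binom_Suc_Suc:
  assumes q: "0 < q" "q < 1" and k: "k \<le> n"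
  shows "gauss_binom q (Suc n) (Suc k) = gauss_binom q n (Suc k) + q ^ (n - k) * gauss_binom q n k"
proof -
  have pos: "qpoch q q m > 0" for m by (rule qpoch_pos[OF q q])
  have ne: "1 - q ^ Suc m \<noteq> 0" for m using power_Suc_less_one[of q m] q by simp
  have S: "qpoch q q (Suc m) = qpoch q q m * (1 - q ^ Suc m)" for m by (simp add: qpoch_Suc)
  show ?thesis
  proof (cases "k = n")
    case True
    thus ?thesis using pos[of n] pos[of "Suc n"] by (simp add: gauss_binom_def)
  next
    case False
    define m where "m = n - Suc k"
    have n: "n = Suc (k + m)" using False k by (simp add: m_def)
    have d: "Suc n - Suc k = Suc m" "n - Suc k = m" "n - k = Suc m" using n by auto
    have e: "1 - q ^ Suc n = (1 - q ^ Suc m) + q ^ Suc m * (1 - q ^ Suc k)" by (simp add: n power_add algebra_simps)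
    have "gauss_binom q (Suc n) (Suc k) = qpoch q q n * (1 - q ^ Suc n) / (qpoch q q k * (1 - q ^ Suc k) * (qpoch q q m * (1 - q ^ Suc m)))"
      using k by (simp only: gauss_binom_def d S Suc_le_mono if_True)
    also have "\<dots> = qpoch q q n / (qpoch q q k * (1 - q ^ Suc k) * qpoch q q m) + q ^ Suc m * (qpoch q q n / (qpoch q q k * (qpoch q q m * (1 - q ^ Suc m))))"
      unfolding e using pos[of k] pos[of m] ne[of k] ne[of m] by (simp add: divide_simps del: power_Suc) (simp add: algebra_simps del: power_Suc)
    also have "\<dots> = gauss_binom q n (Suc k) + q ^ (n - k) * gauss_binom q n k"
      using n by (simp add: gauss_binom_def d S[of k] S[of m] del: power_Suc)
    finally show ?thesis .
  qed
qed

text \<open>Pascal's rule turns the sum \<open>S\<^sub>n(b)\<close> into \<open>S\<^sub>n\<^sub>+\<^sub>1(b) = (1 - bq\<^sup>n) S\<^sub>n(b) + bq\<^sup>n S\<^sub>n(bq)\<close>.\<close>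

lemma gauss_durfee_sum:
  assumes q: "0 < q" "q < 1"
  shows "(\<Sum>k\<le>n. gauss_binom q n k * b ^ k * q ^ (k * (k - 1)) * qpoch (b * q ^ k) q (n - k)) = 1"
proof (induction n arbitrary: b)
  case 0 show ?case by (simp add: gauss_binom_0[OF q])
next
  case (Suc n)
  define c where "c k = b ^ k * q ^ (k * (k - 1)) * qpoch (b * q ^ k) q (Suc n - k)" for k
  have c1: "c k = (1 - b * q ^ n) * (b ^ k * q ^ (k * (k - 1)) * qpoch (b * q ^ k) q (n - k))" if "k \<le> n" for k
  proof -
    have "Suc n - k = Suc (n - k)" using that by simp
    moreover have "b * q ^ k * q ^ (n - k) = b * q ^ n" using that by (simp add: mult.assoc power_add[symmetric])
    ultimately show ?thesis by (simp add: c_def qpoch_Suc)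
  qed
  have c2: "q ^ (n - k) * c (Suc k) = b * q ^ n * ((b * q) ^ k * q ^ (k * (k - 1)) * qpoch (b * q * q ^ k) q (n - k))" if "k \<le> n" for k
  proof -
    have pw: "q ^ (n - k) * q ^ (Suc k * (Suc k - 1)) = q ^ n * q ^ k * q ^ (k * (k - 1))"
    proof -
      have "(n - k) + Suc k * (Suc k - 1) = n + k + k * (k - 1)" using that by (cases k) (auto simp: algebra_simps)
      thus ?thesis by (simp only: power_add[symmetric])
    qed
    have "q ^ (n - k) * c (Suc k) = b ^ Suc k * (q ^ (n - k) * q ^ (Suc k * (Suc k - 1))) * qpoch (b * q ^ Suc k) q (n - k)"
      by (simp only: c_def diff_Suc_Suc ac_simps)
    hence "q ^ (n - k) * c (Suc k) = b ^ Suc k * (q ^ n * q ^ k * q ^ (k * (k - 1))) * qpoch (b * q ^ Suc k) q (n - k)"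
      by (simp only: pw)
    thus ?thesis by (simp add: power_mult_distrib ac_simps)
  qed
  have "(\<Sum>k\<le>Suc n. gauss_binom q (Suc n) k * b ^ k * q ^ (k * (k - 1)) * qpoch (b * q ^ k) q (Suc n - k)) = (\<Sum>k\<le>Suc n. gauss_binom q (Suc n) k * c k)"
    by (simp add: c_def mult.assoc)
  also have "\<dots> = gauss_binom q (Suc n) 0 * c 0 + (\<Sum>k\<le>n. gauss_binom q (Suc n) (Suc k) * c (Suc k))" by (rule sum.atMost_Suc_shift)
  also have "(\<Sum>k\<le>n. gauss_binom q (Suc n) (Suc k) * c (Suc k)) = (\<Sum>k\<le>n. gauss_binom q n (Suc k) * c (Suc k)) + (\<Sum>k\<le>n. gauss_binom q n k * (q ^ (n - k) * c (Suc k)))"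
    unfolding sum.distrib[symmetric] by (intro sum.cong refl) (simp add: gauss_binom_Suc_Suc[OF q] algebra_simps)
  also have "gauss_binom q (Suc n) 0 * c 0 + ((\<Sum>k\<le>n. gauss_binom q n (Suc k) * c (Suc k)) + (\<Sum>k\<le>n. gauss_binom q n k * (q ^ (n - k) * c (Suc k))))
     = (\<Sum>k\<le>Suc n. gauss_binom q n k * c k) + (\<Sum>k\<le>n. gauss_binom q n k * (q ^ (n - k) * c (Suc k)))"
    unfolding sum.atMost_Suc_shift[of "\<lambda>k. gauss_binom q n k * c k"] by (simp add: gauss_binom_0[OF q])
  also have "(\<Sum>k\<le>Suc n. gauss_binom q n k * c k) = (\<Sum>k\<le>n. gauss_binom q n k * c k)" by (simp add: gauss_binom_def)
  also have "\<dots> = (1 - b * q ^ n) * (\<Sum>k\<le>n. gauss_binom q n k * b ^ k * q ^ (k * (k - 1)) * qpoch (b * q ^ k) q (n - k))"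
    unfolding sum_distrib_left by (intro sum.cong refl) (simp add: c1 ac_simps)
  also have "(\<Sum>k\<le>n. gauss_binom q n k * (q ^ (n - k) * c (Suc k))) = b * q ^ n * (\<Sum>k\<le>n. gauss_binom q n k * (b * q) ^ k * q ^ (k * (k - 1)) * qpoch (b * q * q ^ k) q (n - k))"
    unfolding sum_distrib_left by (intro sum.cong refl) (simp only: atMost_iff c2, simp only: ac_simps)
  finally show ?case unfolding Suc.IH by simp
qed

context hua
begin

abbreviation "aa \<equiv> real p powr (-1 - s)"
abbreviation "qq \<equiv> 1 / real p"

lemma qq_pos: "qpoch qq qq n > 0" by (rule qpoch_pos[OF q_bounds q_bounds])
lemma aa_pos: "qpoch aa qq n > 0" by (rule qpoch_pos[OF q_bounds a_bounds])

lemma Pker_nonneg: "0 \<le> Pker p s x y" using qq_pos aa_pos by (simp add: Pker_def less_imp_le)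

text \<open>With \<open>a = p^(-1-s)\<close> the weight \<open>p^(-y\<^sup>2-sy)\<close> is
  \<open>a^y q^(y(y-1))\<close>, and the quotient of the two \<open>(a; q)\<close> factors is a
  shifted one. This is the summand of \<open>gauss_durfee_sum\<close> at
  \<open>b = a\<close>.\<close>

lemma Pker_gauss: assumes "y \<le> x"
  shows "Pker p s x y = gauss_binom qq x y * aa ^ y * qq ^ (y * (y - 1)) * qpoch (aa * qq ^ y) qq (x - y)"
proof -
  have "real p powr (- ((real y)^2) - s * real y) = aa ^ y * qq ^ (y * (y - 1))"
  proof -
    have "real p powr (- ((real y)^2) - s * real y) = real p powr ((-1 - s) * real y) * real p powr (- real (y * (y - 1)))"
    proof -
      have "real (y * (y - 1)) = real y * (real y - 1)" by (cases y) (auto simp: algebra_simps)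
      thus ?thesis by (simp add: powr_add[symmetric] power2_eq_square algebra_simps)
    qed
    also have "real p powr ((-1 - s) * real y) = aa ^ y" using p_gt1 by (simp add: powr_powr[symmetric] powr_realpow)
    also have "real p powr (- real (y * (y - 1))) = qq ^ (y * (y - 1))" using p_gt1 by (simp only: powr_minus powr_realpow) (simp add: powr_realpow power_inverse divide_inverse)
    finally show ?thesis .
  qed
  moreover have "qpoch aa qq x = qpoch aa qq y * qpoch (aa * qq ^ y) qq (x - y)" using qpoch_add[of aa qq y "x - y"] assms by simp
  ultimately show ?thesis using assms qq_pos aa_pos[of y] by (simp add: Pker_def gauss_binom_def)
qed

lemma sum_Pker_le1: "(\<Sum>y\<le>B. Pker p s x y) \<le> 1"
proof -
  have "(\<Sum>y\<le>B. Pker p s x y) \<le> (\<Sum>y\<le>max B x. Pker p s x y)" by (rule sum_mono2) (auto simp: Pker_nonneg)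
  also have "\<dots> = (\<Sum>y\<le>x. Pker p s x y)" by (rule sum.mono_neutral_right) (auto simp: Pker_def)
  also have "\<dots> = 1" using gauss_durfee_sum[OF q_bounds, of x aa] by (simp add: Pker_gauss)
  finally show ?thesis .
qed

lemma qpoch_inf_pos: "qpoch_inf aa qq > 0" using qpoch_inf_limit[of aa qq] a_bounds q_bounds by auto

lemma pidist_nonneg: "0 \<le> pidist p s x" using qpoch_inf_pos qq_pos aa_pos by (simp add: pidist_def less_imp_le)

text \<open>\<open>pidist\<close> is the kernel started from infinity; its partial sums inherit the
  bound 1 from the kernel.\<close>

lemma Pker_limit: "(\<lambda>n. Pker p s n y) \<longlonglongrightarrow> pidist p s y"
proof -
  have la: "qpoch aa qq \<longlonglongrightarrow> qpoch_inf aa qq" using qpoch_inf_limit[of aa qq] a_bounds q_bounds by auto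
  have lq: "qpoch qq qq \<longlonglongrightarrow> qpoch_inf qq qq" and pq: "qpoch_inf qq qq > 0" using qpoch_inf_limit[of qq qq] q_bounds by auto
  have "(\<lambda>n. real p powr (- ((real y)^2) - s * real y) * qpoch qq qq (n + y) * qpoch aa qq (n + y)
     / (qpoch qq qq y * qpoch qq qq n * qpoch aa qq y)) \<longlonglongrightarrow> real p powr (- ((real y)^2) - s * real y) * qpoch_inf qq qq * qpoch_inf aa qq
     / (qpoch qq qq y * qpoch_inf qq qq * qpoch aa qq y)"
    by (intro tendsto_intros LIMSEQ_ignore_initial_segment la lq) (use qq_pos[of y] aa_pos[of y] pq in simp)
  hence "(\<lambda>n. Pker p s (n + y) y) \<longlonglongrightarrow> pidist p s y" using pq by (simp add: Pker_def pidist_def)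
  thus ?thesis by (rule LIMSEQ_offset)
qed

lemma sum_pidist_le1: "(\<Sum>y\<le>B. pidist p s y) \<le> 1"
proof -
  have "(\<lambda>n. \<Sum>y\<le>B. Pker p s n y) \<longlonglongrightarrow> (\<Sum>y\<le>B. pidist p s y)" by (intro tendsto_sum Pker_limit)
  thus ?thesis by (rule LIMSEQ_le_const2) (use sum_Pker_le1 in blast)
qed

text \<open>The weight of a path of \<open>d\<close> steps for an initial weight \<open>f\<close>,
  which may be the initial law or a row of the kernel.\<close>

definition chain :: "(nat \<Rightarrow> real) \<Rightarrow> nat \<Rightarrow> (nat \<Rightarrow> nat) \<Rightarrow> real" where
  "chain f d z = f (z 0) * (\<Prod>i<d. Pker p s (z i) (z (Suc i)))"

lemma chain_nonneg: "(\<And>y. 0 \<le> f y) ==> 0 \<le> chain f d z"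
  unfolding chain_def by (intro mult_nonneg_nonneg prod_nonneg) (auto simp: Pker_nonneg)

text \<open>The last coordinate is summed out first, and each row of the kernel contributes at most
  1.\<close>

lemma sum_chain_le1:
  assumes f: "\<And>y. 0 \<le> f y" "(\<Sum>y\<le>B. f y) \<le> 1"
  shows "(\<Sum>z\<in>{..d} \<rightarrow>\<^sub>E {..B}. chain f d z) \<le> 1"
proof (induction d)
  case 0
  have "(\<Sum>z\<in>{..0::nat} \<rightarrow>\<^sub>E {..B}. chain f 0 z) = (\<Sum>y\<le>B. f y)"
    by (rule sum.reindex_bij_witness[of _ "\<lambda>y. restrict (\<lambda>_. y) {0}" "\<lambda>z. z 0"]) (auto simp: chain_def PiE_def extensional_def restrict_def)
  thus ?case using f by simp
next
  case (Suc d)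
  have "(\<Sum>z\<in>{..Suc d} \<rightarrow>\<^sub>E {..B}. chain f (Suc d) z) = (\<Sum>(z, y)\<in>({..d} \<rightarrow>\<^sub>E {..B}) \<times> {..B}. chain f d z * Pker p s (z d) y)"
  proof (rule sum.reindex_bij_witness[of _ "\<lambda>(z, y). fun_upd z (Suc d) y" "\<lambda>z. (restrict z {..d}, z (Suc d))"])
    fix z assume z: "z \<in> {..Suc d} \<rightarrow>\<^sub>E {..B}"
    show "(\<lambda>(z, y). fun_upd z (Suc d) y) (restrict z {..d}, z (Suc d)) = z"
      using z by (auto simp: fun_eq_iff PiE_def extensional_def restrict_def)
    show "(restrict z {..d}, z (Suc d)) \<in> ({..d} \<rightarrow>\<^sub>E {..B}) \<times> {..B}" using z by (auto simp: PiE_iff)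
    show "(case (restrict z {..d}, z (Suc d)) of (z, y) \<Rightarrow> chain f d z * Pker p s (z d) y) = chain f (Suc d) z"
      by (simp add: chain_def)
  next
    fix r assume r: "r \<in> ({..d} \<rightarrow>\<^sub>E {..B}) \<times> {..B}"
    obtain z y where ry: "r = (z, y)" by (cases r)
    have z: "z \<in> {..d} \<rightarrow>\<^sub>E {..B}" and y: "y \<in> {..B}" using r by (simp_all add: ry)
    have "restrict (fun_upd z (Suc d) y) {..d} = z"
      using z by (auto simp: fun_eq_iff PiE_def extensional_def restrict_def)
    thus "(restrict ((\<lambda>(z, y). fun_upd z (Suc d) y) r) {..d}, (\<lambda>(z, y). fun_upd z (Suc d) y) r (Suc d)) = r" by (simp add: ry)
    show "(\<lambda>(z, y). fun_upd z (Suc d) y) r \<in> {..Suc d} \<rightarrow>\<^sub>E {..B}"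
      unfolding ry prod.case
    proof (rule PiE_I)
      fix i assume "i \<in> {..Suc d}"
      thus "(fun_upd z (Suc d) y) i \<in> {..B}" using z y by (cases "i = Suc d") (auto simp: PiE_iff)
    next
      fix i assume "i \<notin> {..Suc d}"
      thus "(fun_upd z (Suc d) y) i = undefined" using z by (auto simp: PiE_iff extensional_def)
    qed
  qed
  also have "\<dots> = (\<Sum>z\<in>{..d} \<rightarrow>\<^sub>E {..B}. chain f d z * (\<Sum>y\<le>B. Pker p s (z d) y))"
    by (simp add: sum.cartesian_product[symmetric] sum_distrib_left)
  also have "\<dots> \<le> (\<Sum>z\<in>{..d} \<rightarrow>\<^sub>E {..B}. chain f d z * 1)"
    by (intro sum_mono mult_left_mono sum_Pker_le1 chain_nonneg f)
  also have "\<dots> \<le> 1" using Suc by simp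
  finally show ?case .
qed

text \<open>The factors \<open>(q;q)\<close> and \<open>(a;q)\<close> telescope along the chain.\<close>

lemma chain_pidist:
  assumes anti: "\<And>i. x (Suc i) \<le> x i"
  shows "chain (pidist p s) m x = qpoch_inf aa qq * real p powr (- (\<Sum>i\<le>m. (real (x i))\<^sup>2) - s * (\<Sum>i\<le>m. real (x i)))
    / (qpoch qq qq (x m) * qpoch aa qq (x m) * (\<Prod>i<m. qpoch qq qq (x i - x (Suc i))))"
proof (induction m)
  case 0 show ?case by (simp add: chain_def pidist_def)
next
  case (Suc m)
  let ?w = "\<lambda>m. - (\<Sum>i\<le>m. (real (x i))\<^sup>2) - s * (\<Sum>i\<le>m. real (x i))"
  have "chain (pidist p s) (Suc m) x = chain (pidist p s) m x * Pker p s (x m) (x (Suc m))" by (simp add: chain_def)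
  moreover have "real p powr ?w (Suc m) = real p powr ?w m * real p powr (- ((real (x (Suc m)))^2) - s * real (x (Suc m)))"
    unfolding powr_add[symmetric] by (rule arg_cong[of _ _ "\<lambda>t. real p powr t"]) (simp add: algebra_simps)
  ultimately show ?case unfolding Suc Pker_def using anti[of m] qq_pos[of "x m"] aa_pos[of "x m"] by simp
qed

end

section \<open>Identification of the decomposing measure\<close>

context prob_space
begin

lemma prob_UN_le:
  assumes Y: "countable Y" and C: "\<And>y. y \<in> Y ==> C y \<in> events"
    and le: "\<And>F. finite F ==> F \<subseteq> Y ==> prob (\<Union>y\<in>F. C y) \<le> c"
  shows "prob (\<Union>y\<in>Y. C y) \<le> c"
proof (cases "Y = {}")
  case True
  thus ?thesis using le[of "{}"] by simp
next
  case False
  let ?A = "\<lambda>n. \<Union>y\<in>from_nat_into Y ` {..n}. C y"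
  have mem: "from_nat_into Y i \<in> Y" for i by (rule from_nat_into[OF False])
  have lim: "(\<lambda>n. prob (?A n)) \<longlonglongrightarrow> prob (\<Union>n. ?A n)"
  proof (rule finite_Lim_measure_incseq)
    show "range ?A \<subseteq> events" using C mem by (intro image_subsetI sets.finite_UN) auto
    show "incseq ?A" by (intro incseq_SucI UN_mono) auto
  qed
  have eq: "(\<Union>n. ?A n) = (\<Union>y\<in>Y. C y)"
  proof -
    have "(\<Union>n. ?A n) = (\<Union>y\<in>range (from_nat_into Y). C y)" by auto
    thus ?thesis by (simp add: range_from_nat_into[OF False Y])
  qed
  have "prob (?A n) \<le> c" for n by (rule le) (use mem in auto)
  hence "prob (\<Union>n. ?A n) \<le> c" by (intro LIMSEQ_le_const2[OF lim]) blast
  thus ?thesis by (simp only: eq)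
qed

text \<open>If one event fell short of its weight, the deficit would remain in every finite union,
  because the weights sum to at most 1; the events could then not cover mass 1.\<close>

lemma prob_eq_of_le:
  assumes Y: "countable Y" and C: "\<And>y. y \<in> Y ==> C y \<in> events" and dj: "disjoint_family_on C Y" and total: "prob (\<Union>y\<in>Y. C y) = 1"
    and le: "\<And>y. y \<in> Y ==> prob (C y) \<le> w y" and sum: "\<And>F. finite F ==> F \<subseteq> Y ==> sum w F \<le> 1" and y: "y \<in> Y"
  shows "prob (C y) = w y"
proof -
  have "prob (\<Union>y\<in>Y. C y) \<le> 1 - (w y - prob (C y))"
  proof (rule prob_UN_le[OF Y C])
    fix F assume F: "finite F" "F \<subseteq> Y"
    let ?F = "insert y F"
    have "prob (\<Union>y\<in>F. C y) \<le> prob (\<Union>y\<in>?F. C y)"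
      by (rule finite_measure_mono) (use F y C in \<open>auto intro!: sets.finite_UN\<close>)
    also have "\<dots> = (\<Sum>y\<in>?F. prob (C y))"
    proof (rule finite_measure_finite_Union)
      show "disjoint_family_on C ?F" by (rule disjoint_family_on_mono[OF _ dj]) (use F y in auto)
    qed (use F y C in auto)
    also have "\<dots> = prob (C y) + (\<Sum>z\<in>?F - {y}. prob (C z))" by (rule sum.remove) (use F in auto)
    also have "(\<Sum>z\<in>?F - {y}. prob (C z)) \<le> sum w (?F - {y})" by (rule sum_mono) (use le F in auto)
    also have "prob (C y) + sum w (?F - {y}) = sum w ?F - (w y - prob (C y))"
      using sum.remove[of ?F y w] F by simp
    also have "\<dots> \<le> 1 - (w y - prob (C y))" using sum[of ?F] F y by simp
    finally show "prob (\<Union>y\<in>F. C y) \<le> 1 - (w y - prob (C y))" by simp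
  qed
  thus ?thesis using total le[OF y] by simp
qed

end

text \<open>\<open>xs k i\<close> is \<open>X\<^sub>i\<^sub>+\<^sub>1(k)\<close> of the theorem, as a natural number.\<close>

definition xs :: "(nat \<Rightarrow> ereal) \<Rightarrow> nat \<Rightarrow> nat" where "xs k i = card {j. ereal (real i) < k j}"

context
  fixes k :: "nat \<Rightarrow> ereal" and h :: "nat \<Rightarrow> nat" and R :: nat
  assumes kh: "\<And>i. k i = ereal (real (h i))" and anti: "\<And>i j. i \<le> j ==> h j \<le> h i"
    and hR: "\<And>i. i < R ==> h i \<ge> 1" "\<And>i. i \<ge> R ==> h i = 0"
begin

text \<open>\<open>xs k\<close> is the conjugate partition of \<open>h\<close>: as \<open>h\<close>
  is decreasing, the indices \<open>j\<close> with \<open>i < h j\<close> form an initial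
  segment.\<close>

lemma less_xs: "j < xs k i \<longleftrightarrow> i < h j"
proof -
  define m where "m = (LEAST j. h j \<le> i)"
  have "h m \<le> i" unfolding m_def by (rule LeastI[of _ R]) (use hR(2)[of R] in simp)
  hence "{j. i < h j} = {..<m}"
    using anti not_less_Least[of _ "\<lambda>j. h j \<le> i", folded m_def] by (force simp: not_le not_less)
  hence "xs k i = m" by (simp add: xs_def kh)
  thus ?thesis using \<open>{j. i < h j} = {..<m}\<close> by blast
qed

lemma xs_Suc_le_nat: "xs k (Suc i) \<le> xs k i"
proof (rule ccontr)
  assume "\<not> ?thesis"
  hence "xs k i < xs k (Suc i)" by simp
  hence "i < h (xs k i)" unfolding less_xs by simp
  thus False unfolding less_xs[symmetric] by simp
qed

lemma xs_zero_iff: "xs k i = 0 \<longleftrightarrow> h 0 \<le> i" using less_xs[of 0 i] by auto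

lemma lfun_xs_nat: "lfun k (Suc i) = xs k i - xs k (Suc i)"
proof -
  have "h j = Suc i \<longleftrightarrow> xs k (Suc i) \<le> j \<and> j < xs k i" for j
    using less_xs[of j i] less_xs[of j "Suc i"] by linarith
  hence "{j. k j = ereal (real (Suc i))} = {xs k (Suc i)..<xs k i}"
    by (intro set_eqI) (simp only: kh ereal.inject of_nat_eq_iff mem_Collect_eq atLeastLessThan_iff)
  thus ?thesis by (simp add: lfun_def)
qed

text \<open>Counts the cells of a Young diagram by rows and by columns, with weight
  \<open>g j\<close> for the cells in row \<open>j\<close>. For the weights \<open>2 j + 1\<close>
  the column sums are the squares of the conjugate parts.\<close>

lemma sum_conjugate:
  fixes g :: "nat \<Rightarrow> real"
  assumes m: "h 0 \<le> m"
  shows "(\<Sum>j<R. g j * real (h j)) = (\<Sum>i<m. \<Sum>j<xs k i. g j)"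
proof -
  have hm: "h j \<le> m" for j using anti[of 0 j] m by simp
  have jR: "j < R" if "i < h j" for i j using hR(2)[of j] that by (cases "j < R") auto
  have "(\<Sum>j<R. g j * real (h j)) = (\<Sum>j<R. \<Sum>i<m. if i < h j then g j else 0)"
  proof (rule sum.cong[OF refl])
    fix j
    have "(\<Sum>i<m. if i < h j then g j else 0) = (\<Sum>i<h j. g j)"
      by (rule sum.mono_neutral_cong_right) (use hm[of j] in auto)
    thus "g j * real (h j) = (\<Sum>i<m. if i < h j then g j else 0)" by simp
  qed
  also have "\<dots> = (\<Sum>i<m. \<Sum>j<R. if i < h j then g j else 0)" by (rule sum.swap)
  also have "\<dots> = (\<Sum>i<m. \<Sum>j<xs k i. g j)"
  proof (rule sum.cong[OF refl])
    fix i
    show "(\<Sum>j<R. if i < h j then g j else 0) = (\<Sum>j<xs k i. g j)"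
      by (rule sum.mono_neutral_cong_right) (use jR in \<open>auto simp: not_less[symmetric] less_xs\<close>)
  qed
  finally show ?thesis .
qed

text \<open>Factors are grouped by the value of \<open>h\<close>. Within a block of equal values the
  cardinalities run from 1 to the length of the block, which is a difference of consecutive
  conjugate parts.\<close>

lemma prod_conjugate:
  fixes p :: nat
  assumes m: "h 0 \<le> m"
  shows "(\<Prod>j<R. 1 - 1 / real p ^ card {j' \<in> {j..<R}. h j' = h j}) = (\<Prod>i<m. qpoch (1 / real p) (1 / real p) (xs k i - xs k (Suc i)))"
proof -
  let ?f = "\<lambda>j. 1 - 1 / real p ^ card {j' \<in> {j..<R}. h j' = h j}"
  have hm: "h j \<le> m" for j using anti[of 0 j] m by simp
  have "(\<Prod>j<R. ?f j) = (\<Prod>i<m. \<Prod>j\<in>{j \<in> {..<R}. h j - 1 = i}. ?f j)"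
  proof (rule prod.group[symmetric])
    show "(\<lambda>j. h j - 1) ` {..<R} \<subseteq> {..<m}"
    proof (rule image_subsetI)
      fix j assume "j \<in> {..<R}"
      hence "1 \<le> h j" "h j \<le> m" using hm hR(1) by auto
      thus "h j - 1 \<in> {..<m}" by (simp only: lessThan_iff)
    qed
  qed auto
  also have "\<dots> = (\<Prod>i<m. qpoch (1 / real p) (1 / real p) (xs k i - xs k (Suc i)))"
  proof (rule prod.cong[OF refl])
    fix i
    let ?x = "xs k i" and ?y = "xs k (Suc i)"
    have hS: "h j = Suc i \<longleftrightarrow> ?y \<le> j \<and> j < ?x" for j
      using less_xs[of j i] less_xs[of j "Suc i"] by linarith
    have S: "{j \<in> {..<R}. h j - 1 = i} = {?y..<?x}"
    proof (intro set_eqI)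
      fix j
      have "j \<in> {j \<in> {..<R}. h j - 1 = i} \<longleftrightarrow> h j = Suc i" using hR(1)[of j] hR(2)[of j] by (cases "j < R") auto
      thus "j \<in> {j \<in> {..<R}. h j - 1 = i} \<longleftrightarrow> j \<in> {?y..<?x}" by (simp add: hS)
    qed
    have f: "?f j = 1 - 1 / real p * (1 / real p) ^ (?x - Suc j)" if j: "j \<in> {?y..<?x}" for j
    proof -
      have hj: "h j = Suc i" using j hS by simp
      have "{j' \<in> {j..<R}. h j' = h j} = {j..<?x}"
      proof (intro set_eqI)
        fix j'
        have "h j' = Suc i ==> j' < R" using hR(2)[of j'] by (cases "j' < R") auto
        thus "j' \<in> {j' \<in> {j..<R}. h j' = h j} \<longleftrightarrow> j' \<in> {j..<?x}" using j hS[of j'] by (auto simp: hj)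
      qed
      hence "?f j = 1 - 1 / real p ^ (?x - j)" by simp
      also have "?x - j = Suc (?x - Suc j)" using j by auto
      finally show ?thesis by (simp add: power_one_over)
    qed
    have "(\<Prod>j\<in>{?y..<?x}. ?f j) = (\<Prod>j\<in>{?y..<?x}. 1 - 1 / real p * (1 / real p) ^ (?x - Suc j))" by (rule prod.cong[OF refl f])
    also have "\<dots> = (\<Prod>t<?x - ?y. 1 - 1 / real p * (1 / real p) ^ t)"
      by (rule prod.reindex_bij_witness[of _ "\<lambda>t. ?x - Suc t" "\<lambda>j. ?x - Suc j"]) auto
    finally show "(\<Prod>j\<in>{j \<in> {..<R}. h j - 1 = i}. ?f j) = qpoch (1 / real p) (1 / real p) (?x - ?y)"
      unfolding S qpoch_def .
  qed
  finally show ?thesis .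
qed

end

section \<open>Points of \<open>Delta0\<close> and their conjugate partitions\<close>

lemma xs_Suc_le: "k \<in> Delta0 ==> xs k (Suc i) \<le> xs k i" by (erule Delta0_nat) (rule xs_Suc_le_nat)

lemma lfun_xs: "k \<in> Delta0 ==> lfun k (Suc i) = xs k i - xs k (Suc i)" by (erule Delta0_nat) (rule lfun_xs_nat)

lemma xs_le: assumes k: "k \<in> Delta0" and "i \<le> j" shows "xs k j \<le> xs k i"
  using assms(2) by (induction j rule: dec_induct) (use xs_Suc_le[OF k] order_trans in auto)

lemma xs_eventually_0: assumes "k \<in> Delta0" shows "\<exists>m. xs k m = 0"
  using assms by (rule Delta0_nat) (use xs_zero_iff in blast)

lemma xs_inject: assumes k: "k \<in> Delta0" "k' \<in> Delta0" and eq: "\<And>i. xs k i = xs k' i" shows "k = k'"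
proof -
  obtain h R where h: "\<And>i. k i = ereal (real (h i))" "\<And>i j. i \<le> j ==> h j \<le> h i" "\<And>i. i < R ==> h i \<ge> 1" "\<And>i. i \<ge> R ==> h i = 0"
    using Delta0_nat[OF k(1)] by metis
  obtain h' R' where h': "\<And>i. k' i = ereal (real (h' i))" "\<And>i j. i \<le> j ==> h' j \<le> h' i" "\<And>i. i < R' ==> h' i \<ge> 1" "\<And>i. i \<ge> R' ==> h' i = 0"
    using Delta0_nat[OF k(2)] by metis
  have "j < xs k i \<longleftrightarrow> i < h j" for i j by (rule less_xs[where k = k and h = h and R = R]) (fact h)+
  moreover have "j < xs k' i \<longleftrightarrow> i < h' j" for i j by (rule less_xs[where k = k' and h = h' and R = R']) (fact h')+
  ultimately have "i < h j \<longleftrightarrow> i < h' j" for i j using eq by simp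
  hence "h j = h' j" for j by (metis less_irrefl linorder_neqE_nat)
  thus ?thesis by (simp add: fun_eq_iff h(1) h'(1))
qed

text \<open>The multiplicities are differences of consecutive terms of \<open>xs k\<close>, so the
  series telescopes along a sequence that ends in zeros.\<close>

lemma Xs_xs: assumes k: "k \<in> Delta0" shows "Xs k (Suc i) = real (xs k i)"
proof -
  obtain m where m: "xs k m = 0" using xs_eventually_0[OF k] by blast
  have z: "xs k j = 0" if "j \<ge> m" for j using xs_le[OF k that] m by simp
  have "Xs k (Suc i) = (\<Sum>j. real (xs k (i + j)) - real (xs k (i + Suc j)))"
    using xs_Suc_le[OF k] by (simp add: Xs_def lfun_xs[OF k] of_nat_diff)
  also have "\<dots> = (\<Sum>j<m. real (xs k (i + j)) - real (xs k (i + Suc j)))"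
    by (rule suminf_finite) (auto simp: z)
  also have "\<dots> = real (xs k (i + 0)) - real (xs k (i + m))" by (rule sum_lessThan_telescope')
  finally show ?thesis by (simp add: z)
qed

lemma sum_weighted_differences:
  fixes x :: "nat \<Rightarrow> real"
  shows "(\<Sum>i<m. real (Suc i) * (x i - x (Suc i))) = (\<Sum>i<m. x i) - real m * x m"
  by (induction m) (simp_all add: algebra_simps)

lemma sum_odd: "(\<Sum>j<n. 2 * real j + 1) = (real n)\<^sup>2" by (induction n) (simp_all add: power2_eq_square algebra_simps)

text \<open>A point is determined by the finite list of its nonzero conjugate parts.\<close>

lemma countable_Delta0: "countable Delta0"
proof -
  define m where "m k = (LEAST m. xs k m = 0)" for k
  have m: "xs k (m k) = 0" if "k \<in> Delta0" for k using xs_eventually_0[OF that] unfolding m_def by (rule LeastI_ex)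
  have "inj_on (\<lambda>k. map (xs k) [0..<m k]) Delta0"
  proof (rule inj_onI)
    fix k k' assume k: "k \<in> Delta0" "k' \<in> Delta0" and eq: "map (xs k) [0..<m k] = map (xs k') [0..<m k']"
    have mm: "m k = m k'" using arg_cong[OF eq, of length] by simp
    show "k = k'"
    proof (rule xs_inject[OF k])
      fix i
      show "xs k i = xs k' i"
      proof (cases "i < m k")
        case True
        thus ?thesis using arg_cong[OF eq, of "\<lambda>l. l ! i"] mm by simp
      next
        case False
        thus ?thesis using xs_le[OF k(1), of "m k" i] xs_le[OF k(2), of "m k'" i] m[OF k(1)] m[OF k(2)] mm by simp
      qed
    qed
  qed
  thus ?thesis by (rule countable_image_inj_on[rotated]) simp
qed

section \<open>Point masses and cylinder probabilities of the decomposing measure\<close>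

context decomp
begin

text \<open>The path probability up to the first visit to 0. The state 0 is absorbing, so any later
  horizon gives the same value, see \<open>chain_W\<close>.\<close>

definition W :: "(nat \<Rightarrow> ereal) \<Rightarrow> real" where "W k = chain (pidist p s) (LEAST m. xs k m = 0) (xs k)"

lemma Pker_0_0: "Pker p s 0 0 = 1" by (use p_gt1 in \<open>simp add: Pker_def\<close>)

lemma chain_W: assumes k: "k \<in> Delta0" and m: "xs k m = 0" shows "chain (pidist p s) m (xs k) = W k"
proof -
  let ?l = "LEAST m. xs k m = 0"
  have l: "xs k ?l = 0" using m by (rule LeastI)
  have "?l \<le> m" using m by (rule Least_le)
  moreover have "chain (pidist p s) (?l + d) (xs k) = chain (pidist p s) ?l (xs k)" for d
  proof (induction d)
    case (Suc d)
    have "xs k (?l + d) = 0" "xs k (Suc (?l + d)) = 0" using xs_le[OF k, of ?l] l by (metis le_add1 le_zero_eq, metis le_SucI le_add1 le_zero_eq)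
    thus ?case using Suc by (simp add: chain_def Pker_0_0)
  qed simp
  ultimately show ?thesis unfolding W_def using le_add_diff_inverse by metis
qed

lemma chain_zero_formula:
  assumes k: "k \<in> Delta0" and m: "xs k m = 0"
  shows "chain (pidist p s) m (xs k) = qpoch_inf aa qq * real p powr (- (\<Sum>i<m. (real (xs k i))\<^sup>2) - s * (\<Sum>i<m. real (xs k i)))
    / (\<Prod>i<m. qpoch qq qq (xs k i - xs k (Suc i)))"
proof -
  have "(\<Sum>i\<le>m. f (xs k i)) = (\<Sum>i<m. f (xs k i))" if "f 0 = 0" for f :: "nat \<Rightarrow> real"
    using m that by (simp add: lessThan_Suc_atMost[symmetric])
  from this[of "\<lambda>x. (real x)\<^sup>2"] this[of real] show ?thesis
    using chain_pidist[of "xs k" m, OF xs_Suc_le[OF k]] m by simp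
qed

lemma Delta0_Delta: "k \<in> Delta0 ==> k \<in> Delta" by (simp add: Delta0_def)

text \<open>\<open>nu_singleton_le\<close> in terms of the conjugate partition: the sum of
  \<open>(2 i + 1) h i\<close> becomes a sum of squares, and the product over the indices becomes
  the product of the factors \<open>(q; q)\<close> along the path.\<close>

lemma nu_le_W: assumes k: "k \<in> Delta0" shows "measure \<nu> {k} \<le> W k"
proof -
  obtain h R where h: "\<And>i. k i = ereal (real (h i))" "\<And>i j. i \<le> j ==> h j \<le> h i" "\<And>i. i < R ==> h i \<ge> 1" "\<And>i. i \<ge> R ==> h i = 0"
    using Delta0_nat[OF k] by metis
  let ?m = "h 0"
  have "xs k i = 0 \<longleftrightarrow> h 0 \<le> i" for i by (rule xs_zero_iff[where k = k and h = h and R = R]) (fact h)+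
  hence z: "xs k ?m = 0" by simp
  have c: "(\<Sum>j<R. g j * real (h j)) = (\<Sum>i<?m. \<Sum>j<xs k i. g j)" for g :: "nat \<Rightarrow> real"
    by (rule sum_conjugate[where k = k and h = h and R = R]) (fact h order_refl)+
  have 1: "(\<Sum>i<R. (2 * real i + 1) * real (h i)) = (\<Sum>i<?m. (real (xs k i))\<^sup>2)"
    using c[of "\<lambda>i. 2 * real i + 1"] by (simp only: sum_odd)
  have 2: "(\<Sum>i<R. real (h i)) = (\<Sum>i<?m. real (xs k i))"
    using c[of "\<lambda>_. 1"] by simp
  have 3: "(\<Prod>j<R. 1 - 1 / real p ^ card {j' \<in> {j..<R}. h j' = h j}) = (\<Prod>i<?m. qpoch qq qq (xs k i - xs k (Suc i)))"
    by (rule prod_conjugate[where k = k and h = h and R = R]) (fact h order_refl)+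
  have "measure \<nu> {k} \<le> qpoch_inf aa qq
    * real p powr (- (\<Sum>i<R. (2 * real i + 1) * real (h i)) - s * (\<Sum>i<R. real (h i)))
    / (\<Prod>i<R. 1 - 1 / real p ^ card {j \<in> {i..<R}. h j = h i})"
    by (rule nu_singleton_le[where h = h and R = R]) (fact Delta0_Delta[OF k] h)+
  thus ?thesis unfolding 1 2 3 chain_W[OF k z, symmetric] chain_zero_formula[OF k z] .
qed

lemma finite_xs_zero: assumes F: "finite F" "F \<subseteq> Delta0" obtains d where "\<And>k. k \<in> F ==> xs k (n + d) = 0"
proof
  define m where "m k = (LEAST m. xs k m = 0)" for k
  fix k assume k: "k \<in> F"
  have kD: "k \<in> Delta0" using k F(2) by blast
  have "xs k (m k) = 0" unfolding m_def by (rule LeastI_ex) (rule xs_eventually_0[OF kD])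
  moreover have "m k \<le> (\<Sum>k\<in>F. m k)" using F k by (intro member_le_sum) auto
  hence "xs k (n + (\<Sum>k\<in>F. m k)) \<le> xs k (m k)" by (intro xs_le[OF kD]) simp
  ultimately show "xs k (n + (\<Sum>k\<in>F. m k)) = 0" by simp
qed

text \<open>\<open>F\<close> injects into a finite box of paths by the part of \<open>xs\<close>
  from \<open>n\<close> on. The case \<open>n = 0\<close> with the initial law serves the point
  masses; a kernel row after a prescribed beginning serves the cylinders.\<close>

lemma sum_chain_Delta0_le1:
  assumes F: "finite F" "F \<subseteq> Delta0" and inj: "\<And>k k'. k \<in> F ==> k' \<in> F ==> (\<And>i. xs k (n + i) = xs k' (n + i)) ==> k = k'"
    and f: "\<And>y. 0 \<le> f y" "\<And>B. (\<Sum>y\<le>B. f y) \<le> 1" and d: "\<And>k. k \<in> F ==> xs k (n + d) = 0"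
  shows "(\<Sum>k\<in>F. chain f d (\<lambda>i. xs k (n + i))) \<le> 1"
proof -
  let ?\<phi> = "\<lambda>k. restrict (\<lambda>i. xs k (n + i)) {..d}"
  define B where "B = (\<Sum>k\<in>F. xs k 0)"
  have B: "xs k i \<le> B" if "k \<in> F" for k i
  proof -
    have "xs k i \<le> xs k 0" using that F(2) by (intro xs_le) auto
    also have "\<dots> \<le> B" unfolding B_def using F that by (intro member_le_sum) auto
    finally show ?thesis .
  qed
  have "inj_on ?\<phi> F"
  proof (rule inj_onI)
    fix k k' assume k: "k \<in> F" "k' \<in> F" and eq: "?\<phi> k = ?\<phi> k'"
    show "k = k'"
    proof (rule inj[OF k])
      fix i show "xs k (n + i) = xs k' (n + i)"
      proof (cases "i \<le> d")
        case True
        thus ?thesis using fun_cong[OF eq, of i] by simp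
      next
        case False
        thus ?thesis using xs_le[of k "n + d" "n + i"] xs_le[of k' "n + d" "n + i"] k F(2) d by fastforce
      qed
    qed
  qed
  hence "(\<Sum>z\<in>?\<phi> ` F. chain f d z) = (\<Sum>k\<in>F. chain f d (?\<phi> k))" by (simp add: sum.reindex)
  also have "\<dots> = (\<Sum>k\<in>F. chain f d (\<lambda>i. xs k (n + i)))" by (simp add: chain_def)
  finally have "(\<Sum>k\<in>F. chain f d (\<lambda>i. xs k (n + i))) = (\<Sum>z\<in>?\<phi> ` F. chain f d z)" ..
  also have "\<dots> \<le> (\<Sum>z\<in>{..d} \<rightarrow>\<^sub>E {..B}. chain f d z)"
  proof (rule sum_mono2)
    show "?\<phi> ` F \<subseteq> {..d} \<rightarrow>\<^sub>E {..B}" by (rule image_subsetI) (use B in \<open>simp only: restrict_PiE_iff, simp\<close>)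
  qed (auto intro!: finite_PiE chain_nonneg f)
  also have "\<dots> \<le> 1" by (rule sum_chain_le1) (use f in auto)
  finally show ?thesis .
qed

lemma Delta0_events: assumes "A \<subseteq> Delta0" shows "A \<in> sets \<nu>"
proof (rule sets.countable)
  show "countable A" using countable_Delta0 assms countable_subset by blast
  show "{k} \<in> sets \<nu>" if "k \<in> A" for k unfolding sets_nu by (rule delta_singleton_sets) (use that assms Delta0_Delta in blast)
qed

lemma prob_Delta0: "measure \<nu> Delta0 = 1"
  using N.prob_Collect_eq_1[of "\<lambda>k. k \<in> Delta0"] AE_Delta0 Delta0_events[of Delta0] space_nu Delta0_Delta
  by (simp add: Collect_conj_eq Int_absorb1 subset_iff)

text \<open>The bounds \<open>W\<close> sum to at most 1 while the points of \<open>Delta0\<close>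
  carry mass 1, so no bound can be strict.\<close>

theorem nu_singleton: assumes k: "k \<in> Delta0" shows "measure \<nu> {k} = W k"
proof (rule N.prob_eq_of_le[of Delta0 "\<lambda>k. {k}" W])
  show "countable Delta0" by (rule countable_Delta0)
  show "{k} \<in> sets \<nu>" if "k \<in> Delta0" for k by (rule Delta0_events) (use that in simp)
  show "disjoint_family_on (\<lambda>k. {k}) Delta0" by (simp add: disjoint_family_on_def)
  show "measure \<nu> (\<Union>k\<in>Delta0. {k}) = 1" using prob_Delta0 by simp
  show "measure \<nu> {k} \<le> W k" if "k \<in> Delta0" for k by (rule nu_le_W[OF that])
  show "sum W F \<le> 1" if F: "finite F" "F \<subseteq> Delta0" for F
  proof -
    obtain d where d: "\<And>k. k \<in> F ==> xs k (0 + d) = 0" using finite_xs_zero[OF F] by blast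
    have "sum W F = (\<Sum>k\<in>F. chain (pidist p s) d (\<lambda>i. xs k (0 + i)))"
      by (rule sum.cong) (use F(2) d chain_W in auto)
    also have "\<dots> \<le> 1"
      by (rule sum_chain_Delta0_le1[OF F _ pidist_nonneg sum_pidist_le1 d], rule xs_inject) (use F(2) in auto)
    finally show ?thesis .
  qed
qed (rule k)

lemma prod_lessThan_add: "(\<Prod>i<n + m. g i) = (\<Prod>i<n. g i) * (\<Prod>i<m. g (n + i))" for g :: "nat \<Rightarrow> real"
  by (induction m) (simp_all add: mult.assoc)

lemma chain_split: "chain f (n + Suc d) x = chain f n x * chain (Pker p s (x n)) d (\<lambda>i. x (Suc n + i))"
proof -
  have "(\<Prod>i<n + Suc d. Pker p s (x i) (x (Suc i))) = (\<Prod>i<n. Pker p s (x i) (x (Suc i))) * (\<Prod>i<Suc d. Pker p s (x (n + i)) (x (Suc (n + i))))"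
    by (rule prod_lessThan_add)
  also have "(\<Prod>i<Suc d. Pker p s (x (n + i)) (x (Suc (n + i)))) = Pker p s (x n) (x (Suc n)) * (\<Prod>i<d. Pker p s (x (Suc n + i)) (x (Suc n + Suc i)))"
    unfolding prod.lessThan_Suc_shift by simp
  finally show ?thesis by (simp add: chain_def mult.assoc)
qed

lemma chain_cong: "(\<And>i. i \<le> n ==> x i = y i) ==> chain f n x = chain f n y"
  unfolding chain_def by (intro arg_cong2[of _ _ _ _ "(*)"] prod.cong arg_cong[of _ _ f] arg_cong2[of _ _ _ _ "Pker p s"]) auto

definition cylinder :: "nat \<Rightarrow> (nat \<Rightarrow> nat) \<Rightarrow> (nat \<Rightarrow> ereal) set" where
  "cylinder n y = {k \<in> Delta0. \<forall>i\<le>n. xs k i = y i}"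

text \<open>A path that continues past \<open>n\<close> splits into its beginning and a path whose
  initial weight is the kernel row at \<open>y n\<close>. Over finitely many continuations the
  second factors sum to at most 1.\<close>

lemma nu_cylinder_le: "measure \<nu> (cylinder n y) \<le> chain (pidist p s) n y"
proof -
  have "measure \<nu> (\<Union>k\<in>cylinder n y. {k}) \<le> chain (pidist p s) n y"
  proof (rule N.prob_UN_le)
    show "countable (cylinder n y)" by (rule countable_subset[OF _ countable_Delta0]) (auto simp: cylinder_def)
    show "{k} \<in> sets \<nu>" if "k \<in> cylinder n y" for k by (rule Delta0_events) (use that in \<open>auto simp: cylinder_def\<close>)
    fix F assume F: "finite F" "F \<subseteq> cylinder n y"
    have FD: "F \<subseteq> Delta0" using F by (auto simp: cylinder_def)
    have Fy: "xs k i = y i" if "k \<in> F" "i \<le> n" for k i using that F by (auto simp: cylinder_def)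
    obtain d where d: "\<And>k. k \<in> F ==> xs k (Suc n + d) = 0" using finite_xs_zero[OF F(1) FD] by blast
    have "measure \<nu> (\<Union>k\<in>F. {k}) = (\<Sum>k\<in>F. measure \<nu> {k})"
      by (rule N.finite_measure_finite_Union) (use F FD Delta0_events in \<open>auto simp: disjoint_family_on_def\<close>)
    also have "\<dots> = (\<Sum>k\<in>F. chain (pidist p s) n y * chain (Pker p s (y n)) d (\<lambda>i. xs k (Suc n + i)))"
    proof (rule sum.cong[OF refl])
      fix k assume k: "k \<in> F"
      have "measure \<nu> {k} = W k" by (rule nu_singleton) (use k FD in blast)
      also have "\<dots> = chain (pidist p s) (n + Suc d) (xs k)" using chain_W[of k "n + Suc d"] d[OF k] k FD by fastforce
      also have "\<dots> = chain (pidist p s) n (xs k) * chain (Pker p s (xs k n)) d (\<lambda>i. xs k (Suc n + i))" by (rule chain_split)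
      also have "chain (pidist p s) n (xs k) = chain (pidist p s) n y" by (rule chain_cong) (rule Fy[OF k])
      finally show "measure \<nu> {k} = chain (pidist p s) n y * chain (Pker p s (y n)) d (\<lambda>i. xs k (Suc n + i))" using Fy[OF k, of n] by simp
    qed
    also have "\<dots> = chain (pidist p s) n y * (\<Sum>k\<in>F. chain (Pker p s (y n)) d (\<lambda>i. xs k (Suc n + i)))" by (rule sum_distrib_left[symmetric])
    also have "\<dots> \<le> chain (pidist p s) n y * 1"
    proof (rule mult_left_mono)
      show "(\<Sum>k\<in>F. chain (Pker p s (y n)) d (\<lambda>i. xs k (Suc n + i))) \<le> 1"
      proof (rule sum_chain_Delta0_le1[OF F(1) FD _ Pker_nonneg sum_Pker_le1 d])
        fix k k' assume k: "k \<in> F" "k' \<in> F" and eq: "\<And>i. xs k (Suc n + i) = xs k' (Suc n + i)"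
        show "k = k'"
        proof (rule xs_inject)
          show "k \<in> Delta0" "k' \<in> Delta0" using k FD by auto
          fix i show "xs k i = xs k' i"
            using Fy[OF k(1), of i] Fy[OF k(2), of i] eq[of "i - Suc n"] by (cases "i \<le> n") auto
        qed
      qed
      show "0 \<le> chain (pidist p s) n y" by (rule chain_nonneg[OF pidist_nonneg])
    qed
    finally show "measure \<nu> (\<Union>k\<in>F. {k}) \<le> chain (pidist p s) n y" by simp
  qed
  thus ?thesis by simp
qed

text \<open>The same squeeze as for points, with the cylinders as the partition of
  \<open>Delta0\<close>.\<close>

theorem nu_cylinder: "measure \<nu> (cylinder n y) = chain (pidist p s) n y"
proof -
  let ?Y = "{..n} \<rightarrow>\<^sub>E (UNIV :: nat set)"
  \<comment> \<open>The restriction makes the prescribed path an element of the countable index set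
    \<open>?Y\<close>.\<close>
  have "measure \<nu> (cylinder n (restrict y {..n})) = chain (pidist p s) n (restrict y {..n})"
  proof (rule N.prob_eq_of_le[of ?Y "cylinder n"])
    show "countable ?Y" by (rule countable_PiE) auto
    show "cylinder n z \<in> sets \<nu>" for z by (rule Delta0_events) (auto simp: cylinder_def)
    show "disjoint_family_on (cylinder n) ?Y" unfolding disjoint_family_on_def
    proof (intro ballI impI)
      fix z z' assume z: "z \<in> ?Y" "z' \<in> ?Y" "z \<noteq> z'"
      then obtain i where "i \<in> {..n}" "z i \<noteq> z' i" using PiE_ext[OF z(1,2)] by blast
      thus "cylinder n z \<inter> cylinder n z' = {}" by (auto simp: cylinder_def)
    qed
    have "(\<Union>z\<in>?Y. cylinder n z) = Delta0"
    proof
      show "Delta0 \<subseteq> (\<Union>z\<in>?Y. cylinder n z)"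
      proof
        fix k assume "k \<in> Delta0"
        thus "k \<in> (\<Union>z\<in>?Y. cylinder n z)" by (intro UN_I[of "restrict (xs k) {..n}"]) (auto simp: cylinder_def)
      qed
    qed (auto simp: cylinder_def)
    thus "measure \<nu> (\<Union>z\<in>?Y. cylinder n z) = 1" using prob_Delta0 by simp
    show "measure \<nu> (cylinder n z) \<le> chain (pidist p s) n z" for z by (rule nu_cylinder_le)
    fix F assume F: "finite F" "F \<subseteq> ?Y"
    define B where "B = Max (insert 0 ((\<lambda>(z, i). z i) ` (F \<times> {..n})))"
    have B: "z i \<le> B" if "z \<in> F" "i \<le> n" for z i unfolding B_def by (rule Max_ge) (use F that in force)+
    have "F \<subseteq> {..n} \<rightarrow>\<^sub>E {..B}"
    proof
      fix z assume z: "z \<in> F"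
      thus "z \<in> {..n} \<rightarrow>\<^sub>E {..B}" using F B[OF z] by (auto simp: PiE_iff)
    qed
    hence "(\<Sum>z\<in>F. chain (pidist p s) n z) \<le> (\<Sum>z\<in>{..n} \<rightarrow>\<^sub>E {..B}. chain (pidist p s) n z)"
      by (rule sum_mono2[rotated]) (auto intro!: finite_PiE chain_nonneg pidist_nonneg)
    also have "\<dots> \<le> 1" by (rule sum_chain_le1[OF pidist_nonneg sum_pidist_le1])
    finally show "(\<Sum>z\<in>F. chain (pidist p s) n z) \<le> 1" .
  qed (auto simp: PiE_iff extensional_def restrict_def)
  moreover have "cylinder n (restrict y {..n}) = cylinder n y" by (auto simp: cylinder_def)
  moreover have "chain (pidist p s) n (restrict y {..n}) = chain (pidist p s) n y" by (rule chain_cong) simp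
  ultimately show ?thesis by simp
qed

text \<open>Only finitely many terms are nontrivial, so the series and the product are finite.
  Summation by parts turns the weighted sum of the multiplicities into the sum of the conjugate
  parts.\<close>

lemma W_formula:
  assumes k: "k \<in> Delta0"
  shows "W k = qpoch_inf aa qq
         * real p powr (- (\<Sum>i. (Xs k (Suc i))^2) - s * (\<Sum>i. real (Suc i) * real (lfun k (Suc i))))
         * prodinf (\<lambda>i. 1 / qpoch qq qq (lfun k (Suc i)))"
proof -
  obtain m where m: "xs k m = 0" using xs_eventually_0[OF k] by blast
  have z: "xs k j = 0" if "j \<ge> m" for j using xs_le[OF k that] m by simp
  have 1: "(\<Sum>i. (Xs k (Suc i))^2) = (\<Sum>i<m. (real (xs k i))\<^sup>2)"
    unfolding Xs_xs[OF k] by (rule suminf_finite) (auto simp: z)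
  have "(\<Sum>i. real (Suc i) * real (lfun k (Suc i))) = (\<Sum>i<m. real (Suc i) * real (lfun k (Suc i)))"
    by (rule suminf_finite) (auto simp: z lfun_xs[OF k])
  also have "\<dots> = (\<Sum>i<m. real (Suc i) * (real (xs k i) - real (xs k (Suc i))))"
    using xs_Suc_le[OF k] by (simp add: lfun_xs[OF k] of_nat_diff)
  also have "\<dots> = (\<Sum>i<m. real (xs k i))" using sum_weighted_differences[of "\<lambda>i. real (xs k i)" m] m by simp
  finally have 2: "(\<Sum>i. real (Suc i) * real (lfun k (Suc i))) = (\<Sum>i<m. real (xs k i))" .
  have "prodinf (\<lambda>i. 1 / qpoch qq qq (lfun k (Suc i))) = (\<Prod>i<m. 1 / qpoch qq qq (lfun k (Suc i)))"
    by (rule prodinf_finite) (auto simp: z lfun_xs[OF k])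
  also have "\<dots> = 1 / (\<Prod>i<m. qpoch qq qq (xs k i - xs k (Suc i)))" by (simp add: lfun_xs[OF k] prod_dividef)
  finally have 3: "prodinf (\<lambda>i. 1 / qpoch qq qq (lfun k (Suc i))) = 1 / (\<Prod>i<m. qpoch qq qq (xs k i - xs k (Suc i)))" .
  show ?thesis unfolding 1 2 3 chain_W[OF k m, symmetric] chain_zero_formula[OF k m] by simp
qed

end

theorem theorem1p8:
  fixes p :: nat and s :: real and \<nu> :: "(nat \<Rightarrow> ereal) measure"
  assumes "prime p" and "s > -1"
    and "prob_space \<nu>" and "sets \<nu> = sets delta_space"
    and "\<forall>F :: (nat \<times> nat \<Rightarrow> qp) \<Rightarrow> real. F \<in> borel_measurable (matinf p) \<and> bounded (F ` space (matinf p)) \<longrightarrow>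
           (\<integral>Z. F Z \<partial>Ms p s) = (\<integral>k. (\<integral>Z. F Z \<partial>mu p k) \<partial>\<nu>)"
  shows "(AE k in \<nu>. k \<in> Delta0)
    \<and> (\<forall>n\<ge>1. \<forall>x::nat \<Rightarrow> nat.
         measure \<nu> {k \<in> Delta0. \<forall>i<n. Xs k (Suc i) = real (x i)}
           = pidist p s (x 0) * (\<Prod>i<n - 1. Pker p s (x i) (x (Suc i))))
    \<and> (\<forall>k\<in>Delta0. measure \<nu> {k} =
         qpoch_inf (real p powr (-1 - s)) (1 / real p)
         * real p powr (- (\<Sum>i. (Xs k (Suc i))^2) - s * (\<Sum>i. real (Suc i) * real (lfun k (Suc i))))
         * prodinf (\<lambda>i. 1 / qpoch (1 / real p) (1 / real p) (lfun k (Suc i))))"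
proof -
  interpret decomp p s \<nu>
    by (intro decomp.intro hua.intro padic.intro hua_axioms.intro decomp_axioms.intro assms)
  have "measure \<nu> {k \<in> Delta0. \<forall>i<n. Xs k (Suc i) = real (x i)} = pidist p s (x 0) * (\<Prod>i<n - 1. Pker p s (x i) (x (Suc i)))"
    if n: "n \<ge> 1" for n and x :: "nat \<Rightarrow> nat"
  proof -
    have "i < n \<longleftrightarrow> i \<le> n - 1" for i using n by auto
    then have "{k \<in> Delta0. \<forall>i<n. Xs k (Suc i) = real (x i)} = cylinder (n - 1) x" by (auto simp: cylinder_def Xs_xs)
    then show ?thesis using nu_cylinder[of "n - 1" x] by (simp add: chain_def)
  qed
  then show ?thesis using AE_Delta0 nu_singleton W_formula by simp
qed

end
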